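(* The system consisting of the union of the KZ and the dynamical differential equations for any Kac--Moody Lie algebra with (or without) Serre's relations is a compatible system of differential equations. Explicitly: (i) for a Kac--Moody Lie algebra $\mathfrak g$ without Serre's relations and $M=M(\Lambda_1)\otimes\cdots\otimes M(\Lambda_n)$ a tensor product of Verma modules, the system for $M$-valued functions $u(\mu,z)$ $$\kappa\frac{\partial u}{\partial z_i}=\mu^{(i)}u+\sum_{j:\,j\neq i}\frac{\Omega_{+,ij}}{z_i-z_j}u\ (1\le i\le n),\qquad \kappa\,\partial_{\mu'}u=\sum_{i=1}^nz_i(\mu')^{(i)}u+\sum_{\alpha>0}\frac{\langle\alpha,\mu'\rangle}{\langle\alpha,\mu\rangle}\Delta_{+,\alpha}u\ (\mu'\in\mathfrak h)$$ is compatible; (ii) for the Kac--Moody Lie algebra $\bar{\mathfrak g}=\mathfrak g/\ker S$ with Serre's relations and $L=M/\ker(S:M\to M^* )$, the system for $L$-valued functions obtained by replacing $\Omega_{+,ij}$ by $\bar\Omega^{(ij)}$ and $\Delta_{+,\alpha}$ by $\bar\Delta_\alpha$ is compatible.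
   Context: Lie algebra. Let $\mathfrak h$ be a finite dimensional complex vector space with a non-degenerate symmetric bilinear form $(\,,)$, and $\alpha_1,\dots,\alpha_r\in\mathfrak h^*$ linearly independent. $b:\mathfrak h\to\mathfrak h^*$ is the induced isomorphism, the form is transported to $\mathfrak h^*$, $h_i=b^{-1}(\alpha_i)$. $\mathfrak g$ (Kac--Moody Lie algebra without Serre's relations) is generated by $\mathfrak h$, $e_i,f_i$ ($1\le i\le r$) with relations $[h,e_i]=\langle\alpha_i,h\rangle e_i$, $[h,f_i]=-\langle\alpha_i,h\rangle f_i$, $[e_i,f_j]=\delta_{ij}h_i$, $[h,h']=0$. $\mathfrak n_-$, $\mathfrak n_+$ are the subalgebras generated by the $f_i$, resp. $e_i$. For $\alpha=\sum k_i\alpha_i$, $k_i\in\mathbb N$, $(\mathfrak n_-)_\alpha=\{x\in\mathfrak n_-:[h,x]=-\langle\alpha,h\rangle x\ \forall h\}$; $\alpha$ is a positive root ($\alpha>0$) if $\alpha\neq0$ and $(\mathfrak n_-)_\alpha\ne0$. $M(\Lambda)$ is the Verma module with highest weight $\Lambda\in\mathfrak h^*$ and generating vector $v$. $x^{(i)}$ means $x$ acting on the $i$th factor. $\kappa\in\mathbb C\setminus\{0\}$, $\mu\in\mathfrak h$; $\partial_{\mu'}$ is the derivative in $\mu$ in direction $\mu'$. ${}^*$ denotes graded duals (sums of duals of the finite dimensional weight spaces). Operators on $M$. $\nu_-:M(\Lambda)\to\mathfrak n_-\otimes M(\Lambda)$ is the linear map with $\nu_-(v)=0$, $\nu_-(f_ix)=f_i\otimes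 h_ix+f_i\cdot\nu_-(x)$, where $a\cdot(d\otimes y)=[a,d]\otimes y+d\otimes ay$. On $M$, $\nu_{M-}=\sum_{k=1}^n\nu^{(k)}$, where $\nu^{(k)}$ applies $\nu_-$ to the $k$th factor and moves the $\mathfrak n_-$-component to the front. For $\xi\in\mathfrak n_-^*$ put $\xi\lrcorner x=(\xi\otimes\mathrm{id})\nu_{M-}(x)$ (and likewise on a single $M(\Lambda)$). With $(x_k^\beta)_k$ a basis of $(\mathfrak n_-)_\beta$ and $((x_k^\beta)^* )_k$ the dual basis, $\Delta_{+,\alpha}u=\sum_kx^\alpha_k\big((x^\alpha_k)^*\lrcorner u\big)$, and for weight vectors $p\in M(\Lambda')$, $q\in M(\Lambda'')$, $$\Omega_+(p\otimes q)=(\mathrm{wt}\,p,\mathrm{wt}\,q)\,p\otimes q+\sum_{\beta>0}\sum_k\big(x_k^{\beta}p\otimes (x_k^{\beta})^*\lrcorner q+(x_k^{\beta})^*\lrcorner p\otimes x_k^\beta q\big);$$ $\Omega_{+,ij}$ acts as $\Omega_+$ on factors $i,j$ of $M$ and as the identity on the others. Contravariant forms. $\tau$ is the automorphism of $\mathfrak g$ with $\tau(e_i)=-f_i$, $\tau(f_i)=-e_i$, $\tau(h)=-h$. $K$ is the unique $\mathfrak g$-invariant bilinear form on $\mathfrak g$ equal to $(\,,)$ on $\mathfrak h$, zero on $\mathfrak n_+\times\mathfrak n_+$ and $\mathfrak n_-\times\mathfrak n_-$, with $\mathfrak h\perp\mathfrak n_-\oplus\mathfrak n_+$ and $K(f_i,e_j)=K(e_j,f_i)=\delta_{ij}$.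 $S(x,y)=-K(\tau(x),y)$ on $\mathfrak g$. On $M(\Lambda)$, $S$ is the unique bilinear form with $S(v,v)=1$, $S(e_ix,y)=S(x,f_iy)$, $S(f_ix,y)=S(x,e_iy)$; on $M$ it is the product form. $\ker S$ is an ideal in $\mathfrak g$, $\bar{\mathfrak g}$ acts on $L$, and $K$ induces a non-degenerate form on $\bar{\mathfrak g}$ (again $K$). For $\alpha>0$ let $(e_l^{(\alpha)})$ be a basis of $\bar{\mathfrak g}_\alpha$ and $(f_l^{(\alpha)})$ the $K$-dual basis of $\bar{\mathfrak g}_{-\alpha}$. $\bar\Delta_\alpha=\sum_lf_l^{(\alpha)}e_l^{(\alpha)}$ and $\bar\Omega=\sum_sh_s\otimes h_s+\sum_{\alpha>0}\sum_l(e_l^{(\alpha)}\otimes f_l^{(\alpha)}+f_l^{(\alpha)}\otimes e_l^{(\alpha)})$, $(h_s)$ an orthonormal basis of $\mathfrak h$; $\bar\Omega^{(ij)}$ acts on factors $i,j$ of $L$ (which is the tensor product of the modules $M(\Lambda_j)/\ker S$). Compatibility. Writing the equations as $(\kappa\partial_{z_i}-A_i)u=0$, $(\kappa\partial_{\mu'}-B_{\mu'})u=0$, compatible means that all these first order operators pairwise commute. All operators preserve the finite dimensional weight spaces, on each of which only finitely many terms of the sums over $\alpha$ are non-zero. *)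

theory Defs
  imports "HOL-Analysis.Analysis" "HOL-Library.Poly_Mapping"
begin

section \<open>Complex vector spaces\<close>

class complex_vector = ab_group_add +
  fixes scaleC :: "complex \<Rightarrow> 'a \<Rightarrow> 'a" (infixr \<open>*\<^sub>C\<close> 75)
  assumes scaleC_add_right: "a *\<^sub>C (x + y) = a *\<^sub>C x + a *\<^sub>C y"
    and scaleC_add_left: "(a + b) *\<^sub>C x = a *\<^sub>C x + b *\<^sub>C x"
    and scaleC_scaleC: "a *\<^sub>C b *\<^sub>C x = (a * b) *\<^sub>C x"
    and scaleC_one: "1 *\<^sub>C x = x"

global_interpretation complex_vector: vector_space "scaleC :: complex \<Rightarrow> 'a \<Rightarrow> 'a::complex_vector"
  by unfold_locales (fact scaleC_add_right scaleC_add_left scaleC_scaleC scaleC_one)+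

abbreviation cspan :: "'a::complex_vector set \<Rightarrow> 'a set" where
  "cspan \<equiv> complex_vector.span"

abbreviation csubspace :: "'a::complex_vector set \<Rightarrow> bool" where
  "csubspace \<equiv> complex_vector.subspace"

abbreviation clinear :: "('a::complex_vector \<Rightarrow> 'b::complex_vector) \<Rightarrow> bool" where
  "clinear \<equiv> Vector_Spaces.linear scaleC scaleC"

global_interpretation complex_vector_pair:
  vector_space_pair "scaleC :: complex \<Rightarrow> 'a \<Rightarrow> 'a::complex_vector"
    "scaleC :: complex \<Rightarrow> 'b \<Rightarrow> 'b::complex_vector"
  by unfold_locales

lemma clinearI:
  assumes "\<And>x y. f (x + y) = f x + f y" "\<And>c x. f (c *\<^sub>C x) = c *\<^sub>C f x"
  shows "clinear f"
  by unfold_locales (use assms in auto)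

definition is_basis :: "'a::complex_vector set \<Rightarrow> 'a set \<Rightarrow> bool" where
  "is_basis X W \<longleftrightarrow> \<not> complex_vector.dependent X \<and> cspan X = W"

definition cbilinear ::
    "('a::complex_vector \<Rightarrow> 'b::complex_vector \<Rightarrow> 'c::complex_vector) \<Rightarrow> bool" where
  "cbilinear f \<longleftrightarrow> (\<forall>x. clinear (f x)) \<and> (\<forall>y. clinear (\<lambda>x. f x y))"

definition multilinear :: "(('n \<Rightarrow> 'a::complex_vector) \<Rightarrow> 'b::complex_vector) \<Rightarrow> bool" where
  "multilinear f \<longleftrightarrow> (\<forall>m i. clinear (\<lambda>x. f (m(i := x))))"

text \<open>\<open>\<pi>\<close> exhibits its codomain as the quotient of its domain by \<open>N\<close>.\<close>
definition is_quotient :: "('a::complex_vector \<Rightarrow> 'b::complex_vector) \<Rightarrow> 'a set \<Rightarrow> bool" where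
  "is_quotient \<pi> N \<longleftrightarrow> clinear \<pi> \<and> surj \<pi> \<and> {x. \<pi> x = 0} = N"

instantiation complex :: complex_vector
begin
definition "scaleC_complex = ((*) :: complex \<Rightarrow> complex \<Rightarrow> complex)"
instance by standard (simp_all add: scaleC_complex_def algebra_simps)
end

instantiation vec :: (complex_vector, finite) complex_vector
begin
definition "scaleC_vec (c::complex) (x::'a^'b) = (\<chi> i. c *\<^sub>C (x $ i))"
instance
  by standard (simp_all add: scaleC_vec_def vec_eq_iff scaleC_add_right scaleC_add_left
      scaleC_scaleC scaleC_one)
end

instantiation prod :: (complex_vector, complex_vector) complex_vector
begin
definition "scaleC_prod (c::complex) (x::'a \<times> 'b) = (c *\<^sub>C fst x, c *\<^sub>C snd x)"
instance
  by standard (simp_all add: scaleC_prod_def prod_eq_iff scaleC_add_right scaleC_add_left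
      scaleC_scaleC scaleC_one)
end

instantiation poly_mapping :: (type, complex_vector) complex_vector
begin
definition "scaleC_poly_mapping (c::complex) (f::'a \<Rightarrow>\<^sub>0 'b) = Poly_Mapping.map ((*\<^sub>C) c) f"

lemma lookup_scaleC:
  "Poly_Mapping.lookup (c *\<^sub>C (f::'a \<Rightarrow>\<^sub>0 'b)) x = c *\<^sub>C Poly_Mapping.lookup f x"
  by (auto simp: scaleC_poly_mapping_def map.rep_eq when_def)

instance
  by standard (rule poly_mapping_eqI, simp add: lookup_scaleC lookup_add scaleC_add_right
      scaleC_add_left scaleC_scaleC scaleC_one)+
end


section \<open>Tensor products\<close>

text \<open>The linear extension of \<open>f\<close> to the free vector space on its domain.\<close>
definition free_ext :: "('x \<Rightarrow> 'v::complex_vector) \<Rightarrow> ('x \<Rightarrow>\<^sub>0 complex) \<Rightarrow> 'v" where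
  "free_ext f r = (\<Sum>x\<in>Poly_Mapping.keys r. Poly_Mapping.lookup r x *\<^sub>C f x)"

lemma free_ext_superset:
  assumes "finite A" "Poly_Mapping.keys r \<subseteq> A"
  shows "free_ext f r = (\<Sum>x\<in>A. Poly_Mapping.lookup r x *\<^sub>C f x)"
  unfolding free_ext_def
  by (rule sum.mono_neutral_left) (use assms in \<open>auto simp: in_keys_iff\<close>)

lemma free_ext_single [simp]: "free_ext f (Poly_Mapping.single x c) = c *\<^sub>C f x"
  by (simp add: free_ext_superset[of "{x}"])

lemma clinear_free_ext: "clinear (free_ext f)"
proof (rule clinearI)
  fix r s :: "'a \<Rightarrow>\<^sub>0 complex"
  let ?A = "Poly_Mapping.keys r \<union> Poly_Mapping.keys s"
  have "Poly_Mapping.keys (r + s) \<subseteq> ?A" by (rule Poly_Mapping.keys_add)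
  then show "free_ext f (r + s) = free_ext f r + free_ext f s"
    by (simp add: free_ext_superset[of ?A] lookup_add scaleC_add_left sum.distrib)
next
  fix c :: complex and r :: "'a \<Rightarrow>\<^sub>0 complex"
  have "Poly_Mapping.keys (c *\<^sub>C r) \<subseteq> Poly_Mapping.keys r"
    by (auto simp: in_keys_iff lookup_scaleC)
  then show "free_ext f (c *\<^sub>C r) = c *\<^sub>C free_ext f r"
    by (simp add: free_ext_superset[of "Poly_Mapping.keys r"] lookup_scaleC scaleC_complex_def
        complex_vector.scale_sum_right)
qed

lemma quotient_relI:
  fixes N :: "'a::complex_vector set"
  assumes "\<And>s t. R s t \<longleftrightarrow> s - t \<in> cspan N"
  shows "equivp R"
proof (rule equivpI)
  show "reflp R" by (rule reflpI) (simp add: assms complex_vector.span_zero)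
  show "symp R"
    by (rule sympI) (metis assms complex_vector.span_neg minus_diff_eq)
  show "transp R"
  proof (rule transpI)
    fix x y z assume "R x y" "R y z"
    then have "(x - y) + (y - z) \<in> cspan N" by (metis assms complex_vector.span_add)
    then show "R x z" by (simp add: assms)
  qed
qed

definition tensor_relators ::
    "(('a::complex_vector \<times> 'b::complex_vector) \<Rightarrow>\<^sub>0 complex) set" where
  "tensor_relators =
     {Poly_Mapping.single (x + x', y) 1 - Poly_Mapping.single (x, y) 1
        - Poly_Mapping.single (x', y) 1 | x x' y. True} \<union>
     {Poly_Mapping.single (x, y + y') 1 - Poly_Mapping.single (x, y) 1
        - Poly_Mapping.single (x, y') 1 | x y y'. True} \<union>
     {Poly_Mapping.single (c *\<^sub>C x, y) 1 - Poly_Mapping.single (x, y) c | c x y. True} \<union>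
     {Poly_Mapping.single (x, c *\<^sub>C y) 1 - Poly_Mapping.single (x, y) c | c x y. True}"

definition tensor_rel where
  "tensor_rel s t \<longleftrightarrow> s - t \<in> cspan tensor_relators"

quotient_type (overloaded) ('a, 'b) tensor =
  "('a::complex_vector \<times> 'b::complex_vector) \<Rightarrow>\<^sub>0 complex" / tensor_rel
  by (rule quotient_relI) (rule tensor_rel_def)

instantiation tensor :: (complex_vector, complex_vector) complex_vector
begin
lift_definition zero_tensor :: "('a, 'b) tensor" is 0 .
lift_definition plus_tensor :: "('a, 'b) tensor \<Rightarrow> ('a, 'b) tensor \<Rightarrow> ('a, 'b) tensor" is "(+)"
  unfolding tensor_rel_def by (subst add_diff_add) (rule complex_vector.span_add)
lift_definition minus_tensor :: "('a, 'b) tensor \<Rightarrow> ('a, 'b) tensor \<Rightarrow> ('a, 'b) tensor" is "(-)"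
  unfolding tensor_rel_def
proof -
  fix a b c d :: "('a \<times> 'b) \<Rightarrow>\<^sub>0 complex"
  assume "a - b \<in> cspan tensor_relators" "c - d \<in> cspan tensor_relators"
  then have "(a - b) - (c - d) \<in> cspan tensor_relators" by (rule complex_vector.span_diff)
  then show "a - c - (b - d) \<in> cspan tensor_relators" by (simp add: algebra_simps)
qed
lift_definition uminus_tensor :: "('a, 'b) tensor \<Rightarrow> ('a, 'b) tensor" is uminus
  unfolding tensor_rel_def by (drule complex_vector.span_neg) simp
lift_definition scaleC_tensor :: "complex \<Rightarrow> ('a, 'b) tensor \<Rightarrow> ('a, 'b) tensor" is scaleC
  unfolding tensor_rel_def
  by (subst complex_vector.scale_right_diff_distrib[symmetric]) (rule complex_vector.span_scale)
instance
proof
qed (transfer, simp add: tensor_rel_def complex_vector.span_zero algebra_simps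
      scaleC_add_right scaleC_add_left scaleC_scaleC scaleC_one)+
end

definition tens :: "'a::complex_vector \<Rightarrow> 'b::complex_vector \<Rightarrow> ('a, 'b) tensor" (infixl \<open>\<otimes>\<^sub>C\<close> 70) where
  "x \<otimes>\<^sub>C y = abs_tensor (Poly_Mapping.single (x, y) 1)"

text \<open>The linear map on the tensor product induced by a bilinear map \<open>f\<close>; independent of the
  representative by \<open>tensor_lift_abs\<close>.\<close>
definition tensor_lift ::
    "('a::complex_vector \<Rightarrow> 'b::complex_vector \<Rightarrow> 'v::complex_vector) \<Rightarrow> ('a, 'b) tensor \<Rightarrow> 'v" where
  "tensor_lift f t = free_ext (\<lambda>(x, y). f x y) (rep_tensor t)"

lemma tensor_lift_abs:
  assumes "cbilinear f"
  shows "tensor_lift f (abs_tensor r) = free_ext (\<lambda>(x, y). f x y) r"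
proof -
  interpret F: Vector_Spaces.linear scaleC scaleC "free_ext (\<lambda>(x, y). f x y)"
    by (rule clinear_free_ext)
  have l: "clinear (f x)" "clinear (\<lambda>x. f x y)" for x y
    using assms by (auto simp: cbilinear_def)
  have add: "f (x + x') y = f x y + f x' y" "f x (y + y') = f x y + f x y'"
    and sc: "f (c *\<^sub>C x) y = c *\<^sub>C f x y" "f x (c *\<^sub>C y) = c *\<^sub>C f x y" for x x' y y' c
    using complex_vector_pair.linear_add[OF l(1)] complex_vector_pair.linear_add[OF l(2)]
      complex_vector_pair.linear_scale[OF l(1)] complex_vector_pair.linear_scale[OF l(2)]
    by auto
  have "tensor_rel (rep_tensor (abs_tensor r)) r"
    by (rule Quotient3_rep_abs[OF Quotient3_tensor]) (rule equivp_reflp[OF tensor_equivp])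
  then have "rep_tensor (abs_tensor r) - r \<in> cspan tensor_relators"
    by (simp add: tensor_rel_def)
  then have "free_ext (\<lambda>(x, y). f x y) (rep_tensor (abs_tensor r) - r) = 0"
  proof (induction rule: complex_vector.span_induct)
    case base
    show ?case
      by (rule complex_vector.subspaceI) (auto simp: F.zero F.add F.scale)
  next
    case (step t)
    then show ?case
      unfolding tensor_relators_def
      by (auto simp: F.diff F.add add sc scaleC_one)
  qed
  then show ?thesis by (simp add: tensor_lift_def F.diff)
qed

lemma tensor_lift_tens: "cbilinear f \<Longrightarrow> tensor_lift f (x \<otimes>\<^sub>C y) = f x y"
  by (simp add: tens_def tensor_lift_abs scaleC_one)

text \<open>The tensor product of copies of \<open>'a\<close> indexed by \<open>'n\<close>.\<close>

definition tpower_relators :: "(('n \<Rightarrow> 'a::complex_vector) \<Rightarrow>\<^sub>0 complex) set" where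
  "tpower_relators =
     {Poly_Mapping.single (m(i := x + y)) 1 - Poly_Mapping.single (m(i := x)) 1
        - Poly_Mapping.single (m(i := y)) 1 | m i x y. True} \<union>
     {Poly_Mapping.single (m(i := c *\<^sub>C x)) 1 - Poly_Mapping.single (m(i := x)) c | m i c x. True}"

definition tpower_rel where
  "tpower_rel s t \<longleftrightarrow> s - t \<in> cspan tpower_relators"

quotient_type (overloaded) ('n, 'a) tpower =
  "('n \<Rightarrow> 'a::complex_vector) \<Rightarrow>\<^sub>0 complex" / tpower_rel
  by (rule quotient_relI) (rule tpower_rel_def)

instantiation tpower :: (type, complex_vector) complex_vector
begin
lift_definition zero_tpower :: "('a, 'b) tpower" is 0 .
lift_definition plus_tpower :: "('a, 'b) tpower \<Rightarrow> ('a, 'b) tpower \<Rightarrow> ('a, 'b) tpower" is "(+)"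
  unfolding tpower_rel_def by (subst add_diff_add) (rule complex_vector.span_add)
lift_definition minus_tpower :: "('a, 'b) tpower \<Rightarrow> ('a, 'b) tpower \<Rightarrow> ('a, 'b) tpower" is "(-)"
  unfolding tpower_rel_def
proof -
  fix a b c d :: "('a \<Rightarrow> 'b) \<Rightarrow>\<^sub>0 complex"
  assume "a - b \<in> cspan tpower_relators" "c - d \<in> cspan tpower_relators"
  then have "(a - b) - (c - d) \<in> cspan tpower_relators" by (rule complex_vector.span_diff)
  then show "a - c - (b - d) \<in> cspan tpower_relators" by (simp add: algebra_simps)
qed
lift_definition uminus_tpower :: "('a, 'b) tpower \<Rightarrow> ('a, 'b) tpower" is uminus
  unfolding tpower_rel_def by (drule complex_vector.span_neg) simp
lift_definition scaleC_tpower :: "complex \<Rightarrow> ('a, 'b) tpower \<Rightarrow> ('a, 'b) tpower" is scaleC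
  unfolding tpower_rel_def
  by (subst complex_vector.scale_right_diff_distrib[symmetric]) (rule complex_vector.span_scale)
instance
proof
qed (transfer, simp add: tpower_rel_def complex_vector.span_zero algebra_simps
      scaleC_add_right scaleC_add_left scaleC_scaleC scaleC_one)+
end

definition pure :: "('n \<Rightarrow> 'a::complex_vector) \<Rightarrow> ('n, 'a) tpower" where
  "pure m = abs_tpower (Poly_Mapping.single m 1)"

text \<open>The linear map induced by a multilinear map; see \<open>tpower_lift_abs\<close>.\<close>
definition tpower_lift ::
    "(('n \<Rightarrow> 'a::complex_vector) \<Rightarrow> 'v::complex_vector) \<Rightarrow> ('n, 'a) tpower \<Rightarrow> 'v" where
  "tpower_lift f t = free_ext f (rep_tpower t)"

lemma tpower_lift_abs:
  assumes "multilinear f"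
  shows "tpower_lift f (abs_tpower r) = free_ext f r"
proof -
  interpret F: Vector_Spaces.linear scaleC scaleC "free_ext f"
    by (rule clinear_free_ext)
  have l: "clinear (\<lambda>x. f (m(i := x)))" for m i
    using assms by (auto simp: multilinear_def)
  have add: "f (m(i := x + y)) = f (m(i := x)) + f (m(i := y))"
    and sc: "f (m(i := c *\<^sub>C x)) = c *\<^sub>C f (m(i := x))" for m i x y c
    using complex_vector_pair.linear_add[OF l] complex_vector_pair.linear_scale[OF l]
    by auto
  have "tpower_rel (rep_tpower (abs_tpower r)) r"
    by (rule Quotient3_rep_abs[OF Quotient3_tpower]) (rule equivp_reflp[OF tpower_equivp])
  then have "rep_tpower (abs_tpower r) - r \<in> cspan tpower_relators"
    by (simp add: tpower_rel_def)
  then have "free_ext f (rep_tpower (abs_tpower r) - r) = 0"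
  proof (induction rule: complex_vector.span_induct)
    case base
    show ?case
      by (rule complex_vector.subspaceI) (auto simp: F.zero F.add F.scale)
  next
    case (step t)
    then show ?case
      unfolding tpower_relators_def
      by (auto simp: F.diff F.add add sc scaleC_one)
  qed
  then show ?thesis by (simp add: tpower_lift_def F.diff)
qed

lemma tpower_lift_pure: "multilinear f \<Longrightarrow> tpower_lift f (pure m) = f m"
  by (simp add: pure_def tpower_lift_abs scaleC_one)

text \<open>The operator \<open>A\<^sup>(\<^sup>i\<^sup>)\<close>.\<close>
definition on_factor ::
    "'n \<Rightarrow> ('a::complex_vector \<Rightarrow> 'a) \<Rightarrow> ('n, 'a) tpower \<Rightarrow> ('n, 'a) tpower" where
  "on_factor i A = tpower_lift (\<lambda>m. pure (m(i := A (m i))))"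


section \<open>The Kac--Moody Lie algebra without Serre relations\<close>

definition lie_algebra :: "('g::complex_vector \<Rightarrow> 'g \<Rightarrow> 'g) \<Rightarrow> bool" where
  "lie_algebra br \<longleftrightarrow> cbilinear br \<and> (\<forall>x. br x x = 0) \<and>
     (\<forall>x y z. br x (br y z) + br y (br z x) + br z (br x y) = 0)"

text \<open>The Cartan subalgebra is \<open>complex ^ 'd\<close>; since its bilinear form is arbitrary, this only fixes
  a basis. A functional on it is a function \<open>complex ^ 'd \<Rightarrow> complex\<close>.\<close>
record ('d, 'r, 'g) km =
  form :: "complex ^ 'd \<Rightarrow> complex ^ 'd \<Rightarrow> complex"
  sroot :: "'r \<Rightarrow> complex ^ 'd \<Rightarrow> complex"
  brk :: "'g \<Rightarrow> 'g \<Rightarrow> 'g"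
  hh :: "complex ^ 'd \<Rightarrow> 'g"
  ee :: "'r \<Rightarrow> 'g"
  ff :: "'r \<Rightarrow> 'g"

definition flat_inv :: "('d::finite, 'r, 'g) km \<Rightarrow> (complex ^ 'd \<Rightarrow> complex) \<Rightarrow> complex ^ 'd" where
  "flat_inv G l = (THE x. \<forall>y. form G x y = l y)"

definition dual_form ::
    "('d::finite, 'r, 'g) km \<Rightarrow> (complex ^ 'd \<Rightarrow> complex) \<Rightarrow> (complex ^ 'd \<Rightarrow> complex) \<Rightarrow> complex" where
  "dual_form G l l' = form G (flat_inv G l) (flat_inv G l')"

definition hcoroot :: "('d::finite, 'r, 'g) km \<Rightarrow> 'r \<Rightarrow> complex ^ 'd" where
  "hcoroot G i = flat_inv G (sroot G i)"

text \<open>The presentation by generators and relations: formal Lie expressions in the generators, modulo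
  the least congruence that contains the Lie algebra axioms and the defining relations.\<close>

datatype ('h, 'r) lexpr =
    LH 'h | LE 'r | LF 'r | LZero
  | LAdd "('h, 'r) lexpr" "('h, 'r) lexpr"
  | LScale complex "('h, 'r) lexpr"
  | LBrk "('h, 'r) lexpr" "('h, 'r) lexpr"

inductive km_eq ::
    "('d::finite, 'r, 'g) km \<Rightarrow> (complex ^ 'd, 'r) lexpr \<Rightarrow> (complex ^ 'd, 'r) lexpr \<Rightarrow> bool"
  for G :: "('d::finite, 'r, 'g) km" where
    refl: "km_eq G a a"
  | sym: "km_eq G a b \<Longrightarrow> km_eq G b a"
  | trans: "km_eq G a b \<Longrightarrow> km_eq G b c \<Longrightarrow> km_eq G a c"
  | cong_add: "km_eq G a a' \<Longrightarrow> km_eq G b b' \<Longrightarrow> km_eq G (LAdd a b) (LAdd a' b')"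
  | cong_scale: "km_eq G a a' \<Longrightarrow> km_eq G (LScale s a) (LScale s a')"
  | cong_brk: "km_eq G a a' \<Longrightarrow> km_eq G b b' \<Longrightarrow> km_eq G (LBrk a b) (LBrk a' b')"
  | add_assoc: "km_eq G (LAdd (LAdd a b) c) (LAdd a (LAdd b c))"
  | add_comm: "km_eq G (LAdd a b) (LAdd b a)"
  | add_zero: "km_eq G (LAdd LZero a) a"
  | add_neg: "km_eq G (LAdd (LScale (-1) a) a) LZero"
  | scale_add: "km_eq G (LScale s (LAdd a b)) (LAdd (LScale s a) (LScale s b))"
  | add_scale: "km_eq G (LScale (s + t) a) (LAdd (LScale s a) (LScale t a))"
  | scale_scale: "km_eq G (LScale s (LScale t a)) (LScale (s * t) a)"
  | scale_one: "km_eq G (LScale 1 a) a"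
  | brk_add_left: "km_eq G (LBrk (LAdd a b) c) (LAdd (LBrk a c) (LBrk b c))"
  | brk_add_right: "km_eq G (LBrk a (LAdd b c)) (LAdd (LBrk a b) (LBrk a c))"
  | brk_scale_left: "km_eq G (LBrk (LScale s a) b) (LScale s (LBrk a b))"
  | brk_scale_right: "km_eq G (LBrk a (LScale s b)) (LScale s (LBrk a b))"
  | alternating: "km_eq G (LBrk a a) LZero"
  | jacobi: "km_eq G (LAdd (LBrk a (LBrk b c)) (LAdd (LBrk b (LBrk c a)) (LBrk c (LBrk a b)))) LZero"
  | h_add: "km_eq G (LH (x + y)) (LAdd (LH x) (LH y))"
  | h_scale: "km_eq G (LH (s *\<^sub>C x)) (LScale s (LH x))"
  | rel_he: "km_eq G (LBrk (LH x) (LE i)) (LScale (sroot G i x) (LE i))"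
  | rel_hf: "km_eq G (LBrk (LH x) (LF i)) (LScale (- sroot G i x) (LF i))"
  | rel_ef: "km_eq G (LBrk (LE i) (LF j)) (if i = j then LH (hcoroot G i) else LZero)"
  | rel_hh: "km_eq G (LBrk (LH x) (LH y)) LZero"

primrec leval :: "('d::finite, 'r, 'g::complex_vector) km \<Rightarrow> (complex ^ 'd, 'r) lexpr \<Rightarrow> 'g" where
    "leval G (LH x) = hh G x"
  | "leval G (LE i) = ee G i"
  | "leval G (LF i) = ff G i"
  | "leval G LZero = 0"
  | "leval G (LAdd a b) = leval G a + leval G b"
  | "leval G (LScale s a) = s *\<^sub>C leval G a"
  | "leval G (LBrk a b) = brk G (leval G a) (leval G b)"

text \<open>The last two conditions say that \<open>'g\<close>, with its bracket and generators, is (isomorphic to) the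
  Lie algebra given by the presentation.\<close>
definition kac_moody :: "('d::finite, 'r::finite, 'g::complex_vector) km \<Rightarrow> bool" where
  "kac_moody G \<longleftrightarrow>
     cbilinear (form G) \<and> (\<forall>x y. form G x y = form G y x) \<and>
     (\<forall>x. (\<forall>y. form G x y = 0) \<longrightarrow> x = 0) \<and>
     (\<forall>i. clinear (sroot G i)) \<and>
     (\<forall>c. (\<forall>x. (\<Sum>i\<in>UNIV. c i * sroot G i x) = 0) \<longrightarrow> (\<forall>i. c i = 0)) \<and>
     lie_algebra (brk G) \<and>
     surj (leval G) \<and> (\<forall>a b. leval G a = leval G b \<longleftrightarrow> km_eq G a b)"

definition lie_subalgebra :: "('d::finite, 'r, 'g::complex_vector) km \<Rightarrow> 'g set \<Rightarrow> bool" where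
  "lie_subalgebra G W \<longleftrightarrow> csubspace W \<and> (\<forall>x\<in>W. \<forall>y\<in>W. brk G x y \<in> W)"

definition n_minus :: "('d::finite, 'r, 'g::complex_vector) km \<Rightarrow> 'g set" where
  "n_minus G = lie_subalgebra G hull (range (ff G))"

definition n_plus :: "('d::finite, 'r, 'g::complex_vector) km \<Rightarrow> 'g set" where
  "n_plus G = lie_subalgebra G hull (range (ee G))"

definition n_minus_space ::
    "('d::finite, 'r, 'g::complex_vector) km \<Rightarrow> (complex ^ 'd \<Rightarrow> complex) \<Rightarrow> 'g set" where
  "n_minus_space G \<alpha> = {x \<in> n_minus G. \<forall>h. brk G (hh G h) x = - (\<alpha> h *\<^sub>C x)}"

definition pos_roots :: "('d::finite, 'r::finite, 'g::complex_vector) km \<Rightarrow> (complex ^ 'd \<Rightarrow> complex) set" where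
  "pos_roots G = {\<alpha>. (\<exists>k :: 'r \<Rightarrow> nat. \<alpha> = (\<lambda>h. \<Sum>i\<in>UNIV. of_nat (k i) * sroot G i h)) \<and>
     \<alpha> \<noteq> (\<lambda>h. 0) \<and> n_minus_space G \<alpha> \<noteq> {0}}"


section \<open>Verma modules\<close>

definition lie_module ::
    "('d::finite, 'r, 'g::complex_vector) km \<Rightarrow> ('g \<Rightarrow> 'm \<Rightarrow> 'm::complex_vector) \<Rightarrow> bool" where
  "lie_module G act \<longleftrightarrow> cbilinear act \<and>
     (\<forall>x y u. act (brk G x y) u = act x (act y u) - act y (act x u))"

text \<open>The Verma module is the module on one generator \<open>v\<close> subject to \<open>x v = 0\<close> for \<open>x\<close> in
  \<open>n_plus\<close> and \<open>h v = \<Lambda>(h) v\<close>, again presented by formal expressions.\<close>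

datatype 'g mexpr =
    MV | MZero | MAdd "'g mexpr" "'g mexpr" | MScale complex "'g mexpr" | MAct 'g "'g mexpr"

inductive verma_eq ::
    "('d::finite, 'r, 'g::complex_vector) km \<Rightarrow> (complex ^ 'd \<Rightarrow> complex) \<Rightarrow> 'g mexpr \<Rightarrow> 'g mexpr \<Rightarrow> bool"
  for G :: "('d::finite, 'r, 'g::complex_vector) km" and \<Lambda> :: "complex ^ 'd \<Rightarrow> complex" where
    refl: "verma_eq G \<Lambda> a a"
  | sym: "verma_eq G \<Lambda> a b \<Longrightarrow> verma_eq G \<Lambda> b a"
  | trans: "verma_eq G \<Lambda> a b \<Longrightarrow> verma_eq G \<Lambda> b c \<Longrightarrow> verma_eq G \<Lambda> a c"
  | cong_add: "verma_eq G \<Lambda> a a' \<Longrightarrow> verma_eq G \<Lambda> b b' \<Longrightarrow> verma_eq G \<Lambda> (MAdd a b) (MAdd a' b')"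
  | cong_scale: "verma_eq G \<Lambda> a a' \<Longrightarrow> verma_eq G \<Lambda> (MScale s a) (MScale s a')"
  | cong_act: "verma_eq G \<Lambda> a a' \<Longrightarrow> verma_eq G \<Lambda> (MAct x a) (MAct x a')"
  | add_assoc: "verma_eq G \<Lambda> (MAdd (MAdd a b) c) (MAdd a (MAdd b c))"
  | add_comm: "verma_eq G \<Lambda> (MAdd a b) (MAdd b a)"
  | add_zero: "verma_eq G \<Lambda> (MAdd MZero a) a"
  | add_neg: "verma_eq G \<Lambda> (MAdd (MScale (-1) a) a) MZero"
  | scale_add: "verma_eq G \<Lambda> (MScale s (MAdd a b)) (MAdd (MScale s a) (MScale s b))"
  | add_scale: "verma_eq G \<Lambda> (MScale (s + t) a) (MAdd (MScale s a) (MScale t a))"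
  | scale_scale: "verma_eq G \<Lambda> (MScale s (MScale t a)) (MScale (s * t) a)"
  | scale_one: "verma_eq G \<Lambda> (MScale 1 a) a"
  | act_add: "verma_eq G \<Lambda> (MAct x (MAdd a b)) (MAdd (MAct x a) (MAct x b))"
  | act_scale: "verma_eq G \<Lambda> (MAct x (MScale s a)) (MScale s (MAct x a))"
  | add_act: "verma_eq G \<Lambda> (MAct (x + y) a) (MAdd (MAct x a) (MAct y a))"
  | scale_act: "verma_eq G \<Lambda> (MAct (s *\<^sub>C x) a) (MScale s (MAct x a))"
  | act_brk: "verma_eq G \<Lambda> (MAct (brk G x y) a)
      (MAdd (MAct x (MAct y a)) (MScale (-1) (MAct y (MAct x a))))"
  | highest: "x \<in> n_plus G \<Longrightarrow> verma_eq G \<Lambda> (MAct x MV) MZero"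
  | weight: "verma_eq G \<Lambda> (MAct (hh G h) MV) (MScale (\<Lambda> h) MV)"

primrec meval :: "('g \<Rightarrow> 'm \<Rightarrow> 'm::complex_vector) \<Rightarrow> 'm \<Rightarrow> 'g mexpr \<Rightarrow> 'm" where
    "meval act v MV = v"
  | "meval act v MZero = 0"
  | "meval act v (MAdd a b) = meval act v a + meval act v b"
  | "meval act v (MScale s a) = s *\<^sub>C meval act v a"
  | "meval act v (MAct x a) = act x (meval act v a)"

definition verma_module ::
    "('d::finite, 'r, 'g::complex_vector) km \<Rightarrow> (complex ^ 'd \<Rightarrow> complex) \<Rightarrow>
     ('g \<Rightarrow> 'm \<Rightarrow> 'm::complex_vector) \<Rightarrow> 'm \<Rightarrow> bool" where
  "verma_module G \<Lambda> act v \<longleftrightarrow> lie_module G act \<and> surj (meval act v) \<and>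
     (\<forall>a b. meval act v a = meval act v b \<longleftrightarrow> verma_eq G \<Lambda> a b)"

definition weight_space ::
    "('d::finite, 'r, 'g) km \<Rightarrow> ('g \<Rightarrow> 'm \<Rightarrow> 'm::complex_vector) \<Rightarrow> (complex ^ 'd \<Rightarrow> complex) \<Rightarrow> 'm set" where
  "weight_space G act l = {u. \<forall>h. act (hh G h) u = l h *\<^sub>C u}"


section \<open>The operators on a tensor product of Verma modules\<close>

text \<open>A family of modules is given by \<open>act k\<close> and \<open>v k\<close> for the \<open>k\<close>-th factor. All factors live on
  one type \<open>'m\<close>; this is no restriction for Verma modules, since as a vector space each of them is
  isomorphic to the enveloping algebra of \<open>n_minus\<close>, whatever the highest weight. Tensors in
  \<open>n_minus \<otimes> V\<close> are regarded as elements of \<open>('g, 'v) tensor\<close>, and a functional on \<open>n_minus\<close> is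
  represented by any linear extension to \<open>'g\<close>; its values off \<open>n_minus\<close> do not matter.\<close>

definition tens_act ::
    "('d::finite, 'r, 'g::complex_vector) km \<Rightarrow> ('g \<Rightarrow> 'm \<Rightarrow> 'm::complex_vector) \<Rightarrow>
     'g \<Rightarrow> ('g, 'm) tensor \<Rightarrow> ('g, 'm) tensor" where
  "tens_act G act a = tensor_lift (\<lambda>d y. brk G a d \<otimes>\<^sub>C y + d \<otimes>\<^sub>C act a y)"

definition nu_minus ::
    "('d::finite, 'r, 'g::complex_vector) km \<Rightarrow> ('g \<Rightarrow> 'm \<Rightarrow> 'm::complex_vector) \<Rightarrow> 'm \<Rightarrow>
     'm \<Rightarrow> ('g, 'm) tensor" where
  "nu_minus G act v = (THE \<nu>. clinear \<nu> \<and> \<nu> v = 0 \<and>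
     (\<forall>i x. \<nu> (act (ff G i) x) =
        ff G i \<otimes>\<^sub>C act (hh G (hcoroot G i)) x + tens_act G act (ff G i) (\<nu> x)))"

definition contract :: "('g \<Rightarrow> complex) \<Rightarrow> ('g::complex_vector, 'v::complex_vector) tensor \<Rightarrow> 'v" where
  "contract \<xi> = tensor_lift (\<lambda>d y. \<xi> d *\<^sub>C y)"

definition nu_factor ::
    "('d::finite, 'r, 'g::complex_vector) km \<Rightarrow> ('n \<Rightarrow> 'g \<Rightarrow> 'm \<Rightarrow> 'm::complex_vector) \<Rightarrow> ('n \<Rightarrow> 'm) \<Rightarrow>
     'n \<Rightarrow> ('n, 'm) tpower \<Rightarrow> ('g, ('n, 'm) tpower) tensor" where
  "nu_factor G act v k = tpower_lift (\<lambda>m.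
     tensor_lift (\<lambda>d y. d \<otimes>\<^sub>C pure (m(k := y))) (nu_minus G (act k) (v k) (m k)))"

definition nu_total ::
    "('d::finite, 'r, 'g::complex_vector) km \<Rightarrow> ('n::finite \<Rightarrow> 'g \<Rightarrow> 'm \<Rightarrow> 'm::complex_vector) \<Rightarrow> ('n \<Rightarrow> 'm) \<Rightarrow>
     ('n, 'm) tpower \<Rightarrow> ('g, ('n, 'm) tpower) tensor" where
  "nu_total G act v u = (\<Sum>k\<in>UNIV. nu_factor G act v k u)"

definition total_act ::
    "('n::finite \<Rightarrow> 'g \<Rightarrow> 'm \<Rightarrow> 'm::complex_vector) \<Rightarrow> 'g \<Rightarrow> ('n, 'm) tpower \<Rightarrow> ('n, 'm) tpower" where
  "total_act act x u = (\<Sum>k\<in>UNIV. on_factor k (act k x) u)"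

text \<open>\<open>X \<beta>\<close> is a basis of \<open>n_minus_space G \<beta>\<close>. The dual basis vector is \<open>1\<close> on \<open>x\<close> and \<open>0\<close> on the
  other elements of the union of these bases, in particular on all other weight spaces.\<close>
definition dual_vec ::
    "('d::finite, 'r::finite, 'g::complex_vector) km \<Rightarrow> ((complex ^ 'd \<Rightarrow> complex) \<Rightarrow> 'g set) \<Rightarrow> 'g \<Rightarrow> 'g \<Rightarrow> complex" where
  "dual_vec G X x = complex_vector_pair.construct (\<Union>\<beta>\<in>pos_roots G. X \<beta>) (\<lambda>y. if y = x then 1 else 0)"

definition Delta_plus ::
    "('d::finite, 'r::finite, 'g::complex_vector) km \<Rightarrow> ('n::finite \<Rightarrow> 'g \<Rightarrow> 'm \<Rightarrow> 'm::complex_vector) \<Rightarrow> ('n \<Rightarrow> 'm) \<Rightarrow>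
     ((complex ^ 'd \<Rightarrow> complex) \<Rightarrow> 'g set) \<Rightarrow> (complex ^ 'd \<Rightarrow> complex) \<Rightarrow>
     ('n, 'm) tpower \<Rightarrow> ('n, 'm) tpower" where
  "Delta_plus G act v X \<alpha> u =
     (\<Sum>x\<in>X \<alpha>. total_act act x (contract (dual_vec G X x) (nu_total G act v u)))"

text \<open>\<open>Sum_any\<close> sums over all \<open>\<beta>\<close> with non-zero term; there are finitely many of these.\<close>
definition Omega_plus ::
    "('d::finite, 'r::finite, 'g::complex_vector) km \<Rightarrow> ('n \<Rightarrow> 'g \<Rightarrow> 'm \<Rightarrow> 'm::complex_vector) \<Rightarrow> ('n \<Rightarrow> 'm) \<Rightarrow>
     ((complex ^ 'd \<Rightarrow> complex) \<Rightarrow> 'g set) \<Rightarrow> 'n \<Rightarrow> 'n \<Rightarrow> ('n, 'm) tpower \<Rightarrow> ('n, 'm) tpower" where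
  "Omega_plus G act v X i j = (THE T. clinear T \<and>
     (\<forall>m l l'. m i \<in> weight_space G (act i) l \<and> m j \<in> weight_space G (act j) l' \<longrightarrow>
        T (pure m) = dual_form G l l' *\<^sub>C pure m +
          Sum_any (\<lambda>\<beta>. if \<beta> \<in> pos_roots G then
            \<Sum>x\<in>X \<beta>.
              pure (m(i := act i x (m i),
                      j := contract (dual_vec G X x) (nu_minus G (act j) (v j) (m j)))) +
              pure (m(i := contract (dual_vec G X x) (nu_minus G (act i) (v i) (m i)),
                      j := act j x (m j)))
            else 0)))"


section \<open>Contravariant forms and the algebra with Serre relations\<close>

definition tau :: "('d::finite, 'r, 'g::complex_vector) km \<Rightarrow> 'g \<Rightarrow> 'g" where
  "tau G = (THE t. clinear t \<and> bij t \<and> (\<forall>x y. t (brk G x y) = brk G (t x) (t y)) \<and>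
     (\<forall>i. t (ee G i) = - ff G i) \<and> (\<forall>i. t (ff G i) = - ee G i) \<and> (\<forall>h. t (hh G h) = - hh G h))"

definition invariant_form :: "('d::finite, 'r, 'g::complex_vector) km \<Rightarrow> ('g \<Rightarrow> 'g \<Rightarrow> complex) \<Rightarrow> bool" where
  "invariant_form G K \<longleftrightarrow> cbilinear K \<and>
     (\<forall>x y z. K (brk G x y) z = K x (brk G y z)) \<and>
     (\<forall>a b. K (hh G a) (hh G b) = form G a b) \<and>
     (\<forall>x\<in>n_plus G. \<forall>y\<in>n_plus G. K x y = 0) \<and>
     (\<forall>x\<in>n_minus G. \<forall>y\<in>n_minus G. K x y = 0) \<and>
     (\<forall>a. \<forall>x\<in>n_minus G \<union> n_plus G. K (hh G a) x = 0 \<and> K x (hh G a) = 0) \<and>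
     (\<forall>i j. K (ff G i) (ee G j) = (if i = j then 1 else 0) \<and>
            K (ee G j) (ff G i) = (if i = j then 1 else 0))"

definition S_lie :: "('d::finite, 'r, 'g::complex_vector) km \<Rightarrow> ('g \<Rightarrow> 'g \<Rightarrow> complex) \<Rightarrow> 'g \<Rightarrow> 'g \<Rightarrow> complex" where
  "S_lie G K x y = - K (tau G x) y"

definition contravariant_form ::
    "('d::finite, 'r, 'g) km \<Rightarrow> ('g \<Rightarrow> 'm \<Rightarrow> 'm::complex_vector) \<Rightarrow> 'm \<Rightarrow> ('m \<Rightarrow> 'm \<Rightarrow> complex) \<Rightarrow> bool" where
  "contravariant_form G act v S \<longleftrightarrow> cbilinear S \<and> S v v = 1 \<and>
     (\<forall>i x y. S (act (ee G i) x) y = S x (act (ff G i) y) \<and>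
              S (act (ff G i) x) y = S x (act (ee G i) y))"

definition product_form ::
    "('n::finite \<Rightarrow> 'm \<Rightarrow> 'm \<Rightarrow> complex) \<Rightarrow> ('n, 'm::complex_vector) tpower \<Rightarrow> ('n, 'm) tpower \<Rightarrow> complex" where
  "product_form S u w =
     tpower_lift (\<lambda>m. tpower_lift (\<lambda>m'. \<Prod>k\<in>UNIV. S k (m k) (m' k)) w) u"

definition form_kernel :: "('a \<Rightarrow> 'a \<Rightarrow> complex) \<Rightarrow> 'a set" where
  "form_kernel S = {x. \<forall>y. S x y = 0}"

text \<open>In the following \<open>p\<close> is the projection onto the Lie algebra with Serre relations and \<open>\<pi>\<close> the
  projection of the tensor product of Verma modules onto its quotient \<open>L\<close>. The induced structures
  are computed on representatives.\<close>

definition bar_brk :: "('d::finite, 'r, 'g) km \<Rightarrow> ('g \<Rightarrow> 'q) \<Rightarrow> 'q \<Rightarrow> 'q \<Rightarrow> 'q" where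
  "bar_brk G p x y = p (brk G (inv p x) (inv p y))"

definition bar_form :: "('g \<Rightarrow> 'g \<Rightarrow> complex) \<Rightarrow> ('g \<Rightarrow> 'q) \<Rightarrow> 'q \<Rightarrow> 'q \<Rightarrow> complex" where
  "bar_form K p x y = K (inv p x) (inv p y)"

definition bar_act ::
    "('n \<Rightarrow> 'g \<Rightarrow> 'm \<Rightarrow> 'm::complex_vector) \<Rightarrow> ('g \<Rightarrow> 'q) \<Rightarrow> (('n, 'm) tpower \<Rightarrow> 'l) \<Rightarrow>
     'n \<Rightarrow> 'q \<Rightarrow> 'l \<Rightarrow> 'l" where
  "bar_act act p \<pi> i x w = \<pi> (on_factor i (act i (inv p x)) (inv \<pi> w))"

definition bar_root_space ::
    "('d::finite, 'r, 'g) km \<Rightarrow> ('g \<Rightarrow> 'q::complex_vector) \<Rightarrow> (complex ^ 'd \<Rightarrow> complex) \<Rightarrow> 'q set" where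
  "bar_root_space G p \<alpha> = {x. \<forall>h. bar_brk G p (p (hh G h)) x = \<alpha> h *\<^sub>C x}"

text \<open>\<open>E \<alpha>\<close> is a basis of the root space for \<open>\<alpha>\<close>; \<open>bar_dual\<close> sends \<open>e\<^sub>l\<close> to the dual basis vector \<open>f\<^sub>l\<close>.\<close>
definition bar_dual ::
    "('d::finite, 'r, 'g) km \<Rightarrow> ('g \<Rightarrow> 'g \<Rightarrow> complex) \<Rightarrow> ('g \<Rightarrow> 'q::complex_vector) \<Rightarrow>
     ((complex ^ 'd \<Rightarrow> complex) \<Rightarrow> 'q set) \<Rightarrow> (complex ^ 'd \<Rightarrow> complex) \<Rightarrow> 'q \<Rightarrow> 'q" where
  "bar_dual G K p E \<alpha> x = (THE y. y \<in> bar_root_space G p (\<lambda>h. - \<alpha> h) \<and>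
     (\<forall>x'\<in>E \<alpha>. bar_form K p y x' = (if x' = x then 1 else 0)))"

definition bar_Delta ::
    "('d::finite, 'r, 'g) km \<Rightarrow> ('n::finite \<Rightarrow> 'g \<Rightarrow> 'm \<Rightarrow> 'm::complex_vector) \<Rightarrow> ('g \<Rightarrow> 'g \<Rightarrow> complex) \<Rightarrow>
     ('g \<Rightarrow> 'q::complex_vector) \<Rightarrow> (('n, 'm) tpower \<Rightarrow> 'l::complex_vector) \<Rightarrow>
     ((complex ^ 'd \<Rightarrow> complex) \<Rightarrow> 'q set) \<Rightarrow> (complex ^ 'd \<Rightarrow> complex) \<Rightarrow> 'l \<Rightarrow> 'l" where
  "bar_Delta G act K p \<pi> E \<alpha> w =
     (let a = (\<lambda>x w. \<Sum>k\<in>UNIV. bar_act act p \<pi> k x w)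
      in \<Sum>x\<in>E \<alpha>. a (bar_dual G K p E \<alpha> x) (a x w))"

definition bar_Omega ::
    "('d::finite, 'r::finite, 'g::complex_vector) km \<Rightarrow> ('n \<Rightarrow> 'g \<Rightarrow> 'm \<Rightarrow> 'm::complex_vector) \<Rightarrow>
     ('g \<Rightarrow> 'g \<Rightarrow> complex) \<Rightarrow> ('g \<Rightarrow> 'q::complex_vector) \<Rightarrow> (('n, 'm) tpower \<Rightarrow> 'l::complex_vector) \<Rightarrow>
     ((complex ^ 'd \<Rightarrow> complex) \<Rightarrow> 'q set) \<Rightarrow> ('d \<Rightarrow> complex ^ 'd) \<Rightarrow> 'n \<Rightarrow> 'n \<Rightarrow> 'l \<Rightarrow> 'l" where
  "bar_Omega G act K p \<pi> E hs i j w =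
     (let a = bar_act act p \<pi>
      in (\<Sum>s\<in>UNIV. a i (p (hh G (hs s))) (a j (p (hh G (hs s))) w)) +
         Sum_any (\<lambda>\<alpha>. if \<alpha> \<in> pos_roots G then
           \<Sum>x\<in>E \<alpha>. a i x (a j (bar_dual G K p E \<alpha> x) w) + a i (bar_dual G K p E \<alpha> x) (a j x w)
           else 0))"


section \<open>Differential equations and compatibility\<close>

text \<open>Points are pairs \<open>(\<mu>, z)\<close>. Derivatives of functions with values in a (finite dimensional
  subspace of a) vector space are taken weakly, i.e. after applying arbitrary linear functionals;
  in finite dimension this agrees with the usual notion.\<close>

type_synonym ('d, 'n) point = "(complex ^ 'd) \<times> (complex ^ 'n)"

definition holomorphic_vec ::
    "(('d, 'n) point) set \<Rightarrow>
     (('d::finite, 'n::finite) point \<Rightarrow> 'v::complex_vector) \<Rightarrow> bool" where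
  "holomorphic_vec U u \<longleftrightarrow> (\<forall>\<phi> :: 'v \<Rightarrow> complex. clinear \<phi> \<longrightarrow>
     (\<forall>P\<in>U. \<exists>D. ((\<lambda>Q. \<phi> (u Q)) has_derivative D) (at P) \<and> (\<forall>c w. D (c *\<^sub>C w) = c * D w)))"

definition dir_deriv ::
    "('d, 'n) point \<Rightarrow>
     (('d::finite, 'n::finite) point \<Rightarrow> 'v::complex_vector) \<Rightarrow>
     ('d, 'n) point \<Rightarrow> 'v" where
  "dir_deriv w u P = (THE D. \<forall>\<phi> :: 'v \<Rightarrow> complex. clinear \<phi> \<longrightarrow>
     ((\<lambda>t. \<phi> (u (P + t *\<^sub>C w))) has_field_derivative \<phi> D) (at 0))"

text \<open>The operator \<open>\<kappa> \<partial>\<^sub>w - A\<close>.\<close>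
definition conn ::
    "complex \<Rightarrow> ('d, 'n) point \<Rightarrow>
     (('d::finite, 'n::finite) point \<Rightarrow> 'v \<Rightarrow> 'v::complex_vector) \<Rightarrow>
     (('d, 'n) point \<Rightarrow> 'v) \<Rightarrow> ('d, 'n) point \<Rightarrow> 'v" where
  "conn \<kappa> w A u P = \<kappa> *\<^sub>C dir_deriv w u P - A P (u P)"

text \<open>The right-hand sides, for a tensor product on whose \<open>i\<close>-th factor \<open>h\<close> acts by \<open>hact i h\<close>.\<close>

definition KZ_rhs ::
    "('n::finite \<Rightarrow> complex ^ 'd \<Rightarrow> 'v \<Rightarrow> 'v) \<Rightarrow> ('n \<Rightarrow> 'n \<Rightarrow> 'v \<Rightarrow> 'v::complex_vector) \<Rightarrow>
     'n \<Rightarrow> ('d, 'n) point \<Rightarrow> 'v \<Rightarrow> 'v" where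
  "KZ_rhs hact Om i = (\<lambda>(\<mu>, z) u.
     hact i \<mu> u + (\<Sum>j\<in>UNIV - {i}. (1 / (z $ i - z $ j)) *\<^sub>C Om i j u))"

definition dyn_rhs ::
    "('n::finite \<Rightarrow> complex ^ 'd \<Rightarrow> 'v \<Rightarrow> 'v) \<Rightarrow> (complex ^ 'd \<Rightarrow> complex) set \<Rightarrow>
     ((complex ^ 'd \<Rightarrow> complex) \<Rightarrow> 'v \<Rightarrow> 'v::complex_vector) \<Rightarrow>
     complex ^ 'd \<Rightarrow> ('d, 'n) point \<Rightarrow> 'v \<Rightarrow> 'v" where
  "dyn_rhs hact R Del \<mu>' = (\<lambda>(\<mu>, z) u.
     (\<Sum>i\<in>UNIV. (z $ i) *\<^sub>C hact i \<mu>' u) +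
     Sum_any (\<lambda>\<alpha>. if \<alpha> \<in> R then (\<alpha> \<mu>' / \<alpha> \<mu>) *\<^sub>C Del \<alpha> u else 0))"

definition KZ_dyn_operators ::
    "complex \<Rightarrow> (complex ^ 'd \<Rightarrow> complex) set \<Rightarrow> ('n \<Rightarrow> complex ^ 'd \<Rightarrow> 'v \<Rightarrow> 'v) \<Rightarrow>
     ('n \<Rightarrow> 'n \<Rightarrow> 'v \<Rightarrow> 'v) \<Rightarrow> ((complex ^ 'd \<Rightarrow> complex) \<Rightarrow> 'v \<Rightarrow> 'v) \<Rightarrow>
     ((('d::finite, 'n::finite) point \<Rightarrow> 'v::complex_vector) \<Rightarrow>
        ('d, 'n) point \<Rightarrow> 'v) set" where
  "KZ_dyn_operators \<kappa> R hact Om Del =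
     range (\<lambda>i. conn \<kappa> (0, axis i 1) (KZ_rhs hact Om i)) \<union>
     range (\<lambda>\<mu>'. conn \<kappa> (\<mu>', 0) (dyn_rhs hact R Del \<mu>'))"

text \<open>The complement of the poles of the equations on a weight space \<open>W\<close>. Only the roots whose
  operator does not vanish on \<open>W\<close> contribute; the set of all root hyperplanes need not be closed.\<close>
definition regular_points ::
    "(complex ^ 'd::finite \<Rightarrow> complex) set \<Rightarrow> ((complex ^ 'd \<Rightarrow> complex) \<Rightarrow> 'v \<Rightarrow> 'v::zero) \<Rightarrow> 'v set \<Rightarrow>
     (('d, 'n::finite) point) set" where
  "regular_points R Del W = {(\<mu>, z). (\<forall>i j. i \<noteq> j \<longrightarrow> z $ i \<noteq> z $ j) \<and>
     (\<forall>\<alpha>\<in>R. (\<exists>u\<in>W. Del \<alpha> u \<noteq> 0) \<longrightarrow> \<alpha> \<mu> \<noteq> 0)}"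

text \<open>All operators commute pairwise on holomorphic functions with values in any weight space.\<close>
definition KZ_dyn_compatible ::
    "complex \<Rightarrow> (complex ^ 'd::finite \<Rightarrow> complex) set \<Rightarrow> ('n::finite \<Rightarrow> complex ^ 'd \<Rightarrow> 'v \<Rightarrow> 'v) \<Rightarrow>
     ('n \<Rightarrow> 'n \<Rightarrow> 'v \<Rightarrow> 'v::complex_vector) \<Rightarrow> ((complex ^ 'd \<Rightarrow> complex) \<Rightarrow> 'v \<Rightarrow> 'v) \<Rightarrow> bool" where
  "KZ_dyn_compatible \<kappa> R hact Om Del \<longleftrightarrow>
     (\<forall>l W U u. W = {w. \<forall>h. (\<Sum>k\<in>UNIV. hact k h w) = l h *\<^sub>C w} \<longrightarrow>
        open U \<longrightarrow> U \<subseteq> regular_points R Del W \<longrightarrow>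
        holomorphic_vec U u \<longrightarrow> u ` U \<subseteq> W \<longrightarrow>
        (\<forall>A\<in>KZ_dyn_operators \<kappa> R hact Om Del. \<forall>B\<in>KZ_dyn_operators \<kappa> R hact Om Del.
           \<forall>P\<in>U. A (B u) P = B (A u) P))"

end

theory Submission
  imports Defs "HOL-Complex_Analysis.Cauchy_Integral_Formula"
begin

text \<open>
  Both \<open>M\<close> and \<open>L\<close> are tensor products of modules over a graded Lie algebra that has dual bases
  \<open>x\<^sub>b\<close>, \<open>y\<^sub>b\<close> of its lowering and raising parts, with the mixed brackets \<open>[y\<^sub>a, x\<^sub>b]\<close> determined by
  invariance of the pairing. For \<open>L\<close> this is the algebra with Serre relations and its form \<open>K\<close>. For
  \<open>M\<close> it is the double of the Lie bialgebra \<open>n_minus\<close>: functionals on \<open>n_minus\<close> act through \<open>\<nu>\<^sub>-\<close>, and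
  since \<open>n_minus\<close> acts faithfully on the generating vector of a Verma module, these actions determine
  the cobracket.

  Compatibility follows from these relations alone. In the commutator of two connection operators the
  part of order \<open>\<kappa>\<close> vanishes because mixed derivatives agree. The part of order one vanishes by
  \<open>[\<Omega>\<^sub>i\<^sub>j, \<Omega>\<^sub>i\<^sub>k + \<Omega>\<^sub>j\<^sub>k] = 0\<close> for two KZ operators; because \<open>[h\<^sup>(\<^sup>i\<^sup>), \<Omega>\<^sub>i\<^sub>j]\<close> and \<open>[h\<^sup>(\<^sup>i\<^sup>), \<Delta>\<^sub>\<alpha>]\<close>
  have the same root components for a KZ and a dynamical operator; and for two dynamical operators
  because \<open>\<Delta>\<^sub>\<alpha>\<close> commutes with the sum of the \<open>\<Delta>\<^sub>\<beta>\<close> over the roots \<open>\<beta>\<close> of any plane through \<open>\<alpha>\<close>, this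
  sum being the positive part of the Casimir operator of a subalgebra.
\<close>

text \<open>The double of \<open>n_minus\<close> is never built as a Lie algebra: only its structure
  constants and its operators on modules appear. Two obstacles shape this. The sums over roots are
  infinite, so every relation carries a cut-off in height, and each identity is checked on one
  vector, with the cut-off beyond the height from which the raising operators kill it. And all
  tensor factors must share the same structure constants, although \<open>nu_minus\<close> is
  defined on each Verma module separately; hence the relation between a functional and an element of
  \<open>n_minus\<close> is required on all factors at once. Evaluated at a generating vector it
  determines its unknown term, and induction on iterated brackets shows that this term exists.
  Planes suffice for two dynamical operators because the coefficient \<alpha>(p) \<beta>(q) /
  (\<alpha>(\<mu>) \<beta>(\<mu>)), once antisymmetrized, is on each plane a multiple of the
  difference of one function at \<beta> and at \<alpha>, so only row sums of commutators matter.
  Verma modules are given by a presentation; a model on words shows that the words in the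
  \<open>ff G i\<close>, applied to the generating vector, are independent, so that maps may be
  defined by recursion on them.\<close>

lemma clinear_add: "clinear f \<Longrightarrow> f (x + y) = f x + f y"
  by (rule complex_vector_pair.linear_add)

lemma clinear_scale: "clinear f \<Longrightarrow> f (c *\<^sub>C x) = c *\<^sub>C f x"
  by (rule complex_vector_pair.linear_scale)

lemma clinear_zero: "clinear f \<Longrightarrow> f 0 = 0"
  by (rule complex_vector_pair.linear_0)

lemma clinear_diff: "clinear f \<Longrightarrow> f (x - y) = f x - f y"
  by (rule complex_vector_pair.linear_diff)

lemma clinear_minus: "clinear f \<Longrightarrow> f (- x) = - f x"
  by (rule complex_vector_pair.linear_neg)

lemma clinear_sum: "clinear f \<Longrightarrow> f (sum g A) = (\<Sum>a\<in>A. f (g a))"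
  by (rule complex_vector_pair.linear_sum)

lemmas clinear_simps = clinear_add clinear_scale clinear_zero clinear_diff clinear_minus

lemma scaleC_complex: "(a::complex) *\<^sub>C b = a * b"
  by (simp add: scaleC_complex_def)

lemma scaleC_zero [simp]: "0 *\<^sub>C x = 0" "c *\<^sub>C 0 = 0" "1 *\<^sub>C x = x" "(-1) *\<^sub>C x = - x"
    "c *\<^sub>C (- x) = - (c *\<^sub>C x)" "(- c) *\<^sub>C x = - (c *\<^sub>C x)"
  for x :: "'a::complex_vector"
  by (simp_all add: scaleC_one complex_vector.scale_minus_left)

lemmas scaleC_distribs = scaleC_add_right scaleC_add_left
  complex_vector.scale_right_diff_distrib complex_vector.scale_left_diff_distrib

lemma clinear_compose: "clinear f \<Longrightarrow> clinear g \<Longrightarrow> clinear (\<lambda>x. f (g x))"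
  by (rule clinearI) (simp_all add: clinear_simps)

lemma clinear_ident: "clinear (\<lambda>x. x)"
  by (rule clinearI) simp_all

lemma clinear_const0: "clinear (\<lambda>x. 0)"
  by (rule clinearI) simp_all

lemma clinear_plus: "clinear f \<Longrightarrow> clinear g \<Longrightarrow> clinear (\<lambda>x. f x + g x)"
  by (rule clinearI) (simp_all add: clinear_simps scaleC_distribs)

lemma clinear_minus_fun: "clinear f \<Longrightarrow> clinear g \<Longrightarrow> clinear (\<lambda>x. f x - g x)"
  by (rule clinearI) (simp_all add: clinear_simps scaleC_distribs)

lemma clinear_uminus_fun: "clinear f \<Longrightarrow> clinear (\<lambda>x. - f x)"
  by (rule clinearI) (simp_all add: clinear_simps)

lemma clinear_scaleC: "clinear f \<Longrightarrow> clinear (\<lambda>x. c *\<^sub>C f x)"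
  by (rule clinearI) (simp_all add: clinear_simps scaleC_distribs scaleC_scaleC mult.commute)

lemma clinear_scaleC_left: "clinear f \<Longrightarrow> clinear (\<lambda>x. f x *\<^sub>C v)"
  by (rule clinearI) (simp_all add: clinear_add clinear_scale scaleC_complex scaleC_distribs scaleC_scaleC)

lemma clinear_mult_left: "clinear f \<Longrightarrow> clinear (\<lambda>x. (c::complex) * f x)"
  using clinear_scaleC[of f c] by (simp add: scaleC_complex_def)

lemma clinear_sum_fun: "(\<And>a. a \<in> A \<Longrightarrow> clinear (f a)) \<Longrightarrow> clinear (\<lambda>x. \<Sum>a\<in>A. f a x)"
  by (rule clinearI) (simp_all add: clinear_simps sum.distrib complex_vector.scale_sum_right)

lemmas clinear_intros = clinear_ident clinear_const0 clinear_plus clinear_minus_fun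
  clinear_uminus_fun clinear_scaleC clinear_sum_fun

lemma clinear_eq_on_span:
  assumes "clinear f" "clinear g" "\<And>x. x \<in> S \<Longrightarrow> f x = g x" "x \<in> cspan S"
  shows "f x = g x"
  using complex_vector_pair.linear_eq_on[OF assms(1,2,4)] assms(3) by auto

lemma csubspace_vimage: "clinear f \<Longrightarrow> csubspace W \<Longrightarrow> csubspace {x. f x \<in> W}"
  by (auto intro!: complex_vector.subspaceI
      simp: clinear_simps complex_vector.subspace_0 complex_vector.subspace_add complex_vector.subspace_scale)

lemma clinear_span_image:
  assumes "clinear f" "\<And>x. x \<in> S \<Longrightarrow> f x \<in> W" "csubspace W" "x \<in> cspan S"
  shows "f x \<in> W"
  using complex_vector.span_minimal[of S "{x. f x \<in> W}"] csubspace_vimage[OF assms(1,3)] assms by auto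

section \<open>Functionals, coordinates and dual systems\<close>

lemma separating_functional:
  fixes x :: "'a::complex_vector"
  assumes "x \<noteq> 0"
  shows "\<exists>\<phi>. clinear \<phi> \<and> \<phi> x = (1::complex)"
  using assms complex_vector_pair.linear_independent_extend[of "{x}" "\<lambda>_. 1::complex"] by auto

text \<open>Weak derivatives are tested on linear functionals, so their uniqueness rests on
  functionals separating points.\<close>

lemma functionals_eqI:
  fixes x y :: "'a::complex_vector"
  assumes "\<And>\<phi> :: 'a \<Rightarrow> complex. clinear \<phi> \<Longrightarrow> \<phi> x = \<phi> y"
  shows "x = y"
  proof (rule ccontr)
  assume "x \<noteq> y"
  then obtain \<phi> :: "'a \<Rightarrow> complex" where "clinear \<phi>" "\<phi> (x - y) = 1"
    using separating_functional[of "x - y"] by auto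
  then show False using assms[of \<phi>] by (simp add: clinear_diff)
qed

text \<open>The coordinates are extended to functionals on the whole space, because weak derivatives
  are tested on such functionals only.\<close>

lemma basis_coordinates:
  fixes B :: "'a::complex_vector set"
  assumes ind: "\<not> complex_vector.dependent B" and fin: "finite B"
  shows "\<exists>c :: 'a \<Rightarrow> 'a \<Rightarrow> complex. (\<forall>b. clinear (c b)) \<and> (\<forall>w\<in>cspan B. w = (\<Sum>b\<in>B. c b w *\<^sub>C b)) \<and>
    (\<forall>b\<in>B. \<forall>b'\<in>B. c b b' = (if b' = b then 1 else 0))"
proof -
  define c :: "'a \<Rightarrow> 'a \<Rightarrow> complex"
    where "c b = complex_vector_pair.construct B (\<lambda>y. if y = b then 1 else 0)" for b
  have lin: "clinear (c b)" for b
    unfolding c_def by (rule complex_vector_pair.linear_construct[OF ind])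
  have val: "c b b' = (if b' = b then 1 else 0)" if "b' \<in> B" for b b'
    unfolding c_def by (rule complex_vector_pair.construct_basis[OF ind that])
  have "w = (\<Sum>b\<in>B. c b w *\<^sub>C b)" if "w \<in> cspan B" for w
  proof (rule clinear_eq_on_span[OF clinear_ident _ _ that])
    show "clinear (\<lambda>w. \<Sum>b\<in>B. c b w *\<^sub>C b)"
      by (intro clinear_intros clinear_scaleC_left lin)
    show "x = (\<Sum>b\<in>B. c b x *\<^sub>C b)" if "x \<in> B" for x
      using fin that by (simp add: val if_distrib[of "\<lambda>c. c *\<^sub>C _"] cong: if_cong)
  qed
  then show ?thesis using lin val by blast
qed

text \<open>Induction on \<open>A\<close> in the manner of Gram-Schmidt; the last hypothesis is the
  independence of the functionals on \<open>V\<close>. The lemma supplies the inverse of a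
  non-degenerate form, the element on which all simple roots are 1, and dual bases of opposite root
  spaces.\<close>

lemma dual_vectors:
  fixes \<phi> :: "'i \<Rightarrow> 'a::complex_vector \<Rightarrow> complex"
  assumes "finite A" "csubspace V" "\<And>a. a \<in> A \<Longrightarrow> clinear (\<phi> a)"
    and "\<And>c. (\<And>y. y \<in> V \<Longrightarrow> (\<Sum>a\<in>A. c a * \<phi> a y) = 0) \<Longrightarrow> \<forall>a\<in>A. c a = 0"
  shows "\<exists>d. \<forall>a\<in>A. d a \<in> V \<and> (\<forall>b\<in>A. \<phi> b (d a) = (if b = a then 1 else 0))"
  using assms
proof (induction A rule: finite_induct)
  case (insert a A)
  note lin = insert.prems(2)
  have ne: "\<forall>b\<in>A. c b = 0" if "\<And>y. y \<in> V \<Longrightarrow> (\<Sum>b\<in>A. c b * \<phi> b y) = 0" for c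
  proof -
    have eq: "(\<Sum>b\<in>insert a A. (c(a := 0)) b * \<phi> b y) = (\<Sum>b\<in>A. c b * \<phi> b y)" for y
      using insert.hyps by (auto intro: sum.cong)
    have "\<forall>b\<in>insert a A. (c(a := 0)) b = 0"
      using insert.prems(3)[of "c(a := 0)"] eq that by auto
    then show ?thesis using insert.hyps by (auto split: if_splits)
  qed
  have "\<exists>d. \<forall>a\<in>A. d a \<in> V \<and> (\<forall>b\<in>A. \<phi> b (d a) = (if b = a then 1 else 0))"
    by (rule insert.IH) (use insert.prems ne in auto)
  then obtain d where d: "\<And>b. b \<in> A \<Longrightarrow> d b \<in> V"
    "\<And>b b'. b \<in> A \<Longrightarrow> b' \<in> A \<Longrightarrow> \<phi> b' (d b) = (if b' = b then 1 else 0)"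
    by blast
  \<comment> \<open>Otherwise \<phi> a would agree on \<open>V\<close> with a combination of the old
    functionals.\<close>
  have "\<exists>y\<in>V. \<phi> a y - (\<Sum>b\<in>A. \<phi> a (d b) * \<phi> b y) \<noteq> 0"
  proof (rule ccontr)
    assume "\<not> ?thesis"
    then have z: "\<phi> a y - (\<Sum>b\<in>A. \<phi> a (d b) * \<phi> b y) = 0" if "y \<in> V" for y using that by auto
    let ?c = "\<lambda>b. if b = a then 1 else - \<phi> a (d b)"
    have eq: "(\<Sum>b\<in>insert a A. ?c b * \<phi> b y) = \<phi> a y - (\<Sum>b\<in>A. \<phi> a (d b) * \<phi> b y)" for y
    proof -
      have "(\<Sum>b\<in>A. ?c b * \<phi> b y) = (\<Sum>b\<in>A. - (\<phi> a (d b) * \<phi> b y))"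
        using insert.hyps by (intro sum.cong) auto
      then show ?thesis using insert.hyps by (simp add: sum_negf)
    qed
    have "\<forall>b\<in>insert a A. ?c b = 0"
      using insert.prems(3)[of ?c] eq z by auto
    then show False by simp
  qed
  then obtain y where y: "y \<in> V" "\<phi> a y - (\<Sum>b\<in>A. \<phi> a (d b) * \<phi> b y) \<noteq> 0" by blast
  \<comment> \<open>Removing the components of \<open>y\<close> along the old dual vectors makes
    every old functional vanish, while the new one stays non-zero. The old dual vectors are then
    corrected by multiples of \<open>w\<close>.\<close>
  define w where "w = y - (\<Sum>b\<in>A. \<phi> b y *\<^sub>C d b)"
  have wV: "w \<in> V" unfolding w_def
    by (intro complex_vector.subspace_diff complex_vector.subspace_sum complex_vector.subspace_scale
        insert.prems(1) y(1) d(1))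
  have w0: "\<phi> b w = 0" if "b \<in> A" for b
  proof -
    have l: "clinear (\<phi> b)" using lin that by simp
    have "\<phi> b w = \<phi> b y - (\<Sum>b'\<in>A. \<phi> b' y * \<phi> b (d b'))"
      by (simp add: w_def clinear_diff[OF l] clinear_sum[OF l] clinear_scale[OF l] scaleC_complex)
    also have "(\<Sum>b'\<in>A. \<phi> b' y * \<phi> b (d b')) = (\<Sum>b'\<in>A. if b' = b then \<phi> b y else 0)"
      by (rule sum.cong) (auto simp: d(2) that)
    finally show ?thesis using insert.hyps that by simp
  qed
  have la: "clinear (\<phi> a)" using lin by simp
  have wa: "\<phi> a w \<noteq> 0"
    using y(2) by (simp add: w_def clinear_diff[OF la] clinear_sum[OF la] clinear_scale[OF la] mult.commute scaleC_complex)
  define d' where "d' b = (if b = a then (1 / \<phi> a w) *\<^sub>C w else d b - (\<phi> a (d b) / \<phi> a w) *\<^sub>C w)" for b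
  show ?case
  proof (intro exI[of _ d'] ballI conjI)
    fix b assume b: "b \<in> insert a A"
    show "d' b \<in> V" using b wV d(1) insert.prems(1)
      by (auto simp: d'_def intro!: complex_vector.subspace_diff complex_vector.subspace_scale)
    fix b' assume b': "b' \<in> insert a A"
    have [simp]: "\<phi> e (x - y) = \<phi> e x - \<phi> e y" "\<phi> e (c *\<^sub>C x) = c * \<phi> e x"
      if "e \<in> insert a A" for e x y c
      using clinear_diff[OF lin[OF that]] clinear_scale[OF lin[OF that]] by (simp_all add: scaleC_complex)
    show "\<phi> b' (d' b) = (if b' = b then 1 else 0)"
      using b b' wa w0 insert.hyps
      by (auto simp: d'_def d(2))
  qed
qed auto

lemma is_basis_finite:
  assumes "is_basis X W" "W \<subseteq> cspan S" "finite S"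
  shows "finite X"
  using assms complex_vector.independent_span_bound[of S X] complex_vector.span_superset[of X]
  by (auto simp: is_basis_def)

section \<open>Simultaneous eigenvectors\<close>

text \<open>The index type of the family is free: it is the Cartan subalgebra when weights are
  meant, and \<open>unit\<close> where only the grading element acts.\<close>

definition weight_vec :: "('i \<Rightarrow> 'v \<Rightarrow> 'v::complex_vector) \<Rightarrow> ('i \<Rightarrow> complex) \<Rightarrow> 'v \<Rightarrow> bool" where
  "weight_vec T l u \<longleftrightarrow> (\<forall>h. T h u = l h *\<^sub>C u)"

lemma weight_vec_subspace:
  assumes "\<And>h. clinear (T h)"
  shows "csubspace {u. weight_vec T l u}"
  using assms by (auto intro!: complex_vector.subspaceI
      simp: weight_vec_def clinear_simps scaleC_distribs scaleC_scaleC mult.commute)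

text \<open>The operator T_h - a(h) kills the component of weight a and multiplies that of weight l
  by l(h) - a(h), which is non-zero for some h.\<close>

lemma weight_vec_independent:
  assumes T: "\<And>h. clinear (T h)"
  shows "finite L \<Longrightarrow> (\<And>l. l \<in> L \<Longrightarrow> weight_vec T l (u l)) \<Longrightarrow> (\<Sum>l\<in>L. u l) = 0 \<Longrightarrow> l \<in> L \<Longrightarrow> u l = 0"
proof (induction L arbitrary: u l rule: finite_induct)
  case (insert a L)
  have s: "u a + (\<Sum>l\<in>L. u l) = 0" using insert by simp
  have 0: "u l = 0" if l: "l \<in> L" for l
  proof -
    have e: "(l h - a h) *\<^sub>C u l = 0" for h
    proof (rule insert.IH[where u = "\<lambda>l. (l h - a h) *\<^sub>C u l"])
      show "weight_vec T l ((l h - a h) *\<^sub>C u l)" if "l \<in> L" for l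
        using insert.prems(1)[of l] that
        by (simp add: weight_vec_def clinear_scale[OF T] scaleC_scaleC mult.commute)
      have "0 = T h (u a + (\<Sum>l\<in>L. u l)) - a h *\<^sub>C (u a + (\<Sum>l\<in>L. u l))"
        by (simp add: s clinear_zero[OF T])
      also have "\<dots> = (\<Sum>l\<in>L. T h (u l)) - (\<Sum>l\<in>L. a h *\<^sub>C u l)"
        using insert.prems(1)[of a]
        by (simp add: clinear_add[OF T] clinear_sum[OF T] weight_vec_def scaleC_distribs
            complex_vector.scale_sum_right)
      also have "(\<Sum>l\<in>L. T h (u l)) = (\<Sum>l\<in>L. l h *\<^sub>C u l)"
        using insert.prems(1) by (intro sum.cong) (auto simp: weight_vec_def)
      finally show "(\<Sum>l\<in>L. (l h - a h) *\<^sub>C u l) = 0"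
        by (simp add: scaleC_distribs sum_subtractf)
    qed (rule l)
    have "l \<noteq> a" using l insert.hyps by auto
    then obtain h where "l h \<noteq> a h" by auto
    then show ?thesis using e[of h] by simp
  qed
  then have "u a = 0" using s by simp
  with 0 insert.prems(3) show ?case by auto
qed simp

lemma weight_decomposition:
  assumes S: "\<And>s. s \<in> S \<Longrightarrow> \<exists>l. weight_vec T l s"
    and u: "u \<in> cspan S"
  shows "\<exists>L f. finite L \<and> u = (\<Sum>l\<in>L. f l) \<and> (\<forall>l. f l \<in> cspan {s\<in>S. weight_vec T l s}) \<and>
    (\<forall>l. l \<notin> L \<longrightarrow> f l = 0)"
  using u
proof (induction rule: complex_vector.span_induct_alt)
  case base
  show ?case by (rule exI[of _ "{}"], rule exI[of _ "\<lambda>_. 0"]) (auto intro: complex_vector.span_zero)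
next
  case (step c x y)
  obtain L f where L: "finite L" "y = (\<Sum>l\<in>L. f l)" "\<And>l. f l \<in> cspan {s\<in>S. weight_vec T l s}"
    "\<And>l. l \<notin> L \<Longrightarrow> f l = 0"
    using step.IH by blast
  obtain k where k: "weight_vec T k x" using S step.hyps by blast
  have eq: "y = (\<Sum>l\<in>insert k L. f l)"
    unfolding L(2) by (rule sum.mono_neutral_left) (use L in auto)
  let ?g = "\<lambda>l. f l + (if l = k then c *\<^sub>C x else 0)"
  have "c *\<^sub>C x + y = (\<Sum>l\<in>insert k L. ?g l)"
    using L(1) by (subst sum.distrib) (simp add: eq[symmetric] add.commute)
  moreover have "?g l \<in> cspan {s\<in>S. weight_vec T l s}" for l
    using L(3)[of l] k step.hyps
    by (intro complex_vector.span_add)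
      (auto intro: complex_vector.span_scale complex_vector.span_base complex_vector.span_zero)
  ultimately show ?case using L(1,4)
    by (intro exI[of _ "insert k L"] exI[of _ ?g]) auto
qed

text \<open>Split \<open>u\<close> into weight components and subtract \<open>u\<close> from the
  component of weight \<open>l\<close>: the result is a vanishing sum of vectors of distinct
  weights. In this way weight spaces are read off from any spanning set of weight vectors.\<close>

lemma weight_span:
  assumes T: "\<And>h. clinear (T h)"
    and S: "\<And>s. s \<in> S \<Longrightarrow> \<exists>l. weight_vec T l s"
    and u: "u \<in> cspan S" and l: "weight_vec T l u"
  shows "u \<in> cspan {s\<in>S. weight_vec T l s}"
proof -
  obtain L f where L: "finite L" "u = (\<Sum>l\<in>L. f l)" "\<And>l. f l \<in> cspan {s\<in>S. weight_vec T l s}"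
    "\<And>l. l \<notin> L \<Longrightarrow> f l = 0"
    using weight_decomposition[OF S u] by blast
  have w: "weight_vec T k (f k)" for k
    using complex_vector.span_minimal[of "{s\<in>S. weight_vec T k s}" "{u. weight_vec T k u}"]
      weight_vec_subspace[where T = T, OF T] L(3) by blast
  have eq: "u = (\<Sum>l\<in>insert l L. f l)"
    unfolding L(2) by (rule sum.mono_neutral_left) (use L in auto)
  let ?g = "\<lambda>k. f k - (if k = l then u else 0)"
  have "?g l = 0"
  proof (rule weight_vec_independent[OF T, where L = "insert l L" and u = ?g])
    show "weight_vec T k (?g k)" for k
      using w[of k] l by (auto simp: weight_vec_def clinear_simps[OF T] scaleC_distribs)
    show "(\<Sum>k\<in>insert l L. ?g k) = 0"
      using L(1) by (subst sum_subtractf) (simp add: eq[symmetric])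
  qed (use L in auto)
  then show ?thesis using L(3)[of l] by simp
qed


section \<open>Tensor products\<close>

lemma free_ext_self: "free_ext (\<lambda>x. Poly_Mapping.single x 1) r = (r :: 'x \<Rightarrow>\<^sub>0 complex)"
  by (rule poly_mapping_eqI)
    (auto simp: free_ext_def lookup_sum lookup_scaleC lookup_single when_def in_keys_iff if_distrib scaleC_complex cong: if_cong)

lemma free_ext_clinear:
  assumes "clinear f"
  shows "f r = free_ext (\<lambda>x. f (Poly_Mapping.single x 1)) r"
proof -
  have "f r = f (free_ext (\<lambda>x. Poly_Mapping.single x 1) r)" by (simp add: free_ext_self)
  also have "\<dots> = free_ext (\<lambda>x. f (Poly_Mapping.single x 1)) r"
    by (simp add: free_ext_def clinear_sum[OF assms] clinear_scale[OF assms])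
  finally show ?thesis .
qed

lemma clinear_free_eqI:
  assumes "clinear f" "clinear g" "\<And>x. f (Poly_Mapping.single x (1::complex)) = g (Poly_Mapping.single x 1)"
  shows "f r = g r"
  using free_ext_clinear[OF assms(1), of r] free_ext_clinear[OF assms(2), of r] assms(3) by simp

lemma clinear_abs_tensor: "clinear abs_tensor"
  by (rule clinearI) (simp_all add: plus_tensor.abs_eq scaleC_tensor.abs_eq)

lemma clinear_abs_tpower: "clinear abs_tpower"
  by (rule clinearI) (simp_all add: plus_tpower.abs_eq scaleC_tpower.abs_eq)

lemma clinear_tensor_lift:
  assumes "cbilinear f"
  shows "clinear (tensor_lift f)"
proof (rule clinearI)
  fix x y :: "('a, 'b) tensor" and c
  obtain r s where "x = abs_tensor r" "y = abs_tensor s"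
    by (metis Quotient3_abs_rep Quotient3_tensor)
  then show "tensor_lift f (x + y) = tensor_lift f x + tensor_lift f y"
    "tensor_lift f (c *\<^sub>C x) = c *\<^sub>C tensor_lift f x"
    by (simp_all add: plus_tensor.abs_eq scaleC_tensor.abs_eq tensor_lift_abs[OF assms]
        clinear_simps[OF clinear_free_ext])
qed

lemma clinear_tpower_lift:
  assumes "multilinear f"
  shows "clinear (tpower_lift f)"
proof (rule clinearI)
  fix x y :: "('a, 'b) tpower" and c
  obtain r s where "x = abs_tpower r" "y = abs_tpower s"
    by (metis Quotient3_abs_rep Quotient3_tpower)
  then show "tpower_lift f (x + y) = tpower_lift f x + tpower_lift f y"
    "tpower_lift f (c *\<^sub>C x) = c *\<^sub>C tpower_lift f x"
    by (simp_all add: plus_tpower.abs_eq scaleC_tpower.abs_eq tpower_lift_abs[OF assms]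
        clinear_simps[OF clinear_free_ext])
qed

lemma tensor_eqI:
  assumes "clinear f" "clinear g" "\<And>x y. f (x \<otimes>\<^sub>C y) = g (x \<otimes>\<^sub>C y)"
  shows "f t = g t"
proof -
  obtain r where r: "t = abs_tensor r" by (metis Quotient3_abs_rep Quotient3_tensor)
  show ?thesis unfolding r
    by (rule clinear_free_eqI[OF clinear_compose[OF assms(1) clinear_abs_tensor]
          clinear_compose[OF assms(2) clinear_abs_tensor]])
      (use assms(3) in \<open>auto simp: tens_def\<close>)
qed

lemma tpower_eqI:
  assumes "clinear f" "clinear g" "\<And>m. f (pure m) = g (pure m)"
  shows "f t = g t"
proof -
  obtain r where r: "t = abs_tpower r" by (metis Quotient3_abs_rep Quotient3_tpower)
  show ?thesis unfolding r
    by (rule clinear_free_eqI[OF clinear_compose[OF assms(1) clinear_abs_tpower]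
          clinear_compose[OF assms(2) clinear_abs_tpower]])
      (use assms(3) in \<open>auto simp: pure_def\<close>)
qed

lemma tpower_span: "t \<in> cspan (range pure)"
proof -
  obtain r where r: "t = abs_tpower r" by (metis Quotient3_abs_rep Quotient3_tpower)
  have "abs_tpower r = free_ext pure r"
    using free_ext_clinear[OF clinear_abs_tpower, of r] by (simp add: pure_def[abs_def])
  also have "\<dots> \<in> cspan (range pure)" unfolding free_ext_def
    by (intro complex_vector.span_sum complex_vector.span_scale complex_vector.span_base) auto
  finally show ?thesis unfolding r .
qed

lemma abs_tensor_eqI: "r - s \<in> cspan tensor_relators \<Longrightarrow> abs_tensor r = abs_tensor s"
  by (simp add: tensor.abs_eq_iff tensor_rel_def)

lemma abs_tpower_eqI: "r - s \<in> cspan tpower_relators \<Longrightarrow> abs_tpower r = abs_tpower s"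
  by (simp add: tpower.abs_eq_iff tpower_rel_def)

lemma single_scaleC: "Poly_Mapping.single x c = c *\<^sub>C Poly_Mapping.single x (1::complex)"
  by (rule poly_mapping_eqI) (simp add: lookup_scaleC lookup_single when_def scaleC_complex)

lemma cbilinear_tens: "cbilinear (\<otimes>\<^sub>C)"
proof -
  let ?s = "\<lambda>x y. Poly_Mapping.single (x, y) (1::complex)"
  have "(x + x') \<otimes>\<^sub>C y = x \<otimes>\<^sub>C y + x' \<otimes>\<^sub>C y" for x x' :: 'a and y :: 'b
    unfolding tens_def plus_tensor.abs_eq
    by (rule abs_tensor_eqI, rule complex_vector.span_base, unfold tensor_relators_def diff_diff_eq) blast
  moreover have "x \<otimes>\<^sub>C (y + y') = x \<otimes>\<^sub>C y + x \<otimes>\<^sub>C y'" for x :: 'a and y y' :: 'b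
    unfolding tens_def plus_tensor.abs_eq
    by (rule abs_tensor_eqI, rule complex_vector.span_base, unfold tensor_relators_def diff_diff_eq) blast
  moreover have "(c *\<^sub>C x) \<otimes>\<^sub>C y = c *\<^sub>C (x \<otimes>\<^sub>C y)" "x \<otimes>\<^sub>C (c *\<^sub>C y) = c *\<^sub>C (x \<otimes>\<^sub>C y)"
    for x :: 'a and y :: 'b and c
    unfolding tens_def scaleC_tensor.abs_eq
    by (rule abs_tensor_eqI, rule complex_vector.span_base,
        unfold tensor_relators_def single_scaleC[symmetric], blast)+
  ultimately show ?thesis by (auto simp: cbilinear_def intro!: clinearI)
qed

lemma multilinear_pure: "multilinear (pure :: ('n \<Rightarrow> 'a::complex_vector) \<Rightarrow> _)"
proof -
  have "pure (m(i := x + y)) = pure (m(i := x)) + pure (m(i := y))"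
    for m :: "'n \<Rightarrow> 'a" and i x y
    unfolding pure_def plus_tpower.abs_eq
    by (rule abs_tpower_eqI, rule complex_vector.span_base)
      (auto simp: tpower_relators_def diff_diff_eq)
  moreover have "pure (m(i := c *\<^sub>C x)) = c *\<^sub>C pure (m(i := x))"
    for m :: "'n \<Rightarrow> 'a" and i c x
    unfolding pure_def scaleC_tpower.abs_eq
    by (rule abs_tpower_eqI, rule complex_vector.span_base, unfold tpower_relators_def single_scaleC[symmetric])
      blast
  ultimately show ?thesis by (auto simp: multilinear_def intro!: clinearI)
qed

lemma clinear_pure: "clinear (\<lambda>x. pure (m(i := x)))"
  using multilinear_pure by (auto simp: multilinear_def)

lemmas pure_add = clinear_add[OF clinear_pure]
  and pure_scale = clinear_scale[OF clinear_pure]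
  and pure_zero = clinear_zero[OF clinear_pure]

lemma pure_eq_0: "m i = 0 \<Longrightarrow> pure m = 0"
  using pure_zero[of m i] by (metis fun_upd_triv)

lemma multilinear_on_factor:
  fixes A :: "'a::complex_vector \<Rightarrow> 'a" and i :: 'n
  assumes "clinear A"
  shows "multilinear (\<lambda>m. pure (m(i := A (m i))))"
  unfolding multilinear_def
proof (intro allI)
  fix m :: "'n \<Rightarrow> 'a" and j
  show "clinear (\<lambda>x. pure ((m(j := x))(i := A ((m(j := x)) i))))"
  proof (cases "j = i")
    case True
    then show ?thesis using clinear_compose[OF clinear_pure[of m i] assms] by simp
  next
    case False
    then have "(\<lambda>x. pure ((m(j := x))(i := A ((m(j := x)) i)))) = (\<lambda>x. pure ((m(i := A (m i)))(j := x)))"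
      by (auto simp: fun_upd_twist)
    then show ?thesis using clinear_pure[of "m(i := A (m i))" j] by simp
  qed
qed

lemma on_factor_pure [simp]: "clinear A \<Longrightarrow> on_factor i A (pure m) = pure (m(i := A (m i)))"
  unfolding on_factor_def by (rule tpower_lift_pure[OF multilinear_on_factor])

lemma clinear_on_factor: "clinear A \<Longrightarrow> clinear (on_factor i A)"
  unfolding on_factor_def by (rule clinear_tpower_lift[OF multilinear_on_factor])

lemma on_factor_add:
  "clinear A \<Longrightarrow> clinear B \<Longrightarrow> on_factor i (\<lambda>x. A x + B x) u = on_factor i A u + on_factor i B u"
  by (rule tpower_eqI[where t = u]) (simp_all add: clinear_on_factor clinear_plus pure_add)

lemma on_factor_scale:
  "clinear A \<Longrightarrow> on_factor i (\<lambda>x. c *\<^sub>C A x) u = c *\<^sub>C on_factor i A u"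
  by (rule tpower_eqI[where t = u]) (simp_all add: clinear_on_factor clinear_scaleC pure_scale)

lemma on_factor_zero: "on_factor i (\<lambda>x. 0) u = 0"
  by (rule tpower_eqI[where t = u]) (simp_all add: clinear_on_factor clinear_const0 pure_zero)

lemma on_factor_diff:
  "clinear A \<Longrightarrow> clinear B \<Longrightarrow> on_factor i (\<lambda>x. A x - B x) u = on_factor i A u - on_factor i B u"
  using on_factor_add[of A "\<lambda>x. (-1) *\<^sub>C B x" i u] on_factor_scale[of B i "-1" u]
    clinear_scaleC[of B "-1"] by simp

lemma on_factor_sum:
  assumes "\<And>a. a \<in> I \<Longrightarrow> clinear (A a)"
  shows "on_factor i (\<lambda>x. \<Sum>a\<in>I. A a x) u = (\<Sum>a\<in>I. on_factor i (A a) u)"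
  using assms
  by (induction I rule: infinite_finite_induct)
    (simp_all add: on_factor_zero on_factor_add clinear_sum_fun)

lemma on_factor_compose:
  "clinear A \<Longrightarrow> clinear B \<Longrightarrow> on_factor i A (on_factor i B u) = on_factor i (\<lambda>x. A (B x)) u"
  by (rule tpower_eqI[where t = u]) (simp_all add: clinear_on_factor clinear_compose)

lemma on_factor_commute:
  "clinear A \<Longrightarrow> clinear B \<Longrightarrow> i \<noteq> j \<Longrightarrow>
    on_factor i A (on_factor j B u) = on_factor j B (on_factor i A u)"
  by (rule tpower_eqI[where t = u]) (simp_all add: clinear_on_factor clinear_compose fun_upd_twist)

lemma cbilinearD:
  "cbilinear f \<Longrightarrow> clinear (f x)" "cbilinear f \<Longrightarrow> clinear (\<lambda>x. f x y)"
  by (auto simp: cbilinear_def)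

lemma cbilinearI:
  "(\<And>x. clinear (f x)) \<Longrightarrow> (\<And>y. clinear (\<lambda>x. f x y)) \<Longrightarrow> cbilinear f"
  by (auto simp: cbilinear_def)

lemma cbilinear_contract: "clinear \<xi> \<Longrightarrow> cbilinear (\<lambda>d y. \<xi> d *\<^sub>C y)"
  by (intro cbilinearI clinear_scaleC_left clinear_scaleC clinear_ident)

lemma contract_tens [simp]: "clinear \<xi> \<Longrightarrow> contract \<xi> (d \<otimes>\<^sub>C y) = \<xi> d *\<^sub>C y"
  unfolding contract_def by (rule tensor_lift_tens[OF cbilinear_contract])

lemma clinear_contract: "clinear \<xi> \<Longrightarrow> clinear (contract \<xi>)"
  unfolding contract_def by (rule clinear_tensor_lift[OF cbilinear_contract])

section \<open>Mixed derivatives\<close>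

text \<open>The difference quotients in the second variable converge, uniformly in the first, to the
  partial derivative: this is Taylor's formula with the remainder controlled by Cauchy's inequality.
  A locally uniform limit of holomorphic functions may be differentiated term by term. Only a
  sequence of increments is used, as the theorem on limits is about sequences.\<close>

lemma mixed_partial_limit:
  fixes F Fs Ft :: "complex \<Rightarrow> complex \<Rightarrow> complex"
  assumes R: "0 < R"
    and cont: "continuous_on (ball 0 R \<times> ball 0 R) (\<lambda>(s, t). F s t)"
    and ds: "\<And>s t. s \<in> ball 0 R \<Longrightarrow> t \<in> ball 0 R \<Longrightarrow> ((\<lambda>s. F s t) has_field_derivative Fs s t) (at s)"
    and dt: "\<And>s t. s \<in> ball 0 R \<Longrightarrow> t \<in> ball 0 R \<Longrightarrow> (F s has_field_derivative Ft s t) (at t)"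
  shows "\<exists>D. ((\<lambda>s. Ft s 0) has_field_derivative D) (at 0) \<and>
    (\<lambda>n. (Fs 0 (of_real (R / 4 / Suc n)) - Fs 0 0) / of_real (R / 4 / Suc n)) \<longlonglongrightarrow> D"
proof -
  \<comment> \<open>The radii leave room for the Cauchy estimate: the points \<open>t n\<close> have
    norm at most r/2, and discs of radius r/2 about points of norm at most r/2 stay in the compact
    disc of radius r, where \<open>F\<close> is bounded.\<close>
  define r where "r = R / 2"
  have r: "0 < r" "r < R" using R by (auto simp: r_def)
  define t :: "nat \<Rightarrow> complex" where "t n = of_real (R / 4 / Suc n)" for n
  have nt: "norm (t n) = r / 2 / Suc n" for n
    unfolding t_def norm_of_real r_def using R by simp
  have tr: "norm (t n) \<le> r / 2" for n
    unfolding nt using r(1) by (simp add: divide_le_eq field_simps)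
  have t0: "t n \<noteq> 0" for n using R unfolding t_def of_real_eq_0_iff by simp
  have "continuous_on (cball 0 r \<times> cball 0 r) (\<lambda>(s, t). F s t)"
    by (rule continuous_on_subset[OF cont]) (use r in auto)
  then have "compact ((\<lambda>(s, t). F s t) ` (cball 0 r \<times> cball 0 r))"
    by (intro compact_continuous_image compact_Times) auto
  then obtain B where B: "\<And>s t. norm s \<le> r \<Longrightarrow> norm t \<le> r \<Longrightarrow> norm (F s t) \<le> B"
    by (fastforce dest!: compact_imp_bounded simp: bounded_iff)
  \<comment> \<open>Cauchy's bound for the second derivative on a disc of radius r/2.\<close>
  define C where "C = 2 * B / (r / 2)\<^sup>2"
  have est: "norm ((F s (t n) - F s 0) / t n - Ft s 0) \<le> C * norm (t n)" if s: "norm s \<le> r" for s n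
  proof -
    have sR: "s \<in> ball 0 R" using s r by simp
    have hol: "F s holomorphic_on ball 0 R"
      by (rule holomorphic_onI) (use dt[OF sR] field_differentiable_def field_differentiable_at_within in blast)
    have "norm (F s (t n) - (\<Sum>i\<le>1. (deriv ^^ i) (F s) 0 * (t n - 0) ^ i / fact i))
      \<le> C * norm (t n - 0) ^ Suc 1 / fact 1"
    proof (rule complex_Taylor[where S = "cball 0 (r / 2)" and f = "\<lambda>i. (deriv ^^ i) (F s)", simplified funpow_0])
      show "0 \<in> cball 0 (r / 2)" "t n \<in> cball 0 (r / 2)" using r tr by auto
      fix x :: complex assume x: "x \<in> cball 0 (r / 2)"
      have xR: "x \<in> ball 0 R" using x r by auto
      show "((deriv ^^ i) (F s) has_field_derivative (deriv ^^ Suc i) (F s) x) (at x within cball 0 (r / 2))" for i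
      proof -
        have "(deriv ^^ i) (F s) holomorphic_on ball 0 R" by (rule holomorphic_higher_deriv[OF hol]) simp
        then have "((deriv ^^ i) (F s) has_field_derivative deriv ((deriv ^^ i) (F s)) x) (at x)"
          by (rule holomorphic_derivI) (use xR in auto)
        then show ?thesis by (simp add: has_field_derivative_at_within)
      qed
      have "cball x (r / 2) \<subseteq> cball 0 r"
        using x by (auto simp: dist_norm) (smt (verit) norm_minus_commute norm_triangle_sub field_sum_of_halves)
      then have sub: "cball x (r / 2) \<subseteq> ball 0 R" and sub': "y \<in> cball x (r / 2) \<Longrightarrow> norm y \<le> r" for y
        using r by auto
      have "norm ((deriv ^^ 2) (F s) x) \<le> fact 2 * B / (r / 2) ^ 2"
      proof (rule Cauchy_inequality)
        show "F s holomorphic_on ball x (r / 2)"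
          by (rule holomorphic_on_subset[OF hol]) (use sub ball_subset_cball in blast)
        show "continuous_on (cball x (r / 2)) (F s)"
          by (rule continuous_on_subset[OF holomorphic_on_imp_continuous_on[OF hol] sub])
        show "norm (F s y) \<le> B" if "norm (x - y) = r / 2" for y
          using that by (intro B[OF s] sub') (auto simp: dist_norm)
      qed (use r in auto)
      then show "norm ((deriv ^^ Suc 1) (F s) x) \<le> C" by (simp add: C_def numeral_2_eq_2)
    qed (auto)
    moreover have "deriv (F s) 0 = Ft s 0" by (rule DERIV_imp_deriv[OF dt[OF sR]]) (use R in simp)
    ultimately have e: "norm (F s (t n) - F s 0 - Ft s 0 * t n) \<le> C * norm (t n) * norm (t n)"
      by (simp add: algebra_simps power2_eq_square)
    have "(F s (t n) - F s 0) / t n - Ft s 0 = (F s (t n) - F s 0 - Ft s 0 * t n) / t n"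
      using t0[of n] by (simp add: field_simps)
    then have "norm ((F s (t n) - F s 0) / t n - Ft s 0) = norm (F s (t n) - F s 0 - Ft s 0 * t n) / norm (t n)"
      by (simp add: norm_divide)
    also have "\<dots> \<le> C * norm (t n)" using e t0[of n] by (simp add: divide_le_eq)
    finally show ?thesis .
  qed
  have tlim: "(\<lambda>n. C * norm (t n)) \<longlonglongrightarrow> 0"
  proof -
    have "(\<lambda>n. (r / 2) * inverse (real (Suc n))) \<longlonglongrightarrow> (r / 2) * 0"
      by (intro tendsto_mult tendsto_const LIMSEQ_inverse_real_of_nat)
    then have "(\<lambda>n. norm (t n)) \<longlonglongrightarrow> 0" by (simp add: nt field_simps)
    from tendsto_mult_left[OF this, of C] show ?thesis by simp
  qed
  have ul: "uniform_limit (cball 0 r) (\<lambda>n s. (F s (t n) - F s 0) / t n) (\<lambda>s. Ft s 0) sequentially"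
  proof (rule uniform_limitI)
    fix e :: real assume "0 < e"
    then have "\<forall>\<^sub>F n in sequentially. C * norm (t n) < e"
      using order_tendstoD(2)[OF tlim] by simp
    then show "\<forall>\<^sub>F n in sequentially. \<forall>s\<in>cball 0 r. dist ((F s (t n) - F s 0) / t n) (Ft s 0) < e"
      by eventually_elim (auto simp: dist_norm intro: le_less_trans[OF est])
  qed
  have "\<exists>g'. \<forall>s\<in>ball 0 r. ((\<lambda>s. Ft s 0) has_field_derivative g' s) (at s) \<and>
    (\<lambda>n. (Fs s (t n) - Fs s 0) / t n) \<longlonglongrightarrow> g' s"
  proof (rule has_complex_derivative_uniform_sequence)
    show "((\<lambda>s. (F s (t n) - F s 0) / t n) has_field_derivative (Fs s (t n) - Fs s 0) / t n) (at s)"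
      if "s \<in> ball 0 r" for n s
      using that tr[of n] r by (intro DERIV_cdivide DERIV_diff ds) auto
    fix x :: complex assume "x \<in> ball 0 r"
    then obtain d where d: "0 < d" "cball x d \<subseteq> ball 0 r"
      by (meson open_contains_cball open_ball)
    then have "cball x d \<subseteq> cball 0 r" using ball_subset_cball by blast
    then show "\<exists>d>0. cball x d \<subseteq> ball 0 r \<and>
        uniform_limit (cball x d) (\<lambda>n s. (F s (t n) - F s 0) / t n) (\<lambda>s. Ft s 0) sequentially"
      using d uniform_limit_on_subset[OF ul] by blast
  qed simp
  then show ?thesis using r(1) unfolding t_def[abs_def] by (auto dest!: bspec[of _ _ 0])
qed

text \<open>The limit lemma is applied twice, with the variables exchanged. One application gives
  the value of the limit along a sequence of increments, the other the existence of the full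
  derivative; along the sequence the two must agree.\<close>

lemma mixed_partials:
  fixes F Fs Ft :: "complex \<Rightarrow> complex \<Rightarrow> complex"
  assumes R: "0 < R"
    and cont: "continuous_on (ball 0 R \<times> ball 0 R) (\<lambda>(s, t). F s t)"
    and ds: "\<And>s t. s \<in> ball 0 R \<Longrightarrow> t \<in> ball 0 R \<Longrightarrow> ((\<lambda>s. F s t) has_field_derivative Fs s t) (at s)"
    and dt: "\<And>s t. s \<in> ball 0 R \<Longrightarrow> t \<in> ball 0 R \<Longrightarrow> (F s has_field_derivative Ft s t) (at t)"
  shows "\<exists>D. ((\<lambda>s. Ft s 0) has_field_derivative D) (at 0) \<and> (Fs 0 has_field_derivative D) (at 0)"
proof -
  let ?t = "\<lambda>n. complex_of_real (R / 4 / Suc n)"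
  obtain D where D: "((\<lambda>s. Ft s 0) has_field_derivative D) (at 0)"
    "(\<lambda>n. (Fs 0 (?t n) - Fs 0 0) / ?t n) \<longlonglongrightarrow> D"
    using mixed_partial_limit[OF R cont ds dt] by blast
  have cont': "continuous_on (ball 0 R \<times> ball 0 R) (\<lambda>(t, s). F s t)"
  proof -
    have "continuous_on (ball 0 R \<times> ball 0 R) (\<lambda>p. (\<lambda>(s, t). F s t) (prod.swap p))"
      by (rule continuous_on_compose2[OF cont continuous_on_swap]) auto
    then show ?thesis by (simp add: case_prod_beta)
  qed
  obtain D' where D': "((\<lambda>t. Fs 0 t) has_field_derivative D') (at 0)"
    using mixed_partial_limit[of R "\<lambda>t s. F s t" "\<lambda>t s. Ft s t" "\<lambda>t s. Fs s t", OF R cont' dt ds] by blast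
  have lim: "?t \<longlonglongrightarrow> 0"
  proof -
    have "(\<lambda>n. (R / 4) * inverse (real (Suc n))) \<longlonglongrightarrow> (R / 4) * 0"
      by (intro tendsto_mult tendsto_const LIMSEQ_inverse_real_of_nat)
    then have "(\<lambda>n. R / 4 / Suc n) \<longlonglongrightarrow> 0" by (simp add: field_simps)
    then show ?thesis using tendsto_of_real[of "\<lambda>n. R / 4 / Suc n" 0 sequentially] unfolding of_real_0 by blast
  qed
  have "((\<lambda>h. (Fs 0 (0 + h) - Fs 0 0) / h) \<longlongrightarrow> D') (at 0)" using D' by (simp only: DERIV_def)
  moreover have "filterlim ?t (at 0) sequentially"
  proof (rule filterlim_atI[OF lim], rule always_eventually, rule allI)
    show "?t n \<noteq> 0" for n using R unfolding of_real_eq_0_iff by simp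
  qed
  ultimately have "(\<lambda>n. (Fs 0 (0 + ?t n) - Fs 0 0) / ?t n) \<longlonglongrightarrow> D'"
    by (rule filterlim_compose)
  then have "D' = D" using D(2) LIMSEQ_unique by simp
  then show ?thesis using D D' by blast
qed

section \<open>Derivatives of vector-valued functions\<close>

text \<open>The property selected by the \<open>THE\<close> in \<open>dir_deriv\<close>, kept apart
  so that existence and value can be argued separately.\<close>

definition weak_deriv :: "('d, 'n) point \<Rightarrow> (('d::finite, 'n::finite) point \<Rightarrow> 'v::complex_vector) \<Rightarrow>
    ('d, 'n) point \<Rightarrow> 'v \<Rightarrow> bool" where
  "weak_deriv w u P D \<longleftrightarrow> (\<forall>\<phi> :: 'v \<Rightarrow> complex. clinear \<phi> \<longrightarrow>
     ((\<lambda>t. \<phi> (u (P + t *\<^sub>C w))) has_field_derivative \<phi> D) (at 0))"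

lemma weak_derivD:
  "weak_deriv w u P D \<Longrightarrow> clinear \<phi> \<Longrightarrow> ((\<lambda>t. \<phi> (u (P + t *\<^sub>C w))) has_field_derivative \<phi> D) (at 0)"
  by (simp add: weak_deriv_def)

lemma dir_deriv_eqI:
  assumes "weak_deriv w u P D"
  shows "dir_deriv w u P = D"
  unfolding dir_deriv_def
proof (rule the_equality)
  show "\<forall>\<phi> :: 'c \<Rightarrow> complex. clinear \<phi> \<longrightarrow>
     ((\<lambda>t. \<phi> (u (P + t *\<^sub>C w))) has_field_derivative \<phi> D) (at 0)"
    using assms by (simp add: weak_deriv_def)
  fix D' assume "\<forall>\<phi> :: 'c \<Rightarrow> complex. clinear \<phi> \<longrightarrow>
     ((\<lambda>t. \<phi> (u (P + t *\<^sub>C w))) has_field_derivative \<phi> D') (at 0)"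
  then show "D' = D"
    by (rule_tac functionals_eqI) (rule DERIV_unique[OF _ weak_derivD[OF assms]]; simp)
qed

lemma bounded_linear_scaleC_point:
  fixes w :: "('d::finite, 'n::finite) point"
  shows "bounded_linear (\<lambda>t::complex. t *\<^sub>C w)"
  unfolding linear_conv_bounded_linear[symmetric]
proof (rule linearI)
  show "(r *\<^sub>R t) *\<^sub>C w = r *\<^sub>R (t *\<^sub>C w)" for r t
    by (rule prod_eqI) (simp_all add: scaleC_prod_def scaleC_vec_def scaleC_complex_def vec_eq_iff)
qed (rule scaleC_add_left)

lemma continuous_on_scaleC_point [continuous_intros]:
  fixes w :: "('d::finite, 'n::finite) point"
  shows "continuous_on A f \<Longrightarrow> continuous_on A (\<lambda>x. (f x::complex) *\<^sub>C w)"
  by (rule bounded_linear.continuous_on[OF bounded_linear_scaleC_point])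

lemma has_field_derivative_along:
  fixes f :: "('d::finite, 'n::finite) point \<Rightarrow> complex"
  assumes "(f has_derivative D) (at (P + t *\<^sub>C w))" "\<And>c w. D (c *\<^sub>C w) = c * D w"
  shows "((\<lambda>t. f (P + t *\<^sub>C w)) has_field_derivative D w) (at t)"
proof -
  have "((\<lambda>t. P + t *\<^sub>C w) has_derivative (\<lambda>t. 0 + t *\<^sub>C w)) (at t)"
    by (intro has_derivative_add has_derivative_const
        bounded_linear_imp_has_derivative bounded_linear_scaleC_point)
  from has_derivative_compose[OF this assms(1)]
  have "((\<lambda>t. f (P + t *\<^sub>C w)) has_derivative (\<lambda>t. D (t *\<^sub>C w))) (at t)" by simp
  then show ?thesis by (simp add: has_field_derivative_def assms(2) mult.commute[of _ "D w"])
qed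

lemma eventually_on_line:
  fixes P :: "('d::finite, 'n::finite) point"
  assumes "open U" "P \<in> U"
  shows "\<forall>\<^sub>F t in nhds 0. P + t *\<^sub>C w \<in> U"
proof -
  have "continuous_on UNIV (\<lambda>t. P + t *\<^sub>C w)" by (intro continuous_intros)
  then have "open ((\<lambda>t. P + t *\<^sub>C w) -` U)" using assms(1) open_vimage by blast
  then show ?thesis unfolding eventually_nhds
    using assms(2) by (intro exI[of _ "(\<lambda>t. P + t *\<^sub>C w) -` U"]) auto
qed

lemma subspace_coordinates:
  fixes W :: "'a::complex_vector set"
  assumes "csubspace W" "W \<subseteq> cspan S" "finite S"
  shows "\<exists>B (c :: 'a \<Rightarrow> 'a \<Rightarrow> complex). finite B \<and> B \<subseteq> W \<and> (\<forall>b. clinear (c b)) \<and>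
    (\<forall>w\<in>W. w = (\<Sum>b\<in>B. c b w *\<^sub>C b))"
proof -
  obtain B where B: "B \<subseteq> W" "\<not> complex_vector.dependent B" "W \<subseteq> cspan B"
    using complex_vector.maximal_independent_subset by blast
  have "finite B" using complex_vector.independent_span_bound[OF assms(3) B(2)] B assms(2) by blast
  then show ?thesis using basis_coordinates[OF B(2)] B by (metis subsetD)
qed

text \<open>\<open>W\<close> stands for a weight space. The set \<open>S\<close> witnesses that it
  is finite dimensional, which is what makes weak derivatives exist.\<close>

locale finite_dim_holomorphic =
  fixes U :: "('d::finite, 'n::finite) point set" and u :: "('d, 'n) point \<Rightarrow> 'v::complex_vector"
    and W S :: "'v set"
  assumes U: "open U" and hol: "holomorphic_vec U u" and uW: "u ` U \<subseteq> W"
    and W: "csubspace W" "W \<subseteq> cspan S" "finite S"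
begin

lemma has_derivative_along:
  assumes \<phi>: "clinear \<phi>" and Q: "P + t *\<^sub>C w \<in> U"
  shows "\<exists>D. ((\<lambda>t. \<phi> (u (P + t *\<^sub>C w))) has_field_derivative D) (at t)"
proof -
  obtain D where "((\<lambda>Q. \<phi> (u Q)) has_derivative D) (at (P + t *\<^sub>C w))" "\<And>c w. D (c *\<^sub>C w) = c * D w"
    using hol \<phi> Q unfolding holomorphic_vec_def by meson
  from has_field_derivative_along[OF this] show ?thesis by blast
qed

text \<open>Weak derivatives exist because they can be computed in coordinates on \<open>W\<close>.\<close>
lemma weak_deriv_of_coordinates:
  fixes f :: "('d, 'n) point \<Rightarrow> 'v"
  assumes B: "finite B" "\<And>Q. Q \<in> U \<Longrightarrow> f Q = (\<Sum>b\<in>B. c b (f Q) *\<^sub>C b)" and P: "P \<in> U"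
    and d: "\<And>b. b \<in> B \<Longrightarrow> ((\<lambda>t. c b (f (P + t *\<^sub>C w))) has_field_derivative d b) (at 0)"
  shows "weak_deriv w f P (\<Sum>b\<in>B. d b *\<^sub>C b)"
  unfolding weak_deriv_def
proof (intro allI impI)
  fix \<phi> :: "'v \<Rightarrow> complex" assume \<phi>: "clinear \<phi>"
  have s: "\<phi> (\<Sum>b\<in>B. e b *\<^sub>C b) = (\<Sum>b\<in>B. e b * \<phi> b)" for e
    by (simp add: clinear_sum[OF \<phi>] clinear_scale[OF \<phi>] scaleC_complex)
  have "((\<lambda>t. \<Sum>b\<in>B. c b (f (P + t *\<^sub>C w)) * \<phi> b) has_field_derivative (\<Sum>b\<in>B. d b * \<phi> b)) (at 0)"
    by (intro DERIV_sum DERIV_cmult_right d)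
  moreover have "\<forall>\<^sub>F t in nhds 0. \<phi> (f (P + t *\<^sub>C w)) = (\<Sum>b\<in>B. c b (f (P + t *\<^sub>C w)) * \<phi> b)"
    using eventually_on_line[OF U P, of w] by eventually_elim (use B(2) s in metis)
  ultimately show "((\<lambda>t. \<phi> (f (P + t *\<^sub>C w))) has_field_derivative \<phi> (\<Sum>b\<in>B. d b *\<^sub>C b)) (at 0)"
    unfolding s by (subst DERIV_cong_ev[OF HOL.refl _ HOL.refl])
qed

lemma weak_deriv_exists:
  assumes P: "P \<in> U"
  shows "\<exists>D\<in>W. weak_deriv w u P D"
proof -
  obtain B and c :: "'v \<Rightarrow> 'v \<Rightarrow> complex" where B: "finite B" "B \<subseteq> W" "\<And>b. clinear (c b)"
    "\<And>w. w \<in> W \<Longrightarrow> w = (\<Sum>b\<in>B. c b w *\<^sub>C b)"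
    using subspace_coordinates[OF W] by metis
  have "\<exists>d. ((\<lambda>t. c b (u (P + t *\<^sub>C w))) has_field_derivative d) (at 0)" for b
    using has_derivative_along[OF B(3), of P 0 w b] P by simp
  then obtain d where d: "\<And>b. ((\<lambda>t. c b (u (P + t *\<^sub>C w))) has_field_derivative d b) (at 0)" by metis
  have "weak_deriv w u P (\<Sum>b\<in>B. d b *\<^sub>C b)"
    by (rule weak_deriv_of_coordinates[OF B(1) _ P d]) (use B(4) uW in auto)
  moreover have "(\<Sum>b\<in>B. d b *\<^sub>C b) \<in> W"
    using B(2) by (intro complex_vector.subspace_sum complex_vector.subspace_scale W) auto
  ultimately show ?thesis by blast
qed

lemma weak_deriv_dir_deriv:
  assumes "P \<in> U"
  shows "weak_deriv w u P (dir_deriv w u P)" "dir_deriv w u P \<in> W"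
  using weak_deriv_exists[OF assms, of w] dir_deriv_eqI by fastforce+

text \<open>In coordinates on \<open>W\<close> the claim concerns scalar functions of the two
  complex variables s and t in P + s w + t w', so equality of mixed partial derivatives applies to
  each coordinate.\<close>

lemma mixed_dir_deriv:
  assumes P: "P \<in> U"
  shows "\<exists>E. weak_deriv w (dir_deriv w' u) P E \<and> weak_deriv w' (dir_deriv w u) P E"
proof -
  obtain B and c :: "'v \<Rightarrow> 'v \<Rightarrow> complex" where B: "finite B" "B \<subseteq> W" "\<And>b. clinear (c b)"
    "\<And>w. w \<in> W \<Longrightarrow> w = (\<Sum>b\<in>B. c b w *\<^sub>C b)"
    using subspace_coordinates[OF W] by metis
  define G where "G = (\<lambda>p :: complex \<times> complex. P + fst p *\<^sub>C w + snd p *\<^sub>C w')"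
  have contG: "continuous_on X G" for X unfolding G_def by (intro continuous_intros)
  have "open (G -` U)" using open_vimage[OF U contG] .
  moreover have "(0, 0) \<in> G -` U" using P by (simp add: G_def)
  ultimately obtain A A' where A: "open A" "open A'" "(0, 0) \<in> A \<times> A'" "A \<times> A' \<subseteq> G -` U"
    using open_prod_elim by metis
  then obtain R1 R2 where R1: "0 < R1" "ball 0 R1 \<subseteq> A" and R2: "0 < R2" "ball 0 R2 \<subseteq> A'"
    using open_contains_ball by (metis mem_Sigma_iff)
  define R where "R = min R1 R2"
  have R: "0 < R" using R1 R2 by (simp add: R_def)
  have GU: "P + s *\<^sub>C w + t *\<^sub>C w' \<in> U" if "s \<in> ball 0 R" "t \<in> ball 0 R" for s t
  proof -
    have "(s, t) \<in> A \<times> A'" using that R1 R2 by (auto simp: R_def)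
    then show ?thesis using A(4) by (auto simp: G_def)
  qed
  have at: "((\<lambda>t. \<phi> (u (Q + t *\<^sub>C z))) has_field_derivative \<phi> (dir_deriv z u (Q + t *\<^sub>C z))) (at t)"
    if "clinear \<phi>" "Q + t *\<^sub>C z \<in> U" for \<phi> Q t z
  proof -
    have "((\<lambda>s. \<phi> (u ((Q + t *\<^sub>C z) + s *\<^sub>C z))) has_field_derivative \<phi> (dir_deriv z u (Q + t *\<^sub>C z))) (at 0)"
      by (rule weak_derivD[OF weak_deriv_dir_deriv(1)[OF that(2)] that(1)])
    then show ?thesis
      using DERIV_shift[of "\<lambda>t. \<phi> (u (Q + t *\<^sub>C z))" "\<phi> (dir_deriv z u (Q + t *\<^sub>C z))" 0 t]
      by (simp add: scaleC_add_left add.assoc add.commute[of "_ *\<^sub>C z" "t *\<^sub>C z"])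
  qed
  have "\<exists>D. ((\<lambda>s. c b (dir_deriv w' u (P + s *\<^sub>C w))) has_field_derivative D) (at 0) \<and>
      ((\<lambda>t. c b (dir_deriv w u (P + t *\<^sub>C w'))) has_field_derivative D) (at 0)" for b
  proof -
    have "continuous_on U (\<lambda>Q. c b (u Q))"
    proof (rule continuous_at_imp_continuous_on, rule ballI)
      fix Q assume "Q \<in> U"
      then obtain D where "((\<lambda>Q. c b (u Q)) has_derivative D) (at Q)"
        using hol B(3) unfolding holomorphic_vec_def by meson
      then show "isCont (\<lambda>Q. c b (u Q)) Q" by (rule has_derivative_continuous)
    qed
    then have cont: "continuous_on (ball 0 R \<times> ball 0 R) (\<lambda>p. c b (u (G p)))"
      by (rule continuous_on_compose2[OF _ contG]) (use GU in \<open>auto simp: G_def\<close>)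
    have e: "Q + s *\<^sub>C w + t *\<^sub>C w' = Q + t *\<^sub>C w' + s *\<^sub>C w" for Q s t by (simp add: algebra_simps)
    have "\<exists>D. ((\<lambda>s. c b (dir_deriv w' u (P + s *\<^sub>C w + 0 *\<^sub>C w'))) has_field_derivative D) (at 0) \<and>
      ((\<lambda>t. c b (dir_deriv w u (P + 0 *\<^sub>C w + t *\<^sub>C w'))) has_field_derivative D) (at 0)"
    proof (rule mixed_partials[OF R])
      show "continuous_on (ball 0 R \<times> ball 0 R) (\<lambda>(s, t). c b (u (P + s *\<^sub>C w + t *\<^sub>C w')))"
        using cont by (simp add: G_def case_prod_beta)
      fix s t :: complex assume st: "s \<in> ball 0 R" "t \<in> ball 0 R"
      show "((\<lambda>s. c b (u (P + s *\<^sub>C w + t *\<^sub>C w'))) has_field_derivative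
          c b (dir_deriv w u (P + s *\<^sub>C w + t *\<^sub>C w'))) (at s)"
        using at[OF B(3), of "P + t *\<^sub>C w'" s w b] GU[OF st] by (simp add: e)
      show "((\<lambda>t. c b (u (P + s *\<^sub>C w + t *\<^sub>C w'))) has_field_derivative
          c b (dir_deriv w' u (P + s *\<^sub>C w + t *\<^sub>C w'))) (at t)"
        using at[OF B(3), of "P + s *\<^sub>C w" t w' b] GU[OF st] by simp
    qed
    then show ?thesis by simp
  qed
  then obtain d where d: "\<And>b. ((\<lambda>s. c b (dir_deriv w' u (P + s *\<^sub>C w))) has_field_derivative d b) (at 0)"
      "\<And>b. ((\<lambda>t. c b (dir_deriv w u (P + t *\<^sub>C w'))) has_field_derivative d b) (at 0)" by metis
  have "weak_deriv w (dir_deriv w' u) P (\<Sum>b\<in>B. d b *\<^sub>C b)" "weak_deriv w' (dir_deriv w u) P (\<Sum>b\<in>B. d b *\<^sub>C b)"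
    by (rule weak_deriv_of_coordinates[OF B(1) _ P d(1)] weak_deriv_of_coordinates[OF B(1) _ P d(2)],
        rule B(4)[OF weak_deriv_dir_deriv(2)], assumption)+
  then show ?thesis by blast
qed

lemma weak_deriv_product:
  fixes T :: "'k \<Rightarrow> 'v \<Rightarrow> 'v"
  assumes P: "P \<in> U" and I: "finite I"
    and T: "\<And>k. k \<in> I \<Longrightarrow> clinear (T k)"
    and da: "\<And>k. k \<in> I \<Longrightarrow> ((\<lambda>t. a k (P + t *\<^sub>C w)) has_field_derivative a' k) (at 0)"
  shows "weak_deriv w (\<lambda>Q. \<Sum>k\<in>I. a k Q *\<^sub>C T k (u Q)) P
    ((\<Sum>k\<in>I. a' k *\<^sub>C T k (u P)) + (\<Sum>k\<in>I. a k P *\<^sub>C T k (dir_deriv w u P)))"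
  unfolding weak_deriv_def
proof (intro allI impI)
  fix \<phi> :: "'v \<Rightarrow> complex" assume \<phi>: "clinear \<phi>"
  have "((\<lambda>t. \<Sum>k\<in>I. a k (P + t *\<^sub>C w) * \<phi> (T k (u (P + t *\<^sub>C w)))) has_field_derivative
     (\<Sum>k\<in>I. a' k * \<phi> (T k (u (P + 0 *\<^sub>C w))) + \<phi> (T k (dir_deriv w u P)) * a k (P + 0 *\<^sub>C w))) (at 0)"
    by (intro DERIV_sum DERIV_mult da weak_derivD[OF weak_deriv_dir_deriv(1)[OF P]]
        clinear_compose[OF \<phi>] T)
  then show "((\<lambda>t. \<phi> (\<Sum>k\<in>I. a k (P + t *\<^sub>C w) *\<^sub>C T k (u (P + t *\<^sub>C w)))) has_field_derivative
    \<phi> ((\<Sum>k\<in>I. a' k *\<^sub>C T k (u P)) + (\<Sum>k\<in>I. a k P *\<^sub>C T k (dir_deriv w u P)))) (at 0)"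
    by (simp add: clinear_add[OF \<phi>] clinear_sum[OF \<phi>] clinear_scale[OF \<phi>] sum.distrib mult.commute scaleC_complex)
qed

text \<open>To differentiate B u, the operator is written as a finite sum of scalar functions of the
  point times fixed linear operators. The expansion is assumed on \<open>U\<close> and
  \<open>W\<close> only, since on a weight space an infinite sum over roots becomes finite.
  Differentiation then gives one term with the coefficients differentiated and one with
  \<open>u\<close> differentiated.\<close>

lemma conn_conn:
  assumes P: "P \<in> U" and I: "finite J"
    and B: "\<And>Q x. Q \<in> U \<Longrightarrow> x \<in> W \<Longrightarrow> B Q x = (\<Sum>k\<in>J. b k Q *\<^sub>C T k x)"
    and T: "\<And>k. k \<in> J \<Longrightarrow> clinear (T k)"
    and db: "\<And>k. k \<in> J \<Longrightarrow> ((\<lambda>t. b k (P + t *\<^sub>C w)) has_field_derivative b' k) (at 0)"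
    and E: "weak_deriv w (dir_deriv w' u) P E"
  shows "conn \<kappa> w A (conn \<kappa> w' B u) P =
    \<kappa> *\<^sub>C (\<kappa> *\<^sub>C E - (\<Sum>k\<in>J. b' k *\<^sub>C T k (u P)) - B P (dir_deriv w u P)) -
    A P (\<kappa> *\<^sub>C dir_deriv w' u P - B P (u P))"
proof -
  let ?D = "\<kappa> *\<^sub>C E - ((\<Sum>k\<in>J. b' k *\<^sub>C T k (u P)) + (\<Sum>k\<in>J. b k P *\<^sub>C T k (dir_deriv w u P)))"
  have "weak_deriv w (conn \<kappa> w' B u) P ?D"
    unfolding weak_deriv_def
  proof (intro allI impI)
    fix \<phi> :: "'v \<Rightarrow> complex" assume \<phi>: "clinear \<phi>"
    have "((\<lambda>t. \<kappa> * \<phi> (dir_deriv w' u (P + t *\<^sub>C w)) -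
        \<phi> (\<Sum>k\<in>J. b k (P + t *\<^sub>C w) *\<^sub>C T k (u (P + t *\<^sub>C w)))) has_field_derivative
      \<kappa> * \<phi> E - \<phi> ((\<Sum>k\<in>J. b' k *\<^sub>C T k (u P)) + (\<Sum>k\<in>J. b k P *\<^sub>C T k (dir_deriv w u P)))) (at 0)"
      by (intro DERIV_diff DERIV_cmult weak_derivD[OF E \<phi>]
          weak_derivD[OF weak_deriv_product[OF P I T db] \<phi>])
    moreover have "\<forall>\<^sub>F t in nhds 0. \<phi> (conn \<kappa> w' B u (P + t *\<^sub>C w)) =
      \<kappa> * \<phi> (dir_deriv w' u (P + t *\<^sub>C w)) - \<phi> (\<Sum>k\<in>J. b k (P + t *\<^sub>C w) *\<^sub>C T k (u (P + t *\<^sub>C w)))"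
      using eventually_on_line[OF U P, of w]
    proof eventually_elim
      case (elim t)
      then have "B (P + t *\<^sub>C w) (u (P + t *\<^sub>C w)) = (\<Sum>k\<in>J. b k (P + t *\<^sub>C w) *\<^sub>C T k (u (P + t *\<^sub>C w)))"
        using B uW by blast
      then show ?case by (simp add: conn_def clinear_diff[OF \<phi>] clinear_scale[OF \<phi>] scaleC_complex)
    qed
    ultimately show "((\<lambda>t. \<phi> (conn \<kappa> w' B u (P + t *\<^sub>C w))) has_field_derivative \<phi> ?D) (at 0)"
      by (subst DERIV_cong_ev[OF HOL.refl _ HOL.refl])
        (simp_all add: clinear_diff[OF \<phi>] clinear_scale[OF \<phi>] scaleC_complex)
  qed
  then have "dir_deriv w (conn \<kappa> w' B u) P = ?D" by (rule dir_deriv_eqI)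
  then show ?thesis
    using B[OF P weak_deriv_dir_deriv(2)[OF P]] by (simp add: conn_def diff_diff_eq)
qed

text \<open>Flatness of the connection, split into its part of order \<open>\<kappa>\<close> and its part of order \<open>1\<close>.\<close>
lemma conn_commute:
  assumes P: "P \<in> U" and I: "finite I" "finite J"
    and A: "\<And>Q x. Q \<in> U \<Longrightarrow> x \<in> W \<Longrightarrow> A Q x = (\<Sum>k\<in>I. a k Q *\<^sub>C T k x)"
    and B: "\<And>Q x. Q \<in> U \<Longrightarrow> x \<in> W \<Longrightarrow> B Q x = (\<Sum>k\<in>J. b k Q *\<^sub>C T' k x)"
    and T: "\<And>k. k \<in> I \<Longrightarrow> clinear (T k)" "\<And>k. k \<in> J \<Longrightarrow> clinear (T' k)"
    and da: "\<And>k. k \<in> I \<Longrightarrow> ((\<lambda>t. a k (P + t *\<^sub>C w')) has_field_derivative a' k) (at 0)"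
    and db: "\<And>k. k \<in> J \<Longrightarrow> ((\<lambda>t. b k (P + t *\<^sub>C w)) has_field_derivative b' k) (at 0)"
    and inv: "\<And>x. x \<in> W \<Longrightarrow> A P x \<in> W" "\<And>x. x \<in> W \<Longrightarrow> B P x \<in> W"
    and flat: "\<And>x. x \<in> W \<Longrightarrow> (\<Sum>k\<in>J. b' k *\<^sub>C T' k x) = (\<Sum>k\<in>I. a' k *\<^sub>C T k x)"
    and comm: "\<And>x. x \<in> W \<Longrightarrow> A P (B P x) = B P (A P x)"
  shows "conn \<kappa> w A (conn \<kappa> w' B u) P = conn \<kappa> w' B (conn \<kappa> w A u) P"
proof -
  have linA: "A P (\<kappa> *\<^sub>C x - y) = \<kappa> *\<^sub>C A P x - A P y" if "x \<in> W" "y \<in> W" for x y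
  proof -
    have l: "clinear (\<lambda>x. \<Sum>k\<in>I. a k P *\<^sub>C T k x)" by (intro clinear_intros T)
    have "\<kappa> *\<^sub>C x - y \<in> W" by (intro complex_vector.subspace_diff complex_vector.subspace_scale W that)
    then show ?thesis using that by (simp only: A[OF P] clinear_diff[OF l] clinear_scale[OF l])
  qed
  have linB: "B P (\<kappa> *\<^sub>C x - y) = \<kappa> *\<^sub>C B P x - B P y" if "x \<in> W" "y \<in> W" for x y
  proof -
    have l: "clinear (\<lambda>x. \<Sum>k\<in>J. b k P *\<^sub>C T' k x)" by (intro clinear_intros T)
    have "\<kappa> *\<^sub>C x - y \<in> W" by (intro complex_vector.subspace_diff complex_vector.subspace_scale W that)
    then show ?thesis using that by (simp only: B[OF P] clinear_diff[OF l] clinear_scale[OF l])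
  qed
  have uP: "u P \<in> W" using uW P by auto
  obtain E where E: "weak_deriv w (dir_deriv w' u) P E" "weak_deriv w' (dir_deriv w u) P E"
    using mixed_dir_deriv[OF P] by blast
  have e1: "conn \<kappa> w A (conn \<kappa> w' B u) P =
    \<kappa> *\<^sub>C (\<kappa> *\<^sub>C E - (\<Sum>k\<in>J. b' k *\<^sub>C T' k (u P)) - B P (dir_deriv w u P)) -
    A P (\<kappa> *\<^sub>C dir_deriv w' u P - B P (u P))"
    by (rule conn_conn[OF P I(2) B T(2) db E(1)])
  have e2: "conn \<kappa> w' B (conn \<kappa> w A u) P =
    \<kappa> *\<^sub>C (\<kappa> *\<^sub>C E - (\<Sum>k\<in>I. a' k *\<^sub>C T k (u P)) - A P (dir_deriv w' u P)) -
    B P (\<kappa> *\<^sub>C dir_deriv w u P - A P (u P))"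
    by (rule conn_conn[OF P I(1) A T(1) da E(2)])
  show ?thesis
    unfolding e1 e2 linA[OF weak_deriv_dir_deriv(2)[OF P] inv(2)[OF uP]]
      linB[OF weak_deriv_dir_deriv(2)[OF P] inv(1)[OF uP]] flat[OF uP] comm[OF uP]
    by (simp add: scaleC_distribs algebra_simps)
qed

end

section \<open>Modules over a graded Lie algebra with an invariant form, in coordinates\<close>

text \<open>\<open>Bs\<close> indexes a homogeneous basis \<open>x\<^sub>b\<close> of the lowering part and the dual basis \<open>y\<^sub>b\<close> of the
  raising part; \<open>C\<close> and \<open>F\<close> are the structure constants of the two parts, and invariance of the
  pairing determines the remaining brackets.\<close>

locale double_data =
  fixes Bs :: "'b set" and wt :: "'b \<Rightarrow> complex ^ 'd::finite \<Rightarrow> complex" and ht :: "'b \<Rightarrow> nat"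
    and C F :: "'b \<Rightarrow> 'b \<Rightarrow> 'b \<Rightarrow> complex" and cor :: "'b \<Rightarrow> complex ^ 'd"
  assumes finite_ht: "finite {b\<in>Bs. ht b \<le> N}"
    and wt_ht: "a \<in> Bs \<Longrightarrow> b \<in> Bs \<Longrightarrow> wt a = wt b \<Longrightarrow> ht a = ht b \<and> cor a = cor b"
    and C_wt: "C a b c \<noteq> 0 \<Longrightarrow> ht c = ht a + ht b \<and> wt c = (\<lambda>h. wt a h + wt b h)"
    and F_wt: "F a b c \<noteq> 0 \<Longrightarrow> ht c = ht a + ht b \<and> wt c = (\<lambda>h. wt a h + wt b h)"
    and C_antisym: "C b a c = - C a b c"
    and F_antisym: "F b a c = - F a b c"
begin

text \<open>The cut-off by height that replaces the infinite basis in every sum.\<close>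

definition BN :: "nat \<Rightarrow> 'b set" where "BN N = {b\<in>Bs. ht b \<le> N}"

lemma finite_BN [simp]: "finite (BN N)" unfolding BN_def by (rule finite_ht)

lemma BN_sum_restrict:
  assumes "\<And>c. c \<in> BN N \<Longrightarrow> \<not> Q c \<Longrightarrow> f c = 0"
  shows "(\<Sum>c\<in>BN N. f c) = (\<Sum>c\<in>{c\<in>BN N. Q c}. f c)"
  by (rule sum.mono_neutral_right) (use assms in auto)

end

text \<open>\<open>Y_X\<close> is the mixed bracket of the double. By invariance, the coefficient of
  \<open>y_c\<close> in \<open>[y_a, x_b]\<close> is the pairing of \<open>y_a\<close> with
  \<open>[x_b, x_c]\<close>, that is \<open>C b c a\<close>, and the coefficient of
  \<open>x_c\<close> is the pairing of \<open>[y_c, y_a]\<close> with \<open>x_b\<close>, that is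
  \<open>F c a b\<close>. A term of either kind has height at most that of \<open>a\<close> or
  \<open>b\<close>, so the sum over \<open>BN N\<close> is complete.\<close>

locale double_ops = double_data Bs wt ht C F cor
  for Bs :: "'b set" and wt :: "'b \<Rightarrow> complex ^ 'd::finite \<Rightarrow> complex" and ht C F cor +
  fixes X Y :: "'b \<Rightarrow> 'v \<Rightarrow> 'v::complex_vector" and H :: "complex ^ 'd \<Rightarrow> 'v \<Rightarrow> 'v"
  assumes lin_X: "clinear (X b)" and lin_Y: "clinear (Y b)" and lin_H: "clinear (H h)"
    and H_H: "H h (H k u) = H k (H h u)"
    and H_X: "b \<in> Bs \<Longrightarrow> H h (X b u) = X b (H h u) - wt b h *\<^sub>C X b u"
    and H_Y: "b \<in> Bs \<Longrightarrow> H h (Y b u) = Y b (H h u) + wt b h *\<^sub>C Y b u"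
    and locally_finite: "\<exists>N. \<forall>b\<in>Bs. N < ht b \<longrightarrow> Y b u = 0"
    and X_X: "a \<in> Bs \<Longrightarrow> b \<in> Bs \<Longrightarrow> ht a + ht b \<le> N \<Longrightarrow>
      X a (X b u) - X b (X a u) = (\<Sum>c\<in>BN N. C a b c *\<^sub>C X c u)"
    and Y_Y: "a \<in> Bs \<Longrightarrow> b \<in> Bs \<Longrightarrow> ht a + ht b \<le> N \<Longrightarrow>
      Y a (Y b u) - Y b (Y a u) = (\<Sum>c\<in>BN N. F a b c *\<^sub>C Y c u)"
    and Y_X: "a \<in> BN N \<Longrightarrow> b \<in> BN N \<Longrightarrow>
      Y a (X b u) - X b (Y a u) = (if a = b then H (cor a) u else 0) +
        (\<Sum>c\<in>BN N. C b c a *\<^sub>C Y c u) + (\<Sum>c\<in>BN N. F c a b *\<^sub>C X c u)"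
begin

lemmas op_simps = clinear_simps[OF lin_X] clinear_simps[OF lin_Y] clinear_simps[OF lin_H]
  clinear_sum[OF lin_X] clinear_sum[OF lin_Y] clinear_sum[OF lin_H]

text \<open>A bound beyond which all raising operators kill \<open>u\<close>; sums containing
  \<open>Y c u\<close> may be cut off at any such height.\<close>

definition adm :: "nat \<Rightarrow> 'v \<Rightarrow> bool" where "adm N u \<longleftrightarrow> (\<forall>b\<in>Bs. N < ht b \<longrightarrow> Y b u = 0)"

lemma adm_ex: "\<exists>N. adm N u" using locally_finite[of u] by (simp add: adm_def)

lemma adm_mono: "adm N u \<Longrightarrow> N \<le> M \<Longrightarrow> adm M u" by (auto simp: adm_def)

lemma adm_ex_finite:
  assumes "finite T" shows "\<exists>N. \<forall>u\<in>T. adm N u"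
  using assms
proof (induction T)
  case (insert t T)
  then obtain N where "\<forall>u\<in>T. adm N u" by blast
  moreover obtain M where "adm M t" using adm_ex by blast
  ultimately have "\<forall>u\<in>insert t T. adm (max N M) u" using adm_mono by (metis insertE max.cobounded1 max.cobounded2)
  then show ?case by blast
qed simp

lemma Y_Y_adm:
  assumes "a \<in> Bs" "b \<in> Bs" "adm N u"
  shows "Y a (Y b u) = Y b (Y a u) + (\<Sum>c\<in>BN N. F a b c *\<^sub>C Y c u)"
proof -
  let ?M = "max N (ht a + ht b)"
  have "(\<Sum>c\<in>BN N. F a b c *\<^sub>C Y c u) = (\<Sum>c\<in>BN ?M. F a b c *\<^sub>C Y c u)"
    by (rule sum.mono_neutral_left[OF finite_BN]) (use assms(3) in \<open>auto simp: adm_def BN_def\<close>)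
  also have "\<dots> = Y a (Y b u) - Y b (Y a u)" by (rule Y_Y[OF assms(1,2), symmetric]) simp
  finally show ?thesis by simp
qed

lemma Y_X':
  assumes "a \<in> BN N" "b \<in> BN N"
  shows "Y a (X b u) = X b (Y a u) + (if a = b then H (cor a) u else 0) +
        (\<Sum>c\<in>BN N. C b c a *\<^sub>C Y c u) + (\<Sum>c\<in>BN N. F c a b *\<^sub>C X c u)"
  using Y_X[OF assms, of u] by (simp add: algebra_simps)

section \<open>Casimir operators attached to planes of roots\<close>

definition Delta :: "(complex ^ 'd \<Rightarrow> complex) \<Rightarrow> 'v \<Rightarrow> 'v" where
  "Delta \<alpha> u = (\<Sum>a | a \<in> Bs \<and> wt a = \<alpha>. X a (Y a u))"

lemma lin_Delta: "clinear (Delta \<alpha>)"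
  unfolding Delta_def by (intro clinear_sum_fun clinear_compose[OF lin_X lin_Y])

lemma finite_wt: "finite {a\<in>Bs. wt a = \<alpha>}"
proof (cases "\<exists>b\<in>Bs. wt b = \<alpha>")
  case True
  then obtain b where b: "b \<in> Bs" "wt b = \<alpha>" by blast
  have "ht a \<le> ht b" if "a \<in> Bs" "wt a = \<alpha>" for a using wt_ht[OF that(1) b(1)] that b by simp
  then have "{a\<in>Bs. wt a = \<alpha>} \<subseteq> BN (ht b)" by (auto simp: BN_def)
  then show ?thesis using finite_BN finite_subset by blast
next
  case False
  then have "{a\<in>Bs. wt a = \<alpha>} = {}" by auto
  then show ?thesis by (simp only: finite.emptyI)
qed

lemma H_Delta: "H h (Delta \<alpha> u) = Delta \<alpha> (H h u)"
  unfolding Delta_def op_simps by (intro sum.cong) (auto simp: H_X H_Y op_simps)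

text \<open>What is used of a linear span of weights: closure under sums, and under differences in
  the form in which they occur between the weights of a non-zero structure constant.\<close>

definition plane :: "((complex ^ 'd \<Rightarrow> complex) \<Rightarrow> bool) \<Rightarrow> bool" where
  "plane P \<longleftrightarrow> (\<forall>\<alpha> \<beta>. P \<alpha> \<longrightarrow> P \<beta> \<longrightarrow> P (\<lambda>h. \<alpha> h + \<beta> h)) \<and>
     (\<forall>\<alpha> \<beta>. P \<alpha> \<longrightarrow> P (\<lambda>h. \<alpha> h + \<beta> h) \<longrightarrow> P \<beta>)"

text \<open>The positive part of the Casimir operator of the subalgebra with roots in \<open>P\<close>. It fails to
  commute with \<open>x\<^sub>a\<close> and \<open>y\<^sub>a\<close>, but the defects cancel in \<open>\<Sum> x\<^sub>a y\<^sub>a\<close>.\<close>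
definition CP :: "((complex ^ 'd \<Rightarrow> complex) \<Rightarrow> bool) \<Rightarrow> nat \<Rightarrow> 'v \<Rightarrow> 'v" where
  "CP P N u = (\<Sum>b | b \<in> BN N \<and> P (wt b). X b (Y b u))"

context
  fixes P assumes P: "plane P"
begin

lemma P_C: "C a b c \<noteq> 0 \<Longrightarrow> P (wt a) \<Longrightarrow> P (wt b) \<longleftrightarrow> P (wt c)"
  using P C_wt[of a b c] unfolding plane_def by metis

lemma P_F: "F a b c \<noteq> 0 \<Longrightarrow> P (wt a) \<Longrightarrow> P (wt b) \<longleftrightarrow> P (wt c)"
  using P F_wt[of a b c] unfolding plane_def by metis

lemma P_F2: "F a b c \<noteq> 0 \<Longrightarrow> P (wt b) \<Longrightarrow> P (wt a) \<longleftrightarrow> P (wt c)"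
  using P_F[of b a c] F_antisym[of a b c] by auto

text \<open>The \<open>F\<close> terms from \<open>[y_b, y_a]\<close> and from
  \<open>[y_a, x_b]\<close> cancel after exchanging the two summation indices. What remains is the
  Cartan term and a term quadratic in the raising operators. Closure of the plane ensures that all
  the sums may be restricted to it.\<close>

lemma CP_Y:
  assumes a: "a \<in> BN N" "P (wt a)" and u: "adm N u"
  shows "CP P N (Y a u) - Y a (CP P N u) = - H (cor a) (Y a u) -
    (\<Sum>b | b \<in> BN N \<and> P (wt b). \<Sum>c | c \<in> BN N \<and> P (wt c). C b c a *\<^sub>C Y c (Y b u))"
proof -
  let ?A = "{b\<in>BN N. P (wt b)}"
  have fin: "finite ?A" by simp
  have aA: "a \<in> ?A" using a by simp
  have trm: "X b (Y b (Y a u)) - Y a (X b (Y b u)) =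
      (\<Sum>c\<in>?A. F b a c *\<^sub>C X b (Y c u)) - (if b = a then H (cor a) (Y a u) else 0) -
      (\<Sum>c\<in>?A. C b c a *\<^sub>C Y c (Y b u)) - (\<Sum>c\<in>?A. F c a b *\<^sub>C X c (Y b u))" if b: "b \<in> ?A" for b
  proof -
    have bs: "b \<in> Bs" "a \<in> Bs" using b a by (auto simp: BN_def)
    have r1: "(\<Sum>c\<in>BN N. F b a c *\<^sub>C X b (Y c u)) = (\<Sum>c\<in>?A. F b a c *\<^sub>C X b (Y c u))"
      by (rule BN_sum_restrict) (use b a P_F[of b a] in auto)
    have r2: "(\<Sum>c\<in>BN N. C b c a *\<^sub>C Y c (Y b u)) = (\<Sum>c\<in>?A. C b c a *\<^sub>C Y c (Y b u))"
      by (rule BN_sum_restrict) (use b a P_C[of b _ a] in auto)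
    have r3: "(\<Sum>c\<in>BN N. F c a b *\<^sub>C X c (Y b u)) = (\<Sum>c\<in>?A. F c a b *\<^sub>C X c (Y b u))"
      by (rule BN_sum_restrict) (use b a P_F2[of _ a b] in auto)
    have "X b (Y b (Y a u)) = X b (Y a (Y b u)) + (\<Sum>c\<in>?A. F b a c *\<^sub>C X b (Y c u))"
      by (simp add: Y_Y_adm[OF bs u] op_simps r1)
    moreover have "Y a (X b (Y b u)) = X b (Y a (Y b u)) + (if a = b then H (cor a) (Y b u) else 0) +
        (\<Sum>c\<in>?A. C b c a *\<^sub>C Y c (Y b u)) + (\<Sum>c\<in>?A. F c a b *\<^sub>C X c (Y b u))"
      using Y_X'[of a N b "Y b u"] a b by (simp add: r2 r3)
    ultimately show ?thesis by auto
  qed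
  have "CP P N (Y a u) - Y a (CP P N u) = (\<Sum>b\<in>?A. X b (Y b (Y a u)) - Y a (X b (Y b u)))"
    by (simp add: CP_def op_simps sum_subtractf)
  also have "\<dots> = (\<Sum>b\<in>?A. \<Sum>c\<in>?A. F b a c *\<^sub>C X b (Y c u)) - (\<Sum>b\<in>?A. if b = a then H (cor a) (Y a u) else 0)
      - (\<Sum>b\<in>?A. \<Sum>c\<in>?A. C b c a *\<^sub>C Y c (Y b u)) - (\<Sum>b\<in>?A. \<Sum>c\<in>?A. F c a b *\<^sub>C X c (Y b u))"
    by (simp only: trm sum_subtractf cong: sum.cong)
  also have "(\<Sum>b\<in>?A. \<Sum>c\<in>?A. F b a c *\<^sub>C X b (Y c u)) = (\<Sum>b\<in>?A. \<Sum>c\<in>?A. F c a b *\<^sub>C X c (Y b u))"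
    by (rule sum.swap)
  finally show ?thesis using aA fin by simp
qed

text \<open>Here the \<open>C\<close> terms cancel, by antisymmetry and exchange of the indices. The
  cut-off must exceed n + ht a because brackets of \<open>x_a\<close> with \<open>x_b\<close> for ht
  b up to n occur.\<close>

lemma CP_X:
  assumes a: "a \<in> Bs" "P (wt a)" and u: "adm n u" and N: "n + ht a \<le> N"
  shows "CP P N (X a u) - X a (CP P N u) = X a (H (cor a) u) +
    (\<Sum>b | b \<in> BN N \<and> P (wt b). \<Sum>c | c \<in> BN N \<and> P (wt c). F c b a *\<^sub>C X b (X c u))"
proof -
  let ?A = "{b\<in>BN N. P (wt b)}"
  have fin: "finite ?A" by simp
  have aN: "a \<in> BN N" using a N by (simp add: BN_def)
  then have aA: "a \<in> ?A" using a by simp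
  have trm: "X b (Y b (X a u)) - X a (X b (Y b u)) =
      (if b = a then X a (H (cor a) u) else 0) + (\<Sum>c\<in>?A. C a c b *\<^sub>C X b (Y c u)) +
      (\<Sum>c\<in>?A. F c b a *\<^sub>C X b (X c u)) + (\<Sum>c\<in>?A. C b a c *\<^sub>C X c (Y b u))" if b: "b \<in> ?A" for b
  proof -
    have bs: "b \<in> Bs" using b by (auto simp: BN_def)
    have r1: "(\<Sum>c\<in>BN N. F c b a *\<^sub>C X b (X c u)) = (\<Sum>c\<in>?A. F c b a *\<^sub>C X b (X c u))"
      by (rule BN_sum_restrict) (use b a P_F2[of _ b a] in auto)
    have r2: "(\<Sum>c\<in>BN N. C a c b *\<^sub>C X b (Y c u)) = (\<Sum>c\<in>?A. C a c b *\<^sub>C X b (Y c u))"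
      by (rule BN_sum_restrict) (use b a P_C[of a _ b] in auto)
    have r3: "(\<Sum>c\<in>BN N. C b a c *\<^sub>C X c (Y b u)) = (\<Sum>c\<in>?A. C b a c *\<^sub>C X c (Y b u))"
      by (rule BN_sum_restrict) (use b a P_C[of b a] in auto)
    \<comment> \<open>Above height n the vector \<open>Y b u\<close> vanishes; up to height n the
      bracket fits under the cut-off.\<close>
    have "X b (X a (Y b u)) - X a (X b (Y b u)) = (\<Sum>c\<in>BN N. C b a c *\<^sub>C X c (Y b u))"
    proof (cases "ht b \<le> n")
      case True
      then show ?thesis using N by (intro X_X bs a) simp
    next
      case False
      then have "Y b u = 0" using u bs by (simp add: adm_def)
      then show ?thesis by (simp add: op_simps)
    qed
    moreover have "X b (Y b (X a u)) = X b (X a (Y b u)) + (if b = a then X a (H (cor a) u) else 0) +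
        (\<Sum>c\<in>?A. C a c b *\<^sub>C X b (Y c u)) + (\<Sum>c\<in>?A. F c b a *\<^sub>C X b (X c u))"
      using Y_X'[of b N a u] aN b by (auto simp: r1[symmetric] r2[symmetric] op_simps)
    ultimately show ?thesis by (auto simp: r3[symmetric] algebra_simps)
  qed
  have "CP P N (X a u) - X a (CP P N u) = (\<Sum>b\<in>?A. X b (Y b (X a u)) - X a (X b (Y b u)))"
    by (simp add: CP_def op_simps sum_subtractf)
  also have "\<dots> = (\<Sum>b\<in>?A. if b = a then X a (H (cor a) u) else 0) + (\<Sum>b\<in>?A. \<Sum>c\<in>?A. C a c b *\<^sub>C X b (Y c u)) +
      (\<Sum>b\<in>?A. \<Sum>c\<in>?A. F c b a *\<^sub>C X b (X c u)) + (\<Sum>b\<in>?A. \<Sum>c\<in>?A. C b a c *\<^sub>C X c (Y b u))"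
    by (simp only: trm sum.distrib cong: sum.cong)
  also have "(\<Sum>b\<in>?A. \<Sum>c\<in>?A. C a c b *\<^sub>C X b (Y c u)) = - (\<Sum>b\<in>?A. \<Sum>c\<in>?A. C b a c *\<^sub>C X c (Y b u))"
    by (subst sum.swap) (simp add: C_antisym[of a] sum_negf)
  finally show ?thesis using aA fin by simp
qed

text \<open>In the sum of x_a y_a the Cartan defects of \<open>CP_X\<close> and \<open>CP_Y\<close>
  cancel. In the quadratic defects, summation over a turns structure constants back into brackets of
  two raising or two lowering operators; the resulting quartic terms are antisymmetric in b and
  c.\<close>

lemma CP_Delta:
  assumes \<alpha>: "P \<alpha>"
  shows "\<exists>N0. \<forall>N\<ge>N0. CP P N (Delta \<alpha> u) = Delta \<alpha> (CP P N u)"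
proof -
  let ?D = "{a\<in>Bs. wt a = \<alpha>}"
  note fin = finite_wt[of \<alpha>]
  have "\<exists>n. \<forall>v \<in> insert u ((\<lambda>a. Y a u) ` ?D). adm n v" by (rule adm_ex_finite) (use fin in simp)
  then obtain n where n: "adm n u" "\<And>a. a \<in> ?D \<Longrightarrow> adm n (Y a u)" by auto
  obtain k where k: "\<And>a. a \<in> ?D \<Longrightarrow> ht a = k"
  proof (cases "?D = {}")
    case False
    then obtain b where b: "b \<in> Bs" "wt b = \<alpha>" by blast
    show ?thesis
    proof (rule that)
      show "ht a = ht b" if "a \<in> ?D" for a using wt_ht[of a b] that b by simp
    qed
  qed (use that in blast)
  have "CP P N (Delta \<alpha> u) = Delta \<alpha> (CP P N u)" if N: "n + k \<le> N" for N
  proof -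
    let ?A = "{b\<in>BN N. P (wt b)}"
    have DA: "?D \<subseteq> ?A" using k N \<alpha> by (auto simp: BN_def)
    have uN: "adm N u" using adm_mono[OF n(1)] N by simp
    let ?g = "\<lambda>b c a. F c b a *\<^sub>C X b (X c (Y a u)) - C b c a *\<^sub>C X a (Y c (Y b u))"
    have trm: "CP P N (X a (Y a u)) - X a (Y a (CP P N u)) = (\<Sum>b\<in>?A. \<Sum>c\<in>?A. ?g b c a)" if a: "a \<in> ?D" for a
    proof -
      have a': "a \<in> BN N" "P (wt a)" "a \<in> Bs" using a DA by auto
      have N': "n + ht a \<le> N" using k[OF a] N by simp
      have "CP P N (X a (Y a u)) - X a (Y a (CP P N u)) =
        (CP P N (X a (Y a u)) - X a (CP P N (Y a u))) + X a (CP P N (Y a u) - Y a (CP P N u))"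
        by (simp add: op_simps)
      also have "\<dots> = (\<Sum>b\<in>?A. \<Sum>c\<in>?A. F c b a *\<^sub>C X b (X c (Y a u))) - (\<Sum>b\<in>?A. \<Sum>c\<in>?A. C b c a *\<^sub>C X a (Y c (Y b u)))"
        unfolding CP_X[OF a'(3,2) n(2)[OF a] N'] CP_Y[OF a'(1,2) uN] by (simp add: op_simps)
      finally show ?thesis by (simp add: sum_subtractf)
    qed
    \<comment> \<open>After the brackets are expanded, the two copies of X b (X c (Y c (Y b u)))
      cancel; \<open>G\<close> is what is left, and exchanging b and c changes its sign.\<close>
    define G where "G b c = (if (\<lambda>h. wt b h + wt c h) = \<alpha> then
        X c (X b (Y c (Y b u))) - X b (X c (Y b (Y c u))) else 0)" for b c
    have inner: "(\<Sum>a\<in>?D. ?g b c a) = G b c" if bc: "b \<in> ?A" "c \<in> ?A" for b c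
    proof (cases "(\<lambda>h. wt b h + wt c h) = \<alpha>")
      case False
      have "?g b c a = 0" if "a \<in> ?D" for a
        using C_wt[of b c a] F_wt[of c b a] that False
        by (cases "C b c a = 0"; cases "F c b a = 0") (auto simp: add.commute)
      then show ?thesis using False by (simp add: G_def)
    next
      case True
      have bs: "b \<in> Bs" "c \<in> Bs" using bc by (auto simp: BN_def)
      have supp: "(\<Sum>a\<in>?D. f a) = (\<Sum>a\<in>BN N. f a)" if "\<And>a. f a \<noteq> 0 \<Longrightarrow> wt a = \<alpha>" for f :: "'b \<Rightarrow> 'v"
        by (rule sum.mono_neutral_left[OF finite_BN]) (use that DA in \<open>auto simp: BN_def\<close>)
      have s1: "(\<Sum>a\<in>?D. F c b a *\<^sub>C X b (X c (Y a u))) = X b (X c (Y c (Y b u) - Y b (Y c u)))"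
      proof -
        have "(\<Sum>a\<in>?D. F c b a *\<^sub>C X b (X c (Y a u))) = (\<Sum>a\<in>BN N. F c b a *\<^sub>C X b (X c (Y a u)))"
          by (rule supp) (use F_wt[of c b] True in \<open>auto simp: add.commute\<close>)
        then show ?thesis by (simp add: Y_Y_adm[OF bs(2,1) uN] op_simps)
      qed
      have s2: "(\<Sum>a\<in>?D. C b c a *\<^sub>C X a (Y c (Y b u))) = X b (X c (Y c (Y b u))) - X c (X b (Y c (Y b u)))"
      \<comment> \<open>The bracket relation needs ht b + ht c below the cut-off. A non-zero
        constant \<open>C b c a\<close> forces this sum to be the height \<open>k\<close> of
        \<alpha>; if all constants vanish, both sides are zero.\<close>
      proof (cases "\<forall>a\<in>BN (max N (ht b + ht c)). C b c a = 0")
        case True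
        then have "\<forall>a\<in>?D. C b c a = 0" using DA by (auto simp: BN_def)
        then show ?thesis using X_X[OF bs, of "max N (ht b + ht c)"] True by simp
      next
        case False
        then obtain a where a: "a \<in> Bs" "C b c a \<noteq> 0" by (auto simp: BN_def)
        then have "wt a = \<alpha>" "ht a = ht b + ht c" using C_wt[OF a(2)] True by auto
        then have le: "ht b + ht c \<le> N" using k[of a] a N by auto
        have "(\<Sum>a\<in>?D. C b c a *\<^sub>C X a (Y c (Y b u))) = (\<Sum>a\<in>BN N. C b c a *\<^sub>C X a (Y c (Y b u)))"
          by (rule supp) (use C_wt[of b c] True in auto)
        then show ?thesis by (simp add: X_X[OF bs le])
      qed
      show ?thesis using True by (simp add: sum_subtractf s1 s2 G_def op_simps)
    qed
    have "CP P N (Delta \<alpha> u) - Delta \<alpha> (CP P N u) = (\<Sum>a\<in>?D. CP P N (X a (Y a u)) - X a (Y a (CP P N u)))"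
    proof -
      have "CP P N (Delta \<alpha> u) = (\<Sum>a\<in>?D. CP P N (X a (Y a u)))"
        unfolding CP_def Delta_def op_simps by (rule sum.swap)
      then show ?thesis by (simp add: Delta_def sum_subtractf)
    qed
    also have "\<dots> = (\<Sum>a\<in>?D. \<Sum>b\<in>?A. \<Sum>c\<in>?A. ?g b c a)" by (rule sum.cong[OF HOL.refl trm])
    also have "\<dots> = (\<Sum>b\<in>?A. \<Sum>a\<in>?D. \<Sum>c\<in>?A. ?g b c a)" by (rule sum.swap)
    also have "\<dots> = (\<Sum>b\<in>?A. \<Sum>c\<in>?A. \<Sum>a\<in>?D. ?g b c a)" by (rule sum.cong[OF HOL.refl], rule sum.swap)
    also have "\<dots> = (\<Sum>b\<in>?A. \<Sum>c\<in>?A. G b c)" by (intro sum.cong HOL.refl inner)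
    also have "\<dots> = 0"
    proof -
      let ?G1 = "\<lambda>b c. if (\<lambda>h. wt b h + wt c h) = \<alpha> then X b (X c (Y b (Y c u))) else 0"
      have "(\<Sum>b\<in>?A. \<Sum>c\<in>?A. G b c) = (\<Sum>b\<in>?A. \<Sum>c\<in>?A. ?G1 c b) - (\<Sum>b\<in>?A. \<Sum>c\<in>?A. ?G1 b c)"
        unfolding sum_subtractf[symmetric] by (intro sum.cong HOL.refl) (auto simp: G_def add.commute)
      also have "(\<Sum>b\<in>?A. \<Sum>c\<in>?A. ?G1 c b) = (\<Sum>b\<in>?A. \<Sum>c\<in>?A. ?G1 b c)" by (rule sum.swap)
      finally show ?thesis by simp
    qed
    finally show ?thesis by simp
  qed
  then show ?thesis by blast
qed

text \<open>Roots of the plane outside \<open>R\<close> act by zero on both vectors involved, so for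
  a large cut-off \<open>CP\<close> is there the sum over \<open>R\<close>. This removes the cut-off
  from \<open>CP_Delta\<close>.\<close>

lemma Delta_plane_commute:
  assumes \<alpha>: "P \<alpha>" and R: "finite R" "\<And>\<beta>. \<beta> \<in> R \<Longrightarrow> P \<beta>"
    and z: "\<And>\<beta>. P \<beta> \<Longrightarrow> \<beta> \<notin> R \<Longrightarrow> Delta \<beta> u = 0 \<and> Delta \<beta> (Delta \<alpha> u) = 0"
  shows "(\<Sum>\<beta>\<in>R. Delta \<alpha> (Delta \<beta> u) - Delta \<beta> (Delta \<alpha> u)) = 0"
proof -
  obtain N0 where N0: "\<And>N. N \<ge> N0 \<Longrightarrow> CP P N (Delta \<alpha> u) = Delta \<alpha> (CP P N u)"
    using CP_Delta[OF \<alpha>, of u] by blast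
  have "\<exists>M. \<forall>b\<in>Bs. wt b \<in> R \<longrightarrow> ht b \<le> M"
  proof -
    have "finite (\<Union>\<beta>\<in>R. {b\<in>Bs. wt b = \<beta>})" using R finite_wt by blast
    then have "finite (ht ` (\<Union>\<beta>\<in>R. {b\<in>Bs. wt b = \<beta>}))" by blast
    then obtain M where "\<forall>k\<in>ht ` (\<Union>\<beta>\<in>R. {b\<in>Bs. wt b = \<beta>}). k \<le> M" using finite_nat_set_iff_bounded_le by blast
    then show ?thesis by blast
  qed
  then obtain M where M: "\<And>b. b \<in> Bs \<Longrightarrow> wt b \<in> R \<Longrightarrow> ht b \<le> M" by blast
  define N where "N = max N0 M"
  have CP_eq: "CP P N v = (\<Sum>\<beta>\<in>R. Delta \<beta> v)"
    if v: "\<And>\<beta>. P \<beta> \<Longrightarrow> \<beta> \<notin> R \<Longrightarrow> Delta \<beta> v = 0" for v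
  proof -
    let ?A = "{b\<in>BN N. P (wt b)}"
    have "CP P N v = (\<Sum>\<beta>\<in>wt ` ?A. \<Sum>b\<in>{b\<in>?A. wt b = \<beta>}. X b (Y b v))"
      unfolding CP_def by (rule sum.image_gen) simp
    also have "\<dots> = (\<Sum>\<beta>\<in>wt ` ?A. Delta \<beta> v)"
    proof (rule sum.cong[OF HOL.refl])
      fix \<beta> assume "\<beta> \<in> wt ` ?A"
      then obtain b where b: "b \<in> Bs" "ht b \<le> N" "P \<beta>" "wt b = \<beta>" by (auto simp: BN_def)
      have "ht a \<le> N" if "a \<in> Bs" "wt a = \<beta>" for a using wt_ht[OF that(1) b(1)] that b by simp
      then have "{b\<in>?A. wt b = \<beta>} = {b\<in>Bs. wt b = \<beta>}" using b by (auto simp: BN_def)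
      then show "(\<Sum>b\<in>{b\<in>?A. wt b = \<beta>}. X b (Y b v)) = Delta \<beta> v" by (simp add: Delta_def)
    qed
    also have "\<dots> = (\<Sum>\<beta>\<in>wt ` ?A \<inter> R. Delta \<beta> v)"
      by (rule sum.mono_neutral_right) (use v in auto)
    also have "\<dots> = (\<Sum>\<beta>\<in>R. Delta \<beta> v)"
    proof (rule sum.mono_neutral_left)
      show "\<forall>\<beta>\<in>R - wt ` ?A \<inter> R. Delta \<beta> v = 0"
      proof
        fix \<beta> assume \<beta>: "\<beta> \<in> R - wt ` ?A \<inter> R"
        have "b \<in> ?A" if "b \<in> Bs" "wt b = \<beta>" for b
          using that \<beta> R(2)[of \<beta>] M[of b] by (simp add: BN_def N_def)
        then have "{b\<in>Bs. wt b = \<beta>} = {}" using \<beta> by blast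
        then show "Delta \<beta> v = 0" by (simp add: Delta_def del: Collect_empty_eq)
      qed
    qed (use R in auto)
    finally show ?thesis .
  qed
  have "Delta \<alpha> (\<Sum>\<beta>\<in>R. Delta \<beta> u) = (\<Sum>\<beta>\<in>R. Delta \<beta> (Delta \<alpha> u))"
    using N0[of N] CP_eq[of u] CP_eq[of "Delta \<alpha> u"] z by (simp add: N_def)
  then show ?thesis by (simp add: clinear_sum[OF lin_Delta] sum_subtractf)
qed

end
end

section \<open>Tensor products of such modules\<close>

text \<open>\<open>hs\<close> and \<open>hs'\<close> play the role of dual bases of the Cartan
  subalgebra, a property used only through the two expansions of \<open>cor\<close> and the symmetry
  of the Cartan tensor. They coincide when an orthonormal basis is given.\<close>

locale double_tensor = double_data Bs wt ht C F cor
  for Bs :: "'b set" and wt :: "'b \<Rightarrow> complex ^ 'd::finite \<Rightarrow> complex" and ht C F cor +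
  fixes xo yo :: "'n::finite \<Rightarrow> 'b \<Rightarrow> 'v \<Rightarrow> 'v::complex_vector" and ho :: "'n \<Rightarrow> complex ^ 'd \<Rightarrow> 'v \<Rightarrow> 'v"
    and hs hs' :: "'d \<Rightarrow> complex ^ 'd"
  assumes ops: "double_ops Bs wt ht C F cor (xo i) (yo i) (ho i)"
    and comm: "i \<noteq> j \<Longrightarrow> xo i a (xo j b u) = xo j b (xo i a u)"
      "i \<noteq> j \<Longrightarrow> yo i a (yo j b u) = yo j b (yo i a u)"
      "i \<noteq> j \<Longrightarrow> yo i a (xo j b u) = xo j b (yo i a u)"
      "i \<noteq> j \<Longrightarrow> ho i h (xo j b u) = xo j b (ho i h u)"
      "i \<noteq> j \<Longrightarrow> ho i h (yo j b u) = yo j b (ho i h u)"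
      "i \<noteq> j \<Longrightarrow> ho i h (ho j k u) = ho j k (ho i h u)"
    and lin_ho: "ho i (h + k) u = ho i h u + ho i k u" "ho i (c *\<^sub>C h) u = c *\<^sub>C ho i h u"
    and lin_wt: "b \<in> Bs \<Longrightarrow> clinear (wt b)"
    and cor_hs: "b \<in> Bs \<Longrightarrow> cor b = (\<Sum>s\<in>UNIV. wt b (hs s) *\<^sub>C hs' s)"
      "b \<in> Bs \<Longrightarrow> cor b = (\<Sum>s\<in>UNIV. wt b (hs' s) *\<^sub>C hs s)"
    and hs_sym: "(\<Sum>s\<in>UNIV. ho i (hs s) (ho j (hs' s) u)) = (\<Sum>s\<in>UNIV. ho i (hs' s) (ho j (hs s) u))"
begin

sublocale ops: double_ops Bs wt ht C F cor "xo i" "yo i" "ho i" for i by (rule ops)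

lemma lin_ho_left: "clinear (\<lambda>h. ho i h u)" by (rule clinearI) (simp_all add: lin_ho)

lemmas ho_sum = clinear_sum[OF lin_ho_left]

lemma ho_cor: "b \<in> Bs \<Longrightarrow> ho i (cor b) u = (\<Sum>s\<in>UNIV. wt b (hs s) *\<^sub>C ho i (hs' s) u)"
  "b \<in> Bs \<Longrightarrow> ho i (cor b) u = (\<Sum>s\<in>UNIV. wt b (hs' s) *\<^sub>C ho i (hs s) u)"
  by (simp add: cor_hs(1) ho_sum lin_ho) (simp add: cor_hs(2) ho_sum lin_ho)

definition tx :: "'b \<Rightarrow> 'v \<Rightarrow> 'v" where "tx b u = (\<Sum>i\<in>UNIV. xo i b u)"
definition ty :: "'b \<Rightarrow> 'v \<Rightarrow> 'v" where "ty b u = (\<Sum>i\<in>UNIV. yo i b u)"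
definition th :: "complex ^ 'd \<Rightarrow> 'v \<Rightarrow> 'v" where "th h u = (\<Sum>i\<in>UNIV. ho i h u)"

definition adm :: "nat \<Rightarrow> 'v \<Rightarrow> bool" where "adm N u \<longleftrightarrow> (\<forall>i. ops.adm i N u)"

lemma adm_mono: "adm N u \<Longrightarrow> N \<le> M \<Longrightarrow> adm M u"
  unfolding adm_def using ops.adm_mono by blast

lemma adm_ex: "\<exists>N. adm N u"
proof -
  have "\<exists>N. ops.adm i N u" for i by (rule ops.adm_ex)
  then obtain f where f: "\<And>i. ops.adm i (f i) u" by metis
  have "ops.adm i (Max (range f)) u" for i
    by (rule ops.adm_mono[OF f]) simp
  then show ?thesis by (auto simp: adm_def)
qed

lemma adm_ex_finite:
  assumes "finite T" shows "\<exists>N. \<forall>u\<in>T. adm N u"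
  using assms
proof (induction T)
  case (insert t T)
  then obtain N where "\<forall>u\<in>T. adm N u" by blast
  moreover obtain M where "adm M t" using adm_ex by blast
  ultimately have "\<forall>u\<in>insert t T. adm (max N M) u" using adm_mono by (metis insertE max.cobounded1 max.cobounded2)
  then show ?case by blast
qed simp

lemma adm_zero: "adm N u \<Longrightarrow> b \<in> Bs \<Longrightarrow> N < ht b \<Longrightarrow> yo i b u = 0"
  by (simp add: adm_def ops.adm_def)

text \<open>Operators on different factors commute, so only the diagonal terms survive. This carries
  every commutation relation from the factors to their sum.\<close>

lemma total_commutator:
  fixes A B :: "'n \<Rightarrow> 'v \<Rightarrow> 'v"
  assumes "\<And>i. clinear (A i)" "\<And>i. clinear (B i)" "\<And>i j. i \<noteq> j \<Longrightarrow> A i (B j u) = B j (A i u)"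
  shows "(\<Sum>i\<in>UNIV. A i (\<Sum>j\<in>UNIV. B j u)) - (\<Sum>j\<in>UNIV. B j (\<Sum>i\<in>UNIV. A i u)) =
    (\<Sum>i\<in>UNIV. A i (B i u) - B i (A i u))"
proof -
  have "(\<Sum>i\<in>UNIV. A i (\<Sum>j\<in>UNIV. B j u)) - (\<Sum>j\<in>UNIV. B j (\<Sum>i\<in>UNIV. A i u)) =
    (\<Sum>i\<in>UNIV. \<Sum>j\<in>UNIV. A i (B j u)) - (\<Sum>j\<in>UNIV. \<Sum>i\<in>UNIV. B j (A i u))"
    by (simp add: clinear_sum[OF assms(1)] clinear_sum[OF assms(2)])
  also have "(\<Sum>j\<in>UNIV. \<Sum>i\<in>UNIV. B j (A i u)) = (\<Sum>i\<in>UNIV. \<Sum>j\<in>UNIV. B j (A i u))" by (rule sum.swap)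
  also have "(\<Sum>i\<in>UNIV. \<Sum>j\<in>UNIV. A i (B j u)) - \<dots> = (\<Sum>i\<in>UNIV. \<Sum>j\<in>UNIV. A i (B j u) - B j (A i u))"
    by (simp add: sum_subtractf)
  also have "\<dots> = (\<Sum>i\<in>UNIV. \<Sum>j\<in>UNIV. if j = i then A i (B i u) - B i (A i u) else 0)"
    by (intro sum.cong HOL.refl) (use assms(3) in auto)
  finally show ?thesis by simp
qed

lemma lin_tx: "clinear (tx b)" and lin_ty: "clinear (ty b)" and lin_th: "clinear (th h)"
  unfolding tx_def ty_def th_def
  by (intro clinear_sum_fun ops.lin_X ops.lin_Y ops.lin_H)+

text \<open>The relations are those of a Lie algebra, linear in commutators, so the diagonal action
  satisfies them again; the results on \<Delta> then apply to the tensor product itself.\<close>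

sublocale total: double_ops Bs wt ht C F cor tx ty th
proof (rule double_ops.intro[OF double_data_axioms], rule double_ops_axioms.intro)
  show "clinear (tx b)" "clinear (ty b)" for b by (rule lin_tx lin_ty)+
  show "clinear (th h)" for h by (rule lin_th)
  show "th h (th k u) = th k (th h u)" for h k u
    using total_commutator[of "\<lambda>i. ho i h" "\<lambda>i. ho i k" u]
    by (simp add: th_def ops.lin_H ops.H_H[of _ h] comm)
  show "th h (tx b u) = tx b (th h u) - wt b h *\<^sub>C tx b u" if "b \<in> Bs" for b h u
    using total_commutator[of "\<lambda>i. ho i h" "\<lambda>i. xo i b" u] that
    by (simp add: th_def tx_def ops.lin_H ops.lin_X comm ops.H_X sum_negf complex_vector.scale_sum_right)
      (simp add: algebra_simps)
  show "th h (ty b u) = ty b (th h u) + wt b h *\<^sub>C ty b u" if "b \<in> Bs" for b h u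
    using total_commutator[of "\<lambda>i. ho i h" "\<lambda>i. yo i b" u] that
    by (simp add: th_def ty_def ops.lin_H ops.lin_Y comm ops.H_Y complex_vector.scale_sum_right)
      (simp add: algebra_simps)
  show "\<exists>N. \<forall>b\<in>Bs. N < ht b \<longrightarrow> ty b u = 0" for u
  proof -
    obtain N where N: "adm N u" using adm_ex by blast
    show ?thesis
      by (rule exI[of _ N]) (use adm_zero[OF N] in \<open>auto simp: ty_def intro: sum.neutral\<close>)
  qed
  show "tx a (tx b u) - tx b (tx a u) = (\<Sum>c\<in>BN N. C a b c *\<^sub>C tx c u)"
    if "a \<in> Bs" "b \<in> Bs" "ht a + ht b \<le> N" for a b N u
  proof -
    have "tx a (tx b u) - tx b (tx a u) = (\<Sum>i\<in>UNIV. xo i a (xo i b u) - xo i b (xo i a u))"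
      unfolding tx_def by (rule total_commutator) (auto simp: ops.lin_X comm)
    also have "\<dots> = (\<Sum>i\<in>UNIV. \<Sum>c\<in>BN N. C a b c *\<^sub>C xo i c u)"
      by (intro sum.cong HOL.refl ops.X_X that)
    also have "\<dots> = (\<Sum>c\<in>BN N. C a b c *\<^sub>C tx c u)"
      unfolding tx_def complex_vector.scale_sum_right by (rule sum.swap)
    finally show ?thesis .
  qed
  show "ty a (ty b u) - ty b (ty a u) = (\<Sum>c\<in>BN N. F a b c *\<^sub>C ty c u)"
    if "a \<in> Bs" "b \<in> Bs" "ht a + ht b \<le> N" for a b N u
  proof -
    have "ty a (ty b u) - ty b (ty a u) = (\<Sum>i\<in>UNIV. yo i a (yo i b u) - yo i b (yo i a u))"
      unfolding ty_def by (rule total_commutator) (auto simp: ops.lin_Y comm)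
    also have "\<dots> = (\<Sum>i\<in>UNIV. \<Sum>c\<in>BN N. F a b c *\<^sub>C yo i c u)"
      by (intro sum.cong HOL.refl ops.Y_Y that)
    also have "\<dots> = (\<Sum>c\<in>BN N. F a b c *\<^sub>C ty c u)"
      unfolding ty_def complex_vector.scale_sum_right by (rule sum.swap)
    finally show ?thesis .
  qed
  show "ty a (tx b u) - tx b (ty a u) = (if a = b then th (cor a) u else 0) +
      (\<Sum>c\<in>BN N. C b c a *\<^sub>C ty c u) + (\<Sum>c\<in>BN N. F c a b *\<^sub>C tx c u)"
    if "a \<in> BN N" "b \<in> BN N" for a b N u
  proof -
    have "ty a (tx b u) - tx b (ty a u) = (\<Sum>i\<in>UNIV. yo i a (xo i b u) - xo i b (yo i a u))"
      unfolding ty_def tx_def by (rule total_commutator) (auto simp: ops.lin_X ops.lin_Y comm)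
    also have "\<dots> = (\<Sum>i\<in>UNIV. (if a = b then ho i (cor a) u else 0) +
      (\<Sum>c\<in>BN N. C b c a *\<^sub>C yo i c u) + (\<Sum>c\<in>BN N. F c a b *\<^sub>C xo i c u))"
      by (intro sum.cong HOL.refl ops.Y_X that)
    also have "\<dots> = (if a = b then th (cor a) u else 0) +
      (\<Sum>c\<in>BN N. C b c a *\<^sub>C ty c u) + (\<Sum>c\<in>BN N. F c a b *\<^sub>C tx c u)"
      unfolding tx_def ty_def th_def complex_vector.scale_sum_right sum.distrib
      by (subst (1 2) sum.swap) auto
    finally show ?thesis .
  qed
qed

section \<open>The operators \<Omega> and their invariance\<close>

definition OmN :: "nat \<Rightarrow> 'n \<Rightarrow> 'n \<Rightarrow> 'v \<Rightarrow> 'v" where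
  "OmN N i j u = (\<Sum>b\<in>BN N. xo i b (yo j b u) + yo i b (xo j b u)) +
     (\<Sum>s\<in>UNIV. ho i (hs s) (ho j (hs' s) u))"

text \<open>\<open>LEAST\<close> only fixes one admissible cut-off. By \<open>Om_eq\<close> any
  other gives the same value for distinct factors, so linearity can be checked with a cut-off common
  to finitely many vectors.\<close>

definition Om :: "'n \<Rightarrow> 'n \<Rightarrow> 'v \<Rightarrow> 'v" where
  "Om i j u = OmN (LEAST N. adm N u) i j u"

lemma Om_eq:
  assumes "i \<noteq> j" "adm N u"
  shows "Om i j u = OmN N i j u"
proof -
  let ?L = "LEAST N. adm N u"
  have L: "adm ?L u" using assms(2) by (rule LeastI)
  have le: "?L \<le> N" using assms(2) by (rule Least_le)
  have "(\<Sum>b\<in>BN ?L. xo i b (yo j b u) + yo i b (xo j b u)) = (\<Sum>b\<in>BN N. xo i b (yo j b u) + yo i b (xo j b u))"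
  proof (rule sum.mono_neutral_left[OF finite_BN])
    show "\<forall>b\<in>BN N - BN ?L. xo i b (yo j b u) + yo i b (xo j b u) = 0"
    proof
      fix b assume "b \<in> BN N - BN ?L"
      then have "yo i b u = 0" "yo j b u = 0" using adm_zero[OF L] by (auto simp: BN_def)
      then show "xo i b (yo j b u) + yo i b (xo j b u) = 0"
        using comm(3)[OF assms(1)] ops.op_simps by simp
    qed
  qed (use le in \<open>auto simp: BN_def\<close>)
  then show ?thesis by (simp add: Om_def OmN_def)
qed

lemma lin_OmN: "clinear (OmN N i j)"
  unfolding OmN_def
  by (intro clinear_plus clinear_sum_fun clinear_compose[OF ops.lin_X ops.lin_Y]
      clinear_compose[OF ops.lin_Y ops.lin_X] clinear_compose[OF ops.lin_H ops.lin_H])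

lemma lin_Om: "i \<noteq> j \<Longrightarrow> clinear (Om i j)"
proof (rule clinearI)
  assume ij: "i \<noteq> j"
  fix u w c
  obtain N where "\<forall>v\<in>{u, w, u + w, c *\<^sub>C u}. adm N v" using adm_ex_finite[of "{u, w, u + w, c *\<^sub>C u}"] by blast
  then have N: "adm N u" "adm N w" "adm N (u + w)" "adm N (c *\<^sub>C u)" by auto
  show "Om i j (u + w) = Om i j u + Om i j w" "Om i j (c *\<^sub>C u) = c *\<^sub>C Om i j u"
    by (simp_all add: Om_eq[OF ij N(1)] Om_eq[OF ij N(2)] Om_eq[OF ij N(3)] Om_eq[OF ij N(4)]
        clinear_simps[OF lin_OmN])
qed

lemma Om_sym:
  assumes ij: "i \<noteq> j"
  shows "Om i j u = Om j i u"
proof -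
  obtain N where N: "adm N u" using adm_ex by blast
  have "(\<Sum>s\<in>UNIV. ho i (hs s) (ho j (hs' s) u)) = (\<Sum>s\<in>UNIV. ho j (hs s) (ho i (hs' s) u))"
    unfolding hs_sym[of j] by (intro sum.cong HOL.refl comm ij)
  then show ?thesis
    using ij by (simp add: Om_eq[OF _ N] OmN_def comm(3)[of j i] comm(3)[of i j] add.commute)
qed

lemma Om_H_far:
  assumes "i \<noteq> j" "k \<noteq> i" "k \<noteq> j"
  shows "Om i j (ho k h u) = ho k h (Om i j u)"
proof -
  obtain N where "\<forall>v\<in>{u, ho k h u}. adm N v" using adm_ex_finite[of "{u, ho k h u}"] by blast
  then have N: "adm N u" "adm N (ho k h u)" by auto
  show ?thesis
    using assms by (simp add: Om_eq[OF assms(1) N(1)] Om_eq[OF assms(1) N(2)] OmN_def ops.op_simps comm)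
qed

lemma Om_X_far:
  assumes "i \<noteq> j" "k \<noteq> i" "k \<noteq> j"
  shows "Om i j (xo k a u) = xo k a (Om i j u)"
proof -
  obtain N where "\<forall>v\<in>{u, xo k a u}. adm N v" using adm_ex_finite[of "{u, xo k a u}"] by blast
  then have N: "adm N u" "adm N (xo k a u)" by auto
  show ?thesis
    using assms
    by (simp add: Om_eq[OF assms(1) N(1)] Om_eq[OF assms(1) N(2)] OmN_def ops.op_simps
        comm(1)[of _ k] comm(3,4))
qed

lemma Om_Y_far:
  assumes "i \<noteq> j" "k \<noteq> i" "k \<noteq> j"
  shows "Om i j (yo k a u) = yo k a (Om i j u)"
proof -
  obtain N where "\<forall>v\<in>{u, yo k a u}. adm N v" using adm_ex_finite[of "{u, yo k a u}"] by blast
  then have N: "adm N u" "adm N (yo k a u)" by auto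
  show ?thesis
    using assms
    by (simp add: Om_eq[OF assms(1) N(1)] Om_eq[OF assms(1) N(2)] OmN_def ops.op_simps
        comm(2)[of _ k] comm(3,5))
qed

lemma Om_H_near:
  assumes ij: "i \<noteq> j"
  shows "Om i j (ho i h u + ho j h u) = ho i h (Om i j u) + ho j h (Om i j u)"
proof -
  obtain N where "\<forall>v\<in>{u, ho i h u + ho j h u}. adm N v" using adm_ex_finite[of "{u, ho i h u + ho j h u}"] by blast
  then have N: "adm N u" "adm N (ho i h u + ho j h u)" by auto
  have b: "xo i b (yo j b (ho i h u + ho j h u)) + yo i b (xo j b (ho i h u + ho j h u)) =
     ho i h (xo i b (yo j b u) + yo i b (xo j b u)) + ho j h (xo i b (yo j b u) + yo i b (xo j b u))"
    if "b \<in> Bs" for b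
    using ij that by (simp add: ops.op_simps ops.H_X ops.H_Y comm)
  have s: "ho i g (ho j k (ho i h u + ho j h u)) = ho i h (ho i g (ho j k u)) + ho j h (ho i g (ho j k u))" for g k
    using ij comm(6)[of j i k h u] comm(6)[of i j g h "ho j k u"]
    by (simp add: ops.op_simps ops.H_H[of i g h] ops.H_H[of j k h])
  have BNs: "b \<in> BN N \<Longrightarrow> b \<in> Bs" for b by (simp add: BN_def)
  let ?T = "\<lambda>b. xo i b (yo j b u) + yo i b (xo j b u)" and ?S = "\<lambda>s. ho i (hs s) (ho j (hs' s) u)"
  have "OmN N i j (ho i h u + ho j h u) = (\<Sum>b\<in>BN N. ho i h (?T b) + ho j h (?T b)) +
      (\<Sum>s\<in>UNIV. ho i h (?S s) + ho j h (?S s))"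
    unfolding OmN_def by (intro arg_cong2[where f = "(+)"] sum.cong HOL.refl b BNs s)
  also have "\<dots> = ho i h (OmN N i j u) + ho j h (OmN N i j u)"
    unfolding OmN_def by (simp add: ops.op_simps sum.distrib algebra_simps)
  finally show ?thesis unfolding Om_eq[OF ij N(1)] Om_eq[OF ij N(2)] .
qed

text \<open>Invariance of the Casimir tensor. The \<open>C\<close> terms and the \<open>F\<close>
  terms cancel in pairs after exchanging summation indices; the Cartan terms of
  \<open>[y_a, x_a]\<close> cancel against the weight shift of the Cartan part. The cut-off n + ht a
  covers every bracket of \<open>x_a\<close> with an \<open>x_b\<close> whose \<open>y_b\<close>
  does not kill \<open>u\<close>.\<close>

lemma Om_X_near:
  assumes ij: "i \<noteq> j" and a: "a \<in> Bs"
  shows "Om i j (xo i a u + xo j a u) = xo i a (Om i j u) + xo j a (Om i j u)"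
proof -
  let ?v = "xo i a u + xo j a u"
  obtain n where "\<forall>v\<in>{u, ?v}. adm n v" using adm_ex_finite[of "{u, ?v}"] by blast
  then have n: "adm n u" "adm n ?v" by auto
  define N where "N = n + ht a"
  have N: "adm N u" "adm N ?v" using n adm_mono by (auto simp: N_def)
  have aN: "a \<in> BN N" using a by (simp add: N_def BN_def)
  have XX: "xo k b (xo k a (yo l b u)) - xo k a (xo k b (yo l b u)) = (\<Sum>c\<in>BN N. C b a c *\<^sub>C xo k c (yo l b u))"
    if "b \<in> BN N" for b k l
  proof (cases "ht b \<le> n")
    case True
    then show ?thesis using that a by (intro ops.X_X) (auto simp: N_def BN_def)
  next
    case False
    then have "yo l b u = 0" using adm_zero[OF n(1)] that by (auto simp: BN_def)
    then show ?thesis by (simp add: ops.op_simps)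
  qed
  have YX: "yo k b (xo k a w) = xo k a (yo k b w) + (if b = a then ho k (cor a) w else 0) +
      (\<Sum>c\<in>BN N. C a c b *\<^sub>C yo k c w) + (\<Sum>c\<in>BN N. F c b a *\<^sub>C xo k c w)" if "b \<in> BN N" for k b w
    using ops.Y_X'[OF that aN, of k w] by auto
  let ?T = "\<lambda>b w. xo i b (yo j b w) + yo i b (xo j b w)"
  have trm: "?T b ?v - (xo i a (?T b u) + xo j a (?T b u)) =
      (if b = a then ho i (cor a) (xo j a u) + xo i a (ho j (cor a) u) else 0) +
      (\<Sum>c\<in>BN N. C b a c *\<^sub>C xo i c (yo j b u)) + (\<Sum>c\<in>BN N. C a c b *\<^sub>C xo i b (yo j c u)) +
      (\<Sum>c\<in>BN N. C a c b *\<^sub>C yo i c (xo j b u)) + (\<Sum>c\<in>BN N. C b a c *\<^sub>C yo i b (xo j c u)) +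
      (\<Sum>c\<in>BN N. F c b a *\<^sub>C xo i c (xo j b u)) + (\<Sum>c\<in>BN N. F c b a *\<^sub>C xo i b (xo j c u))"
    if b: "b \<in> BN N" for b
  proof -
    have 1: "xo i b (yo j b (xo i a u)) - xo i a (xo i b (yo j b u)) = (\<Sum>c\<in>BN N. C b a c *\<^sub>C xo i c (yo j b u))"
      using XX[OF b, of i j] ij by (simp add: comm(3)[of j i])
    have 2: "yo i b (xo j b (xo i a u)) - xo i a (yo i b (xo j b u)) =
      (if b = a then ho i (cor a) (xo j a u) else 0) +
      (\<Sum>c\<in>BN N. C a c b *\<^sub>C yo i c (xo j b u)) + (\<Sum>c\<in>BN N. F c b a *\<^sub>C xo i c (xo j b u))"
      using YX[OF b, of i "xo j b u"] ij by (auto simp: comm(1)[of j i])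
    have 3: "xo i b (yo j b (xo j a u)) - xo j a (xo i b (yo j b u)) =
      (if b = a then xo i a (ho j (cor a) u) else 0) +
      (\<Sum>c\<in>BN N. C a c b *\<^sub>C xo i b (yo j c u)) + (\<Sum>c\<in>BN N. F c b a *\<^sub>C xo i b (xo j c u))"
      using ij by (auto simp: YX[OF b, of j u] ops.op_simps comm(1)[of i j])
    have 4: "yo i b (xo j b (xo j a u)) - xo j a (yo i b (xo j b u)) = (\<Sum>c\<in>BN N. C b a c *\<^sub>C yo i b (xo j c u))"
      using XX[OF b, of j i] ij by (simp add: comm(3)[of i j] ops.op_simps)
    have "?T b ?v - (xo i a (?T b u) + xo j a (?T b u)) =
      (xo i b (yo j b (xo i a u)) - xo i a (xo i b (yo j b u))) + (yo i b (xo j b (xo i a u)) - xo i a (yo i b (xo j b u))) +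
      (xo i b (yo j b (xo j a u)) - xo j a (xo i b (yo j b u))) + (yo i b (xo j b (xo j a u)) - xo j a (yo i b (xo j b u)))"
      by (simp add: ops.op_simps)
    then show ?thesis unfolding 1 2 3 4 by simp
  qed
  have H: "(\<Sum>s\<in>UNIV. ho i (hs s) (ho j (hs' s) ?v)) - (xo i a (\<Sum>s\<in>UNIV. ho i (hs s) (ho j (hs' s) u)) +
      xo j a (\<Sum>s\<in>UNIV. ho i (hs s) (ho j (hs' s) u))) = - xo i a (ho j (cor a) u) - ho i (cor a) (xo j a u)"
  proof -
    have "ho i (hs s) (ho j (hs' s) ?v) - (xo i a (ho i (hs s) (ho j (hs' s) u)) + xo j a (ho i (hs s) (ho j (hs' s) u)))
      = - wt a (hs s) *\<^sub>C xo i a (ho j (hs' s) u) - wt a (hs' s) *\<^sub>C ho i (hs s) (xo j a u)" for s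
      using ij a by (simp add: ops.op_simps ops.H_X comm)
    then have "(\<Sum>s\<in>UNIV. ho i (hs s) (ho j (hs' s) ?v)) - (xo i a (\<Sum>s\<in>UNIV. ho i (hs s) (ho j (hs' s) u)) +
      xo j a (\<Sum>s\<in>UNIV. ho i (hs s) (ho j (hs' s) u))) =
      (\<Sum>s\<in>UNIV. - wt a (hs s) *\<^sub>C xo i a (ho j (hs' s) u) - wt a (hs' s) *\<^sub>C ho i (hs s) (xo j a u))"
      by (simp add: ops.op_simps sum_subtractf[symmetric] sum.distrib[symmetric])
    then show ?thesis
      by (simp add: ho_cor(1)[OF a, of j] ho_cor(2)[OF a, of i] ops.op_simps sum_subtractf sum_negf)
  qed
  have "Om i j ?v - (xo i a (Om i j u) + xo j a (Om i j u)) =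
    (\<Sum>b\<in>BN N. ?T b ?v - (xo i a (?T b u) + xo j a (?T b u))) + ((\<Sum>s\<in>UNIV. ho i (hs s) (ho j (hs' s) ?v)) -
      (xo i a (\<Sum>s\<in>UNIV. ho i (hs s) (ho j (hs' s) u)) + xo j a (\<Sum>s\<in>UNIV. ho i (hs s) (ho j (hs' s) u))))"
    unfolding Om_eq[OF ij N(1)] Om_eq[OF ij N(2)] OmN_def
    by (simp only: sum_subtractf sum.distrib clinear_add[OF ops.lin_X] clinear_sum[OF ops.lin_X]) (simp add: algebra_simps)
  also have "\<dots> = (\<Sum>b\<in>BN N. (if b = a then ho i (cor a) (xo j a u) + xo i a (ho j (cor a) u) else 0)) +
      ((\<Sum>b\<in>BN N. \<Sum>c\<in>BN N. C b a c *\<^sub>C xo i c (yo j b u)) + (\<Sum>b\<in>BN N. \<Sum>c\<in>BN N. C a c b *\<^sub>C xo i b (yo j c u))) +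
      ((\<Sum>b\<in>BN N. \<Sum>c\<in>BN N. C a c b *\<^sub>C yo i c (xo j b u)) + (\<Sum>b\<in>BN N. \<Sum>c\<in>BN N. C b a c *\<^sub>C yo i b (xo j c u))) +
      ((\<Sum>b\<in>BN N. \<Sum>c\<in>BN N. F c b a *\<^sub>C xo i c (xo j b u)) + (\<Sum>b\<in>BN N. \<Sum>c\<in>BN N. F c b a *\<^sub>C xo i b (xo j c u))) +
      (- xo i a (ho j (cor a) u) - ho i (cor a) (xo j a u))"
    unfolding H by (simp only: trm sum.distrib cong: sum.cong) (simp add: algebra_simps)
  also have "(\<Sum>b\<in>BN N. \<Sum>c\<in>BN N. C b a c *\<^sub>C xo i c (yo j b u)) = - (\<Sum>b\<in>BN N. \<Sum>c\<in>BN N. C a c b *\<^sub>C xo i b (yo j c u))"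
    by (subst sum.swap) (simp add: C_antisym[of a] sum_negf)
  also have "(\<Sum>b\<in>BN N. \<Sum>c\<in>BN N. C a c b *\<^sub>C yo i c (xo j b u)) = - (\<Sum>b\<in>BN N. \<Sum>c\<in>BN N. C b a c *\<^sub>C yo i b (xo j c u))"
    by (subst sum.swap) (simp add: C_antisym[of a] sum_negf)
  also have "(\<Sum>b\<in>BN N. \<Sum>c\<in>BN N. F c b a *\<^sub>C xo i c (xo j b u)) = - (\<Sum>b\<in>BN N. \<Sum>c\<in>BN N. F c b a *\<^sub>C xo i b (xo j c u))"
    by (subst sum.swap, subst F_antisym) (simp add: sum_negf)
  finally show ?thesis using aN by simp
qed

text \<open>The counterpart for raising operators. Now the \<open>F\<close> terms cancel by
  exchanging indices alone, and only the \<open>C\<close> terms need antisymmetry.\<close>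

lemma Om_Y_near:
  assumes ij: "i \<noteq> j" and a: "a \<in> Bs"
  shows "Om i j (yo i a u + yo j a u) = yo i a (Om i j u) + yo j a (Om i j u)"
proof -
  let ?v = "yo i a u + yo j a u"
  obtain n where "\<forall>v\<in>{u, ?v}. adm n v" using adm_ex_finite[of "{u, ?v}"] by blast
  then have n: "adm n u" "adm n ?v" by auto
  define N where "N = n + ht a"
  have N: "adm N u" "adm N ?v" using n adm_mono by (auto simp: N_def)
  have aN: "a \<in> BN N" using a by (simp add: N_def BN_def)
  have YY: "yo k b (yo k a u) = yo k a (yo k b u) + (\<Sum>c\<in>BN N. F b a c *\<^sub>C yo k c u)" if "b \<in> BN N" for b k
    by (rule ops.Y_Y_adm) (use N(1) that a in \<open>auto simp: adm_def BN_def\<close>)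
  have YX: "yo k a (xo k b w) = xo k b (yo k a w) + (if b = a then ho k (cor a) w else 0) +
      (\<Sum>c\<in>BN N. C b c a *\<^sub>C yo k c w) + (\<Sum>c\<in>BN N. F c a b *\<^sub>C xo k c w)" if "b \<in> BN N" for k b w
    using ops.Y_X'[OF aN that, of k w] by auto
  let ?T = "\<lambda>b w. xo i b (yo j b w) + yo i b (xo j b w)"
  have trm: "?T b ?v - (yo i a (?T b u) + yo j a (?T b u)) =
      (if b = a then - ho i (cor a) (yo j a u) - yo i a (ho j (cor a) u) else 0) +
      ((\<Sum>c\<in>BN N. F b a c *\<^sub>C yo i c (xo j b u)) - (\<Sum>c\<in>BN N. F c a b *\<^sub>C yo i b (xo j c u))) +
      ((\<Sum>c\<in>BN N. F b a c *\<^sub>C xo i b (yo j c u)) - (\<Sum>c\<in>BN N. F c a b *\<^sub>C xo i c (yo j b u))) -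
      ((\<Sum>c\<in>BN N. C b c a *\<^sub>C yo i c (yo j b u)) + (\<Sum>c\<in>BN N. C b c a *\<^sub>C yo i b (yo j c u)))"
    if b: "b \<in> BN N" for b
  proof -
    have 1: "xo i b (yo j b (yo i a u)) - yo i a (xo i b (yo j b u)) =
      - ((if b = a then ho i (cor a) (yo j a u) else 0) +
      (\<Sum>c\<in>BN N. C b c a *\<^sub>C yo i c (yo j b u)) + (\<Sum>c\<in>BN N. F c a b *\<^sub>C xo i c (yo j b u)))"
      using YX[OF b, of i "yo j b u"] ij by (auto simp: comm(2)[of j i])
    have 2: "yo i b (xo j b (yo i a u)) - yo i a (yo i b (xo j b u)) = (\<Sum>c\<in>BN N. F b a c *\<^sub>C yo i c (xo j b u))"
      using YY[OF b, of i] ij by (simp add: comm(3)[of i j] ops.op_simps)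
    have 3: "xo i b (yo j b (yo j a u)) - yo j a (xo i b (yo j b u)) = (\<Sum>c\<in>BN N. F b a c *\<^sub>C xo i b (yo j c u))"
      using YY[OF b, of j] ij by (simp add: comm(3)[of j i] ops.op_simps)
    have 4: "yo i b (xo j b (yo j a u)) - yo j a (yo i b (xo j b u)) =
      - ((if b = a then yo i a (ho j (cor a) u) else 0) +
      (\<Sum>c\<in>BN N. C b c a *\<^sub>C yo i b (yo j c u)) + (\<Sum>c\<in>BN N. F c a b *\<^sub>C yo i b (xo j c u)))"
      using YX[OF b, of j u] ij by (auto simp: comm(2)[of j i] ops.op_simps)
    have "?T b ?v - (yo i a (?T b u) + yo j a (?T b u)) =
      (xo i b (yo j b (yo i a u)) - yo i a (xo i b (yo j b u))) + (yo i b (xo j b (yo i a u)) - yo i a (yo i b (xo j b u))) +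
      (xo i b (yo j b (yo j a u)) - yo j a (xo i b (yo j b u))) + (yo i b (xo j b (yo j a u)) - yo j a (yo i b (xo j b u)))"
      by (simp add: ops.op_simps)
    then show ?thesis unfolding 1 2 3 4 by simp
  qed
  have H: "(\<Sum>s\<in>UNIV. ho i (hs s) (ho j (hs' s) ?v)) - (yo i a (\<Sum>s\<in>UNIV. ho i (hs s) (ho j (hs' s) u)) +
      yo j a (\<Sum>s\<in>UNIV. ho i (hs s) (ho j (hs' s) u))) = yo i a (ho j (cor a) u) + ho i (cor a) (yo j a u)"
  proof -
    have "ho i (hs s) (ho j (hs' s) ?v) - (yo i a (ho i (hs s) (ho j (hs' s) u)) + yo j a (ho i (hs s) (ho j (hs' s) u)))
      = wt a (hs s) *\<^sub>C yo i a (ho j (hs' s) u) + wt a (hs' s) *\<^sub>C ho i (hs s) (yo j a u)" for s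
      using ij a by (simp add: ops.op_simps ops.H_Y comm)
    then have "(\<Sum>s\<in>UNIV. ho i (hs s) (ho j (hs' s) ?v)) - (yo i a (\<Sum>s\<in>UNIV. ho i (hs s) (ho j (hs' s) u)) +
      yo j a (\<Sum>s\<in>UNIV. ho i (hs s) (ho j (hs' s) u))) =
      (\<Sum>s\<in>UNIV. wt a (hs s) *\<^sub>C yo i a (ho j (hs' s) u) + wt a (hs' s) *\<^sub>C ho i (hs s) (yo j a u))"
      by (simp add: ops.op_simps sum_subtractf[symmetric] sum.distrib[symmetric])
    then show ?thesis
      by (simp add: ho_cor(1)[OF a, of j] ho_cor(2)[OF a, of i] ops.op_simps sum.distrib)
  qed
  have "Om i j ?v - (yo i a (Om i j u) + yo j a (Om i j u)) =
    (\<Sum>b\<in>BN N. ?T b ?v - (yo i a (?T b u) + yo j a (?T b u))) + ((\<Sum>s\<in>UNIV. ho i (hs s) (ho j (hs' s) ?v)) -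
      (yo i a (\<Sum>s\<in>UNIV. ho i (hs s) (ho j (hs' s) u)) + yo j a (\<Sum>s\<in>UNIV. ho i (hs s) (ho j (hs' s) u))))"
    unfolding Om_eq[OF ij N(1)] Om_eq[OF ij N(2)] OmN_def
    by (simp only: sum_subtractf sum.distrib clinear_add[OF ops.lin_Y] clinear_sum[OF ops.lin_Y]) (simp add: algebra_simps)
  also have "\<dots> = (\<Sum>b\<in>BN N. (if b = a then - ho i (cor a) (yo j a u) - yo i a (ho j (cor a) u) else 0)) +
      ((\<Sum>b\<in>BN N. \<Sum>c\<in>BN N. F b a c *\<^sub>C yo i c (xo j b u)) - (\<Sum>b\<in>BN N. \<Sum>c\<in>BN N. F c a b *\<^sub>C yo i b (xo j c u))) +
      ((\<Sum>b\<in>BN N. \<Sum>c\<in>BN N. F b a c *\<^sub>C xo i b (yo j c u)) - (\<Sum>b\<in>BN N. \<Sum>c\<in>BN N. F c a b *\<^sub>C xo i c (yo j b u))) -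
      ((\<Sum>b\<in>BN N. \<Sum>c\<in>BN N. C b c a *\<^sub>C yo i c (yo j b u)) + (\<Sum>b\<in>BN N. \<Sum>c\<in>BN N. C b c a *\<^sub>C yo i b (yo j c u))) +
      (yo i a (ho j (cor a) u) + ho i (cor a) (yo j a u))"
    unfolding H by (simp only: trm sum.distrib sum_subtractf cong: sum.cong)
  also have "(\<Sum>b\<in>BN N. \<Sum>c\<in>BN N. F b a c *\<^sub>C yo i c (xo j b u)) = (\<Sum>b\<in>BN N. \<Sum>c\<in>BN N. F c a b *\<^sub>C yo i b (xo j c u))"
    by (rule sum.swap)
  also have "(\<Sum>b\<in>BN N. \<Sum>c\<in>BN N. F b a c *\<^sub>C xo i b (yo j c u)) = (\<Sum>b\<in>BN N. \<Sum>c\<in>BN N. F c a b *\<^sub>C xo i c (yo j b u))"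
    by (rule sum.swap)
  also have "(\<Sum>b\<in>BN N. \<Sum>c\<in>BN N. C b c a *\<^sub>C yo i c (yo j b u)) = - (\<Sum>b\<in>BN N. \<Sum>c\<in>BN N. C b c a *\<^sub>C yo i b (yo j c u))"
    by (subst sum.swap, subst C_antisym) (simp add: sum_negf)
  finally show ?thesis using aN by simp
qed

lemma sum_near_far:
  fixes A :: "'n \<Rightarrow> 'v \<Rightarrow> 'v"
  assumes ij: "i \<noteq> j" and near: "Om i j (A i u + A j u) = A i (Om i j u) + A j (Om i j u)"
    and far: "\<And>k. k \<noteq> i \<Longrightarrow> k \<noteq> j \<Longrightarrow> Om i j (A k u) = A k (Om i j u)"
  shows "Om i j (\<Sum>k\<in>UNIV. A k u) = (\<Sum>k\<in>UNIV. A k (Om i j u))"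
proof -
  have split: "(\<Sum>k\<in>UNIV. f k) = (f i + f j) + (\<Sum>k\<in>UNIV - {i, j}. f k)" for f :: "'n \<Rightarrow> 'v"
    using ij sum.remove[of UNIV i f] sum.remove[of "UNIV - {i}" j f]
    by (simp add: insert_commute Diff_insert2[symmetric] add.assoc)
  show ?thesis
    unfolding split[of "\<lambda>k. A k u"] split[of "\<lambda>k. A k (Om i j u)"] clinear_add[OF lin_Om[OF ij]]
      clinear_sum[OF lin_Om[OF ij]] using near far
    by (simp add: clinear_add[OF lin_Om[OF ij]])
qed

lemma Om_tx: "i \<noteq> j \<Longrightarrow> a \<in> Bs \<Longrightarrow> Om i j (tx a u) = tx a (Om i j u)"
  unfolding tx_def by (rule sum_near_far[where A = "\<lambda>k. xo k a"]) (simp_all add: Om_X_near Om_X_far)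

lemma Om_ty: "i \<noteq> j \<Longrightarrow> a \<in> Bs \<Longrightarrow> Om i j (ty a u) = ty a (Om i j u)"
  unfolding ty_def by (rule sum_near_far[where A = "\<lambda>k. yo k a"]) (simp_all add: Om_Y_near Om_Y_far)

lemma Om_th: "i \<noteq> j \<Longrightarrow> Om i j (th h u) = th h (Om i j u)"
  unfolding th_def by (rule sum_near_far[where A = "\<lambda>k. ho k h"]) (simp_all add: Om_H_near Om_H_far)

lemma Om_Delta: "i \<noteq> j \<Longrightarrow> Om i j (total.Delta \<alpha> u) = total.Delta \<alpha> (Om i j u)"
  unfolding total.Delta_def by (simp add: clinear_sum[OF lin_Om] Om_tx Om_ty)

lemma Om_Om_disjoint:
  assumes "i \<noteq> j" "k \<noteq> l" "i \<noteq> k" "i \<noteq> l" "j \<noteq> k" "j \<noteq> l"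
  shows "Om i j (Om k l u) = Om k l (Om i j u)"
proof -
  obtain N where "\<forall>v\<in>{u, Om i j u}. adm N v" using adm_ex_finite[of "{u, Om i j u}"] by blast
  then have N: "adm N u" "adm N (Om i j u)" by auto
  note l = lin_Om[OF assms(1)]
  show ?thesis
    using assms
    by (simp add: Om_eq[OF assms(2) N(1)] Om_eq[OF assms(2) N(2)] OmN_def clinear_add[OF l] clinear_sum[OF l]
        Om_X_far Om_Y_far Om_H_far)
qed

text \<open>The sum of \<Omega>(i,k) and \<Omega>(j,k) consists of products of an operator on factor
  k with the diagonal action on factors i and j; \<Omega>(i,j) commutes with both. These are the
  infinitesimal braid relations.\<close>

lemma Om_Om_chain:
  assumes "i \<noteq> j" "i \<noteq> k" "j \<noteq> k"
  shows "Om i j (Om i k u + Om j k u) = Om i k (Om i j u) + Om j k (Om i j u)"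
proof -
  obtain N where "\<forall>v\<in>{u, Om i j u}. adm N v" using adm_ex_finite[of "{u, Om i j u}"] by blast
  then have N: "adm N u" "adm N (Om i j u)" by auto
  note l = lin_Om[OF assms(1)]
  have far: "k \<noteq> i" "k \<noteq> j" using assms by auto
  have b: "Om i j (xo i b (yo k b u) + yo i b (xo k b u) + (xo j b (yo k b u) + yo j b (xo k b u))) =
     xo i b (yo k b (Om i j u)) + yo i b (xo k b (Om i j u)) + (xo j b (yo k b (Om i j u)) + yo j b (xo k b (Om i j u)))"
    if "b \<in> Bs" for b
  proof -
    have "Om i j (xo i b (yo k b u) + xo j b (yo k b u)) + Om i j (yo i b (xo k b u) + yo j b (xo k b u)) =
      xo i b (yo k b (Om i j u)) + xo j b (yo k b (Om i j u)) + (yo i b (xo k b (Om i j u)) + yo j b (xo k b (Om i j u)))"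
      by (simp only: Om_X_near[OF assms(1) that] Om_Y_near[OF assms(1) that] Om_X_far[OF assms(1) far] Om_Y_far[OF assms(1) far])
    then show ?thesis by (simp add: clinear_add[OF l] algebra_simps)
  qed
  have s: "Om i j (ho i g (ho k h u) + ho j g (ho k h u)) = ho i g (ho k h (Om i j u)) + ho j g (ho k h (Om i j u))" for g h
    by (simp only: Om_H_near[OF assms(1)] Om_H_far[OF assms(1) far])
  have e: "OmN N i k v + OmN N j k v =
     (\<Sum>b\<in>BN N. xo i b (yo k b v) + yo i b (xo k b v) + (xo j b (yo k b v) + yo j b (xo k b v))) +
     (\<Sum>s\<in>UNIV. ho i (hs s) (ho k (hs' s) v) + ho j (hs s) (ho k (hs' s) v))" for v
    by (simp add: OmN_def sum.distrib algebra_simps)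
  have BNs: "b \<in> BN N \<Longrightarrow> b \<in> Bs" for b by (simp add: BN_def)
  show ?thesis
    unfolding Om_eq[OF assms(2) N(1)] Om_eq[OF assms(2) N(2)] Om_eq[OF assms(3) N(1)] Om_eq[OF assms(3) N(2)] e
      clinear_add[OF l] clinear_sum[OF l]
    by (simp only: b[OF BNs, unfolded clinear_add[OF l]] s[unfolded clinear_add[OF l]] cong: sum.cong)
qed

text \<open>The commutators of \<open>h\<^sup>(\<^sup>i\<^sup>)\<close> with \<open>\<Delta>\<^sub>\<alpha>\<close> and with \<open>\<Omega>\<^sub>i\<^sub>j\<close> have the same root components.\<close>
definition Theta :: "'n \<Rightarrow> 'n \<Rightarrow> (complex ^ 'd \<Rightarrow> complex) \<Rightarrow> 'v \<Rightarrow> 'v" where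
  "Theta i j \<alpha> u = (\<Sum>b | b \<in> Bs \<and> wt b = \<alpha>. yo i b (xo j b u) - xo i b (yo j b u))"

text \<open>Only the summands on factor i feel h, so the commutator with x_b y_b is \<langle>wt b,
  h\<rangle> times x_b y_b^(i) - x_b^(i) y_b, where the terms with both operators on factor i
  cancel.\<close>

lemma H_Delta:
  "ho i h (total.Delta \<alpha> u) - total.Delta \<alpha> (ho i h u) = \<alpha> h *\<^sub>C (\<Sum>j\<in>UNIV - {i}. Theta i j \<alpha> u)"
proof -
  have trm: "ho i h (tx b (ty b u)) - tx b (ty b (ho i h u)) =
    (\<Sum>j\<in>UNIV - {i}. wt b h *\<^sub>C (yo i b (xo j b u) - xo i b (yo j b u)))" if b: "b \<in> Bs" for b
  proof -
    have txH: "ho i h (tx b w) = tx b (ho i h w) - wt b h *\<^sub>C xo i b w" for w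
    proof -
      have "ho i h (tx b w) = (\<Sum>k\<in>UNIV. xo k b (ho i h w) - (if k = i then wt b h *\<^sub>C xo i b w else 0))"
        unfolding tx_def ops.op_simps by (intro sum.cong HOL.refl) (use b in \<open>auto simp: ops.H_X comm\<close>)
      then show ?thesis by (simp add: tx_def sum_subtractf)
    qed
    have tyH: "ho i h (ty b w) = ty b (ho i h w) + wt b h *\<^sub>C yo i b w" for w
    proof -
      have "ho i h (ty b w) = (\<Sum>k\<in>UNIV. yo k b (ho i h w) + (if k = i then wt b h *\<^sub>C yo i b w else 0))"
        unfolding ty_def ops.op_simps by (intro sum.cong HOL.refl) (use b in \<open>auto simp: ops.H_Y comm\<close>)
      then show ?thesis by (simp add: ty_def sum.distrib)
    qed
    have "ho i h (tx b (ty b u)) - tx b (ty b (ho i h u)) = wt b h *\<^sub>C (tx b (yo i b u) - xo i b (ty b u))"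
      by (simp add: txH tyH clinear_simps[OF lin_tx] scaleC_distribs)
    also have "tx b (yo i b u) - xo i b (ty b u) = (\<Sum>j\<in>UNIV. xo j b (yo i b u) - xo i b (yo j b u))"
      by (simp add: tx_def ty_def ops.op_simps sum_subtractf)
    also have "\<dots> = (\<Sum>j\<in>UNIV - {i}. xo j b (yo i b u) - xo i b (yo j b u))"
      by (rule sum.mono_neutral_right) auto
    also have "\<dots> = (\<Sum>j\<in>UNIV - {i}. yo i b (xo j b u) - xo i b (yo j b u))"
      by (intro sum.cong HOL.refl) (simp add: comm(3))
    finally show ?thesis by (simp add: complex_vector.scale_sum_right)
  qed
  have "ho i h (total.Delta \<alpha> u) - total.Delta \<alpha> (ho i h u) =
    (\<Sum>b | b \<in> Bs \<and> wt b = \<alpha>. ho i h (tx b (ty b u)) - tx b (ty b (ho i h u)))"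
    by (simp add: total.Delta_def ops.op_simps sum_subtractf)
  also have "\<dots> = (\<Sum>b | b \<in> Bs \<and> wt b = \<alpha>. \<Sum>j\<in>UNIV - {i}. \<alpha> h *\<^sub>C (yo i b (xo j b u) - xo i b (yo j b u)))"
    by (intro sum.cong HOL.refl) (auto simp: trm)
  also have "\<dots> = (\<Sum>j\<in>UNIV - {i}. \<alpha> h *\<^sub>C Theta i j \<alpha> u)"
    unfolding Theta_def complex_vector.scale_sum_right by (rule sum.swap)
  finally show ?thesis by (simp add: complex_vector.scale_sum_right)
qed

text \<open>The Cartan part commutes with h, and the remaining terms are regrouped by weight. One
  cut-off must serve both \<open>u\<close> and its image under h, since \<Omega> is evaluated at
  both.\<close>

lemma H_Om:
  assumes ij: "i \<noteq> j" and N: "adm N u" "adm N (ho i h u)" and R: "finite R" "wt ` BN N \<subseteq> R"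
    and z: "\<And>\<alpha>. \<alpha> \<in> R \<Longrightarrow> \<alpha> \<notin> wt ` BN N \<Longrightarrow> Theta i j \<alpha> u = 0"
  shows "ho i h (Om i j u) - Om i j (ho i h u) = (\<Sum>\<alpha>\<in>R. \<alpha> h *\<^sub>C Theta i j \<alpha> u)"
proof -
  have "ho i h (Om i j u) - Om i j (ho i h u) = (\<Sum>b\<in>BN N.
      ho i h (xo i b (yo j b u) + yo i b (xo j b u)) - (xo i b (yo j b (ho i h u)) + yo i b (xo j b (ho i h u))))"
    using ij unfolding Om_eq[OF ij N(1)] Om_eq[OF ij N(2)] OmN_def ops.op_simps sum_subtractf
    by (simp add: comm ops.H_H[of i h])
  also have "\<dots> = (\<Sum>b\<in>BN N. wt b h *\<^sub>C (yo i b (xo j b u) - xo i b (yo j b u)))"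
    by (intro sum.cong HOL.refl) (use ij in \<open>auto simp: BN_def ops.op_simps ops.H_X ops.H_Y comm scaleC_distribs\<close>)
  also have "\<dots> = (\<Sum>\<alpha>\<in>wt ` BN N. \<Sum>b\<in>{b\<in>BN N. wt b = \<alpha>}. wt b h *\<^sub>C (yo i b (xo j b u) - xo i b (yo j b u)))"
    by (rule sum.image_gen) simp
  also have "\<dots> = (\<Sum>\<alpha>\<in>wt ` BN N. \<alpha> h *\<^sub>C Theta i j \<alpha> u)"
  proof (rule sum.cong[OF HOL.refl])
    fix \<alpha> assume "\<alpha> \<in> wt ` BN N"
    then obtain b where b: "b \<in> Bs" "ht b \<le> N" "wt b = \<alpha>" by (auto simp: BN_def)
    have "ht a \<le> N" if "a \<in> Bs" "wt a = \<alpha>" for a using wt_ht[OF that(1) b(1)] that b by simp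
    then have "{b\<in>BN N. wt b = \<alpha>} = {b\<in>Bs. wt b = \<alpha>}" using b by (auto simp: BN_def)
    then show "(\<Sum>b\<in>{b\<in>BN N. wt b = \<alpha>}. wt b h *\<^sub>C (yo i b (xo j b u) - xo i b (yo j b u))) = \<alpha> h *\<^sub>C Theta i j \<alpha> u"
      by (simp add: Theta_def complex_vector.scale_sum_right)
  qed
  also have "\<dots> = (\<Sum>\<alpha>\<in>R. \<alpha> h *\<^sub>C Theta i j \<alpha> u)"
    by (rule sum.mono_neutral_left) (use R z in auto)
  finally show ?thesis .
qed

lemma Delta_eq_0:
  assumes N: "adm N u" and \<alpha>: "\<alpha> \<notin> wt ` BN N"
  shows "total.Delta \<alpha> u = 0"
  unfolding total.Delta_def
proof (rule sum.neutral, rule ballI)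
  fix b assume "b \<in> {b \<in> Bs. wt b = \<alpha>}"
  then have "b \<in> Bs" "N < ht b" using \<alpha> by (auto simp: BN_def image_iff not_le[symmetric])
  then have "ty b u = 0" using adm_zero[OF N] by (simp add: ty_def)
  then show "tx b (ty b u) = 0" by (simp add: clinear_zero[OF lin_tx])
qed

end

section \<open>Compatibility\<close>

definition cm :: "('v \<Rightarrow> 'v) \<Rightarrow> ('v \<Rightarrow> 'v) \<Rightarrow> 'v \<Rightarrow> 'v::complex_vector" where
  "cm S T x = S (T x) - T (S x)"

lemma cm_swap: "cm S T x = - cm T S x" by (simp add: cm_def)

lemma cm_self [simp]: "cm S S x = 0" by (simp add: cm_def)

lemma cm_scale_left: "clinear T \<Longrightarrow> cm (\<lambda>x. c *\<^sub>C S x) T x = c *\<^sub>C cm S T x"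
  by (simp add: cm_def clinear_simps scaleC_distribs)

lemma cm_scale_right: "clinear S \<Longrightarrow> cm S (\<lambda>x. c *\<^sub>C T x) x = c *\<^sub>C cm S T x"
  by (simp add: cm_def clinear_simps scaleC_distribs)

lemma cm_sum_left: "clinear T \<Longrightarrow> cm (\<lambda>x. \<Sum>k\<in>I. S k x) T x = (\<Sum>k\<in>I. cm (S k) T x)"
  by (simp add: cm_def clinear_sum sum_subtractf)

lemma cm_sum_right: "clinear S \<Longrightarrow> cm S (\<lambda>x. \<Sum>k\<in>I. T k x) x = (\<Sum>k\<in>I. cm S (T k) x)"
  by (simp add: cm_def clinear_sum sum_subtractf)

section \<open>Resummation over planes of roots\<close>

lemma pencil_same_plane:
  fixes \<alpha> \<beta> \<gamma> \<delta> :: "'h \<Rightarrow> complex"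
  assumes "\<And>h. \<gamma> h = x * \<alpha> h + y * \<beta> h" "\<And>h. \<delta> h = z * \<alpha> h + w * \<beta> h"
    and "\<gamma> k * \<delta> m \<noteq> \<delta> k * \<gamma> m"
  shows "{\<epsilon>. \<exists>a b. \<forall>h. \<epsilon> h = a * \<gamma> h + b * \<delta> h} = {\<epsilon>. \<exists>a b. \<forall>h. \<epsilon> h = a * \<alpha> h + b * \<beta> h}"
proof -
  \<comment> \<open>The determinant of the change of basis; the last assumption makes it non-zero,
    and Cramer's rule gives the inverse.\<close>
  define d where "d = x * w - y * z"
  have "\<gamma> k * \<delta> m - \<delta> k * \<gamma> m = d * (\<alpha> k * \<beta> m - \<beta> k * \<alpha> m)"
    by (simp add: assms(1,2) d_def algebra_simps)
  then have d: "d \<noteq> 0" using assms(3) by auto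
  have al: "\<alpha> h = (w * \<gamma> h - y * \<delta> h) / d" "\<beta> h = (x * \<delta> h - z * \<gamma> h) / d" for h
    using d by (simp_all add: assms(1,2) d_def field_simps)
  show ?thesis
  proof (intro set_eqI iffI; clarify)
    fix \<epsilon> :: "'h \<Rightarrow> complex" and a b assume e: "\<forall>h. \<epsilon> h = a * \<gamma> h + b * \<delta> h"
    show "\<exists>a b. \<forall>h. \<epsilon> h = a * \<alpha> h + b * \<beta> h"
      by (rule exI[of _ "a * x + b * z"], rule exI[of _ "a * y + b * w"])
        (simp add: e assms(1,2) algebra_simps)
  next
    fix \<epsilon> :: "'h \<Rightarrow> complex" and a b assume e: "\<forall>h. \<epsilon> h = a * \<alpha> h + b * \<beta> h"
    show "\<exists>a b. \<forall>h. \<epsilon> h = a * \<gamma> h + b * \<delta> h"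
      by (rule exI[of _ "(a * w - b * z) / d"], rule exI[of _ "(b * x - a * y) / d"])
        (use d in \<open>simp add: e al field_simps\<close>)
  qed
qed

text \<open>Normalising the \<open>\<alpha>\<close> by \<open>\<alpha> m = 1\<close>, the coefficient of \<open>c \<alpha> \<beta>\<close> is, along each affine line,
  a constant times a difference \<open>s \<beta> - s \<alpha>\<close>. Hence the sum can be taken line by line.\<close>
lemma plane_sum:
  fixes c :: "('h \<Rightarrow> complex) \<Rightarrow> ('h \<Rightarrow> complex) \<Rightarrow> 'v::complex_vector"
  assumes fin: "finite R" and nz: "\<And>\<alpha>. \<alpha> \<in> R \<Longrightarrow> \<alpha> m \<noteq> 0"
    and anti: "\<And>\<alpha> \<beta>. c \<beta> \<alpha> = - c \<alpha> \<beta>"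
    and plane: "\<And>\<alpha> \<gamma> \<delta>. \<alpha> \<in> R \<Longrightarrow> \<alpha> \<in> {\<epsilon>. \<exists>a b. \<forall>h. \<epsilon> h = a * \<gamma> h + b * \<delta> h} \<Longrightarrow>
      (\<Sum>\<beta> \<in> R \<inter> {\<epsilon>. \<exists>a b. \<forall>h. \<epsilon> h = a * \<gamma> h + b * \<delta> h}. c \<alpha> \<beta>) = 0"
  shows "(\<Sum>\<alpha>\<in>R. \<Sum>\<beta>\<in>R. (\<alpha> p * \<beta> q / (\<alpha> m * \<beta> m)) *\<^sub>C c \<alpha> \<beta>) = 0"
proof -
  define om where "om \<alpha> \<beta> = \<alpha> p * \<beta> q - \<beta> p * \<alpha> q" for \<alpha> \<beta> :: "'h \<Rightarrow> complex"
  define g where "g \<alpha> \<beta> = (om \<alpha> \<beta> / (\<alpha> m * \<beta> m)) *\<^sub>C c \<alpha> \<beta>" for \<alpha> \<beta>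
  define pl where "pl = (\<lambda>(\<gamma>, \<delta>). {\<epsilon> :: 'h \<Rightarrow> complex. \<exists>a b. \<forall>h. \<epsilon> h = a * \<gamma> h + b * (\<delta> h :: complex)})"
  \<comment> \<open>No member of \<open>R\<close> vanishes at \<open>m\<close>, so comparison with
    the values at \<open>m\<close> detects proportionality. Proportional pairs contribute zero; the
    others are sorted by the plane they span.\<close>
  define Q where "Q = {(\<alpha>, \<beta>) \<in> R \<times> R. \<exists>h. \<alpha> h * \<beta> m \<noteq> \<beta> h * \<alpha> m}"
  let ?S = "\<Sum>\<alpha>\<in>R. \<Sum>\<beta>\<in>R. (\<alpha> p * \<beta> q / (\<alpha> m * \<beta> m)) *\<^sub>C c \<alpha> \<beta>"
  have finQ: "finite Q" by (rule finite_subset[of _ "R \<times> R"]) (use fin in \<open>auto simp: Q_def\<close>)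
  have g0: "g \<alpha> \<beta> = 0" if "\<alpha> \<in> R" "\<beta> \<in> R" "(\<alpha>, \<beta>) \<notin> Q" for \<alpha> \<beta>
  proof -
    have e: "\<alpha> h * \<beta> m = \<beta> h * \<alpha> m" for h using that by (auto simp: Q_def)
    have "om \<alpha> \<beta> * \<beta> m = (\<alpha> p * \<beta> m) * \<beta> q - \<beta> p * (\<alpha> q * \<beta> m)" by (simp add: om_def algebra_simps)
    also have "\<dots> = 0" by (simp add: e)
    finally show ?thesis using nz that by (simp add: g_def)
  qed
  have "(\<Sum>\<alpha>\<in>R. \<Sum>\<beta>\<in>R. g \<alpha> \<beta>) = (\<Sum>x\<in>R \<times> R. g (fst x) (snd x))"
    by (simp add: sum.cartesian_product case_prod_beta)
  also have "\<dots> = (\<Sum>x\<in>Q. g (fst x) (snd x))"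
  proof (rule sum.mono_neutral_right)
    show "\<forall>x\<in>R \<times> R - Q. g (fst x) (snd x) = 0" using g0 by auto
  qed (use fin in \<open>auto simp: Q_def\<close>)
  also have "\<dots> = (\<Sum>P\<in>pl ` Q. \<Sum>x\<in>{x\<in>Q. pl x = P}. g (fst x) (snd x))"
    by (rule sum.image_gen[OF finQ])
  also have "\<dots> = 0"
  proof (rule sum.neutral, rule ballI)
    fix P assume "P \<in> pl ` Q"
    then obtain \<alpha>0 \<beta>0 where q0: "(\<alpha>0, \<beta>0) \<in> Q" and P: "P = pl (\<alpha>0, \<beta>0)" by auto
    have "\<exists>x y. \<gamma> \<in> P \<longrightarrow> (\<forall>h. \<gamma> h = x * \<alpha>0 h + y * \<beta>0 h)" for \<gamma> by (auto simp: P pl_def)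
    then obtain x y where xy: "\<And>\<gamma> h. \<gamma> \<in> P \<Longrightarrow> \<gamma> h = x \<gamma> * \<alpha>0 h + y \<gamma> * \<beta>0 h" by metis
    have a0: "\<alpha>0 m \<noteq> 0" using q0 nz by (auto simp: Q_def)
    have plI: "pl (\<alpha>, \<beta>) = P" if ab: "\<alpha> \<in> P" "\<beta> \<in> P" "(\<alpha>, \<beta>) \<in> Q" for \<alpha> \<beta>
    proof -
      obtain k where "\<alpha> k * \<beta> m \<noteq> \<beta> k * \<alpha> m" using ab by (auto simp: Q_def)
      from pencil_same_plane[OF xy[OF ab(1)] xy[OF ab(2)] this] show ?thesis by (simp add: P pl_def)
    qed
    have sub: "\<alpha> \<in> P \<and> \<beta> \<in> P" if "pl (\<alpha>, \<beta>) = P" for \<alpha> \<beta>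
    proof -
      have "\<alpha> \<in> pl (\<alpha>, \<beta>)" unfolding pl_def
        by simp (rule exI[of _ 1], rule exI[of _ 0], simp)
      moreover have "\<beta> \<in> pl (\<alpha>, \<beta>)" unfolding pl_def
        by simp (rule exI[of _ 0], rule exI[of _ 1], simp)
      ultimately show ?thesis using that by simp
    qed
    let ?RP = "R \<inter> P"
    \<comment> \<open>An affine coordinate on the line of members of the plane normalized to take
      the value 1 at \<open>m\<close>.\<close>
    define s where "s \<gamma> = y \<gamma> / \<gamma> m" for \<gamma>
    define k where "k = om \<alpha>0 \<beta>0 / \<alpha>0 m"
    have gk: "g \<gamma> \<delta> = (k * s \<delta>) *\<^sub>C c \<gamma> \<delta> - (k * s \<gamma>) *\<^sub>C c \<gamma> \<delta>" if "\<gamma> \<in> ?RP" "\<delta> \<in> ?RP" for \<gamma> \<delta>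
    proof -
      have n: "\<gamma> m \<noteq> 0" "\<delta> m \<noteq> 0" using that nz by auto
      have o: "om \<gamma> \<delta> = (x \<gamma> * y \<delta> - y \<gamma> * x \<delta>) * om \<alpha>0 \<beta>0"
        using that by (simp add: om_def xy[of \<gamma>] xy[of \<delta>] algebra_simps)
      have "\<gamma> m * y \<delta> - \<delta> m * y \<gamma> = \<alpha>0 m * (x \<gamma> * y \<delta> - y \<gamma> * x \<delta>)"
        using that by (simp add: xy[of \<gamma>] xy[of \<delta>] algebra_simps)
      then have "om \<gamma> \<delta> / (\<gamma> m * \<delta> m) = k * (\<gamma> m * y \<delta> - \<delta> m * y \<gamma>) / (\<gamma> m * \<delta> m)"
        using a0 by (simp add: o k_def)
      also have "\<dots> = k * s \<delta> - k * s \<gamma>" using n by (simp add: s_def field_simps)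
      finally show ?thesis by (simp add: g_def scaleC_distribs)
    qed
    have z: "(\<Sum>\<beta>\<in>?RP. c \<alpha> \<beta>) = 0" if "\<alpha> \<in> ?RP" for \<alpha>
      using plane[of \<alpha> \<alpha>0 \<beta>0] that by (simp add: P pl_def)
    have "(\<Sum>x\<in>{x\<in>Q. pl x = P}. g (fst x) (snd x)) = (\<Sum>x\<in>?RP \<times> ?RP. g (fst x) (snd x))"
    proof (rule sum.mono_neutral_left)
      show "{x \<in> Q. pl x = P} \<subseteq> ?RP \<times> ?RP"
      proof
        fix x assume "x \<in> {x \<in> Q. pl x = P}"
        then show "x \<in> ?RP \<times> ?RP" using sub by (cases x) (auto simp: Q_def)
      qed
      show "\<forall>x\<in>?RP \<times> ?RP - {x \<in> Q. pl x = P}. g (fst x) (snd x) = 0"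
      proof
        fix x assume "x \<in> ?RP \<times> ?RP - {x \<in> Q. pl x = P}"
        then show "g (fst x) (snd x) = 0" using plI g0 by (cases x) auto
      qed
    qed (use fin in auto)
    also have "\<dots> = (\<Sum>\<gamma>\<in>?RP. \<Sum>\<delta>\<in>?RP. g \<gamma> \<delta>)"
      by (simp add: sum.cartesian_product case_prod_beta)
    also have "\<dots> = (\<Sum>\<gamma>\<in>?RP. \<Sum>\<delta>\<in>?RP. (k * s \<delta>) *\<^sub>C c \<gamma> \<delta> - (k * s \<gamma>) *\<^sub>C c \<gamma> \<delta>)"
      by (intro sum.cong HOL.refl gk)
    also have "\<dots> = (\<Sum>\<gamma>\<in>?RP. \<Sum>\<delta>\<in>?RP. (k * s \<delta>) *\<^sub>C c \<gamma> \<delta>) - (\<Sum>\<gamma>\<in>?RP. \<Sum>\<delta>\<in>?RP. (k * s \<gamma>) *\<^sub>C c \<gamma> \<delta>)"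
      by (simp add: sum_subtractf)
    also have "(\<Sum>\<gamma>\<in>?RP. \<Sum>\<delta>\<in>?RP. (k * s \<gamma>) *\<^sub>C c \<gamma> \<delta>) = 0"
      by (rule sum.neutral) (simp add: complex_vector.scale_sum_right[symmetric] z)
    also have "(\<Sum>\<gamma>\<in>?RP. \<Sum>\<delta>\<in>?RP. (k * s \<delta>) *\<^sub>C c \<gamma> \<delta>) = (\<Sum>\<delta>\<in>?RP. \<Sum>\<gamma>\<in>?RP. (k * s \<delta>) *\<^sub>C c \<gamma> \<delta>)"
      by (rule sum.swap)
    also have "\<dots> = 0"
    proof (rule sum.neutral, rule ballI)
      fix \<delta> assume \<delta>: "\<delta> \<in> ?RP"
      have "(\<Sum>\<gamma>\<in>?RP. (k * s \<delta>) *\<^sub>C c \<gamma> \<delta>) = (k * s \<delta>) *\<^sub>C (- (\<Sum>\<gamma>\<in>?RP. c \<delta> \<gamma>))"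
        unfolding complex_vector.scale_sum_right sum_negf[symmetric] by (intro sum.cong HOL.refl) (metis anti)
      then show "(\<Sum>\<gamma>\<in>?RP. (k * s \<delta>) *\<^sub>C c \<gamma> \<delta>) = 0" using z[OF \<delta>] by simp
    qed
    finally show "(\<Sum>x\<in>{x\<in>Q. pl x = P}. g (fst x) (snd x)) = 0" by simp
  qed
  finally have D: "(\<Sum>\<alpha>\<in>R. \<Sum>\<beta>\<in>R. g \<alpha> \<beta>) = 0" .
  \<comment> \<open>As \<open>c\<close> is antisymmetric, antisymmetrizing the coefficient doubles
    the sum.\<close>
  have "(\<Sum>\<alpha>\<in>R. \<Sum>\<beta>\<in>R. g \<alpha> \<beta>) = ?S - (\<Sum>\<alpha>\<in>R. \<Sum>\<beta>\<in>R. (\<beta> p * \<alpha> q / (\<alpha> m * \<beta> m)) *\<^sub>C c \<alpha> \<beta>)"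
    by (simp add: g_def om_def diff_divide_distrib scaleC_distribs sum_subtractf)
  also have "(\<Sum>\<alpha>\<in>R. \<Sum>\<beta>\<in>R. (\<beta> p * \<alpha> q / (\<alpha> m * \<beta> m)) *\<^sub>C c \<alpha> \<beta>) = (\<Sum>\<alpha>\<in>R. \<Sum>\<beta>\<in>R. (\<alpha> p * \<beta> q / (\<beta> m * \<alpha> m)) *\<^sub>C c \<beta> \<alpha>)"
    by (rule sum.swap)
  also have "\<dots> = - ?S"
    unfolding sum_negf[symmetric] by (intro sum.cong HOL.refl) (subst anti, simp add: mult.commute)
  finally have "?S + ?S = 0" using D by simp
  then have "2 *\<^sub>C ?S = 0" using scaleC_add_left[of 1 1 ?S] by simp
  then show ?thesis by simp
qed

lemma clinear_nonzero_quot: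
  fixes \<alpha> :: "complex ^ 'd::finite \<Rightarrow> complex"
  assumes "clinear \<alpha>" "\<alpha> (fst P) \<noteq> 0"
  shows "((\<lambda>t. \<alpha> p / \<alpha> (fst (P + t *\<^sub>C (q, 0)))) has_field_derivative - (\<alpha> p * \<alpha> q / (\<alpha> (fst P))\<^sup>2)) (at 0)"
proof -
  have e: "\<alpha> (fst (P + t *\<^sub>C (q, 0))) = \<alpha> (fst P) + t * \<alpha> q" for t
    by (simp add: scaleC_prod_def clinear_add[OF assms(1)] clinear_scale[OF assms(1)] scaleC_complex)
  show ?thesis unfolding e
    using assms(2) by (auto intro!: derivative_eq_intros simp: power2_eq_square)
qed

lemma scaleC_vec_expansion:
  fixes \<mu> :: "complex ^ 'd::finite"
  shows "\<mu> = (\<Sum>s\<in>UNIV. (\<mu> $ s) *\<^sub>C axis s 1)"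
proof -
  have "(\<Sum>s\<in>UNIV. \<mu> $ s * (if i = s then 1 else 0)) = \<mu> $ i" for i
    by (simp add: if_distrib cong: if_cong)
  then show ?thesis
    by (simp add: vec_eq_iff sum_component scaleC_vec_def scaleC_complex_def axis_def)
qed

section \<open>Flatness of the joint connection\<close>

context double_tensor
begin

lemma adm_subspace: "csubspace {u. adm N u}"
  by (auto intro!: complex_vector.subspaceI simp: adm_def ops.adm_def ops.op_simps)

lemma th_ho: "th k (ho i h u) = ho i h (th k u)"
  unfolding th_def ops.op_simps
  by (intro sum.cong HOL.refl) (metis comm(6) ops.H_H)

lemma ho_expansion: "ho i \<mu> u = (\<Sum>s\<in>UNIV. (\<mu> $ s) *\<^sub>C ho i (axis s 1) u)"
  by (subst scaleC_vec_expansion[of \<mu>]) (simp add: ho_sum lin_ho)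

text \<open>\<open>Om'\<close> and \<open>Del'\<close> are the operators as the equations define
  them. They have to be compared with the abstract ones only off the diagonal and on
  \<open>R\<close>, which is where the equations use them. \<open>fd\<close> is the finiteness of
  weight spaces.\<close>

context
  fixes R :: "(complex ^ 'd \<Rightarrow> complex) set"
    and Om' :: "'n \<Rightarrow> 'n \<Rightarrow> 'v \<Rightarrow> 'v" and Del' :: "(complex ^ 'd \<Rightarrow> complex) \<Rightarrow> 'v \<Rightarrow> 'v"
  assumes R: "wt ` Bs \<subseteq> R"
    and Om': "\<And>i j u. i \<noteq> j \<Longrightarrow> Om' i j u = Om i j u"
    and Del': "\<And>\<alpha> u. \<alpha> \<in> R \<Longrightarrow> Del' \<alpha> u = total.Delta \<alpha> u"
    and fd: "\<And>l. \<exists>S. finite S \<and> {w. \<forall>h. th h w = l h *\<^sub>C w} \<subseteq> cspan S"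
begin

lemma KZ_rhs_eq:
  "KZ_rhs ho Om' i P x = ho i (fst P) x + (\<Sum>j\<in>UNIV - {i}. (1 / (snd P $ i - snd P $ j)) *\<^sub>C Om i j x)"
  by (cases P) (auto simp: KZ_rhs_def Om' intro!: sum.cong)

text \<open>On one weight space everything is finite: one cut-off serves all its vectors, finitely
  many roots act, and all operators preserve it. The right-hand sides become finite sums of
  functions times fixed operators, and \<open>conn_commute\<close> is applied to each of the three
  kinds of pairs.\<close>

lemma compatible: "KZ_dyn_compatible \<kappa> R ho Om' Del'"
  unfolding KZ_dyn_compatible_def
proof (intro allI impI)
  fix l :: "complex ^ 'd \<Rightarrow> complex" and W :: "'v set" and U :: "('d, 'n) point set" and u
  assume W': "W = {w. \<forall>h. (\<Sum>k\<in>UNIV. ho k h w) = l h *\<^sub>C w}"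
    and U: "open U" "U \<subseteq> regular_points R Del' W" "holomorphic_vec U u" "u ` U \<subseteq> W"
  have W: "W = {w. \<forall>h. th h w = l h *\<^sub>C w}" using W' by (simp add: th_def)
  obtain S where S: "finite S" "W \<subseteq> cspan S" using fd[of l] W by auto
  have subW: "csubspace W"
    using weight_vec_subspace[of th l, OF lin_th] by (simp add: W weight_vec_def)
  interpret fdh: finite_dim_holomorphic U u W S by unfold_locales (use U S subW in auto)
  obtain B and c :: "'v \<Rightarrow> 'v \<Rightarrow> complex" where B: "finite B" "B \<subseteq> W" "\<And>w. w \<in> W \<Longrightarrow> w = (\<Sum>b\<in>B. c b w *\<^sub>C b)"
    using subspace_coordinates[OF subW S(2,1)] by metis
  obtain N where "\<forall>b\<in>B. adm N b" using adm_ex_finite[OF B(1)] by blast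
  then have N: "adm N w" if "w \<in> W" for w
    using complex_vector.subspace_sum[OF adm_subspace, of B "\<lambda>b. c b w *\<^sub>C b" N]
      complex_vector.subspace_scale[OF adm_subspace] B(3)[OF that] by auto
  \<comment> \<open>The roots acting non-trivially on \<open>W\<close>. These are exactly the ones
    whose hyperplanes are removed in \<open>regular_points\<close>, so division by \<alpha>(\<mu>)
    is legitimate for all of them.\<close>
  define Rf where "Rf = {\<alpha>\<in>wt ` BN N. \<exists>w\<in>W. total.Delta \<alpha> w \<noteq> 0}"
  have Rf: "finite Rf" "Rf \<subseteq> R" "\<And>\<alpha>. \<alpha> \<in> Rf \<Longrightarrow> clinear \<alpha>"
  proof -
    show "finite Rf" by (simp add: Rf_def)
    show "Rf \<subseteq> R" using R by (auto simp: Rf_def BN_def)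
    show "clinear \<alpha>" if "\<alpha> \<in> Rf" for \<alpha> using lin_wt that by (auto simp: Rf_def BN_def)
  qed
  have D0: "total.Delta \<alpha> w = 0" if "\<alpha> \<notin> Rf" "w \<in> W" for \<alpha> w
    using Delta_eq_0[OF N[OF that(2)]] that by (auto simp: Rf_def)
  have W_ho: "ho i h w \<in> W" if "w \<in> W" for i h w
    using that by (simp add: W th_ho clinear_scale[OF ops.lin_H])
  have W_Om: "Om i j w \<in> W" if "w \<in> W" "i \<noteq> j" for i j w
    using that by (simp add: W Om_th[symmetric] clinear_scale[OF lin_Om])
  have W_D: "total.Delta \<alpha> w \<in> W" if "w \<in> W" for \<alpha> w
    using that by (simp add: W total.H_Delta clinear_scale[OF total.lin_Delta])
  note W_intros = complex_vector.subspace_add[OF subW] complex_vector.subspace_sum[OF subW]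
    complex_vector.subspace_scale[OF subW] W_ho W_Om W_D
  have regz: "snd P $ i \<noteq> snd P $ j" if "P \<in> U" "i \<noteq> j" for P i j
    using that U(2) by (auto simp: regular_points_def)
  have regm: "\<alpha> (fst P) \<noteq> 0" if "P \<in> U" "\<alpha> \<in> Rf" for P \<alpha>
  proof -
    have "\<alpha> \<in> R" "\<exists>w\<in>W. total.Delta \<alpha> w \<noteq> 0" using that(2) Rf(2) by (blast, simp add: Rf_def)
    then have "\<alpha> \<in> R" "\<exists>w\<in>W. Del' \<alpha> w \<noteq> 0" using Del' by auto
    moreover have "P \<in> regular_points R Del' W" using U(2) that(1) by blast
    ultimately show ?thesis by (auto simp: regular_points_def)
  qed
  have dyn_eq: "dyn_rhs ho R Del' p P x =
      (\<Sum>i\<in>UNIV. (snd P $ i) *\<^sub>C ho i p x) + (\<Sum>\<alpha>\<in>Rf. (\<alpha> p / \<alpha> (fst P)) *\<^sub>C total.Delta \<alpha> x)"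
    if "x \<in> W" for P p x
  proof -
    obtain \<mu> z where P: "P = (\<mu>, z)" by (cases P)
    have "Sum_any (\<lambda>\<alpha>. if \<alpha> \<in> R then (\<alpha> p / \<alpha> \<mu>) *\<^sub>C Del' \<alpha> x else 0) =
      (\<Sum>\<alpha>\<in>Rf. if \<alpha> \<in> R then (\<alpha> p / \<alpha> \<mu>) *\<^sub>C Del' \<alpha> x else 0)"
      by (rule Sum_any.expand_superset[OF Rf(1)]) (use D0[OF _ that] Del' in \<open>auto split: if_splits\<close>)
    also have "\<dots> = (\<Sum>\<alpha>\<in>Rf. (\<alpha> p / \<alpha> \<mu>) *\<^sub>C total.Delta \<alpha> x)"
      by (intro sum.cong HOL.refl) (use Rf(2) Del' in auto)
    finally show ?thesis by (simp add: dyn_rhs_def P)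
  qed
  \<comment> \<open>The coefficients and the fixed operators of the right-hand sides. The index is a
    disjoint sum: a Cartan coordinate or a second factor for KZ, a factor or a root for the
    dynamical equations.\<close>
  define aK where "aK i k P = (case k of Inl s \<Rightarrow> fst P $ s | Inr j \<Rightarrow> 1 / (snd P $ i - snd P $ j))"
    for i :: 'n and k :: "'d + 'n" and P :: "('d, 'n) point"
  define TK where "TK i k = (case k of Inl s \<Rightarrow> ho i (axis s 1) | Inr j \<Rightarrow> Om i j)"
    for i :: 'n and k :: "'d + 'n"
  define IK where "IK i = (UNIV :: 'd set) <+> (UNIV - {i :: 'n})" for i
  define aD where "aD p k P = (case k of Inl i \<Rightarrow> snd P $ i | Inr \<alpha> \<Rightarrow> \<alpha> p / \<alpha> (fst P))"
    for p :: "complex ^ 'd" and k :: "'n + (complex ^ 'd \<Rightarrow> complex)" and P :: "('d, 'n) point"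
  define TD where "TD p k = (case k of Inl i \<Rightarrow> ho i p | Inr \<alpha> \<Rightarrow> total.Delta \<alpha>)"
    for p :: "complex ^ 'd" and k :: "'n + (complex ^ 'd \<Rightarrow> complex)"
  define ID where "ID = (UNIV :: 'n set) <+> Rf"
  have fin: "finite (IK i)" "finite ID" for i using Rf(1) by (auto simp: IK_def ID_def)
  have sumK: "(\<Sum>k\<in>IK i. f k) = (\<Sum>s\<in>UNIV. f (Inl s)) + (\<Sum>j\<in>UNIV - {i}. f (Inr j))" for i and f :: "_ \<Rightarrow> 'v"
    unfolding IK_def by (subst sum.Plus) (auto simp: o_def)
  have sumD: "(\<Sum>k\<in>ID. f k) = (\<Sum>i\<in>UNIV. f (Inl i)) + (\<Sum>\<alpha>\<in>Rf. f (Inr \<alpha>))" for f :: "_ \<Rightarrow> 'v"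
    unfolding ID_def using Rf(1) by (subst sum.Plus) (auto simp: o_def)
  have linK: "clinear (TK i k)" if "k \<in> IK i" for i k
    using that by (auto simp: TK_def IK_def intro: ops.lin_H lin_Om)
  have linD: "clinear (TD p k)" for p k
    by (cases k) (auto simp: TD_def ops.lin_H total.lin_Delta)
  have K_rep: "KZ_rhs ho Om' i P x = (\<Sum>k\<in>IK i. aK i k P *\<^sub>C TK i k x)" for i P x
    unfolding KZ_rhs_eq sumK by (subst ho_expansion) (simp add: aK_def TK_def)
  have D_rep: "dyn_rhs ho R Del' p P x = (\<Sum>k\<in>ID. aD p k P *\<^sub>C TD p k x)" if "x \<in> W" for p P x
    unfolding dyn_eq[OF that] sumD by (simp add: aD_def TD_def)
  have K_W: "KZ_rhs ho Om' i P x \<in> W" if "x \<in> W" for i P x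
    unfolding KZ_rhs_eq using that by (intro W_intros) auto
  have D_W: "dyn_rhs ho R Del' p P x \<in> W" if "x \<in> W" for p P x
    unfolding dyn_eq[OF that] using that by (intro W_intros) auto
  have snd_z: "snd (t *\<^sub>C (0 :: complex ^ 'd, axis m 1 :: complex ^ 'n)) $ i = (if i = m then t else 0)"
    and fst_z: "fst (t *\<^sub>C (0 :: complex ^ 'd, axis m 1 :: complex ^ 'n)) = 0" for t m i
    by (auto simp: scaleC_prod_def scaleC_vec_def scaleC_complex_def axis_def vec_eq_iff)
  have snd_m: "snd (t *\<^sub>C (p, 0 :: complex ^ 'n)) = 0"
    and fst_m: "fst (t *\<^sub>C (p, 0 :: complex ^ 'n)) $ s = t * p $ s" for t and p :: "complex ^ 'd" and s
    by (auto simp: scaleC_prod_def scaleC_vec_def scaleC_complex_def vec_eq_iff)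

  have KK: "conn \<kappa> (0, axis i 1) (KZ_rhs ho Om' i) (conn \<kappa> (0, axis m 1) (KZ_rhs ho Om' m) u) P =
      conn \<kappa> (0, axis m 1) (KZ_rhs ho Om' m) (conn \<kappa> (0, axis i 1) (KZ_rhs ho Om' i) u) P"
    if P: "P \<in> U" for i m P
  proof (cases "i = m")
    case False
    define z where "z = snd P"
    have zz: "z $ i \<noteq> z $ j" if "i \<noteq> j" for i j using regz[OF P that] by (simp add: z_def)
    define aK' where "aK' i m k = (case k of Inl s \<Rightarrow> 0 | Inr j \<Rightarrow> if j = m then 1 / (z $ i - z $ m)\<^sup>2 else 0)"
      for i m :: 'n and k :: "'d + 'n"
    have der: "((\<lambda>t. aK i k (P + t *\<^sub>C (0, axis m 1))) has_field_derivative aK' i m k) (at 0)"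
      if "i \<noteq> m" for i m k
    proof (cases k)
      case (Inr j)
      have "((\<lambda>t. 1 / (z $ i - (z $ m + t))) has_field_derivative 1 / (z $ i - z $ m)\<^sup>2) (at 0)"
        using zz[OF that] by (auto intro!: derivative_eq_intros simp: power2_eq_square)
      then show ?thesis using that by (auto simp: aK_def aK'_def Inr snd_z z_def[symmetric])
    qed (simp add: aK_def aK'_def fst_z)
    \<comment> \<open>Both sides are \<Omega>(i,m) divided by the square of z_i - z_m, by the
      symmetry of \<Omega>.\<close>
    have flat: "(\<Sum>k\<in>IK m. aK' m i k *\<^sub>C TK m k x) = (\<Sum>k\<in>IK i. aK' i m k *\<^sub>C TK i k x)" for x
    proof -
      have "(\<Sum>k\<in>IK i. aK' i m k *\<^sub>C TK i k x) = (1 / (z $ i - z $ m)\<^sup>2) *\<^sub>C Om i m x" if "i \<noteq> m" for i m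
      proof -
        have "(\<Sum>k\<in>IK i. aK' i m k *\<^sub>C TK i k x) =
          (\<Sum>j\<in>UNIV - {i}. (if j = m then 1 / (z $ i - z $ m)\<^sup>2 else 0) *\<^sub>C Om i j x)"
          unfolding sumK by (simp add: aK'_def TK_def)
        also have "\<dots> = (\<Sum>j\<in>UNIV - {i}. if j = m then (1 / (z $ i - z $ m)\<^sup>2) *\<^sub>C Om i m x else 0)"
          by (intro sum.cong HOL.refl) simp
        finally show ?thesis using that by simp
      qed
      then show ?thesis using False Om_sym[OF False] by (simp add: power2_commute)
    qed
    have comm: "KZ_rhs ho Om' i P (KZ_rhs ho Om' m P x) = KZ_rhs ho Om' m P (KZ_rhs ho Om' i P x)" for x
    proof -
      define K where "K = UNIV - {i, m}"
      define r where "r i j = 1 / (z $ i - z $ j)" for i j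
      define h where "h = fst P"
      define D where "D = Om i m"
      have rmi: "r m i = - r i m" unfolding r_def using zz[OF False] by (simp add: field_simps)
      \<comment> \<open>The partial fraction identity 1/(ab) = 1/((a+b)a) + 1/((a+b)b) with a = z_i
        - z_m and b = z_m - z_k.\<close>
      have rr: "r i m * r m k - r i k * r i m - r i k * r m k = 0" if "k \<in> K" for k
      proof -
        have pf: "1 / a * (1 / b) - 1 / (a + b) * (1 / a) - 1 / (a + b) * (1 / b) = 0"
          if "a \<noteq> 0" "b \<noteq> 0" "a + b \<noteq> 0" for a b :: complex
          using that by (simp add: divide_simps)
        have "i \<noteq> k" "m \<noteq> k" using that by (auto simp: K_def)
        then show ?thesis
          using pf[of "z $ i - z $ m" "z $ m - z $ k"] zz[OF False] zz[of i k] zz[of m k] by (simp add: r_def)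
      qed
      have Ki: "UNIV - {i} = insert m K" and Km: "UNIV - {m} = insert i K" using False by (auto simp: K_def)
      have mK: "m \<notin> K" "i \<notin> K" "finite K" by (auto simp: K_def)
      define SP where "SP = (\<lambda>x. \<Sum>j\<in>K. r i j *\<^sub>C Om i j x)"
      define SQ where "SQ = (\<lambda>x. \<Sum>j\<in>K. r m j *\<^sub>C Om m j x)"
      have lin: "clinear D" "clinear SP" "clinear SQ" "\<And>j. j \<in> K \<Longrightarrow> clinear (Om i j)" "\<And>j. j \<in> K \<Longrightarrow> clinear (Om m j)"
        unfolding D_def SP_def SQ_def using False
        by (auto intro!: lin_Om clinear_sum_fun clinear_scaleC simp: K_def)
      have A: "KZ_rhs ho Om' i P = (\<lambda>x. ho i h x + (r i m *\<^sub>C D x + SP x))"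
        by (rule ext) (simp add: KZ_rhs_eq Ki mK h_def z_def[symmetric] r_def SP_def D_def)
      have Bq: "KZ_rhs ho Om' m P = (\<lambda>x. ho m h x + ((- r i m) *\<^sub>C D x + SQ x))"
        by (rule ext) (simp add: KZ_rhs_eq Km mK h_def z_def[symmetric] rmi[symmetric] r_def[symmetric] SQ_def D_def Om_sym[OF False])
      have hSQ: "cm (ho i h) SQ x = 0"
      proof -
        have "cm (ho i h) SQ x = (\<Sum>j\<in>K. r m j *\<^sub>C cm (ho i h) (Om m j) x)"
          unfolding SQ_def by (simp add: cm_sum_right cm_scale_right ops.lin_H)
        also have "\<dots> = 0" by (rule sum.neutral) (use False in \<open>auto simp: cm_def K_def Om_H_far\<close>)
        finally show ?thesis .
      qed
      have hSP: "cm SP (ho m h) x = 0"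
      proof -
        have "cm SP (ho m h) x = (\<Sum>j\<in>K. r i j *\<^sub>C cm (Om i j) (ho m h) x)"
          unfolding SP_def by (simp add: cm_sum_left cm_scale_left ops.lin_H)
        also have "\<dots> = 0" by (rule sum.neutral) (use False in \<open>auto simp: cm_def K_def Om_H_far\<close>)
        finally show ?thesis .
      qed
      have hD: "cm (ho i h) D x + cm (ho m h) D x = 0"
        using Om_H_near[OF False, of h x] clinear_add[OF lin(1)] by (simp add: cm_def D_def algebra_simps)
      have DQ: "cm D SQ x = (\<Sum>k\<in>K. r m k *\<^sub>C cm D (Om m k) x)"
        unfolding SQ_def using lin(1) by (simp add: cm_sum_right cm_scale_right)
      have PD: "cm SP D x = (\<Sum>k\<in>K. r i k *\<^sub>C cm (Om i k) D x)"
        unfolding SP_def using lin(1) by (simp add: cm_sum_left cm_scale_left)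
      have PQ: "cm SP SQ x = (\<Sum>k\<in>K. (r i k * r m k) *\<^sub>C cm (Om i k) (Om m k) x)"
      proof -
        have "cm SP SQ x = (\<Sum>j\<in>K. r i j *\<^sub>C cm (Om i j) SQ x)"
          unfolding SP_def using lin(3) by (simp add: cm_sum_left cm_scale_left)
        also have "\<dots> = (\<Sum>j\<in>K. r i j *\<^sub>C (r m j *\<^sub>C cm (Om i j) (Om m j) x))"
        proof (intro sum.cong HOL.refl arg_cong[where f = "(*\<^sub>C) _"])
          fix j assume j: "j \<in> K"
          have "cm (Om i j) SQ x = (\<Sum>k\<in>K. r m k *\<^sub>C cm (Om i j) (Om m k) x)"
            unfolding SQ_def using lin(4)[OF j] by (simp add: cm_sum_right cm_scale_right)
          also have "\<dots> = (\<Sum>k\<in>K. if k = j then r m j *\<^sub>C cm (Om i j) (Om m j) x else 0)"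
            by (intro sum.cong HOL.refl)
              (use j False in \<open>auto simp: cm_def K_def Om_Om_disjoint\<close>)
          finally show "cm (Om i j) SQ x = r m j *\<^sub>C cm (Om i j) (Om m j) x" using j mK by simp
        qed
        finally show ?thesis by (simp add: scaleC_scaleC)
      qed
      \<comment> \<open>The braid relations for the triple i, m, k express all commutators of its
        three \<Omega> by a single one, whose coefficient is then the vanishing expression
        \<open>rr\<close>.\<close>
      have e1: "cm (Om i k) D x = cm D (Om m k) x" and e2: "cm (Om i k) (Om m k) x = - cm D (Om m k) x"
        if "k \<in> K" for k
      proof -
        have k: "i \<noteq> k" "m \<noteq> k" using that by (auto simp: K_def)
        have "D (Om i k x) + D (Om m k x) = Om i k (D x) + Om m k (D x)"
          using Om_Om_chain[OF False k, of x] clinear_add[OF lin(1)] by (simp add: D_def)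
        then show 1: "cm (Om i k) D x = cm D (Om m k) x" by (simp add: cm_def algebra_simps)
        have "Om i k (D x) + Om i k (Om m k x) = D (Om i k x) + Om m k (Om i k x)"
          using Om_Om_chain[OF k(1) False, of x] k clinear_add[OF lin(4)[OF that]] by (simp add: D_def Om_sym[of k m])
        then show "cm (Om i k) (Om m k) x = - cm D (Om m k) x"
          unfolding 1[symmetric] by (simp add: cm_def algebra_simps)
      qed
      have "cm (KZ_rhs ho Om' i P) (KZ_rhs ho Om' m P) x =
        - r i m *\<^sub>C (cm (ho i h) D x + cm (ho m h) D x) +
        (r i m *\<^sub>C cm D SQ x - r i m *\<^sub>C cm SP D x + cm SP SQ x)"
      proof -
        have hh: "cm (ho i h) (ho m h) x = 0" using comm(6)[OF False] by (simp add: cm_def)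
        have Dm: "cm D (ho m h) x = - cm (ho m h) D x" by (rule cm_swap)
        have "cm (KZ_rhs ho Om' i P) (KZ_rhs ho Om' m P) x =
           (cm (ho i h) (ho m h) x + (- r i m) *\<^sub>C cm (ho i h) D x + cm (ho i h) SQ x) +
           r i m *\<^sub>C (cm D (ho m h) x + (- r i m) *\<^sub>C cm D D x + cm D SQ x) +
           (cm SP (ho m h) x + (- r i m) *\<^sub>C cm SP D x + cm SP SQ x)"
          unfolding A Bq
          by (simp add: cm_scale_left cm_scale_right
              clinear_plus clinear_uminus_fun clinear_scaleC ops.lin_H lin scaleC_distribs cm_def clinear_simps)
            (simp add: algebra_simps)?
        then show ?thesis by (simp add: hh hSQ hSP Dm scaleC_distribs algebra_simps)
      qed
      also have "\<dots> = (\<Sum>k\<in>K. (r i m * r m k - r i k * r i m - r i k * r m k) *\<^sub>C cm D (Om m k) x)"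
        unfolding hD DQ PD PQ
        by (simp add: e1 e2 complex_vector.scale_sum_right sum_subtractf sum.distrib scaleC_scaleC
            scaleC_distribs mult.commute sum_negf cong: sum.cong)
      also have "\<dots> = 0" by (rule sum.neutral) (simp add: rr)
      finally show ?thesis by (simp add: cm_def)
    qed
    show ?thesis
      by (rule fdh.conn_commute[OF P fin(1)[of i] fin(1)[of m], where a = "aK i" and T = "TK i" and b = "aK m" and T' = "TK m"
            and a' = "aK' i m" and b' = "aK' m i"])
        (use False K_rep linK der[OF False] der[OF False[symmetric]] K_W flat comm in auto)
  qed simp

  have KD: "conn \<kappa> (0, axis i 1) (KZ_rhs ho Om' i) (conn \<kappa> (p, 0) (dyn_rhs ho R Del' p) u) P =
      conn \<kappa> (p, 0) (dyn_rhs ho R Del' p) (conn \<kappa> (0, axis i 1) (KZ_rhs ho Om' i) u) P"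
    if P: "P \<in> U" for i p P
  proof -
    define z where "z = snd P"
    define h where "h = fst P"
    have zz: "z $ i \<noteq> z $ j" if "i \<noteq> j" for i j using regz[OF P that] by (simp add: z_def)
    have hz: "\<alpha> h \<noteq> 0" if "\<alpha> \<in> Rf" for \<alpha> using regm[OF P that] by (simp add: h_def)
    define aK' where "aK' k = (case k of Inl s \<Rightarrow> p $ s | Inr j \<Rightarrow> 0)" for k :: "'d + 'n"
    define aD' where "aD' k = (case k of Inl j \<Rightarrow> if j = i then 1 else 0 | Inr \<alpha> \<Rightarrow> (0 :: complex))"
      for k :: "'n + (complex ^ 'd \<Rightarrow> complex)"
    have derK: "((\<lambda>t. aK i k (P + t *\<^sub>C (p, 0))) has_field_derivative aK' k) (at 0)" for k
      by (cases k) (auto simp: aK_def aK'_def fst_m snd_m intro!: derivative_eq_intros)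
    have derD: "((\<lambda>t. aD p k (P + t *\<^sub>C (0, axis i 1))) has_field_derivative aD' k) (at 0)" for k
      by (cases k) (auto simp: aD_def aD'_def fst_z snd_z intro!: derivative_eq_intros)
    \<comment> \<open>The z_i-derivative of the sum of z_k p^(k) and the p-derivative of \<mu>^(i)
      are both p^(i).\<close>
    have flat: "(\<Sum>k\<in>ID. aD' k *\<^sub>C TD p k x) = (\<Sum>k\<in>IK i. aK' k *\<^sub>C TK i k x)" for x
      unfolding sumD sumK
      by (simp add: aD'_def aK'_def TD_def TK_def ho_expansion[of i p, symmetric] if_distrib[of "\<lambda>c. c *\<^sub>C _"] cong: if_cong)
    have comm: "KZ_rhs ho Om' i P (dyn_rhs ho R Del' p P x) = dyn_rhs ho R Del' p P (KZ_rhs ho Om' i P x)"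
      if x: "x \<in> W" for x
    proof -
      define J where "J = UNIV - {i}"
      define SO where "SO = (\<lambda>x. \<Sum>j\<in>J. (1 / (z $ i - z $ j)) *\<^sub>C Om i j x)"
      define SH where "SH = (\<lambda>x. \<Sum>k\<in>UNIV. (z $ k) *\<^sub>C ho k p x)"
      define SD where "SD = (\<lambda>x. \<Sum>\<alpha>\<in>Rf. (\<alpha> p / \<alpha> h) *\<^sub>C total.Delta \<alpha> x)"
      have linO: "clinear (Om i j)" if "j \<in> J" for j using that by (auto simp: J_def intro!: lin_Om)
      have lin: "clinear SO" "clinear SH" "clinear SD"
        unfolding SO_def SH_def SD_def
        by (auto intro!: clinear_sum_fun clinear_scaleC linO ops.lin_H total.lin_Delta)
      have HH: "cm (ho i h) SH x = 0"
      proof -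
        have "ho i h (ho k p x) = ho k p (ho i h x)" for k
          using comm(6)[of i k h p x] ops.H_H[of i h p x] by (cases "i = k") auto
        then show ?thesis unfolding SH_def by (simp add: cm_def ops.op_simps)
      qed
      have HD: "cm (ho i h) SD x = (\<Sum>\<alpha>\<in>wt ` BN N. \<alpha> p *\<^sub>C (\<Sum>j\<in>J. Theta i j \<alpha> x))"
      proof -
        have "cm (ho i h) SD x = (\<Sum>\<alpha>\<in>Rf. (\<alpha> p / \<alpha> h) *\<^sub>C cm (ho i h) (total.Delta \<alpha>) x)"
          unfolding SD_def by (simp add: cm_sum_right cm_scale_right ops.lin_H)
        also have "\<dots> = (\<Sum>\<alpha>\<in>Rf. \<alpha> p *\<^sub>C (\<Sum>j\<in>J. Theta i j \<alpha> x))"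
          by (intro sum.cong HOL.refl) (simp add: cm_def H_Delta J_def scaleC_scaleC hz)
        \<comment> \<open>The sum is enlarged to all roots under the cut-off, to match the
          commutator with \<Omega>. For a root that acts by zero on \<open>W\<close>,
          \<open>H_Delta\<close> shows that the added term vanishes, although the individual
          \<open>Theta\<close> need not.\<close>
        also have "\<dots> = (\<Sum>\<alpha>\<in>wt ` BN N. \<alpha> p *\<^sub>C (\<Sum>j\<in>J. Theta i j \<alpha> x))"
        proof (rule sum.mono_neutral_left)
          show "\<forall>\<alpha>\<in>wt ` BN N - Rf. \<alpha> p *\<^sub>C (\<Sum>j\<in>J. Theta i j \<alpha> x) = 0"
          proof
            fix \<alpha> assume "\<alpha> \<in> wt ` BN N - Rf"
            then have "total.Delta \<alpha> x = 0" "total.Delta \<alpha> (ho i p x) = 0" using D0 x W_ho by auto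
            then show "\<alpha> p *\<^sub>C (\<Sum>j\<in>J. Theta i j \<alpha> x) = 0"
              using H_Delta[of i p \<alpha> x] by (simp add: J_def clinear_zero[OF ops.lin_H] del: complex_vector.scale_eq_0_iff)
          qed
        qed (auto simp: Rf_def)
        finally show ?thesis .
      qed
      have OD: "cm SO SD x = 0"
      proof -
        have "cm SO SD x = (\<Sum>j\<in>J. (1 / (z $ i - z $ j)) *\<^sub>C cm (Om i j) SD x)"
          unfolding SO_def using lin by (simp add: cm_sum_left cm_scale_left)
        also have "\<dots> = 0"
        proof (rule sum.neutral, rule ballI)
          fix j assume j: "j \<in> J"
          have "cm (Om i j) SD x = (\<Sum>\<alpha>\<in>Rf. (\<alpha> p / \<alpha> h) *\<^sub>C cm (Om i j) (total.Delta \<alpha>) x)"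
            unfolding SD_def using linO[OF j] by (simp add: cm_sum_right cm_scale_right)
          also have "\<dots> = 0" by (rule sum.neutral) (use j in \<open>auto simp: cm_def J_def Om_Delta\<close>)
          finally show "(1 / (z $ i - z $ j)) *\<^sub>C cm (Om i j) SD x = 0" by simp
        qed
        finally show ?thesis .
      qed
      have OH: "cm SO SH x = - (\<Sum>\<alpha>\<in>wt ` BN N. \<alpha> p *\<^sub>C (\<Sum>j\<in>J. Theta i j \<alpha> x))"
      proof -
        have "cm SO SH x = (\<Sum>j\<in>J. (1 / (z $ i - z $ j)) *\<^sub>C cm (Om i j) SH x)"
          unfolding SO_def using lin by (simp add: cm_sum_left cm_scale_left)
        also have "\<dots> = (\<Sum>j\<in>J. - (\<Sum>\<alpha>\<in>wt ` BN N. \<alpha> p *\<^sub>C Theta i j \<alpha> x))"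
        proof (intro sum.cong HOL.refl)
          fix j assume j: "j \<in> J"
          then have ij: "i \<noteq> j" by (auto simp: J_def)
          have "cm (Om i j) SH x = (\<Sum>k\<in>UNIV. (z $ k) *\<^sub>C cm (Om i j) (ho k p) x)"
            unfolding SH_def using linO[OF j] by (simp add: cm_sum_right cm_scale_right)
          also have "\<dots> = (\<Sum>k\<in>{i, j}. (z $ k) *\<^sub>C cm (Om i j) (ho k p) x)"
            by (rule sum.mono_neutral_right) (use ij in \<open>auto simp: cm_def Om_H_far\<close>)
          also have "\<dots> = (z $ i) *\<^sub>C cm (Om i j) (ho i p) x + (z $ j) *\<^sub>C cm (Om i j) (ho j p) x"
            using ij by simp
          also have "cm (Om i j) (ho j p) x = - cm (Om i j) (ho i p) x"
            using Om_H_near[OF ij, of p x] clinear_add[OF linO[OF j]] by (simp add: cm_def algebra_simps)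
          also have "cm (Om i j) (ho i p) x = - (\<Sum>\<alpha>\<in>wt ` BN N. \<alpha> p *\<^sub>C Theta i j \<alpha> x)"
            using H_Om[OF ij N[OF x] N[OF W_ho[OF x]], of "wt ` BN N" p] by (simp add: cm_def algebra_simps)
          \<comment> \<open>The factor z_i - z_j cancels the denominator of the KZ coefficient, so
            this commutator becomes independent of z and opposite to the one of \<mu>^(i) with the
            \<Delta> part.\<close>
          finally have e: "cm (Om i j) SH x = - ((z $ i - z $ j) *\<^sub>C (\<Sum>\<alpha>\<in>wt ` BN N. \<alpha> p *\<^sub>C Theta i j \<alpha> x))"
            by (simp add: scaleC_distribs)
          show "(1 / (z $ i - z $ j)) *\<^sub>C cm (Om i j) SH x = - (\<Sum>\<alpha>\<in>wt ` BN N. \<alpha> p *\<^sub>C Theta i j \<alpha> x)"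
            using zz[OF ij] by (simp add: e scaleC_scaleC)
        qed
        also have "\<dots> = - (\<Sum>\<alpha>\<in>wt ` BN N. \<Sum>j\<in>J. \<alpha> p *\<^sub>C Theta i j \<alpha> x)"
          unfolding sum_negf by (subst sum.swap) simp
        finally show ?thesis by (simp add: complex_vector.scale_sum_right)
      qed
      have A: "KZ_rhs ho Om' i P = (\<lambda>x. ho i h x + SO x)"
        by (rule ext) (simp add: KZ_rhs_eq h_def z_def SO_def J_def)
      have Bq: "dyn_rhs ho R Del' p P w = SH w + SD w" if "w \<in> W" for w
        by (simp add: dyn_eq[OF that] SH_def SD_def h_def z_def)
      have AW: "ho i h x + SO x \<in> W" using K_W[OF x, of i P] by (simp add: A)
      have "KZ_rhs ho Om' i P (dyn_rhs ho R Del' p P x) - dyn_rhs ho R Del' p P (KZ_rhs ho Om' i P x) =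
        cm (ho i h) SH x + cm (ho i h) SD x + cm SO SH x + cm SO SD x"
        unfolding A Bq[OF x] Bq[OF AW]
        by (simp add: cm_def clinear_add[OF lin(1)] clinear_add[OF lin(2)] clinear_add[OF lin(3)] ops.op_simps)
      also have "\<dots> = 0" unfolding HH HD OH OD by simp
      finally show ?thesis by simp
    qed
    show ?thesis
      by (rule fdh.conn_commute[OF P fin(1)[of i] fin(2), where a = "aK i" and T = "TK i" and b = "aD p" and T' = "TD p"
            and a' = aK' and b' = aD'])
        (use K_rep D_rep linK linD derK derD K_W D_W flat comm in auto)
  qed

  have DD: "conn \<kappa> (p, 0) (dyn_rhs ho R Del' p) (conn \<kappa> (q, 0) (dyn_rhs ho R Del' q) u) P =
      conn \<kappa> (q, 0) (dyn_rhs ho R Del' q) (conn \<kappa> (p, 0) (dyn_rhs ho R Del' p) u) P"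
    if P: "P \<in> U" for p q P
  proof -
    define z where "z = snd P"
    define h where "h = fst P"
    have hz: "\<alpha> h \<noteq> 0" if "\<alpha> \<in> Rf" for \<alpha> using regm[OF P that] by (simp add: h_def)
    define aD' where "aD' p q k = (case k of Inl j \<Rightarrow> 0 | Inr \<alpha> \<Rightarrow> - (\<alpha> p * \<alpha> q / (\<alpha> h)\<^sup>2))"
      for p q and k :: "'n + (complex ^ 'd \<Rightarrow> complex)"
    have der: "((\<lambda>t. aD p k (P + t *\<^sub>C (q, 0))) has_field_derivative aD' p q k) (at 0)" if "k \<in> ID" for p q k
    proof (cases k)
      case (Inr \<alpha>)
      then have \<alpha>: "\<alpha> \<in> Rf" using that by (auto simp: ID_def)
      show ?thesis using clinear_nonzero_quot[OF Rf(3)[OF \<alpha>] regm[OF P \<alpha>], of p q]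
        by (simp add: Inr aD_def aD'_def h_def)
    qed (simp add: aD_def aD'_def snd_m)
    \<comment> \<open>The differentiated coefficient -\<alpha>(p) \<alpha>(q) / \<alpha>(h)^2 is
      symmetric in p and q.\<close>
    have flat: "(\<Sum>k\<in>ID. aD' q p k *\<^sub>C TD q k x) = (\<Sum>k\<in>ID. aD' p q k *\<^sub>C TD p k x)" for x
      unfolding sumD by (simp add: aD'_def TD_def mult.commute)
    have comm: "dyn_rhs ho R Del' p P (dyn_rhs ho R Del' q P x) = dyn_rhs ho R Del' q P (dyn_rhs ho R Del' p P x)"
      if x: "x \<in> W" for x
    proof -
      define SH where "SH p = (\<lambda>x. \<Sum>k\<in>UNIV. (z $ k) *\<^sub>C ho k p x)" for p
      define SD where "SD p = (\<lambda>x. \<Sum>\<alpha>\<in>Rf. (\<alpha> p / \<alpha> h) *\<^sub>C total.Delta \<alpha> x)" for p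
      have lin: "clinear (SH p)" "clinear (SD p)" for p
        unfolding SH_def SD_def by (auto intro!: clinear_sum_fun clinear_scaleC ops.lin_H total.lin_Delta)
      have HH: "cm (SH p) (SH q) x = 0"
      proof -
        have e: "ho i p (ho k q w) = ho k q (ho i p w)" for i k w
          using comm(6)[of i k p q w] ops.H_H[of i p q w] by (cases "i = k") auto
        have "cm (\<lambda>x. (z $ i) *\<^sub>C ho i p x) (SH q) x = 0" for i
          unfolding SH_def by (simp add: cm_def e ops.op_simps scaleC_scaleC complex_vector.scale_sum_right mult.commute)
        then show ?thesis unfolding SH_def[of p] by (simp add: cm_sum_left[OF lin(1)])
      qed
      have HD: "cm (SH p) (SD q) x = (\<Sum>\<alpha>\<in>Rf. \<Sum>k\<in>UNIV. (\<alpha> q / \<alpha> h * z $ k * \<alpha> p) *\<^sub>C (\<Sum>j\<in>UNIV - {k}. Theta k j \<alpha> x))" for p q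
      proof -
        have "cm (SH p) (SD q) x = (\<Sum>\<alpha>\<in>Rf. (\<alpha> q / \<alpha> h) *\<^sub>C cm (SH p) (total.Delta \<alpha>) x)"
          unfolding SD_def by (simp add: cm_sum_right cm_scale_right lin)
        also have "\<dots> = (\<Sum>\<alpha>\<in>Rf. (\<alpha> q / \<alpha> h) *\<^sub>C (\<Sum>k\<in>UNIV. (z $ k) *\<^sub>C (\<alpha> p *\<^sub>C (\<Sum>j\<in>UNIV - {k}. Theta k j \<alpha> x))))"
          unfolding SH_def by (simp add: cm_sum_left cm_scale_left total.lin_Delta) (simp add: cm_def H_Delta)
        finally show ?thesis by (simp add: complex_vector.scale_sum_right scaleC_scaleC mult.assoc)
      qed
      \<comment> \<open>By \<open>HD\<close> the commutator depends on p and q only through the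
        product \<alpha>(p) \<alpha>(q).\<close>
      have HDs: "cm (SH p) (SD q) x = cm (SH q) (SD p) x"
        unfolding HD by (intro sum.cong HOL.refl arg_cong2[where f = "(*\<^sub>C)"]) (simp add: mult_ac)
      have DDx: "cm (SD p) (SD q) x = 0"
      proof -
        have "cm (SD p) (SD q) x = (\<Sum>\<alpha>\<in>Rf. \<Sum>\<beta>\<in>Rf. (\<alpha> p * \<beta> q / (\<alpha> h * \<beta> h)) *\<^sub>C cm (total.Delta \<alpha>) (total.Delta \<beta>) x)"
        proof -
          have "cm (SD p) (SD q) x = (\<Sum>\<alpha>\<in>Rf. (\<alpha> p / \<alpha> h) *\<^sub>C cm (total.Delta \<alpha>) (SD q) x)"
            unfolding SD_def[of p] by (simp add: cm_sum_left cm_scale_left lin)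
          also have "\<dots> = (\<Sum>\<alpha>\<in>Rf. (\<alpha> p / \<alpha> h) *\<^sub>C (\<Sum>\<beta>\<in>Rf. (\<beta> q / \<beta> h) *\<^sub>C cm (total.Delta \<alpha>) (total.Delta \<beta>) x))"
            unfolding SD_def by (simp add: cm_sum_right cm_scale_right total.lin_Delta)
          finally show ?thesis by (simp add: complex_vector.scale_sum_right scaleC_scaleC)
        qed
        also have "\<dots> = 0"
        proof (rule plane_sum[OF Rf(1) hz])
          show "cm (total.Delta \<beta>) (total.Delta \<alpha>) x = - cm (total.Delta \<alpha>) (total.Delta \<beta>) x" for \<alpha> \<beta>
            by (rule cm_swap)
          fix \<alpha> \<gamma> \<delta> :: "complex ^ 'd \<Rightarrow> complex"
          let ?P = "{\<epsilon>. \<exists>a b. \<forall>h. \<epsilon> h = a * \<gamma> h + b * \<delta> h}"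
          assume \<alpha>: "\<alpha> \<in> Rf" "\<alpha> \<in> ?P"
          have "total.plane (\<lambda>\<epsilon>. \<epsilon> \<in> ?P)"
            unfolding total.plane_def
          proof (intro conjI allI impI)
            fix \<alpha> \<beta> assume "\<alpha> \<in> ?P" "\<beta> \<in> ?P"
            then obtain a b a' b' where "\<forall>h. \<alpha> h = a * \<gamma> h + b * \<delta> h" "\<forall>h. \<beta> h = a' * \<gamma> h + b' * \<delta> h" by blast
            then have "\<forall>h. \<alpha> h + \<beta> h = (a + a') * \<gamma> h + (b + b') * \<delta> h" by (simp add: algebra_simps)
            then show "(\<lambda>h. \<alpha> h + \<beta> h) \<in> ?P" by blast
          next
            fix \<alpha> \<beta> assume "\<alpha> \<in> ?P" "(\<lambda>h. \<alpha> h + \<beta> h) \<in> ?P"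
            then obtain a b a' b' where 1: "\<forall>h. \<alpha> h = a * \<gamma> h + b * \<delta> h" "\<forall>h. \<alpha> h + \<beta> h = a' * \<gamma> h + b' * \<delta> h" by blast
            have "\<beta> h = (a' - a) * \<gamma> h + (b' - b) * \<delta> h" for h
            proof -
              have "\<beta> h = (a' * \<gamma> h + b' * \<delta> h) - (a * \<gamma> h + b * \<delta> h)"
                using 1(1)[rule_format, of h] 1(2)[rule_format, of h] by (metis add_diff_cancel_left')
              then show ?thesis by (simp add: algebra_simps)
            qed
            then show "\<beta> \<in> ?P" by blast
          qed
          from total.Delta_plane_commute[OF this \<alpha>(2), of "Rf \<inter> ?P" x]
          show "(\<Sum>\<beta>\<in>Rf \<inter> ?P. cm (total.Delta \<alpha>) (total.Delta \<beta>) x) = 0"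
            using Rf(1) D0 x W_D by (simp add: cm_def)
        qed
        finally show ?thesis .
      qed
      have Bq: "dyn_rhs ho R Del' p P w = SH p w + SD p w" if "w \<in> W" for p w
        by (simp add: dyn_eq[OF that] SH_def SD_def h_def z_def)
      have SW: "SH p x + SD p x \<in> W" for p using D_W[OF x, of p P] by (simp add: Bq[OF x])
      have "dyn_rhs ho R Del' p P (dyn_rhs ho R Del' q P x) - dyn_rhs ho R Del' q P (dyn_rhs ho R Del' p P x) =
        cm (SH p) (SH q) x + (cm (SH p) (SD q) x - cm (SH q) (SD p) x) + cm (SD p) (SD q) x"
        unfolding Bq[OF x] Bq[OF SW] by (simp add: cm_def clinear_add[OF lin(1)] clinear_add[OF lin(2)])
      also have "\<dots> = 0" unfolding HH HDs DDx by simp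
      finally show ?thesis by simp
    qed
    show ?thesis
      by (rule fdh.conn_commute[OF P fin(2) fin(2), where a = "aD p" and T = "TD p" and b = "aD q" and T' = "TD q"
            and a' = "aD' p q" and b' = "aD' q p"])
        (use D_rep linD der D_W flat comm in auto)
  qed

  show "\<forall>A\<in>KZ_dyn_operators \<kappa> R ho Om' Del'. \<forall>B\<in>KZ_dyn_operators \<kappa> R ho Om' Del'. \<forall>P\<in>U. A (B u) P = B (A u) P"
    unfolding KZ_dyn_operators_def using KK KD DD by (auto simp: KD[symmetric])
qed

end
end

section \<open>The Kac--Moody Lie algebra\<close>

text \<open>A dependence splits into its weight components, each of which is a dependence within one
  set. The map \<theta> turns the index into the weight; for lowering operators it is
  negation.\<close>

lemma weight_union_independent:
  assumes T: "\<And>h. clinear (T h)"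
    and w: "\<And>l x. l \<in> L \<Longrightarrow> x \<in> X l \<Longrightarrow> weight_vec T (\<theta> l) x" and \<theta>: "inj_on \<theta> L"
    and ind: "\<And>l. l \<in> L \<Longrightarrow> \<not> complex_vector.dependent (X l)"
  shows "\<not> complex_vector.dependent (\<Union>l\<in>L. X l)"
proof
  assume "complex_vector.dependent (\<Union>l\<in>L. X l)"
  then obtain t u where t: "finite t" "t \<subseteq> (\<Union>l\<in>L. X l)" "(\<Sum>v\<in>t. u v *\<^sub>C v) = 0" "\<exists>v\<in>t. u v \<noteq> 0"
    unfolding complex_vector.dependent_explicit by blast
  have "\<exists>l. v \<in> t \<longrightarrow> l \<in> L \<and> v \<in> X l" for v using t(2) by auto
  then obtain la where la: "\<And>v. v \<in> t \<Longrightarrow> la v \<in> L \<and> v \<in> X (la v)" by metis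
  define y where "y k = (\<Sum>v\<in>{v\<in>t. \<theta> (la v) = k}. u v *\<^sub>C v)" for k
  have "(\<Sum>k\<in>(\<lambda>v. \<theta> (la v)) ` t. y k) = 0"
    using sum.image_gen[OF t(1), of "\<lambda>v. u v *\<^sub>C v" "\<lambda>v. \<theta> (la v)"] t(3) by (simp add: y_def)
  moreover have "weight_vec T k (y k)" for k
  proof -
    have "y k \<in> {u. weight_vec T k u}" unfolding y_def
      by (intro complex_vector.subspace_sum complex_vector.subspace_scale weight_vec_subspace T)
        (use la w in auto)
    then show ?thesis by simp
  qed
  ultimately have y0: "y k = 0" if "k \<in> (\<lambda>v. \<theta> (la v)) ` t" for k
    using weight_vec_independent[where T = T, OF T, where L = "(\<lambda>v. \<theta> (la v)) ` t" and u = y and l = k] t(1) that by blast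
  obtain v where v: "v \<in> t" "u v \<noteq> 0" using t(4) by blast
  have eq: "{x\<in>t. \<theta> (la x) = \<theta> (la v)} = {x\<in>t. la x = la v}"
    using \<theta> la v(1) by (auto simp: inj_on_def)
  have "(\<Sum>x\<in>{x\<in>t. la x = la v}. u x *\<^sub>C x) = 0" using y0[of "\<theta> (la v)"] v(1) by (simp add: y_def eq)
  moreover have "{x\<in>t. la x = la v} \<subseteq> X (la v)"
  proof
    fix x assume "x \<in> {x\<in>t. la x = la v}"
    then show "x \<in> X (la v)" using la[of x] by simp
  qed
  ultimately have "complex_vector.dependent (X (la v))"
    unfolding complex_vector.dependent_explicit using t(1) v
    by (intro exI[of _ "{x\<in>t. la x = la v}"] exI[of _ u]) auto
  then show False using ind la[OF v(1)] by blast
qed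

definition wtw :: "('d::finite, 'r, 'g) km \<Rightarrow> 'r list \<Rightarrow> complex ^ 'd \<Rightarrow> complex" where
  "wtw G w h = (\<Sum>i\<leftarrow>w. sroot G i h)"

lemma wtw_simps [simp]: "wtw G [] h = 0" "wtw G (i # w) h = sroot G i h + wtw G w h"
  by (simp_all add: wtw_def)

text \<open>Right-normed brackets of generators. The value at the empty word is a default, harmless
  because zero lies in every subspace concerned.\<close>

fun rnest :: "('g \<Rightarrow> 'g \<Rightarrow> 'g) \<Rightarrow> ('r \<Rightarrow> 'g) \<Rightarrow> 'r list \<Rightarrow> 'g::complex_vector" where
  "rnest br q [] = 0"
| "rnest br q [i] = q i"
| "rnest br q (i # j # w) = br (q i) (rnest br q (j # w))"

locale kac_moody_algebra =
  fixes G :: "('d::finite, 'r::finite, 'g::complex_vector) km"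
  assumes km: "kac_moody G"
begin

abbreviation br where "br \<equiv> brk G"
abbreviation hg where "hg \<equiv> hh G"

lemma form_bilinear: "cbilinear (form G)" and form_sym: "form G x y = form G y x"
  and form_nondeg: "(\<And>y. form G x y = 0) \<Longrightarrow> x = 0"
  and lin_sroot: "clinear (sroot G i)"
  and sroot_indep: "(\<And>x. (\<Sum>i\<in>UNIV. c i * sroot G i x) = 0) \<Longrightarrow> c i = 0"
  and lie: "lie_algebra br" and surj_leval: "surj (leval G)"
  and leval_iff: "leval G a = leval G b \<longleftrightarrow> km_eq G a b"
  using km unfolding kac_moody_def by auto

lemma br_bilinear: "cbilinear br" and br_self [simp]: "br x x = 0"
  and br_jacobi0: "br x (br y z) + br y (br z x) + br z (br x y) = 0"
  using lie unfolding lie_algebra_def by auto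

lemmas lin_br_right = cbilinearD(1)[OF br_bilinear] and lin_br_left = cbilinearD(2)[OF br_bilinear]
lemmas br_simps = clinear_simps[OF lin_br_right] clinear_simps[OF lin_br_left]
lemmas form_lin_right = cbilinearD(1)[OF form_bilinear] and form_lin_left = cbilinearD(2)[OF form_bilinear]
lemmas form_simps = clinear_simps[OF form_lin_right] clinear_simps[OF form_lin_left]

lemma br_swap: "br x y = - br y x"
proof -
  have "(br x x + br y x) + (br x y + br y y) = 0"
    using br_self[of "x + y"] by (simp only: clinear_add[OF lin_br_right] clinear_add[OF lin_br_left])
  then have "br x y + br y x = 0" by (simp add: add.commute)
  then show ?thesis by (simp add: add_eq_0_iff)
qed

lemma br_jacobi: "br x (br y z) = br (br x y) z + br y (br x z)"
proof -
  have "br x (br y z) = - (br y (br z x) + br z (br x y))"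
    using br_jacobi0[of x y z] by (simp add: eq_neg_iff_add_eq_0 add.assoc del: minus_add_distrib)
  moreover have "br y (br z x) = - br y (br x z)" by (subst br_swap[of z x]) (simp add: br_simps)
  moreover have "br z (br x y) = - br (br x y) z" by (rule br_swap)
  ultimately show ?thesis by simp
qed

lemma lin_hg: "clinear hg"
proof (rule clinearI)
  show "hg (x + y) = hg x + hg y" for x y
    using leval_iff[THEN iffD2, OF km_eq.h_add[of G x y]] by simp
  show "hg (c *\<^sub>C x) = c *\<^sub>C hg x" for c x
    using leval_iff[THEN iffD2, OF km_eq.h_scale[of G c x]] by simp
qed

lemmas hg_simps = clinear_simps[OF lin_hg]

lemma br_h_e: "br (hg x) (ee G i) = sroot G i x *\<^sub>C ee G i"
  using leval_iff[THEN iffD2, OF km_eq.rel_he[of G x i]] by simp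

lemma br_h_f: "br (hg x) (ff G i) = - sroot G i x *\<^sub>C ff G i"
  using leval_iff[THEN iffD2, OF km_eq.rel_hf[of G x i]] by simp

lemma br_e_f: "br (ee G i) (ff G j) = (if i = j then hg (hcoroot G i) else 0)"
  using leval_iff[THEN iffD2, OF km_eq.rel_ef[of G i j]] by (simp split: if_splits)

lemma br_h_h: "br (hg x) (hg y) = 0"
  using leval_iff[THEN iffD2, OF km_eq.rel_hh[of G x y]] by simp

lemma algebra_induct:
  assumes "csubspace W" "\<And>x. hg x \<in> W" "\<And>i. ee G i \<in> W" "\<And>i. ff G i \<in> W"
    and "\<And>x y. x \<in> W \<Longrightarrow> y \<in> W \<Longrightarrow> br x y \<in> W"
  shows "x \<in> W"
proof -
  have "leval G a \<in> W" for a
    by (induction a)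
      (use assms in \<open>auto intro: complex_vector.subspace_0 complex_vector.subspace_add complex_vector.subspace_scale\<close>)
  then show ?thesis using surj_leval by (metis surjD)
qed

text \<open>Non-degeneracy says that pairing with the coordinate vectors gives independent
  functionals, so they have dual vectors.\<close>

lemma flat_inv_exists:
  assumes l: "clinear l"
  shows "\<exists>x. \<forall>y. form G x y = l y"
proof -
  have "\<exists>d :: 'd \<Rightarrow> complex ^ 'd. \<forall>s\<in>UNIV. d s \<in> UNIV \<and> (\<forall>t\<in>UNIV. form G (d s) (axis t 1) = (if t = s then 1 else 0))"
  proof (rule dual_vectors[where \<phi> = "\<lambda>t x. form G x (axis t 1)"])
    fix c :: "'d \<Rightarrow> complex"
    assume c: "\<And>y. y \<in> UNIV \<Longrightarrow> (\<Sum>a\<in>UNIV. c a * form G y (axis a 1)) = 0"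
    have "(\<chi> s. c s) = 0"
    proof (rule form_nondeg)
      fix y
      have "form G y (\<chi> s. c s) = (\<Sum>s\<in>UNIV. c s * form G y (axis s 1))"
        by (subst scaleC_vec_expansion) (simp add: clinear_sum[OF form_lin_right] form_simps scaleC_complex)
      then show "form G (\<chi> s. c s) y = 0" using c form_sym by simp
    qed
    then show "\<forall>a\<in>UNIV. c a = 0" by (simp add: vec_eq_iff)
  qed (use form_lin_left in auto)
  then obtain d :: "'d \<Rightarrow> complex ^ 'd" where d: "\<And>s t. form G (d s) (axis t 1) = (if t = s then 1 else 0)" by auto
  have "form G (\<Sum>s\<in>UNIV. l (axis s 1) *\<^sub>C d s) y = l y" for y
  proof -
    have *: "form G (\<Sum>s\<in>UNIV. l (axis s 1) *\<^sub>C d s) (axis t 1) = l (axis t 1)" for t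
      by (simp add: clinear_sum[OF form_lin_left] form_simps scaleC_complex d if_distrib cong: if_cong)
    show ?thesis
      by (subst (1 2) scaleC_vec_expansion[of y])
        (simp add: clinear_sum[OF form_lin_right] clinear_scale[OF form_lin_right] clinear_sum[OF l] clinear_scale[OF l] *)
  qed
  then show ?thesis by blast
qed

lemma form_eqD: "(\<And>y. form G x y = form G x' y) \<Longrightarrow> x = x'"
  using form_nondeg[of "x - x'"] by (simp add: form_simps)

lemma flat_inv_eqI: "(\<And>y. form G x y = l y) \<Longrightarrow> flat_inv G l = x"
  unfolding flat_inv_def by (rule the_equality) (auto intro: form_eqD)

lemma form_flat_inv: "clinear l \<Longrightarrow> form G (flat_inv G l) y = l y"
  using flat_inv_exists[of l] flat_inv_eqI by metis

lemma flat_inv_add: "clinear l \<Longrightarrow> clinear l' \<Longrightarrow> flat_inv G (\<lambda>h. l h + l' h) = flat_inv G l + flat_inv G l'"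
  by (rule flat_inv_eqI) (simp add: form_simps form_flat_inv)

lemma lin_wtw: "clinear (wtw G w)"
  by (rule clinearI; induction w) (simp_all add: clinear_simps[OF lin_sroot] scaleC_distribs)

text \<open>This is where linear independence of the simple roots enters. The element found counts
  letters, so it grades the algebra and every Verma module by word length, and it makes all weight
  spaces finite dimensional.\<close>

lemma height_vector: "\<exists>h. \<forall>i. sroot G i h = 1"
proof -
  have "\<exists>d. \<forall>i\<in>UNIV. d i \<in> UNIV \<and> (\<forall>j\<in>UNIV. sroot G j (d i) = (if j = i then 1 else 0))"
    by (rule dual_vectors) (use lin_sroot sroot_indep in auto)
  then obtain d where d: "\<And>i j. sroot G j (d i) = (if j = i then 1 else 0)" by auto
  have "sroot G j (\<Sum>i\<in>UNIV. d i) = 1" for j by (simp add: clinear_sum[OF lin_sroot] d)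
  then show ?thesis by blast
qed

definition h0 where "h0 = (SOME h. \<forall>i. sroot G i h = 1)"

lemma sroot_h0 [simp]: "sroot G i h0 = 1"
  using someI_ex[OF height_vector] by (simp add: h0_def)

lemma wtw_h0: "wtw G w h0 = of_nat (length w)"
  by (induction w) simp_all

lemma finite_wtw: "finite {w. wtw G w = \<beta>}"
proof (cases "\<exists>w. wtw G w = \<beta>")
  case True
  then obtain w where w: "wtw G w = \<beta>" by blast
  have "length w' = length w" if "wtw G w' = \<beta>" for w'
    using wtw_h0[of w'] wtw_h0[of w] w that by simp
  then have "{w. wtw G w = \<beta>} \<subseteq> {w'. set w' \<subseteq> UNIV \<and> length w' = length w}" by auto
  then show ?thesis using finite_lists_length_eq[of "UNIV :: 'r set" "length w"] finite_subset by auto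
qed simp

lemma wtw_count: "wtw G w = (\<lambda>h. \<Sum>i\<in>UNIV. of_nat (count_list w i) * sroot G i h)"
proof (induction w)
  case (Cons j w)
  have "(\<Sum>i\<in>UNIV. of_nat (count_list (j # w) i) * sroot G i h) =
     (\<Sum>i\<in>UNIV. of_nat (count_list w i) * sroot G i h + (if i = j then sroot G j h else 0))" for h
    by (rule sum.cong) (auto simp: algebra_simps)
  then show ?case using Cons by (auto simp: sum.distrib)
qed auto

section \<open>Iterated brackets and root spaces\<close>

abbreviation rn where "rn \<equiv> rnest br"

lemma rn_Cons: "w \<noteq> [] \<Longrightarrow> rn q (i # w) = br (q i) (rn q w)"
  by (cases w) auto

text \<open>The span of right-normed brackets is closed under the bracket: by the Jacobi identity,
  \<open>[[q_i, y], z]\<close> is \<open>[q_i, [y, z]] - [y, [q_i, z]]\<close>, which allows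
  induction on the left argument.\<close>

lemma hull_spanned:
  "lie_subalgebra G hull range q = cspan {rn q w | w. w \<noteq> []}"
proof (rule hull_unique)
  let ?R = "{rn q w | w. w \<noteq> []}"
  show "range q \<subseteq> cspan ?R"
  proof
    fix x assume "x \<in> range q"
    then obtain i where "x = rn q [i]" by auto
    then show "x \<in> cspan ?R" by (blast intro: complex_vector.span_base)
  qed
  have sub: "csubspace (cspan ?R)" by (rule complex_vector.subspace_span)
  have gen: "br (q i) y \<in> cspan ?R" if "y \<in> cspan ?R" for i y
  proof (rule clinear_span_image[OF lin_br_right _ sub that])
    fix x assume "x \<in> ?R"
    then obtain w where w: "x = rn q w" "w \<noteq> []" by blast
    then have "br (q i) x = rn q (i # w)" by (simp add: rn_Cons)
    then show "br (q i) x \<in> cspan ?R" by (blast intro: complex_vector.span_base)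
  qed
  have "br (rn q w) y \<in> cspan ?R" if "w \<noteq> []" "y \<in> cspan ?R" for w y
    using that
  proof (induction w arbitrary: y)
    case (Cons i w)
    show ?case
    proof (cases "w = []")
      case False
      have "br (rn q (i # w)) y = br (q i) (br (rn q w) y) - br (rn q w) (br (q i) y)"
        using br_jacobi[of "q i" "rn q w" y] False by (simp add: rn_Cons)
      then show ?thesis
        using Cons False gen by (auto intro: complex_vector.span_diff)
    qed (use gen Cons in auto)
  qed simp
  then have "br x y \<in> cspan ?R" if "x \<in> cspan ?R" "y \<in> cspan ?R" for x y
    using clinear_span_image[OF lin_br_left _ sub that(1), of y] that(2) by auto
  then show "lie_subalgebra G (cspan ?R)" using sub by (auto simp: lie_subalgebra_def)
  fix W assume W: "range q \<subseteq> W" "lie_subalgebra G W"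
  have "rn q w \<in> W" if "w \<noteq> []" for w
    using that
  proof (induction w)
    case (Cons i w)
    then show ?case using W by (cases "w = []") (auto simp: rn_Cons lie_subalgebra_def)
  qed simp
  then have "?R \<subseteq> W" by auto
  then show "cspan ?R \<subseteq> W" using W by (intro complex_vector.span_minimal) (auto simp: lie_subalgebra_def)
qed

lemma n_minus_span: "n_minus G = cspan {rn (ff G) w | w. w \<noteq> []}"
  unfolding n_minus_def by (rule hull_spanned)

lemma n_plus_span: "n_plus G = cspan {rn (ee G) w | w. w \<noteq> []}"
  unfolding n_plus_def by (rule hull_spanned)

lemma n_minus_subspace: "csubspace (n_minus G)" unfolding n_minus_span by (rule complex_vector.subspace_span)

lemma n_plus_subspace: "csubspace (n_plus G)" unfolding n_plus_span by (rule complex_vector.subspace_span)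

lemma hull_subalgebra: "lie_subalgebra G (lie_subalgebra G hull range q)"
proof -
  have "lie_subalgebra G (\<Inter> S)" if "\<forall>s\<in>S. lie_subalgebra G s" for S
    using that by (auto simp: lie_subalgebra_def intro: complex_vector.subspace_Inter)
  then show ?thesis by (rule hull_in)
qed

lemma n_minus_br: "x \<in> n_minus G \<Longrightarrow> y \<in> n_minus G \<Longrightarrow> br x y \<in> n_minus G"
  and n_plus_br: "x \<in> n_plus G \<Longrightarrow> y \<in> n_plus G \<Longrightarrow> br x y \<in> n_plus G"
  using hull_subalgebra unfolding n_minus_def n_plus_def lie_subalgebra_def by blast+

lemma ff_n_minus: "ff G i \<in> n_minus G" and ee_n_plus: "ee G i \<in> n_plus G"
  unfolding n_minus_def n_plus_def by (meson hull_inc rangeI)+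

lemma rn_n_minus: "rn (ff G) w \<in> n_minus G"
  unfolding n_minus_span
  by (cases "w = []") (simp add: complex_vector.span_zero, blast intro: complex_vector.span_base)

lemma rn_n_plus: "rn (ee G) w \<in> n_plus G"
  unfolding n_plus_span
  by (cases "w = []") (simp add: complex_vector.span_zero, blast intro: complex_vector.span_base)

lemma br_h_rn_f: "br (hg x) (rn (ff G) w) = - wtw G w x *\<^sub>C rn (ff G) w"
proof (induction w)
  case (Cons i w)
  show ?case
  proof (cases "w = []")
    case False
    then show ?thesis
      by (simp add: rn_Cons br_jacobi[of "hg x"] Cons br_h_f br_simps scaleC_distribs)
  qed (simp add: br_h_f)
qed (simp add: br_simps)

lemma br_h_rn_e: "br (hg x) (rn (ee G) w) = wtw G w x *\<^sub>C rn (ee G) w"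
proof (induction w)
  case (Cons i w)
  show ?case
  proof (cases "w = []")
    case False
    then show ?thesis
      by (simp add: rn_Cons br_jacobi[of "hg x"] Cons br_h_e br_simps scaleC_distribs)
  qed (simp add: br_h_e)
qed (simp add: br_simps)

definition adh where "adh = (\<lambda>h. br (hg h))"

lemma lin_adh: "clinear (adh h)" unfolding adh_def by (rule lin_br_right)

lemma n_minus_space_iff: "x \<in> n_minus_space G \<beta> \<longleftrightarrow> x \<in> n_minus G \<and> weight_vec adh (\<lambda>h. - \<beta> h) x"
  by (simp add: n_minus_space_def weight_vec_def adh_def)

lemma n_minus_space_subspace: "csubspace (n_minus_space G \<beta>)"
  using complex_vector.subspace_inter[OF n_minus_subspace weight_vec_subspace[of adh "\<lambda>h. - \<beta> h", OF lin_adh]]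
  by (simp add: n_minus_space_iff[abs_def] Int_def set_eq_iff) (metis (no_types, lifting) Collect_cong mem_Collect_eq n_minus_space_iff Collect_mem_eq)

lemma rn_space: "rn (ff G) w \<in> n_minus_space G (wtw G w)"
  using rn_n_minus br_h_rn_f by (simp add: n_minus_space_def)

lemma n_minus_space_span:
  "n_minus_space G \<beta> = cspan {rn (ff G) w | w. w \<noteq> [] \<and> wtw G w = \<beta>}" (is "_ = cspan ?R")
proof
  show "cspan ?R \<subseteq> n_minus_space G \<beta>"
    by (rule complex_vector.span_minimal[OF _ n_minus_space_subspace]) (use rn_space in auto)
  show "n_minus_space G \<beta> \<subseteq> cspan ?R"
  proof
    fix x assume x: "x \<in> n_minus_space G \<beta>"
    let ?S = "{rn (ff G) w | w. w \<noteq> []}"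
    have wv: "weight_vec adh (\<lambda>h. - wtw G w h) (rn (ff G) w)" for w
      using br_h_rn_f by (simp add: weight_vec_def adh_def)
    have "x \<in> cspan {s\<in>?S. weight_vec adh (\<lambda>h. - \<beta> h) s}"
      by (rule weight_span[OF lin_adh]) (use x wv in \<open>auto simp: n_minus_space_iff n_minus_span\<close>)
    also have "\<dots> \<subseteq> cspan (insert 0 ?R)"
    proof (rule complex_vector.span_mono, rule subsetI)
      fix s assume "s \<in> {s\<in>?S. weight_vec adh (\<lambda>h. - \<beta> h) s}"
      then obtain w where w: "s = rn (ff G) w" "w \<noteq> []" "weight_vec adh (\<lambda>h. - \<beta> h) s" by auto
      show "s \<in> insert 0 ?R"
      proof (cases "s = 0")
        case False
        have "(- \<beta> h) *\<^sub>C s = (- wtw G w h) *\<^sub>C s" for h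
        proof -
          have "adh h s = (- \<beta> h) *\<^sub>C s" using w(3) unfolding weight_vec_def by blast
          moreover have "adh h s = (- wtw G w h) *\<^sub>C s" using wv[of w] unfolding w(1) weight_vec_def by blast
          ultimately show ?thesis by (simp only:)
        qed
        then have "\<beta> h = wtw G w h" for h
          using False by (simp only: complex_vector.scale_cancel_right neg_equal_iff_equal simp_thms)
        then have "wtw G w = \<beta>" by (intro ext) simp
        then show ?thesis using w by auto
      qed simp
    qed
    also have "\<dots> = cspan ?R" by (rule complex_vector.span_insert_0)
    finally show "x \<in> cspan ?R" .
  qed
qed

lemma finite_n_minus_space: "finite {rn (ff G) w | w. w \<noteq> [] \<and> wtw G w = \<beta>}"
proof -
  have "{rn (ff G) w | w. w \<noteq> [] \<and> wtw G w = \<beta>} \<subseteq> rn (ff G) ` {w. wtw G w = \<beta>}" by auto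
  then show ?thesis using finite_wtw finite_subset by blast
qed

lemma pos_root_wtw:
  assumes "n_minus_space G \<beta> \<noteq> {0}"
  shows "\<exists>w. w \<noteq> [] \<and> wtw G w = \<beta>"
proof (rule ccontr)
  assume "\<not> ?thesis"
  then have "{rn (ff G) w | w. w \<noteq> [] \<and> wtw G w = \<beta>} = {}" by auto
  then show False using assms n_minus_space_span[of \<beta>] by (simp del: Collect_empty_eq)
qed

lemma pos_roots_iff: "\<beta> \<in> pos_roots G \<longleftrightarrow> n_minus_space G \<beta> \<noteq> {0}"
proof
  assume n: "n_minus_space G \<beta> \<noteq> {0}"
  obtain w where w: "w \<noteq> []" "wtw G w = \<beta>" using pos_root_wtw[OF n] by blast
  have "\<beta> h0 \<noteq> 0" using wtw_h0[of w] w by simp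
  then have "\<beta> \<noteq> (\<lambda>h. 0)" by auto
  then show "\<beta> \<in> pos_roots G" using n w wtw_count[of w] unfolding pos_roots_def by blast
qed (simp add: pos_roots_def)

lemma pos_roots_wtw: "\<beta> \<in> pos_roots G \<Longrightarrow> \<exists>w. w \<noteq> [] \<and> wtw G w = \<beta>"
  by (metis pos_roots_iff pos_root_wtw)

lemma lin_pos_root: "\<beta> \<in> pos_roots G \<Longrightarrow> clinear \<beta>"
  using pos_roots_wtw lin_wtw by metis

text \<open>A root is only a functional here, without chosen multiplicities, so its height is read
  off from its value at the grading element.\<close>

definition rht :: "(complex ^ 'd \<Rightarrow> complex) \<Rightarrow> nat" where
  "rht \<beta> = (THE n. \<beta> h0 = of_nat n)"

lemma rht_wtw [simp]: "rht (wtw G w) = length w"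
  unfolding rht_def by (simp add: wtw_h0)

lemma finite_pos_roots_ht: "finite {\<beta>\<in>pos_roots G. rht \<beta> \<le> N}"
proof -
  have "{\<beta>\<in>pos_roots G. rht \<beta> \<le> N} \<subseteq> wtw G ` {w. set w \<subseteq> UNIV \<and> length w \<le> N}"
  proof
    fix \<beta> assume "\<beta> \<in> {\<beta>\<in>pos_roots G. rht \<beta> \<le> N}"
    then obtain w where "\<beta> = wtw G w" "rht \<beta> \<le> N" using pos_roots_wtw by blast
    then show "\<beta> \<in> wtw G ` {w. set w \<subseteq> UNIV \<and> length w \<le> N}" by simp
  qed
  then show ?thesis using finite_lists_length_le[of "UNIV :: 'r set" N]
    by (meson finite_imageI finite_subset finite)
qed

text \<open>The grading element acts on a bracket of n letters by -n, and n is positive. This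
  recovers x from \<open>[h0, x]\<close> in the Dynkin argument.\<close>

lemma n_minus_h0:
  assumes "x \<in> n_minus G" "br (hg h0) x = 0"
  shows "x = 0"
proof -
  let ?S = "{rn (ff G) w | w. w \<noteq> []}"
  let ?T = "\<lambda>_ :: unit. br (hg h0)"
  have wv: "weight_vec ?T (\<lambda>_. - of_nat (length w)) (rn (ff G) w)" for w
    using br_h_rn_f wtw_h0 by (simp add: weight_vec_def)
  have S: "\<exists>l. weight_vec ?T l s" if "s \<in> ?S" for s using that wv by blast
  have "x \<in> cspan {s\<in>?S. weight_vec ?T (\<lambda>_. 0) s}"
    by (rule weight_span[OF lin_br_right S]) (use assms in \<open>auto simp: n_minus_span weight_vec_def\<close>)
  also have "\<dots> \<subseteq> cspan {0}"
  proof (rule complex_vector.span_mono, rule subsetI)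
    fix s assume "s \<in> {s\<in>?S. weight_vec ?T (\<lambda>_. 0) s}"
    then obtain w where w: "s = rn (ff G) w" "w \<noteq> []" "br (hg h0) s = 0" by (auto simp: weight_vec_def)
    then show "s \<in> {0}" using br_h_rn_f[of h0 w] by (simp add: wtw_h0)
  qed
  finally show ?thesis using complex_vector.span_insert_0[of "{}"] by simp
qed

lemma n_minus_space_br:
  "x \<in> n_minus_space G \<alpha> \<Longrightarrow> y \<in> n_minus_space G \<beta> \<Longrightarrow> br x y \<in> n_minus_space G (\<lambda>h. \<alpha> h + \<beta> h)"
  by (auto simp: n_minus_space_def n_minus_br br_jacobi[of "hg _"] br_simps scaleC_distribs)

lemma ff_space: "ff G i \<in> n_minus_space G (sroot G i)"
  using ff_n_minus br_h_f by (simp add: n_minus_space_def)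

end

section \<open>Verma modules are free over the lowering operators\<close>

text \<open>The model: the Verma module structure on the span of all words in the \<open>f\<^sub>i\<close>.\<close>

context
  fixes G :: "('d::finite, 'r, 'g::complex_vector) km" and \<Lambda> :: "complex ^ 'd \<Rightarrow> complex"
begin

definition wF :: "'r \<Rightarrow> ('r list \<Rightarrow>\<^sub>0 complex) \<Rightarrow> ('r list \<Rightarrow>\<^sub>0 complex)" where
  "wF i = free_ext (\<lambda>w. Poly_Mapping.single (i # w) 1)"

definition wH :: "complex ^ 'd \<Rightarrow> ('r list \<Rightarrow>\<^sub>0 complex) \<Rightarrow> ('r list \<Rightarrow>\<^sub>0 complex)" where
  "wH x = free_ext (\<lambda>w. (\<Lambda> x - wtw G w x) *\<^sub>C Poly_Mapping.single w 1)"

text \<open>The recursion is forced by e_i v = 0 and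
  \<open>[e_i, f_j] = \<delta>_ij h_i\<close>.\<close>

fun wE0 :: "'r \<Rightarrow> 'r list \<Rightarrow> ('r list \<Rightarrow>\<^sub>0 complex)" where
  "wE0 i [] = 0"
| "wE0 i (j # w) = (if i = j then wH (hcoroot G i) (Poly_Mapping.single w 1) else 0) + wF j (wE0 i w)"

definition wE :: "'r \<Rightarrow> ('r list \<Rightarrow>\<^sub>0 complex) \<Rightarrow> ('r list \<Rightarrow>\<^sub>0 complex)" where
  "wE i = free_ext (wE0 i)"

primrec wrep :: "(complex ^ 'd, 'r) lexpr \<Rightarrow> ('r list \<Rightarrow>\<^sub>0 complex) \<Rightarrow> ('r list \<Rightarrow>\<^sub>0 complex)" where
  "wrep (LH x) = wH x"
| "wrep (LE i) = wE i"
| "wrep (LF i) = wF i"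
| "wrep LZero = (\<lambda>t. 0)"
| "wrep (LAdd a b) = (\<lambda>t. wrep a t + wrep b t)"
| "wrep (LScale s a) = (\<lambda>t. s *\<^sub>C wrep a t)"
| "wrep (LBrk a b) = (\<lambda>t. wrep a (wrep b t) - wrep b (wrep a t))"

lemma lin_wF: "clinear (wF i)" and lin_wH: "clinear (wH x)" and lin_wE: "clinear (wE i)"
  unfolding wF_def wH_def wE_def by (rule clinear_free_ext)+

lemma lin_wrep: "clinear (wrep a)"
  by (induction a) (auto intro!: clinear_intros lin_wF lin_wH lin_wE intro: clinear_compose)

lemmas w_simps = clinear_simps[OF lin_wF] clinear_simps[OF lin_wH] clinear_simps[OF lin_wE]

lemma wF_single [simp]: "wF i (Poly_Mapping.single w 1) = Poly_Mapping.single (i # w) 1"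
  by (simp add: wF_def)

lemma wH_single: "wH x (Poly_Mapping.single w 1) = (\<Lambda> x - wtw G w x) *\<^sub>C Poly_Mapping.single w 1"
  by (simp add: wH_def)

lemma wE_single: "wE i (Poly_Mapping.single w 1) = wE0 i w"
  by (simp add: wE_def)

lemma wH_wF: "wH x (wF i t) = wF i (wH x t) - sroot G i x *\<^sub>C wF i t"
  by (rule clinear_free_eqI[where r = t])
    (auto intro!: clinear_intros lin_wF lin_wH intro: clinear_compose[OF lin_wF lin_wH] clinear_compose[OF lin_wH lin_wF]
      simp: wH_single w_simps scaleC_distribs algebra_simps)

lemma clinear_if: "clinear f \<Longrightarrow> clinear (\<lambda>x. if c then f x else 0)"
  by (cases c) (simp_all add: clinear_const0)

lemma wE_wF: "wE i (wF j t) = wF j (wE i t) + (if i = j then wH (hcoroot G i) t else 0)"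
  by (rule clinear_free_eqI[where r = t])
    (auto intro!: clinear_intros lin_wF lin_wH lin_wE
      intro: clinear_compose[OF lin_wF lin_wE] clinear_compose[OF lin_wE lin_wF] clinear_plus clinear_if
      simp: wE_single)

lemma wH_wH: "wH x (wH y t) = wH y (wH x t)"
  by (rule clinear_free_eqI[where r = t])
    (auto intro: clinear_compose[OF lin_wH lin_wH] simp: wH_single w_simps scaleC_scaleC mult.commute)

lemma wH_wE: "wH x (wE i t) = wE i (wH x t) + sroot G i x *\<^sub>C wE i t"
proof (rule clinear_free_eqI[where r = t])
  show "wH x (wE i (Poly_Mapping.single w 1)) = wE i (wH x (Poly_Mapping.single w 1)) +
    sroot G i x *\<^sub>C wE i (Poly_Mapping.single w 1)" for w
  proof (induction w)
    case Nil
    show ?case by (simp add: wH_single wE_single w_simps)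
  next
    case (Cons j w)
    have "wH x (wE0 i w) = (\<Lambda> x - wtw G w x + sroot G i x) *\<^sub>C wE0 i w"
      using Cons by (simp add: wH_single wE_single w_simps scaleC_distribs)
    then show ?case
      by (simp add: wH_single wE_single w_simps wH_wF scaleC_scaleC)
        (simp add: scaleC_distribs scaleC_scaleC algebra_simps)
  qed
qed (intro clinear_intros clinear_compose[OF lin_wH lin_wE] clinear_compose[OF lin_wE lin_wH] lin_wE)+

text \<open>The algebra consists of the expressions modulo \<open>km_eq\<close>, so checking every
  rule of the congruence on the word model yields an action of the algebra.\<close>

lemma wrep_sound:
  assumes \<Lambda>: "clinear \<Lambda>" and s: "\<And>i. clinear (sroot G i)"
  shows "km_eq G a b \<Longrightarrow> wrep a t = wrep b t"
proof (induction arbitrary: t rule: km_eq.induct)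
  have lw: "clinear (wtw G w)" for w
    by (rule clinearI; induction w) (simp_all add: clinear_simps[OF s] scaleC_distribs)
  {
    case (h_add x y)
    show ?case
      by (simp, rule clinear_free_eqI[where r = t])
        (auto intro!: clinear_plus lin_wH simp: wH_single clinear_add[OF \<Lambda>] clinear_add[OF lw] scaleC_distribs)
  next
    case (h_scale c x)
    have "wH (c *\<^sub>C x) t = c *\<^sub>C wH x t"
      by (rule clinear_free_eqI[where r = t])
        (auto intro!: clinear_scaleC lin_wH
          simp: wH_single clinear_scale[OF \<Lambda>] clinear_scale[OF lw] scaleC_distribs scaleC_scaleC scaleC_complex_def)
    then show ?case by simp
  next
    case (rel_ef i j)
    show ?case by (simp add: wE_wF)
  }
qed (simp_all add: clinear_simps[OF lin_wrep] scaleC_distribs scaleC_scaleC wH_wF wH_wE wH_wH algebra_simps)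

end

context kac_moody_algebra
begin

context
  fixes \<Lambda> :: "complex ^ 'd \<Rightarrow> complex"
  assumes \<Lambda>: "clinear \<Lambda>"
begin

definition wact :: "'g \<Rightarrow> ('r list \<Rightarrow>\<^sub>0 complex) \<Rightarrow> ('r list \<Rightarrow>\<^sub>0 complex)" where
  "wact x = wrep G \<Lambda> (SOME a. leval G a = x)"

lemma wact_leval: "wact (leval G a) t = wrep G \<Lambda> a t"
proof -
  have "leval G (SOME b. leval G b = leval G a) = leval G a" by (rule someI) simp
  then show ?thesis
    unfolding wact_def leval_iff by (rule wrep_sound[OF \<Lambda> lin_sroot])
qed

lemma leval_ex: "\<exists>a. x = leval G a" using surj_leval by (rule surjD)

lemma lin_wact: "clinear (wact x)" unfolding wact_def by (rule lin_wrep)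

lemma wact_simps: "wact (x + y) t = wact x t + wact y t" "wact (c *\<^sub>C x) t = c *\<^sub>C wact x t"
  "wact (br x y) t = wact x (wact y t) - wact y (wact x t)" "wact 0 t = 0"
proof -
  obtain a b where ab: "x = leval G a" "y = leval G b" using leval_ex by metis
  show "wact (x + y) t = wact x t + wact y t" "wact (c *\<^sub>C x) t = c *\<^sub>C wact x t"
    "wact (br x y) t = wact x (wact y t) - wact y (wact x t)" "wact 0 t = 0"
    using wact_leval[of "LAdd a b"] wact_leval[of "LScale c a"] wact_leval[of "LBrk a b"] wact_leval[of LZero]
    by (simp_all add: ab wact_leval)
qed

lemma wact_gen: "wact (hg x) t = wH G \<Lambda> x t" "wact (ee G i) t = wE G \<Lambda> i t" "wact (ff G i) t = wF i t"
  using wact_leval[of "LH x"] wact_leval[of "LE i"] wact_leval[of "LF i"] by simp_all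

abbreviation "w0 \<equiv> Poly_Mapping.single ([] :: 'r list) (1 :: complex)"

lemma wact_n_plus:
  assumes "x \<in> n_plus G"
  shows "wact x w0 = 0"
proof -
  have "lie_subalgebra G {x. wact x w0 = 0}"
    by (auto simp: lie_subalgebra_def wact_simps clinear_zero[OF lin_wact] intro!: complex_vector.subspaceI)
  moreover have "range (ee G) \<subseteq> {x. wact x w0 = 0}" by (auto simp: wact_gen wE_single)
  ultimately have "n_plus G \<subseteq> {x. wact x w0 = 0}" unfolding n_plus_def by (intro hull_minimal)
  then show ?thesis using assms by auto
qed

text \<open>The word model satisfies the relations of the Verma module, hence receives a map from
  it. This map is what proves the words independent.\<close>

lemma verma_sound: "verma_eq G \<Lambda> a b \<Longrightarrow> meval wact w0 a = meval wact w0 b"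
  by (induction rule: verma_eq.induct)
    (simp_all add: wact_simps clinear_simps[OF lin_wact] scaleC_distribs scaleC_scaleC wact_n_plus wact_gen wH_single
      algebra_simps)

end
end

section \<open>Verma modules in terms of words\<close>

locale verma = kac_moody_algebra G for G :: "('d::finite, 'r::finite, 'g::complex_vector) km" +
  fixes \<Lambda> :: "complex ^ 'd \<Rightarrow> complex" and act :: "'g \<Rightarrow> 'm \<Rightarrow> 'm::complex_vector" and v :: 'm
  assumes \<Lambda>: "clinear \<Lambda>" and vm: "verma_module G \<Lambda> act v"
begin

lemma act_bilinear: "cbilinear act"
  and act_br: "act (br x y) u = act x (act y u) - act y (act x u)"
  and surj_meval: "surj (meval act v)"
  and meval_iff: "meval act v a = meval act v b \<longleftrightarrow> verma_eq G \<Lambda> a b"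
  using vm unfolding verma_module_def lie_module_def by auto

lemmas lin_act = cbilinearD(1)[OF act_bilinear] and lin_act_left = cbilinearD(2)[OF act_bilinear]
lemmas act_simps = clinear_simps[OF lin_act] clinear_simps[OF lin_act_left]

lemma act_n_plus: "x \<in> n_plus G \<Longrightarrow> act x v = 0"
  using meval_iff[THEN iffD2, OF verma_eq.highest[of x G \<Lambda>]] by simp

lemma act_h_v: "act (hg h) v = \<Lambda> h *\<^sub>C v"
  using meval_iff[THEN iffD2, OF verma_eq.weight[of G \<Lambda> h]] by simp

lemma act_swap: "act x (act y u) = act y (act x u) + act (br x y) u"
  by (simp add: act_br)

primrec wv :: "'r list \<Rightarrow> 'm" where
  "wv [] = v"
| "wv (i # w) = act (ff G i) (wv w)"

lemma act_h_wv: "act (hg h) (wv w) = (\<Lambda> h - wtw G w h) *\<^sub>C wv w"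
proof (induction w)
  case (Cons i w)
  then show ?case
    by (simp add: act_swap[of "hg h" "ff G i"] br_h_f act_simps scaleC_distribs)
qed (simp add: act_h_v)

lemma act_e_wv: "act (ee G i) (wv w) \<in> cspan (range wv)"
proof (induction w)
  case Nil
  show ?case by (simp add: act_n_plus ee_n_plus complex_vector.span_zero)
next
  case (Cons j w)
  have "act (ff G j) (wv w) \<in> cspan (range wv)" for w
    using complex_vector.span_base[OF rangeI[of wv "j # w"]] by simp
  then have "act (ff G j) (act (ee G i) (wv w)) \<in> cspan (range wv)"
    using clinear_span_image[OF lin_act _ complex_vector.subspace_span Cons] by blast
  moreover have "act (br (ee G i) (ff G j)) (wv w) \<in> cspan (range wv)"
    by (simp add: br_e_f act_h_wv act_simps complex_vector.span_zero complex_vector.span_base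
        complex_vector.span_scale)
  ultimately show ?case
    by (simp add: act_swap[of "ee G i" "ff G j"] complex_vector.span_add)
qed

text \<open>The elements that preserve the span of the words form a subalgebra containing the
  generators, hence are all; and the module is generated by \<open>v\<close>, which is the empty
  word.\<close>

lemma wv_span: "u \<in> cspan (range wv)"
proof -
  let ?W = "{x. \<forall>u\<in>cspan (range wv). act x u \<in> cspan (range wv)}"
  have "x \<in> ?W" for x
  proof (rule algebra_induct)
    show "csubspace ?W"
      by (auto intro!: complex_vector.subspaceI
          simp: act_simps complex_vector.span_zero complex_vector.span_add complex_vector.span_scale)
    show "hg h \<in> ?W" for h
    proof -
      have "act (hg h) (wv w) \<in> cspan (range wv)" for w
        unfolding act_h_wv by (intro complex_vector.span_scale complex_vector.span_base) simp
      then show ?thesis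
        using clinear_span_image[OF lin_act _ complex_vector.subspace_span, of "range wv" "hg h"] by auto
    qed
    show "ee G i \<in> ?W" for i
      using clinear_span_image[OF lin_act _ complex_vector.subspace_span, of "range wv" "ee G i"] act_e_wv by auto
    show "ff G i \<in> ?W" for i
    proof -
      have "act (ff G i) (wv w) \<in> cspan (range wv)" for w
        using complex_vector.span_base[OF rangeI[of wv "i # w"]] by simp
      then show ?thesis
        using clinear_span_image[OF lin_act _ complex_vector.subspace_span, of "range wv" "ff G i"] by auto
    qed
    show "br x y \<in> ?W" if "x \<in> ?W" "y \<in> ?W" for x y
      using that by (auto simp: act_br intro!: complex_vector.span_diff)
  qed
  then have "meval act v a \<in> cspan (range wv)" for a
  proof (induction a)
    case MV
    show ?case using complex_vector.span_base[OF rangeI[of wv "[]"]] by simp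
  qed (auto simp: complex_vector.span_zero complex_vector.span_add complex_vector.span_scale)
  then show ?thesis using surj_meval by (metis surjD)
qed

lemma eq_on_wv:
  assumes "clinear p" "clinear q" "\<And>w. p (wv w) = q (wv w)"
  shows "p u = q u"
  by (rule clinear_eq_on_span[OF assms(1,2) _ wv_span]) (use assms(3) in auto)

text \<open>The module map to the word model. It takes each word vector to the corresponding basis
  vector, so it reads off coordinates.\<close>

definition coord :: "'m \<Rightarrow> ('r list \<Rightarrow>\<^sub>0 complex)" where
  "coord u = meval (wact \<Lambda>) w0 (SOME a. meval act v a = u)"

lemma coord_meval: "coord (meval act v a) = meval (wact \<Lambda>) w0 a"
proof -
  have "meval act v (SOME b. meval act v b = meval act v a) = meval act v a" by (rule someI) simp
  then show ?thesis unfolding coord_def meval_iff by (rule verma_sound[OF \<Lambda>])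
qed

lemma meval_ex: "\<exists>a. u = meval act v a" using surj_meval by (rule surjD)

lemma lin_coord: "clinear coord"
proof (rule clinearI)
  fix x y c
  obtain a b where ab: "x = meval act v a" "y = meval act v b" using meval_ex by metis
  show "coord (x + y) = coord x + coord y" "coord (c *\<^sub>C x) = c *\<^sub>C coord x"
    using coord_meval[of "MAdd a b"] coord_meval[of "MScale c a"] by (simp_all add: ab coord_meval)
qed

lemma coord_act: "coord (act x u) = wact \<Lambda> x (coord u)"
proof -
  obtain a where a: "u = meval act v a" using meval_ex by metis
  show ?thesis using coord_meval[of "MAct x a"] by (simp add: a coord_meval)
qed

lemma coord_wv: "coord (wv w) = Poly_Mapping.single w 1"
proof (induction w)
  case Nil
  show ?case using coord_meval[of MV] by simp
qed (simp add: coord_act wact_gen[OF \<Lambda>])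

text \<open>Freeness over words in the f_i. The two assumptions say that \<open>g i\<close> is
  jointly linear, which extends the recursion from word vectors to all of the module.
  \<open>nu_minus\<close>, the vacuum functional and the Dynkin map are obtained this way.\<close>

lemma recursion:
  fixes g :: "'r \<Rightarrow> 'm \<Rightarrow> 'v \<Rightarrow> 'v::complex_vector"
  assumes add: "\<And>i u u' y y'. g i (u + u') (y + y') = g i u y + g i u' y'"
    and scale: "\<And>i c u y. g i (c *\<^sub>C u) (c *\<^sub>C y) = c *\<^sub>C g i u y"
  shows "\<exists>!\<nu>. clinear \<nu> \<and> \<nu> v = a \<and> (\<forall>i u. \<nu> (act (ff G i) u) = g i u (\<nu> u))"
proof (rule ex_ex1I)
  define nw where "nw = rec_list a (\<lambda>i w y. g i (wv w) y)"
  have nw [simp]: "nw [] = a" "nw (i # w) = g i (wv w) (nw w)" for i w by (simp_all add: nw_def)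
  define \<nu> where "\<nu> u = free_ext nw (coord u)" for u
  have lin: "clinear \<nu>" unfolding \<nu>_def by (rule clinear_compose[OF clinear_free_ext lin_coord])
  have wv: "\<nu> (wv w) = nw w" for w by (simp add: \<nu>_def coord_wv)
  have "\<nu> (act (ff G i) u) = g i u (\<nu> u)" for i u
  proof (rule eq_on_wv)
    show "clinear (\<lambda>u. \<nu> (act (ff G i) u))" by (rule clinear_compose[OF lin lin_act])
    show "clinear (\<lambda>u. g i u (\<nu> u))" by (rule clinearI) (simp_all add: clinear_simps[OF lin] add scale)
    show "\<nu> (act (ff G i) (wv w)) = g i (wv w) (\<nu> (wv w))" for w
      using wv[of "i # w"] wv[of w] by simp
  qed
  then show "\<exists>\<nu>. clinear \<nu> \<and> \<nu> v = a \<and> (\<forall>i u. \<nu> (act (ff G i) u) = g i u (\<nu> u))"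
    using lin wv[of "[]"] by auto
next
  fix p q
  assume p: "clinear p \<and> p v = a \<and> (\<forall>i u. p (act (ff G i) u) = g i u (p u))"
    and q: "clinear q \<and> q v = a \<and> (\<forall>i u. q (act (ff G i) u) = g i u (q u))"
  show "p = q"
  proof
    show "p u = q u" for u
    proof (rule eq_on_wv)
      show "p (wv w) = q (wv w)" for w by (induction w) (use p q in simp_all)
    qed (use p q in auto)
  qed
qed

text \<open>The coefficient of the generating vector in the basis of words; on the enveloping
  algebra of \<open>n_minus\<close> it is the counit.\<close>

definition vac :: "'m \<Rightarrow> complex" where
  "vac = (THE \<epsilon>. clinear \<epsilon> \<and> \<epsilon> v = 1 \<and> (\<forall>i u. \<epsilon> (act (ff G i) u) = 0))"

lemma vac: "clinear vac" "vac v = 1" "vac (act (ff G i) u) = 0"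
proof -
  have "\<exists>!\<epsilon>. clinear \<epsilon> \<and> \<epsilon> v = (1::complex) \<and> (\<forall>i u. \<epsilon> (act (ff G i) u) = 0)"
    by (rule recursion) simp_all
  from theI'[OF this] show "clinear vac" "vac v = 1" "vac (act (ff G i) u) = 0" unfolding vac_def by auto
qed

lemma vac_n_minus:
  assumes "x \<in> n_minus G"
  shows "vac (act x u) = 0"
proof -
  have "lie_subalgebra G {x. \<forall>u. vac (act x u) = 0}"
    by (auto simp: lie_subalgebra_def act_simps act_br clinear_simps[OF vac(1)] intro!: complex_vector.subspaceI)
  then have "n_minus G \<subseteq> {x. \<forall>u. vac (act x u) = 0}"
    unfolding n_minus_def by (intro hull_minimal) (auto simp: vac)
  then show ?thesis using assms by auto
qed

text \<open>The map sending \<open>f\<^sub>i\<^sub>1 \<dots> f\<^sub>i\<^sub>k v\<close> to the right-normed bracket. By the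
  Dynkin--Specht--Wever argument it recovers \<open>x\<close> from \<open>x v\<close>, up to degree.\<close>
lemma dynkin_map:
  "\<exists>p. clinear p \<and> p v = 0 \<and> (\<forall>x\<in>n_minus G. \<forall>u. p (act x u) = br x (p u) - vac u *\<^sub>C br (hg h0) x)"
proof -
  \<comment> \<open>The added term is the claim for x = f_i, since
    \<open>- [h0, f_i] = f_i\<close>.\<close>
  have "\<exists>!p. clinear p \<and> p v = (0::'g) \<and>
    (\<forall>i u. p (act (ff G i) u) = br (ff G i) (p u) + vac u *\<^sub>C ff G i)"
    by (rule recursion) (simp_all add: br_simps clinear_simps[OF vac(1)] scaleC_distribs scaleC_complex scaleC_scaleC)
  then obtain p where p: "clinear p" "p v = 0"
    "\<And>i u. p (act (ff G i) u) = br (ff G i) (p u) + vac u *\<^sub>C ff G i" by blast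
  let ?P = "\<lambda>x. \<forall>u. p (act x u) = br x (p u) - vac u *\<^sub>C br (hg h0) x"
  have rn: "?P (rn (ff G) w)" if "w \<noteq> []" for w
    using that
  proof (induction w)
    case (Cons i w)
    have f: "?P (ff G i)" by (simp add: p br_h_f)
    show ?case
    proof (cases "w = []")
      case False
      then have y: "?P (rn (ff G) w)" using Cons by simp
      show ?thesis
      proof
        fix u
        let ?f = "ff G i" and ?y = "rn (ff G) w" and ?d = "br (hg h0)"
        have 1: "p (act ?f (act ?y u)) = br ?f (br ?y (p u)) - vac u *\<^sub>C br ?f (?d ?y)"
          using f[rule_format, of "act ?y u"] y[rule_format, of u] by (simp add: vac_n_minus[OF rn_n_minus] br_simps)
        have 2: "p (act ?y (act ?f u)) = br ?y (br ?f (p u)) - vac u *\<^sub>C br ?y (?d ?f)"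
          using y[rule_format, of "act ?f u"] f[rule_format, of u] by (simp add: vac br_simps)
        have d: "?d (br ?f ?y) = br ?f (?d ?y) - br ?y (?d ?f)"
          by (subst br_jacobi) (simp add: br_swap[of "?d ?f"])
        have "br (br ?f ?y) (p u) = br ?f (br ?y (p u)) - br ?y (br ?f (p u))"
          using br_jacobi[of ?f ?y "p u"] by simp
        then show "p (act (rn (ff G) (i # w)) u) =
            br (rn (ff G) (i # w)) (p u) - vac u *\<^sub>C ?d (rn (ff G) (i # w))"
          using False by (simp add: rn_Cons act_br clinear_diff[OF p(1)] 1 2 d scaleC_distribs)
      qed
    qed (use f in simp)
  qed simp
  have "?P x" if "x \<in> n_minus G" for x
  proof
    fix u
    show "p (act x u) = br x (p u) - vac u *\<^sub>C br (hg h0) x"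
    proof (rule clinear_eq_on_span[where S = "{rn (ff G) w | w. w \<noteq> []}" and f = "\<lambda>x. p (act x u)"
        and g = "\<lambda>x. br x (p u) - vac u *\<^sub>C br (hg h0) x"])
      show "clinear (\<lambda>x. p (act x u))" by (rule clinear_compose[OF p(1) lin_act_left])
      show "clinear (\<lambda>x. br x (p u) - vac u *\<^sub>C br (hg h0) x)"
        by (intro clinear_intros lin_br_left lin_br_right)
    qed (use rn that n_minus_span in auto)
  qed
  then show ?thesis using p(1,2) by blast
qed

text \<open>Applying the Dynkin map to x v = 0 gives \<open>[h0, x] = 0\<close>, and x has only
  non-zero degrees.\<close>

lemma faithful:
  assumes "x \<in> n_minus G" "act x v = 0"
  shows "x = 0"
proof -
  obtain p where p: "clinear p" "p v = 0"
    "\<forall>x\<in>n_minus G. \<forall>u. p (act x u) = br x (p u) - vac u *\<^sub>C br (hg h0) x"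
    using dynkin_map by blast
  have "br (hg h0) x = 0"
    using p(3)[rule_format, OF assms(1), of v] assms(2) by (simp add: vac p(2) br_simps clinear_zero[OF p(1)])
  then show ?thesis by (rule n_minus_h0[OF assms(1)])
qed

end

section \<open>The action of the dual of \<open>n_minus\<close> on Verma modules\<close>

lemma contract_add:
  "clinear \<xi> \<Longrightarrow> clinear \<eta> \<Longrightarrow> contract (\<lambda>d. \<xi> d + \<eta> d) t = contract \<xi> t + contract \<eta> t"
  by (rule tensor_eqI[where t = t]) (simp_all add: clinear_contract clinear_plus scaleC_distribs)

lemma contract_scale:
  "clinear \<xi> \<Longrightarrow> contract (\<lambda>d. c * \<xi> d) t = c *\<^sub>C contract \<xi> t"
  by (rule tensor_eqI[where t = t])
    (simp_all add: clinear_contract clinear_mult_left clinear_scaleC scaleC_scaleC)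

context kac_moody_algebra
begin

lemma n_minus_br_h:
  assumes "x \<in> n_minus G"
  shows "br (hg h) x \<in> n_minus G"
proof (rule clinear_span_image[OF lin_br_right _ n_minus_subspace assms[unfolded n_minus_span]])
  fix x assume "x \<in> {rn (ff G) w | w. w \<noteq> []}"
  then obtain w where "x = rn (ff G) w" by blast
  then show "br (hg h) x \<in> n_minus G"
    by (simp only: br_h_rn_f complex_vector.subspace_scale[OF n_minus_subspace rn_n_minus])
qed

end

context verma
begin

lemma cbilinear_tens_act: "cbilinear (\<lambda>d y. br a d \<otimes>\<^sub>C y + d \<otimes>\<^sub>C act a y)"
  by (intro cbilinearI clinear_plus cbilinearD[OF cbilinear_tens] clinear_compose[OF _ lin_br_right]
      clinear_compose[OF _ lin_act])

lemma tens_act_tens: "tens_act G act a (d \<otimes>\<^sub>C y) = br a d \<otimes>\<^sub>C y + d \<otimes>\<^sub>C act a y"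
  unfolding tens_act_def by (rule tensor_lift_tens[OF cbilinear_tens_act])

lemma lin_tens_act: "clinear (tens_act G act a)"
  unfolding tens_act_def by (rule clinear_tensor_lift[OF cbilinear_tens_act])

lemma contract_tens_act:
  assumes "clinear \<xi>"
  shows "contract \<xi> (tens_act G act a t) = contract (\<lambda>d. \<xi> (br a d)) t + act a (contract \<xi> t)"
proof -
  have l: "clinear (\<lambda>d. \<xi> (br a d))" by (rule clinear_compose[OF assms lin_br_right])
  note c = clinear_contract[OF assms]
  show ?thesis
    by (rule tensor_eqI[where t = t])
      (auto simp: tens_act_tens clinear_add[OF c] assms l act_simps
        intro: clinear_compose[OF c lin_tens_act] clinear_plus clinear_contract[OF l] clinear_compose[OF lin_act c])
qed

lemma nu: "clinear (nu_minus G act v)" "nu_minus G act v v = 0"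
  "nu_minus G act v (act (ff G i) x) = ff G i \<otimes>\<^sub>C act (hg (hcoroot G i)) x + tens_act G act (ff G i) (nu_minus G act v x)"
proof -
  have t: "clinear (\<lambda>y. d \<otimes>\<^sub>C y)" for d :: 'g by (rule cbilinearD(1)[OF cbilinear_tens])
  have "\<exists>!\<nu>. clinear \<nu> \<and> \<nu> v = 0 \<and>
    (\<forall>i x. \<nu> (act (ff G i) x) = ff G i \<otimes>\<^sub>C act (hg (hcoroot G i)) x + tens_act G act (ff G i) (\<nu> x))"
    by (rule recursion) (simp_all add: act_simps clinear_simps[OF t] clinear_simps[OF lin_tens_act] scaleC_distribs)
  from theI'[OF this] show "clinear (nu_minus G act v)" "nu_minus G act v v = 0"
    "nu_minus G act v (act (ff G i) x) = ff G i \<otimes>\<^sub>C act (hg (hcoroot G i)) x + tens_act G act (ff G i) (nu_minus G act v x)"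
    unfolding nu_minus_def[symmetric] by auto
qed

definition Y :: "('g \<Rightarrow> complex) \<Rightarrow> 'm \<Rightarrow> 'm" where
  "Y \<xi> u = contract \<xi> (nu_minus G act v u)"

lemma lin_Y: "clinear \<xi> \<Longrightarrow> clinear (Y \<xi>)"
  unfolding Y_def by (rule clinear_compose[OF clinear_contract nu(1)])

lemmas Y_simps = clinear_simps[OF lin_Y]

lemma Y_v: "clinear \<xi> \<Longrightarrow> Y \<xi> v = 0"
  by (simp add: Y_def nu clinear_zero[OF clinear_contract])

text \<open>The recursion of \<open>nu_minus\<close> after contraction. Together with
  \<open>Y_v\<close> it is the only access to \<open>Y\<close>: the identities below follow from it
  by induction on words.\<close>

lemma Y_f: "clinear \<xi> \<Longrightarrow> Y \<xi> (act (ff G i) u) =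
    \<xi> (ff G i) *\<^sub>C act (hg (hcoroot G i)) u + act (ff G i) (Y \<xi> u) + Y (\<lambda>d. \<xi> (br (ff G i) d)) u"
  by (simp add: Y_def nu clinear_add[OF clinear_contract] contract_tens_act)

lemma Y_add: "clinear \<xi> \<Longrightarrow> clinear \<eta> \<Longrightarrow> Y (\<lambda>d. \<xi> d + \<eta> d) u = Y \<xi> u + Y \<eta> u"
  unfolding Y_def by (rule contract_add)

lemma Y_scale: "clinear \<xi> \<Longrightarrow> Y (\<lambda>d. c * \<xi> d) u = c *\<^sub>C Y \<xi> u"
  unfolding Y_def by (rule contract_scale)

lemma lin_comp_br: "clinear \<xi> \<Longrightarrow> clinear (\<lambda>d. \<xi> (br x d))"
  by (rule clinear_compose[OF _ lin_br_right])

text \<open>Each letter of a word adds one bracket with some f_i to the argument of \<xi>, so a word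
  of length n tests \<xi> only on brackets of at most n letters. Local finiteness and independence
  of the chosen extension of \<xi> both follow.\<close>

lemma Y_wv_eq_0:
  "clinear \<xi> \<Longrightarrow> (\<And>w'. w' \<noteq> [] \<Longrightarrow> length w' \<le> length w \<Longrightarrow> \<xi> (rn (ff G) w') = 0) \<Longrightarrow> Y \<xi> (wv w) = 0"
proof (induction w arbitrary: \<xi>)
  case (Cons i w)
  have "Y \<xi> (wv w) = 0" by (rule Cons.IH[OF Cons.prems(1)]) (use Cons.prems(2) in auto)
  moreover have "Y (\<lambda>d. \<xi> (br (ff G i) d)) (wv w) = 0"
  proof (rule Cons.IH[OF lin_comp_br[OF Cons.prems(1)]])
    fix w' :: "'r list" assume "w' \<noteq> []" "length w' \<le> length w"
    then show "\<xi> (br (ff G i) (rn (ff G) w')) = 0"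
      using Cons.prems(2)[of "i # w'"] by (simp add: rn_Cons)
  qed
  moreover have "\<xi> (ff G i) = 0" using Cons.prems(2)[of "[i]"] by simp
  ultimately show ?case by (simp add: Y_f Cons.prems(1) act_simps)
qed (simp add: Y_v)

text \<open>A functional on \<open>n_minus\<close> is represented by some extension to the whole
  algebra; this shows that the choice of the extension does not matter.\<close>

lemma Y_cong:
  assumes \<xi>: "clinear \<xi>" and \<eta>: "clinear \<eta>" and eq: "\<And>w. w \<noteq> [] \<Longrightarrow> \<xi> (rn (ff G) w) = \<eta> (rn (ff G) w)"
  shows "Y \<xi> u = Y \<eta> u"
proof (rule eq_on_wv[OF lin_Y[OF \<xi>] lin_Y[OF \<eta>]])
  fix w
  have l: "clinear (\<lambda>d. (-1) * \<eta> d)" by (rule clinear_mult_left[OF \<eta>])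
  have "Y (\<lambda>d. \<xi> d + (-1) * \<eta> d) (wv w) = 0"
    by (rule Y_wv_eq_0[OF clinear_plus[OF \<xi> l]]) (simp add: eq)
  then show "Y \<xi> (wv w) = Y \<eta> (wv w)" by (simp only: Y_add[OF \<xi> l] Y_scale[OF \<eta>]) simp
qed

text \<open>The Cartan subalgebra acts on functionals by the coadjoint action. Induction on words,
  for all \<xi> at once because the recursion replaces \<xi> by its composite with a
  bracket.\<close>

lemma H_Y: "clinear \<xi> \<Longrightarrow>
  act (hg h) (Y \<xi> u) = Y \<xi> (act (hg h) u) - Y (\<lambda>d. \<xi> (br (hg h) d)) u"
proof -
  have "act (hg h) (Y \<xi> (wv w)) = Y \<xi> (act (hg h) (wv w)) - Y (\<lambda>d. \<xi> (br (hg h) d)) (wv w)"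
    if "clinear \<xi>" for w \<xi>
    using that
  proof (induction w arbitrary: \<xi>)
    case Nil
    then show ?case using lin_comp_br[OF Nil, of "hg h"] by (simp add: Y_v act_h_v act_simps Y_simps)
  next
    case (Cons i w)
    let ?f = "ff G i" and ?u = "wv w" and ?s = "sroot G i h"
    let ?\<xi>f = "\<lambda>d. \<xi> (br ?f d)" and ?\<xi>h = "\<lambda>d. \<xi> (br (hg h) d)"
    have lf: "clinear ?\<xi>f" and lh: "clinear ?\<xi>h" using lin_comp_br[OF Cons.prems] by auto
    have hf: "act (hg h) (act ?f u) = act ?f (act (hg h) u) - ?s *\<^sub>C act ?f u" for u
      by (simp add: act_swap[of "hg h" ?f] br_h_f act_simps)
    have hh: "act (hg h) (act (hg k) u) = act (hg k) (act (hg h) u)" for k u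
      by (simp add: act_swap[of "hg h" "hg k"] br_h_h act_simps)
    \<comment> \<open>The Jacobi identity for h, f_i and the argument; the extra term is the weight
      of f_i.\<close>
    have e: "Y (\<lambda>d. ?\<xi>h (br ?f d)) ?u = Y (\<lambda>d. ?\<xi>f (br (hg h) d)) ?u - ?s *\<^sub>C Y ?\<xi>f ?u"
    proof -
      have "(\<lambda>d. ?\<xi>h (br ?f d)) = (\<lambda>d. ?\<xi>f (br (hg h) d) + (- ?s) * ?\<xi>f d)"
        by (rule ext) (simp add: br_jacobi[of "hg h" ?f] br_h_f br_simps clinear_simps[OF Cons.prems] scaleC_complex)
      then show ?thesis
        by (simp only: Y_add[OF lin_comp_br[OF lf] clinear_mult_left[OF lf]] Y_scale[OF lf]) simp
    qed
    have "act (hg h) (Y \<xi> (act ?f ?u)) =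
      \<xi> ?f *\<^sub>C act (hg (hcoroot G i)) (act (hg h) ?u) + (act ?f (act (hg h) (Y \<xi> ?u)) - ?s *\<^sub>C act ?f (Y \<xi> ?u))
      + act (hg h) (Y ?\<xi>f ?u)"
      by (simp add: Y_f[OF Cons.prems] act_simps hh[of "hcoroot G i"] hf)
    also have "\<dots> =
      (\<xi> ?f *\<^sub>C act (hg (hcoroot G i)) (act (hg h) ?u) + act ?f (Y \<xi> (act (hg h) ?u)) + Y ?\<xi>f (act (hg h) ?u))
      - ?s *\<^sub>C (\<xi> ?f *\<^sub>C act (hg (hcoroot G i)) ?u + act ?f (Y \<xi> ?u) + Y ?\<xi>f ?u)
      - (?\<xi>h ?f *\<^sub>C act (hg (hcoroot G i)) ?u + act ?f (Y ?\<xi>h ?u) + Y (\<lambda>d. ?\<xi>h (br ?f d)) ?u)"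
      by (simp add: e Cons.IH[OF Cons.prems] Cons.IH[OF lf] act_simps br_h_f clinear_simps[OF Cons.prems]
          scaleC_distribs scaleC_scaleC scaleC_complex algebra_simps)
    also have "\<dots> = Y \<xi> (act (hg h) (act ?f ?u)) - Y ?\<xi>h (act ?f ?u)"
      by (simp only: hf Y_simps(4)[OF Cons.prems] Y_simps(2)[OF Cons.prems] Y_f[OF Cons.prems] Y_f[OF lh])
    finally show ?case by (simp only: wv.simps)
  qed
  note on_words = this
  assume \<xi>: "clinear \<xi>"
  show ?thesis
  proof (rule eq_on_wv[where u = u])
    show "clinear (\<lambda>u. act (hg h) (Y \<xi> u))" by (rule clinear_compose[OF lin_act lin_Y[OF \<xi>]])
    show "clinear (\<lambda>u. Y \<xi> (act (hg h) u) - Y (\<lambda>d. \<xi> (br (hg h) d)) u)"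
      by (rule clinear_minus_fun[OF clinear_compose[OF lin_Y[OF \<xi>] lin_act] lin_Y[OF lin_comp_br[OF \<xi>]]])
  qed (rule on_words[OF \<xi>])
qed

end

section \<open>The cobracket, read off from Verma modules\<close>

locale verma_family = kac_moody_algebra G for G :: "('d::finite, 'r::finite, 'g::complex_vector) km" +
  fixes \<Lambda> :: "'n::finite \<Rightarrow> complex ^ 'd \<Rightarrow> complex" and act :: "'n \<Rightarrow> 'g \<Rightarrow> 'm \<Rightarrow> 'm::complex_vector"
    and v :: "'n \<Rightarrow> 'm"
  assumes lin_Lambda: "clinear (\<Lambda> k)" and vms: "verma_module G (\<Lambda> k) (act k) (v k)"
begin

sublocale V: verma G "\<Lambda> k" "act k" "v k" for k
  by (rule verma.intro[OF kac_moody_algebra_axioms], rule verma_axioms.intro) (rule lin_Lambda vms)+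

text \<open>\<open>z\<close> is the \<open>n_minus\<close>-component of the bracket of \<open>\<xi>\<close> and \<open>x\<close> in the double of the Lie
  bialgebra, for \<open>x\<close> of weight \<open>- \<beta>\<close>.\<close>
definition cross :: "('g \<Rightarrow> complex) \<Rightarrow> 'g \<Rightarrow> (complex ^ 'd \<Rightarrow> complex) \<Rightarrow> 'g \<Rightarrow> bool" where
  "cross \<xi> x \<beta> z \<longleftrightarrow> z \<in> n_minus G \<and> (\<forall>k u. V.Y k \<xi> (act k x u) = act k x (V.Y k \<xi> u) +
     V.Y k (\<lambda>d. \<xi> (br x d)) u + \<xi> x *\<^sub>C act k (hg (flat_inv G \<beta>)) u + act k z u)"

lemma crossD: "cross \<xi> x \<beta> z \<Longrightarrow> z \<in> n_minus G"
  "cross \<xi> x \<beta> z \<Longrightarrow> V.Y k \<xi> (act k x u) = act k x (V.Y k \<xi> u) +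
     V.Y k (\<lambda>d. \<xi> (br x d)) u + \<xi> x *\<^sub>C act k (hg (flat_inv G \<beta>)) u + act k z u"
  by (auto simp: cross_def)

text \<open>At the generating vector every term of the relation except z v is the same for both
  candidates, and the action of \<open>n_minus\<close> on that vector is faithful.\<close>

lemma cross_unique:
  assumes "cross \<xi> x \<beta> z" "cross \<xi> x \<beta> z'"
  shows "z = z'"
proof -
  have "act k z (v k) = act k z' (v k)" for k
    using crossD(2)[OF assms(1), of k "v k"] crossD(2)[OF assms(2), of k "v k"] by simp
  then have "act k (z - z') (v k) = 0" for k by (simp add: V.act_simps)
  then have "z - z' = 0"
    using V.faithful[of "z - z'"] crossD(1)[OF assms(1)] crossD(1)[OF assms(2)]
    by (meson complex_vector.subspace_diff n_minus_subspace)
  then show ?thesis by simp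
qed

lemma cross_f: "clinear \<xi> \<Longrightarrow> cross \<xi> (ff G i) (sroot G i) 0"
  by (simp add: cross_def V.Y_f V.act_simps hcoroot_def complex_vector.subspace_0[OF n_minus_subspace])

text \<open>The formula results from applying \<xi> to f_i y - y f_i, using the relation for f_i and
  for y; the Cartan operators met on the way are moved past f_i and y, which produces the terms with
  c. It is the cocycle property of the cobracket.\<close>

lemma cross_step:
  assumes \<xi>: "clinear \<xi>" and y: "y \<in> n_minus_space G \<beta>" and \<beta>: "clinear \<beta>"
    and z1: "cross \<xi> y \<beta> z1" and z2: "cross (\<lambda>d. \<xi> (br (ff G i) d)) y \<beta> z2"
  defines "c \<equiv> sroot G i (flat_inv G \<beta>)"
  shows "cross \<xi> (br (ff G i) y) (\<lambda>h. sroot G i h + \<beta> h)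
    ((\<xi> y * c) *\<^sub>C ff G i + br (ff G i) z1 + z2 - (\<xi> (ff G i) * c) *\<^sub>C y)"
proof -
  let ?f = "ff G i" and ?b = "flat_inv G \<beta>" and ?a = "hcoroot G i"
  let ?\<xi>f = "\<lambda>d. \<xi> (br ?f d)" and ?\<xi>y = "\<lambda>d. \<xi> (br y d)"
  have lf: "clinear ?\<xi>f" and ly: "clinear ?\<xi>y" using V.lin_comp_br[OF \<xi>] by auto
  have yn: "y \<in> n_minus G" and hy: "br (hg h) y = - (\<beta> h *\<^sub>C y)" for h
    using y by (auto simp: n_minus_space_def)
  have fb: "br ?f (hg ?b) = c *\<^sub>C ?f" by (subst br_swap) (simp add: br_h_f c_def)
  \<comment> \<open>Both the value of \<beta> at the coroot of i and \<open>c\<close> are the form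
    on the simple root and \<beta>, so the two corrections carry the same constant.\<close>
  have "\<beta> ?a = form G ?b ?a" by (simp add: form_flat_inv[OF \<beta>])
  also have "\<dots> = form G ?a ?b" by (rule form_sym)
  also have "\<dots> = c" by (simp add: hcoroot_def form_flat_inv[OF lin_sroot] c_def)
  finally have ay: "br (hg ?a) y = - (c *\<^sub>C y)" by (simp add: hy)
  have hsum: "flat_inv G (\<lambda>h. sroot G i h + \<beta> h) = ?a + ?b"
    by (simp add: flat_inv_add[OF lin_sroot \<beta>] hcoroot_def)
  have zn: "(\<xi> y * c) *\<^sub>C ?f + br ?f z1 + z2 - (\<xi> ?f * c) *\<^sub>C y \<in> n_minus G"
    using crossD(1)[OF z1] crossD(1)[OF z2] yn n_minus_br[OF ff_n_minus]
    by (intro complex_vector.subspace_add complex_vector.subspace_diff complex_vector.subspace_scale n_minus_subspace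
        ff_n_minus) auto
  moreover have "V.Y k \<xi> (act k (br ?f y) u) = act k (br ?f y) (V.Y k \<xi> u) +
     V.Y k (\<lambda>d. \<xi> (br (br ?f y) d)) u + \<xi> (br ?f y) *\<^sub>C act k (hg (?a + ?b)) u +
     act k ((\<xi> y * c) *\<^sub>C ?f + br ?f z1 + z2 - (\<xi> ?f * c) *\<^sub>C y) u" for k u
  proof -
    note Yf = V.Y_f[OF \<xi>] V.Y_f[OF lf] V.Y_f[OF ly]
    have 1: "V.Y k \<xi> (act k ?f (act k y u)) = \<xi> ?f *\<^sub>C act k (hg ?a) (act k y u) + act k ?f (act k y (V.Y k \<xi> u) +
     V.Y k ?\<xi>y u + \<xi> y *\<^sub>C act k (hg ?b) u + act k z1 u) + (act k y (V.Y k ?\<xi>f u) +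
     V.Y k (\<lambda>d. \<xi> (br ?f (br y d))) u + \<xi> (br ?f y) *\<^sub>C act k (hg ?b) u + act k z2 u)"
      by (simp only: V.Y_f[OF \<xi>] crossD(2)[OF z1] crossD(2)[OF z2])
    have 2: "V.Y k \<xi> (act k y (act k ?f u)) = act k y (\<xi> ?f *\<^sub>C act k (hg ?a) u + act k ?f (V.Y k \<xi> u) + V.Y k ?\<xi>f u)
      + (\<xi> (br y ?f) *\<^sub>C act k (hg ?a) u + act k ?f (V.Y k ?\<xi>y u) + V.Y k (\<lambda>d. \<xi> (br y (br ?f d))) u)
      + \<xi> y *\<^sub>C act k (hg ?b) (act k ?f u) + act k z1 (act k ?f u)"
      by (simp only: V.Y_f[OF \<xi>] V.Y_f[OF ly] crossD(2)[OF z1])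
    have 3: "V.Y k (\<lambda>d. \<xi> (br (br ?f y) d)) u = V.Y k (\<lambda>d. \<xi> (br ?f (br y d))) u - V.Y k (\<lambda>d. \<xi> (br y (br ?f d))) u"
    proof -
      have l1: "clinear (\<lambda>d. \<xi> (br ?f (br y d)))" and l2: "clinear (\<lambda>d. \<xi> (br y (br ?f d)))"
        using V.lin_comp_br[OF lf] V.lin_comp_br[OF ly] by auto
      have "(\<lambda>d. \<xi> (br (br ?f y) d)) = (\<lambda>d. \<xi> (br ?f (br y d)) + (-1) * \<xi> (br y (br ?f d)))"
        by (rule ext) (simp add: br_jacobi[of ?f y] clinear_simps[OF \<xi>])
      then show ?thesis by (simp only: V.Y_add[OF l1 clinear_mult_left[OF l2]] V.Y_scale[OF l2]) simp
    qed
    have yf: "\<xi> (br y ?f) = - \<xi> (br ?f y)" by (subst br_swap) (simp add: clinear_minus[OF \<xi>])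
    have h1: "act k (hg ?a) (act k y u) = act k y (act k (hg ?a) u) - c *\<^sub>C act k y u"
      by (simp add: V.act_swap[of k "hg ?a" y] ay V.act_simps)
    have h2: "act k (hg ?b) (act k ?f u) = act k ?f (act k (hg ?b) u) - c *\<^sub>C act k ?f u"
      by (simp add: V.act_swap[of k "hg ?b" ?f] br_h_f V.act_simps c_def)
    have "V.Y k \<xi> (act k (br ?f y) u) = V.Y k \<xi> (act k ?f (act k y u)) - V.Y k \<xi> (act k y (act k ?f u))"
      by (simp add: V.act_br V.Y_simps[OF \<xi>])
    then show ?thesis unfolding 1 2 3 yf h1 h2
      by (simp add: V.act_simps V.act_br hg_simps scaleC_distribs scaleC_scaleC algebra_simps)
  qed
  ultimately show ?thesis unfolding cross_def hsum by blast
qed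

text \<open>The induction needs the antisymmetry of the cobracket, that is of \<open>\<zeta>\<close>, as well.\<close>
lemma cross_exists_rn:
  assumes "w \<noteq> []"
  shows "\<exists>\<zeta>. \<forall>\<xi>. clinear \<xi> \<longrightarrow> cross \<xi> (rn (ff G) w) (wtw G w) (\<zeta> \<xi>) \<and> (\<forall>\<eta>. clinear \<eta> \<longrightarrow> \<eta> (\<zeta> \<xi>) = - \<xi> (\<zeta> \<eta>))"
  using assms
proof (induction w)
  case (Cons i w)
  let ?f = "ff G i" and ?y = "rn (ff G) w" and ?\<beta> = "wtw G w"
  show ?case
  proof (cases "w = []")
    case True
    have [simp]: "wtw G [i] = sroot G i" by auto
    show ?thesis using True cross_f by (intro exI[of _ "\<lambda>_. 0"]) (auto simp: clinear_zero)
  next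
    case False
    then obtain \<zeta> where \<zeta>: "\<And>\<xi>. clinear \<xi> \<Longrightarrow> cross \<xi> ?y ?\<beta> (\<zeta> \<xi>)"
      "\<And>\<xi> \<eta>. clinear \<xi> \<Longrightarrow> clinear \<eta> \<Longrightarrow> \<eta> (\<zeta> \<xi>) = - \<xi> (\<zeta> \<eta>)"
      using Cons.IH by blast
    define c where "c = sroot G i (flat_inv G ?\<beta>)"
    \<comment> \<open>The first and last terms are antisymmetric together; in the two middle ones,
      antisymmetry for the shorter bracket exchanges the roles of \<xi> and \<eta>.\<close>
    define \<zeta>' where "\<zeta>' \<xi> = (\<xi> ?y * c) *\<^sub>C ?f + br ?f (\<zeta> \<xi>) + \<zeta> (\<lambda>d. \<xi> (br ?f d)) - (\<xi> ?f * c) *\<^sub>C ?y" for \<xi>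
    have e: "wtw G (i # w) = (\<lambda>h. sroot G i h + ?\<beta> h)" by auto
    show ?thesis
    proof (intro exI[of _ \<zeta>'] allI impI conjI)
      fix \<xi> :: "'g \<Rightarrow> complex" assume \<xi>: "clinear \<xi>"
      have lf: "clinear (\<lambda>d. \<xi> (br ?f d))" by (rule V.lin_comp_br[OF \<xi>])
      show "cross \<xi> (rn (ff G) (i # w)) (wtw G (i # w)) (\<zeta>' \<xi>)"
        unfolding \<zeta>'_def c_def e using False
        by (simp add: rn_Cons cross_step[OF \<xi> rn_space lin_wtw \<zeta>(1)[OF \<xi>] \<zeta>(1)[OF lf]])
      fix \<eta> :: "'g \<Rightarrow> complex" assume \<eta>: "clinear \<eta>"
      have lf': "clinear (\<lambda>d. \<eta> (br ?f d))" by (rule V.lin_comp_br[OF \<eta>])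
      show "\<eta> (\<zeta>' \<xi>) = - \<xi> (\<zeta>' \<eta>)"
        using \<zeta>(2)[OF \<xi> lf'] \<zeta>(2)[OF lf \<eta>]
        by (simp add: \<zeta>'_def clinear_add[OF \<xi>] clinear_diff[OF \<xi>] clinear_scale[OF \<xi>]
            clinear_add[OF \<eta>] clinear_diff[OF \<eta>] clinear_scale[OF \<eta>] scaleC_complex)
    qed
  qed
qed simp

lemma cross_zero: "clinear \<xi> \<Longrightarrow> cross \<xi> 0 \<beta> 0"
proof -
  assume \<xi>: "clinear \<xi>"
  have "V.Y k (\<lambda>d. \<xi> (br 0 d)) u = 0" for k u
    using V.Y_scale[OF clinear_const0, of k 0 u] by (simp add: br_simps clinear_zero[OF \<xi>])
  then show ?thesis using \<xi>
    by (simp add: cross_def V.act_simps V.Y_simps clinear_zero complex_vector.subspace_0[OF n_minus_subspace])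
qed

lemma cross_add:
  assumes \<xi>: "clinear \<xi>" and "cross \<xi> x \<beta> z" "cross \<xi> x' \<beta> z'"
  shows "cross \<xi> (x + x') \<beta> (z + z')"
proof -
  have "V.Y k (\<lambda>d. \<xi> (br (x + x') d)) u = V.Y k (\<lambda>d. \<xi> (br x d)) u + V.Y k (\<lambda>d. \<xi> (br x' d)) u" for k u
    using V.Y_add[OF V.lin_comp_br[OF \<xi>] V.lin_comp_br[OF \<xi>]] by (simp add: br_simps clinear_add[OF \<xi>])
  then show ?thesis
    unfolding cross_def
    using crossD(1)[OF assms(2)] crossD(1)[OF assms(3)]
    by (simp add: V.act_simps V.Y_simps[OF \<xi>] clinear_add[OF \<xi>] scaleC_distribs crossD(2)[OF assms(2)]
        crossD(2)[OF assms(3)] complex_vector.subspace_add[OF n_minus_subspace] algebra_simps)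
qed

lemma cross_scale:
  assumes \<xi>: "clinear \<xi>" and "cross \<xi> x \<beta> z"
  shows "cross \<xi> (c *\<^sub>C x) \<beta> (c *\<^sub>C z)"
proof -
  have "V.Y k (\<lambda>d. \<xi> (br (c *\<^sub>C x) d)) u = c *\<^sub>C V.Y k (\<lambda>d. \<xi> (br x d)) u" for k u
    using V.Y_scale[OF V.lin_comp_br[OF \<xi>]] by (simp add: br_simps clinear_scale[OF \<xi>] scaleC_complex)
  then show ?thesis
    unfolding cross_def
    using crossD(1)[OF assms(2)]
    by (simp add: V.act_simps V.Y_simps[OF \<xi>] clinear_scale[OF \<xi>] scaleC_complex scaleC_distribs scaleC_scaleC crossD(2)[OF assms(2)]
        complex_vector.subspace_scale[OF n_minus_subspace])
qed

text \<open>The root space is spanned by iterated brackets, and the relation as well as its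
  antisymmetry pass to linear combinations when the weight \<beta> is fixed.\<close>

lemma cross_exists:
  assumes "y \<in> n_minus_space G \<beta>"
  shows "\<exists>\<zeta>. \<forall>\<xi>. clinear \<xi> \<longrightarrow> cross \<xi> y \<beta> (\<zeta> \<xi>) \<and> (\<forall>\<eta>. clinear \<eta> \<longrightarrow> \<eta> (\<zeta> \<xi>) = - \<xi> (\<zeta> \<eta>))"
    (is "?Q y")
proof -
  have "y \<in> {y. ?Q y}"
  proof (rule subsetD[OF complex_vector.span_minimal])
    show "y \<in> cspan {rn (ff G) w | w. w \<noteq> [] \<and> wtw G w = \<beta>}" using assms n_minus_space_span by simp
    show "{rn (ff G) w | w. w \<noteq> [] \<and> wtw G w = \<beta>} \<subseteq> {y. ?Q y}" using cross_exists_rn by auto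
    show "csubspace {y. ?Q y}"
    proof (rule complex_vector.subspaceI)
      show "0 \<in> {y. ?Q y}" using cross_zero by (intro CollectI exI[of _ "\<lambda>_. 0"]) (auto simp: clinear_zero)
    next
      fix x x' assume "x \<in> {y. ?Q y}" "x' \<in> {y. ?Q y}"
      then obtain \<zeta> \<zeta>' where z:
        "\<And>\<xi>. clinear \<xi> \<Longrightarrow> cross \<xi> x \<beta> (\<zeta> \<xi>)" "\<And>\<xi> \<eta>. clinear \<xi> \<Longrightarrow> clinear \<eta> \<Longrightarrow> \<eta> (\<zeta> \<xi>) = - \<xi> (\<zeta> \<eta>)"
        "\<And>\<xi>. clinear \<xi> \<Longrightarrow> cross \<xi> x' \<beta> (\<zeta>' \<xi>)" "\<And>\<xi> \<eta>. clinear \<xi> \<Longrightarrow> clinear \<eta> \<Longrightarrow> \<eta> (\<zeta>' \<xi>) = - \<xi> (\<zeta>' \<eta>)"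
        by blast
      show "x + x' \<in> {y. ?Q y}"
      proof (intro CollectI exI[of _ "\<lambda>\<xi>. \<zeta> \<xi> + \<zeta>' \<xi>"] allI impI conjI cross_add z(1,3))
        fix \<xi> \<eta> :: "'g \<Rightarrow> complex" assume l: "clinear \<xi>" "clinear \<eta>"
        show "\<eta> (\<zeta> \<xi> + \<zeta>' \<xi>) = - \<xi> (\<zeta> \<eta> + \<zeta>' \<eta>)"
          unfolding clinear_add[OF l(1)] clinear_add[OF l(2)] z(2)[OF l] z(4)[OF l] by simp
      qed
    next
      fix c x assume "x \<in> {y. ?Q y}"
      then obtain \<zeta> where z:
        "\<And>\<xi>. clinear \<xi> \<Longrightarrow> cross \<xi> x \<beta> (\<zeta> \<xi>)" "\<And>\<xi> \<eta>. clinear \<xi> \<Longrightarrow> clinear \<eta> \<Longrightarrow> \<eta> (\<zeta> \<xi>) = - \<xi> (\<zeta> \<eta>)"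
        by blast
      show "c *\<^sub>C x \<in> {y. ?Q y}"
      proof (intro CollectI exI[of _ "\<lambda>\<xi>. c *\<^sub>C \<zeta> \<xi>"] allI impI conjI cross_scale z(1))
        fix \<xi> \<eta> :: "'g \<Rightarrow> complex" assume l: "clinear \<xi>" "clinear \<eta>"
        show "\<eta> (c *\<^sub>C \<zeta> \<xi>) = - \<xi> (c *\<^sub>C \<zeta> \<eta>)"
          unfolding clinear_scale[OF l(1)] clinear_scale[OF l(2)] z(2)[OF l] by simp
      qed
    qed
  qed
  then show ?thesis by simp
qed

text \<open>Up to sign conventions, the contraction of the cobracket of \<open>y\<close> with \<xi>.
  The weight is passed as an argument because the Cartan term of \<open>cross\<close> depends on
  it.\<close>

definition cobr :: "('g \<Rightarrow> complex) \<Rightarrow> 'g \<Rightarrow> (complex ^ 'd \<Rightarrow> complex) \<Rightarrow> 'g" where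
  "cobr \<xi> y \<beta> = (THE z. cross \<xi> y \<beta> z)"

lemma cobr_eqI: "cross \<xi> y \<beta> z \<Longrightarrow> cobr \<xi> y \<beta> = z"
  unfolding cobr_def by (rule the_equality) (auto intro: cross_unique)

lemma cross_cobr: "clinear \<xi> \<Longrightarrow> y \<in> n_minus_space G \<beta> \<Longrightarrow> cross \<xi> y \<beta> (cobr \<xi> y \<beta>)"
  using cross_exists[of y \<beta>] cobr_eqI by metis

lemma cobr_antisym:
  "clinear \<xi> \<Longrightarrow> clinear \<eta> \<Longrightarrow> y \<in> n_minus_space G \<beta> \<Longrightarrow> \<eta> (cobr \<xi> y \<beta>) = - \<xi> (cobr \<eta> y \<beta>)"
  using cross_exists[of y \<beta>] cobr_eqI by metis

text \<open>Act with h on the relation evaluated at a generating vector: all other terms have known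
  weights, so z v has weight lowered by \<beta> - \<alpha>, and faithfulness transfers this to
  z.\<close>

lemma cobr_space:
  assumes \<xi>: "clinear \<xi>" and y: "y \<in> n_minus_space G \<beta>"
    and w: "\<And>h x. x \<in> n_minus G \<Longrightarrow> \<xi> (br (hg h) x) = - \<alpha> h * \<xi> x"
  shows "cobr \<xi> y \<beta> \<in> n_minus_space G (\<lambda>h. \<beta> h - \<alpha> h)"
proof -
  let ?z = "cobr \<xi> y \<beta>"
  have c: "cross \<xi> y \<beta> ?z" by (rule cross_cobr[OF \<xi> y])
  have yn: "y \<in> n_minus G" and hy: "br (hg h) y = - (\<beta> h *\<^sub>C y)" for h using y by (auto simp: n_minus_space_def)
  have "br (hg h) ?z = - ((\<beta> h - \<alpha> h) *\<^sub>C ?z)" for h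
  proof -
    have zn: "?z \<in> n_minus G" using crossD(1)[OF c] .
    obtain k :: 'n where True by blast
    have Yy: "V.Y k \<xi> (act k y (v k)) = \<xi> y *\<^sub>C act k (hg (flat_inv G \<beta>)) (v k) + act k ?z (v k)"
      using crossD(2)[OF c, of k "v k"] \<xi> by (simp add: V.Y_v V.lin_comp_br V.act_simps)
    have "\<xi> (br (hg h) y) = - \<alpha> h * \<xi> y" by (rule w[OF yn])
    \<comment> \<open>The Cartan term is present only if \<xi> is non-zero on y, and then \<alpha>
      and \<beta> agree; so its weight fits the claim.\<close>
    then have ab: "(\<alpha> h - \<beta> h) * \<xi> y = 0"
      by (auto simp: hy clinear_minus[OF \<xi>] clinear_scale[OF \<xi>] scaleC_complex algebra_simps)
    have e1: "act k (hg h) (V.Y k \<xi> (act k y (v k))) = (\<Lambda> k h - \<beta> h + \<alpha> h) *\<^sub>C V.Y k \<xi> (act k y (v k))"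
    proof -
      have "V.Y k (\<lambda>d. \<xi> (br (hg h) d)) u = V.Y k (\<lambda>d. - \<alpha> h * \<xi> d) u" for u
        by (rule V.Y_cong[OF V.lin_comp_br[OF \<xi>] clinear_mult_left[OF \<xi>]]) (simp add: w rn_n_minus)
      moreover have "act k (hg h) (act k y (v k)) = (\<Lambda> k h - \<beta> h) *\<^sub>C act k y (v k)"
        by (simp add: V.act_swap[of k "hg h" y] V.act_h_v hy V.act_simps scaleC_distribs)
      ultimately show ?thesis
        by (simp only: V.H_Y[OF \<xi>] V.Y_scale[OF \<xi>] V.Y_simps[OF \<xi>]) (simp add: scaleC_distribs)
    qed
    have e2: "act k (hg h) (act k (hg (flat_inv G \<beta>)) (v k)) = \<Lambda> k h *\<^sub>C act k (hg (flat_inv G \<beta>)) (v k)"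
      by (simp add: V.act_h_v V.act_simps scaleC_scaleC mult.commute)
    have "act k (hg h) (act k ?z (v k)) = (\<Lambda> k h - \<beta> h + \<alpha> h) *\<^sub>C act k ?z (v k) +
       ((\<alpha> h - \<beta> h) * \<xi> y) *\<^sub>C act k (hg (flat_inv G \<beta>)) (v k)"
      using e1 unfolding Yy
      by (simp add: V.act_simps e2 scaleC_distribs scaleC_scaleC algebra_simps)
    then have "act k (br (hg h) ?z + (\<beta> h - \<alpha> h) *\<^sub>C ?z) (v k) = 0"
      by (simp add: ab V.act_simps V.act_br V.act_h_v scaleC_distribs)
    moreover have "br (hg h) ?z \<in> n_minus G"
      by (rule n_minus_br_h[OF zn])
    ultimately have "br (hg h) ?z + (\<beta> h - \<alpha> h) *\<^sub>C ?z = 0"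
      using zn by (intro V.faithful complex_vector.subspace_add[OF n_minus_subspace] complex_vector.subspace_scale[OF n_minus_subspace])
    then show ?thesis by (simp add: add_eq_0_iff2)
  qed
  then show ?thesis using crossD(1)[OF c] by (simp add: n_minus_space_def)
qed

end

section \<open>Compatibility for tensor products of Verma modules\<close>

text \<open>Shared by both halves: the indices are lowering vectors for the algebra without Serre
  relations and raising vectors for the quotient. Disjointness lets an index determine its
  root.\<close>

locale graded_index = kac_moody_algebra G for G :: "('d::finite, 'r::finite, 'g::complex_vector) km" +
  fixes X :: "(complex ^ 'd \<Rightarrow> complex) \<Rightarrow> 'b set"
  assumes fin_X: "\<beta> \<in> pos_roots G \<Longrightarrow> finite (X \<beta>)"
    and disj_X: "\<beta> \<in> pos_roots G \<Longrightarrow> \<gamma> \<in> pos_roots G \<Longrightarrow> b \<in> X \<beta> \<Longrightarrow> b \<in> X \<gamma> \<Longrightarrow> \<beta> = \<gamma>"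
begin

definition Bs where "Bs = (\<Union>\<beta>\<in>pos_roots G. X \<beta>)"
definition wt where "wt b = (THE \<beta>. \<beta> \<in> pos_roots G \<and> b \<in> X \<beta>)"
definition ht where "ht b = rht (wt b)"
definition cor where "cor b = flat_inv G (wt b)"

lemma wt_eqI: "\<beta> \<in> pos_roots G \<Longrightarrow> b \<in> X \<beta> \<Longrightarrow> wt b = \<beta>"
  unfolding wt_def by (rule the_equality) (auto intro: disj_X)

lemma wt_root: "b \<in> Bs \<Longrightarrow> wt b \<in> pos_roots G \<and> b \<in> X (wt b)"
  unfolding Bs_def using wt_eqI by auto

lemma BsI: "\<beta> \<in> pos_roots G \<Longrightarrow> b \<in> X \<beta> \<Longrightarrow> b \<in> Bs"
  unfolding Bs_def by auto

lemma wt_fiber: "\<alpha> \<in> pos_roots G \<Longrightarrow> {b\<in>Bs. wt b = \<alpha>} = X \<alpha>"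
  using wt_root BsI wt_eqI by auto

lemma finite_ht: "finite {b\<in>Bs. ht b \<le> N}"
proof -
  have "{b\<in>Bs. ht b \<le> N} \<subseteq> (\<Union>\<beta>\<in>{\<beta>\<in>pos_roots G. rht \<beta> \<le> N}. X \<beta>)"
    using wt_root by (auto simp: ht_def)
  moreover have "finite (\<Union>\<beta>\<in>{\<beta>\<in>pos_roots G. rht \<beta> \<le> N}. X \<beta>)"
    using finite_pos_roots_ht fin_X by auto
  ultimately show ?thesis by (rule finite_subset)
qed

lemma root_h0: "\<beta> \<in> pos_roots G \<Longrightarrow> \<beta> h0 = of_nat (rht \<beta>)"
  using pos_roots_wtw[of \<beta>] wtw_h0 rht_wtw by metis

lemma wt_h0: "b \<in> Bs \<Longrightarrow> wt b h0 = of_nat (ht b)"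
  unfolding ht_def using root_h0 wt_root by blast

lemma ht_add:
  assumes "a \<in> Bs" "b \<in> Bs" "c \<in> Bs" "wt c = (\<lambda>h. wt a h + wt b h)"
  shows "ht c = ht a + ht b"
proof -
  have "(of_nat (ht c) :: complex) = of_nat (ht a + ht b)"
    using assms(4) wt_h0[OF assms(1)] wt_h0[OF assms(2)] wt_h0[OF assms(3)] by simp
  then show ?thesis using of_nat_eq_iff by blast
qed

lemma lin_wt: "b \<in> Bs \<Longrightarrow> clinear (wt b)"
  using lin_pos_root wt_root by blast

text \<open>The equations sum over roots, the abstract part over basis elements under a cut-off; on
  a vector killed beyond height N the two agree.\<close>

lemma Sum_any_graded:
  fixes T :: "'b \<Rightarrow> 'v::comm_monoid_add"
  assumes T0: "\<And>b. b \<in> Bs \<Longrightarrow> N < ht b \<Longrightarrow> T b = 0"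
  shows "Sum_any (\<lambda>\<beta>. if \<beta> \<in> pos_roots G then \<Sum>x\<in>X \<beta>. T x else 0) = (\<Sum>b\<in>{b\<in>Bs. ht b \<le> N}. T b)"
    (is "Sum_any ?g = _")
proof -
  let ?B = "{b\<in>Bs. ht b \<le> N}"
  have "Sum_any ?g = (\<Sum>\<beta>\<in>wt ` ?B. ?g \<beta>)"
  proof (rule Sum_any.expand_superset)
    show "{\<beta>. ?g \<beta> \<noteq> 0} \<subseteq> wt ` ?B"
    proof
      fix \<beta> assume "\<beta> \<in> {\<beta>. ?g \<beta> \<noteq> 0}"
      then have r: "\<beta> \<in> pos_roots G" and n: "(\<Sum>x\<in>X \<beta>. T x) \<noteq> 0" by (auto split: if_splits)
      obtain x where x: "x \<in> X \<beta>" "T x \<noteq> 0" using n by (meson sum.neutral)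
      then have "x \<in> ?B" using T0[of x] BsI[OF r x(1)] by (auto simp: not_less[symmetric])
      then show "\<beta> \<in> wt ` ?B" using wt_eqI[OF r x(1)] by blast
    qed
  qed (simp add: finite_ht)
  also have "\<dots> = (\<Sum>\<beta>\<in>wt ` ?B. \<Sum>b\<in>{b\<in>?B. wt b = \<beta>}. T b)"
  proof (rule sum.cong[OF HOL.refl])
    fix \<beta> assume "\<beta> \<in> wt ` ?B"
    then obtain b where b: "b \<in> Bs" "ht b \<le> N" "wt b = \<beta>" by auto
    then have r: "\<beta> \<in> pos_roots G" using wt_root by blast
    have "{b\<in>?B. wt b = \<beta>} = {b\<in>Bs. wt b = \<beta>}" using b by (auto simp: ht_def)
    then have "{b\<in>?B. wt b = \<beta>} = X \<beta>" using wt_fiber[OF r] by simp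
    then show "?g \<beta> = (\<Sum>b\<in>{b\<in>?B. wt b = \<beta>}. T b)" using r by simp
  qed
  also have "\<dots> = (\<Sum>b\<in>?B. T b)" by (rule sum.image_gen[symmetric, OF finite_ht])
  finally show ?thesis .
qed

end

section \<open>Dual bases of the Cartan subalgebra\<close>

context kac_moody_algebra
begin

text \<open>The basis dual to the coordinate basis. The pair replaces an orthonormal basis in the
  first half, where the equations use only the form on weights.\<close>

definition hdual :: "'d \<Rightarrow> complex ^ 'd" where
  "hdual s = flat_inv G (\<lambda>x. x $ s)"

lemma clinear_component: "clinear (\<lambda>x :: complex ^ 'd. x $ s)"
  by (rule clinearI) (simp_all add: scaleC_vec_def)

lemma form_hdual: "form G (hdual s) y = y $ s"
  unfolding hdual_def by (rule form_flat_inv[OF clinear_component])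

lemma flat_inv_expand:
  assumes l: "clinear l"
  shows "flat_inv G l = (\<Sum>s\<in>UNIV. l (axis s 1) *\<^sub>C hdual s)" "flat_inv G l = (\<Sum>s\<in>UNIV. l (hdual s) *\<^sub>C axis s 1)"
proof -
  have e: "l y = (\<Sum>s\<in>UNIV. (y $ s) * l (axis s 1))" for y
    by (subst scaleC_vec_expansion[of y]) (simp add: clinear_sum[OF l] clinear_scale[OF l] scaleC_complex)
  show "flat_inv G l = (\<Sum>s\<in>UNIV. l (axis s 1) *\<^sub>C hdual s)"
    by (rule flat_inv_eqI)
      (simp add: clinear_sum[OF form_lin_left] clinear_scale[OF form_lin_left] form_hdual scaleC_complex e[symmetric] mult.commute)
  have "l (hdual s) = flat_inv G l $ s" for s
    using form_flat_inv[OF l, of "hdual s"] form_hdual[of s "flat_inv G l"] form_sym by metis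
  then show "flat_inv G l = (\<Sum>s\<in>UNIV. l (hdual s) *\<^sub>C axis s 1)"
    by (simp add: scaleC_vec_expansion[symmetric])
qed

text \<open>The matrix of the dual basis in coordinates is symmetric, because the form is.\<close>

lemma hdual_symmetric:
  assumes "cbilinear f"
  shows "(\<Sum>s\<in>UNIV. f (axis s 1) (hdual s)) = (\<Sum>s\<in>UNIV. f (hdual s) (axis s 1))"
proof -
  note r = cbilinearD(1)[OF assms] and l = cbilinearD(2)[OF assms]
  have sym: "hdual s $ t = hdual t $ s" for s t
    using form_hdual[of t "hdual s"] form_hdual[of s "hdual t"] form_sym by metis
  have "(\<Sum>s\<in>UNIV. f (axis s 1) (hdual s)) = (\<Sum>s\<in>UNIV. \<Sum>t\<in>UNIV. hdual s $ t *\<^sub>C f (axis s 1) (axis t 1))"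
    by (subst scaleC_vec_expansion) (simp add: clinear_sum[OF r] clinear_scale[OF r])
  also have "\<dots> = (\<Sum>t\<in>UNIV. \<Sum>s\<in>UNIV. hdual s $ t *\<^sub>C f (axis s 1) (axis t 1))" by (rule sum.swap)
  also have "\<dots> = (\<Sum>t\<in>UNIV. \<Sum>s\<in>UNIV. hdual t $ s *\<^sub>C f (axis s 1) (axis t 1))" by (simp only: sym)
  also have "\<dots> = (\<Sum>s\<in>UNIV. f (hdual s) (axis s 1))"
    by (subst (2) scaleC_vec_expansion) (simp add: clinear_sum[OF l] clinear_scale[OF l])
  finally show ?thesis .
qed

text \<open>Turns the scalar (wt p, wt q) in the definition of \<Omega> into the action of the
  Cartan tensor on a pair of weight vectors.\<close>

lemma dual_form_eq:
  assumes l: "clinear l" and l': "clinear l'"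
  shows "dual_form G l l' = (\<Sum>s\<in>UNIV. l (axis s 1) * l' (hdual s))"
proof -
  have "dual_form G l l' = l (flat_inv G l')" unfolding dual_form_def by (rule form_flat_inv[OF l])
  also have "\<dots> = (\<Sum>s\<in>UNIV. l (axis s 1) * l' (hdual s))"
    by (subst flat_inv_expand(2)[OF l']) (simp add: clinear_sum[OF l] clinear_scale[OF l] scaleC_complex mult.commute)
  finally show ?thesis .
qed

end

section \<open>Operators on one tensor factor and spanning sets of tensors\<close>

lemma double_ops_on_factor:
  assumes "double_ops Bs wt ht C F cor X Y H"
  shows "double_ops Bs wt ht C F cor (\<lambda>b. on_factor i (X b)) (\<lambda>b. on_factor i (Y b)) (\<lambda>h. on_factor i (H h))"
proof -
  interpret D: double_ops Bs wt ht C F cor X Y H by (rule assms)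
  note lin = D.lin_X D.lin_Y D.lin_H
  show ?thesis
  proof (rule double_ops.intro[OF D.double_data_axioms], rule double_ops_axioms.intro)
    show "clinear (on_factor i (X b))" "clinear (on_factor i (Y b))" for b by (rule clinear_on_factor, rule lin)+
    show "clinear (on_factor i (H h))" for h by (rule clinear_on_factor, rule lin)
    show "on_factor i (H h) (on_factor i (H k) u) = on_factor i (H k) (on_factor i (H h) u)" for h k u
      by (simp add: on_factor_compose lin D.H_H[of h])
    show "on_factor i (H h) (on_factor i (X b) u) = on_factor i (X b) (on_factor i (H h) u) - wt b h *\<^sub>C on_factor i (X b) u"
      if "b \<in> Bs" for b h u
      by (simp add: on_factor_compose lin D.H_X[OF that] on_factor_diff clinear_compose clinear_scaleC on_factor_scale)
    show "on_factor i (H h) (on_factor i (Y b) u) = on_factor i (Y b) (on_factor i (H h) u) + wt b h *\<^sub>C on_factor i (Y b) u"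
      if "b \<in> Bs" for b h u
      by (simp add: on_factor_compose lin D.H_Y[OF that] on_factor_add clinear_compose clinear_scaleC on_factor_scale)
    show "\<exists>N. \<forall>b\<in>Bs. N < ht b \<longrightarrow> on_factor i (Y b) u = 0" for u
    proof -
      \<comment> \<open>Local finiteness is checked on pure tensors, where it concerns one entry;
        the bound for a sum is the larger of the two bounds.\<close>
      let ?W = "{u. \<exists>N. \<forall>b\<in>Bs. N < ht b \<longrightarrow> on_factor i (Y b) u = 0}"
      note s = clinear_simps[OF clinear_on_factor[OF D.lin_Y]]
      have "csubspace ?W"
      proof (rule complex_vector.subspaceI)
        fix x y assume "x \<in> ?W" "y \<in> ?W"
        then obtain N M where "\<forall>b\<in>Bs. N < ht b \<longrightarrow> on_factor i (Y b) x = 0" "\<forall>b\<in>Bs. M < ht b \<longrightarrow> on_factor i (Y b) y = 0"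
          by blast
        then have "\<forall>b\<in>Bs. max N M < ht b \<longrightarrow> on_factor i (Y b) (x + y) = 0" by (simp add: s)
        then show "x + y \<in> ?W" by blast
      qed (auto simp: s)
      moreover have "range pure \<subseteq> ?W"
      proof (rule image_subsetI)
        fix m
        obtain N where "\<forall>b\<in>Bs. N < ht b \<longrightarrow> Y b (m i) = 0" using D.locally_finite by blast
        then have "\<forall>b\<in>Bs. N < ht b \<longrightarrow> on_factor i (Y b) (pure m) = 0" by (simp add: lin pure_zero)
        then show "pure m \<in> ?W" by blast
      qed
      ultimately have "cspan (range pure) \<subseteq> ?W" by (rule complex_vector.span_minimal[rotated])
      then show ?thesis using tpower_span by blast
    qed
    show "on_factor i (X a) (on_factor i (X b) u) - on_factor i (X b) (on_factor i (X a) u) =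
        (\<Sum>c\<in>D.BN N. C a b c *\<^sub>C on_factor i (X c) u)" if "a \<in> Bs" "b \<in> Bs" "ht a + ht b \<le> N" for a b N u
    proof -
      have "on_factor i (X a) (on_factor i (X b) u) - on_factor i (X b) (on_factor i (X a) u) =
        on_factor i (\<lambda>x. \<Sum>c\<in>D.BN N. C a b c *\<^sub>C X c x) u"
        by (simp add: on_factor_compose lin on_factor_diff[symmetric] clinear_compose D.X_X[OF that])
      then show ?thesis by (simp add: on_factor_sum on_factor_scale clinear_scaleC lin)
    qed
    show "on_factor i (Y a) (on_factor i (Y b) u) - on_factor i (Y b) (on_factor i (Y a) u) =
        (\<Sum>c\<in>D.BN N. F a b c *\<^sub>C on_factor i (Y c) u)" if "a \<in> Bs" "b \<in> Bs" "ht a + ht b \<le> N" for a b N u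
    proof -
      have "on_factor i (Y a) (on_factor i (Y b) u) - on_factor i (Y b) (on_factor i (Y a) u) =
        on_factor i (\<lambda>x. \<Sum>c\<in>D.BN N. F a b c *\<^sub>C Y c x) u"
        by (simp add: on_factor_compose lin on_factor_diff[symmetric] clinear_compose D.Y_Y[OF that])
      then show ?thesis by (simp add: on_factor_sum on_factor_scale clinear_scaleC lin)
    qed
    show "on_factor i (Y a) (on_factor i (X b) u) - on_factor i (X b) (on_factor i (Y a) u) =
        (if a = b then on_factor i (H (cor a)) u else 0) + (\<Sum>c\<in>D.BN N. C b c a *\<^sub>C on_factor i (Y c) u) +
        (\<Sum>c\<in>D.BN N. F c a b *\<^sub>C on_factor i (X c) u)" if "a \<in> D.BN N" "b \<in> D.BN N" for a b N u
    proof -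
      have "on_factor i (Y a) (on_factor i (X b) u) - on_factor i (X b) (on_factor i (Y a) u) =
        on_factor i (\<lambda>x. (if a = b then H (cor a) x else 0) + (\<Sum>c\<in>D.BN N. C b c a *\<^sub>C Y c x) +
          (\<Sum>c\<in>D.BN N. F c a b *\<^sub>C X c x)) u"
        by (simp add: on_factor_compose lin on_factor_diff[symmetric] clinear_compose D.Y_X[OF that])
      then show ?thesis
        by (cases "a = b")
          (simp_all add: on_factor_sum on_factor_scale on_factor_add clinear_scaleC clinear_plus clinear_sum_fun lin)
    qed
  qed
qed

text \<open>The entries are replaced one factor at a time; \<open>A\<close> holds the factors whose
  entries are still arbitrary.\<close>

lemma tpower_span_pure:
  assumes "\<And>k. cspan (S k) = UNIV"
  shows "u \<in> cspan {pure m | m. \<forall>k :: 'n::finite. m k \<in> S k}"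
proof -
  let ?P = "{pure m | m. \<forall>k. m k \<in> S k}"
  have "pure m \<in> cspan ?P" if "finite A" "\<forall>k. k \<notin> A \<longrightarrow> m k \<in> S k" for A m
    using that
  proof (induction A arbitrary: m rule: finite_induct)
    case empty
    then show ?case by (auto intro!: complex_vector.span_base)
  next
    case (insert a A)
    have "pure (m(a := x)) \<in> cspan ?P" for x
    proof (rule clinear_span_image[OF clinear_pure _ complex_vector.subspace_span])
      show "x \<in> cspan (S a)" using assms by simp
      show "pure (m(a := x)) \<in> cspan ?P" if "x \<in> S a" for x
        by (rule insert.IH) (use insert.prems that in auto)
    qed
    from this[of "m a"] show ?case by simp
  qed
  from this[of UNIV] have "range pure \<subseteq> cspan ?P" by auto
  then have "cspan (range pure) \<subseteq> cspan ?P" by (rule complex_vector.span_minimal[OF _ complex_vector.subspace_span])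
  then show ?thesis using tpower_span by blast
qed

section \<open>Weight spaces of the tensor product of Verma modules\<close>

context verma_family
begin

definition hvec :: "('n \<Rightarrow> 'r list) \<Rightarrow> ('n, 'm) tpower" where
  "hvec ws = pure (\<lambda>k. V.wv k (ws k))"

lemma hvec_span: "u \<in> cspan (range hvec)"
proof -
  have "u \<in> cspan {pure m | m. \<forall>k. m k \<in> range (V.wv k)}"
    by (rule tpower_span_pure) (use V.wv_span in auto)
  also have "{pure m | m. \<forall>k. m k \<in> range (V.wv k)} \<subseteq> range hvec"
  proof
    fix x assume "x \<in> {pure m | m. \<forall>k. m k \<in> range (V.wv k)}"
    then obtain m where m: "x = pure m" "\<forall>k. \<exists>w. m k = V.wv k w" by (auto simp: image_iff)
    then obtain ws where "\<And>k. m k = V.wv k (ws k)" by metis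
    then have "m = (\<lambda>k. V.wv k (ws k))" by auto
    then show "x \<in> range hvec" using m by (auto simp: hvec_def)
  qed
  then have "cspan {pure m | m. \<forall>k. m k \<in> range (V.wv k)} \<subseteq> cspan (range hvec)" by (rule complex_vector.span_mono)
  finally show ?thesis .
qed

definition hfac :: "'n \<Rightarrow> complex ^ 'd \<Rightarrow> ('n, 'm) tpower \<Rightarrow> ('n, 'm) tpower" where
  "hfac k h = on_factor k (act k (hg h))"

lemma lin_hfac: "clinear (hfac k h)" unfolding hfac_def by (rule clinear_on_factor[OF V.lin_act])

definition htot :: "complex ^ 'd \<Rightarrow> ('n, 'm) tpower \<Rightarrow> ('n, 'm) tpower" where
  "htot h u = (\<Sum>k\<in>UNIV. hfac k h u)"

lemma lin_htot: "clinear (htot h)"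
  unfolding htot_def by (intro clinear_sum_fun lin_hfac)

lemma hfac_hvec: "hfac k h (hvec ws) = (\<Lambda> k h - wtw G (ws k) h) *\<^sub>C hvec ws"
proof -
  let ?m = "\<lambda>k. V.wv k (ws k)"
  have "hfac k h (hvec ws) = pure (?m(k := act k (hg h) (?m k)))"
    unfolding hfac_def hvec_def by (rule on_factor_pure[OF V.lin_act])
  also have "\<dots> = (\<Lambda> k h - wtw G (ws k) h) *\<^sub>C pure (?m(k := ?m k))"
    by (simp only: V.act_h_wv pure_scale)
  finally show ?thesis using fun_upd_triv[of ?m k] by (simp only: hvec_def)
qed

definition hwt :: "('n \<Rightarrow> 'r list) \<Rightarrow> complex ^ 'd \<Rightarrow> complex" where
  "hwt ws h = (\<Sum>k\<in>UNIV. \<Lambda> k h - wtw G (ws k) h)"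

lemma htot_hvec: "weight_vec htot (hwt ws) (hvec ws)"
  by (simp add: weight_vec_def htot_def hfac_hvec hwt_def complex_vector.scale_sum_left)

text \<open>The value of a weight at the grading element fixes the total number of letters, and the
  alphabet is finite.\<close>

lemma finite_hwt: "finite {ws. hwt ws = l}"
proof (cases "\<exists>ws. hwt ws = l")
  case True
  then obtain ws0 where ws0: "hwt ws0 = l" by blast
  define n where "n = (\<Sum>k\<in>UNIV. length (ws0 k))"
  have h: "hwt ws h0 = (\<Sum>k\<in>UNIV. \<Lambda> k h0) - of_nat (\<Sum>k\<in>UNIV. length (ws k))" for ws
    by (simp add: hwt_def sum_subtractf wtw_h0)
  have "{ws. hwt ws = l} \<subseteq> PiE UNIV (\<lambda>_. {w. set w \<subseteq> UNIV \<and> length w \<le> n})"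
  proof
    fix ws assume "ws \<in> {ws. hwt ws = l}"
    then have "of_nat (\<Sum>k\<in>UNIV. length (ws k)) = (of_nat n :: complex)"
      using h[of ws] h[of ws0] ws0 unfolding n_def by simp
    then have "(\<Sum>k\<in>UNIV. length (ws k)) = n" using of_nat_eq_iff by blast
    then have "length (ws k) \<le> n" for k using member_le_sum[of k UNIV "\<lambda>k. length (ws k)"] by simp
    then show "ws \<in> PiE UNIV (\<lambda>_. {w. set w \<subseteq> UNIV \<and> length w \<le> n})" by auto
  qed
  moreover have "finite (PiE (UNIV :: 'n set) (\<lambda>_. {w :: 'r list. set w \<subseteq> UNIV \<and> length w \<le> n}))"
    by (intro finite_PiE finite_lists_length_le) auto
  ultimately show ?thesis by (rule finite_subset)
qed simp

lemma htot_weight_space: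
  "{w. \<forall>h. htot h w = l h *\<^sub>C w} \<subseteq> cspan (hvec ` {ws. hwt ws = l})"
proof
  fix w assume "w \<in> {w. \<forall>h. htot h w = l h *\<^sub>C w}"
  then have w: "weight_vec htot l w" by (simp add: weight_vec_def)
  have S: "\<exists>l. weight_vec htot l s" if "s \<in> range hvec" for s using that htot_hvec by blast
  have "w \<in> cspan {s \<in> range hvec. weight_vec htot l s}"
    by (rule weight_span[OF lin_htot S hvec_span w])
  also have "{s \<in> range hvec. weight_vec htot l s} \<subseteq> insert 0 (hvec ` {ws. hwt ws = l})"
  proof
    fix s assume "s \<in> {s \<in> range hvec. weight_vec htot l s}"
    then obtain ws where s: "s = hvec ws" "weight_vec htot l s" by blast
    show "s \<in> insert 0 (hvec ` {ws. hwt ws = l})"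
    proof (cases "s = 0")
      case False
      have "l h *\<^sub>C s = hwt ws h *\<^sub>C s" for h
        using htot_hvec[of ws] s unfolding weight_vec_def by metis
      then have "hwt ws h = l h" for h using False by (simp only: complex_vector.scale_cancel_right simp_thms)
      then have "hwt ws = l" by (intro ext)
      then show ?thesis using s by blast
    qed simp
  qed
  then have "cspan {s \<in> range hvec. weight_vec htot l s} \<subseteq> cspan (hvec ` {ws. hwt ws = l})"
    by (drule_tac complex_vector.span_mono) (simp only: complex_vector.span_insert_0)
  finally show "w \<in> cspan (hvec ` {ws. hwt ws = l})" .
qed

end

section \<open>Structure constants of the double of \<open>n_minus\<close>\<close>

locale verma_basis = verma_family G \<Lambda> act v
  for G :: "('d::finite, 'r::finite, 'g::complex_vector) km" and \<Lambda> :: "'n::finite \<Rightarrow> complex ^ 'd \<Rightarrow> complex"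
    and act :: "'n \<Rightarrow> 'g \<Rightarrow> 'm \<Rightarrow> 'm::complex_vector" and v +
  fixes X :: "(complex ^ 'd \<Rightarrow> complex) \<Rightarrow> 'g set"
  assumes basis: "\<beta> \<in> pos_roots G \<Longrightarrow> is_basis (X \<beta>) (n_minus_space G \<beta>)"
begin

lemma X_space: "\<beta> \<in> pos_roots G \<Longrightarrow> b \<in> X \<beta> \<Longrightarrow> b \<in> n_minus_space G \<beta> \<and> b \<noteq> 0"
  using basis[of \<beta>] complex_vector.span_base[of b "X \<beta>"] complex_vector.dependent_zero[of "X \<beta>"]
  by (auto simp: is_basis_def)

lemma n_minus_space_disjoint:
  assumes "b \<in> n_minus_space G \<beta>" "b \<in> n_minus_space G \<gamma>" "b \<noteq> 0"
  shows "\<beta> = \<gamma>"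
proof
  fix h
  have "- (\<beta> h *\<^sub>C b) = - (\<gamma> h *\<^sub>C b)" using assms by (simp add: n_minus_space_def)
  then show "\<beta> h = \<gamma> h" using assms(3) by simp
qed

sublocale graded_index G X
proof (rule graded_index.intro[OF kac_moody_algebra_axioms], rule graded_index_axioms.intro)
  show "finite (X \<beta>)" if "\<beta> \<in> pos_roots G" for \<beta>
    by (rule is_basis_finite[OF basis[OF that] _ finite_n_minus_space[of \<beta>]]) (simp add: n_minus_space_span)
  show "\<beta> = \<gamma>" if "\<beta> \<in> pos_roots G" "\<gamma> \<in> pos_roots G" "b \<in> X \<beta>" "b \<in> X \<gamma>" for \<beta> \<gamma> b
    using n_minus_space_disjoint X_space that by blast
qed

lemma Bs_space: "b \<in> Bs \<Longrightarrow> b \<in> n_minus_space G (wt b)" and Bs_nz: "b \<in> Bs \<Longrightarrow> b \<noteq> 0"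
  using wt_root X_space by blast+

lemma Bs_independent: "\<not> complex_vector.dependent Bs"
  unfolding Bs_def
proof (rule weight_union_independent[where \<theta> = "\<lambda>\<beta> h. - \<beta> h", OF lin_adh])
  show "weight_vec adh (\<lambda>h. - \<beta> h) x" if "\<beta> \<in> pos_roots G" "x \<in> X \<beta>" for \<beta> x
    using X_space[OF that] by (simp add: n_minus_space_iff)
  show "inj_on (\<lambda>\<beta> h. - \<beta> h) (pos_roots G)" by (auto simp: inj_on_def fun_eq_iff)
  show "\<not> complex_vector.dependent (X \<beta>)" if "\<beta> \<in> pos_roots G" for \<beta> using basis[OF that] by (simp add: is_basis_def)
qed

definition xi :: "'g \<Rightarrow> 'g \<Rightarrow> complex" where "xi b = dual_vec G X b"

lemma lin_xi: "clinear (xi b)"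
  unfolding xi_def dual_vec_def Bs_def[symmetric] by (rule complex_vector_pair.linear_construct[OF Bs_independent])

lemma xi_Bs: "b' \<in> Bs \<Longrightarrow> xi b b' = (if b' = b then 1 else 0)"
  unfolding xi_def dual_vec_def Bs_def[symmetric] by (rule complex_vector_pair.construct_basis[OF Bs_independent])

lemma space_span:
  assumes "y \<in> n_minus_space G \<beta>"
  shows "(\<beta> \<in> pos_roots G \<and> y \<in> cspan (X \<beta>)) \<or> y = 0"
proof (cases "\<beta> \<in> pos_roots G")
  case True
  then show ?thesis using basis[OF True] assms by (simp add: is_basis_def)
next
  case False
  then have "n_minus_space G \<beta> = {0}" by (simp only: pos_roots_iff simp_thms)
  then show ?thesis using assms by blast
qed

lemma expand:
  assumes y: "y \<in> n_minus_space G \<beta>" and N: "\<beta> \<in> pos_roots G \<Longrightarrow> rht \<beta> \<le> N"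
  shows "y = (\<Sum>c\<in>{b\<in>Bs. ht b \<le> N}. xi c y *\<^sub>C c)"
proof -
  have lin: "clinear (\<lambda>y. \<Sum>c\<in>{b\<in>Bs. ht b \<le> N}. xi c y *\<^sub>C c)"
    by (intro clinear_sum_fun clinear_scaleC_left lin_xi)
  consider "\<beta> \<in> pos_roots G" "y \<in> cspan (X \<beta>)" | "y = 0" using space_span[OF y] by blast
  then show ?thesis
  proof cases
    case 1
    show ?thesis
    proof (rule clinear_eq_on_span[OF clinear_ident lin _ 1(2)])
      fix x assume x: "x \<in> X \<beta>"
      then have xB: "x \<in> Bs" "ht x \<le> N" using BsI[OF 1(1) x] wt_eqI[OF 1(1) x] N[OF 1(1)] by (auto simp: ht_def)
      have "(\<Sum>c\<in>{b\<in>Bs. ht b \<le> N}. xi c x *\<^sub>C c) = (\<Sum>c\<in>{b\<in>Bs. ht b \<le> N}. if c = x then x else 0)"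
        by (rule sum.cong) (auto simp: xi_Bs[OF xB(1)])
      then show "x = (\<Sum>c\<in>{b\<in>Bs. ht b \<le> N}. xi c x *\<^sub>C c)" using xB finite_ht[of N] by simp
    qed
  qed (simp add: clinear_zero[OF lin] clinear_zero[OF lin_xi])
qed

lemma xi_wt:
  assumes y: "y \<in> n_minus_space G \<beta>" and c: "c \<in> Bs" "xi c y \<noteq> 0"
  shows "wt c = \<beta>"
proof (rule ccontr)
  assume n: "wt c \<noteq> \<beta>"
  have "y \<noteq> 0" using c clinear_zero[OF lin_xi] by auto
  then have 1: "\<beta> \<in> pos_roots G" "y \<in> cspan (X \<beta>)" using space_span[OF y] by auto
  have "xi c y = 0"
  proof (rule clinear_eq_on_span[OF lin_xi clinear_const0 _ 1(2)])
    show "xi c x = 0" if "x \<in> X \<beta>" for x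
      using that xi_Bs[OF BsI[OF 1(1) that], of c] wt_eqI[OF 1(1) that] n by auto
  qed
  then show False using c by simp
qed

lemma xi_h:
  assumes b: "b \<in> Bs" and x: "x \<in> n_minus G"
  shows "xi b (br (hg h) x) = - wt b h * xi b x"
proof (rule clinear_eq_on_span[where S = "{rn (ff G) w | w. w \<noteq> []}"])
  show "clinear (\<lambda>x. xi b (br (hg h) x))" by (rule clinear_compose[OF lin_xi lin_br_right])
  show "clinear (\<lambda>x. - wt b h * xi b x)" by (rule clinear_mult_left[OF lin_xi])
  show "x \<in> cspan {rn (ff G) w | w. w \<noteq> []}" using x by (simp add: n_minus_span)
  fix y assume "y \<in> {rn (ff G) w | w. w \<noteq> []}"
  then obtain w where w: "y = rn (ff G) w" by blast
  show "xi b (br (hg h) y) = - wt b h * xi b y"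
    using xi_wt[OF rn_space b, of w]
    by (cases "xi b y = 0") (auto simp: w br_h_rn_f clinear_scale[OF lin_xi] clinear_minus[OF lin_xi] scaleC_complex)
qed

text \<open>Coefficients of the bracket of \<open>n_minus\<close> and, in \<open>Fs\<close>, of its
  cobracket. They are cut to zero off \<open>Bs\<close> so that grading and antisymmetry hold
  without side conditions.\<close>

definition Cs where "Cs a b c = (if a \<in> Bs \<and> b \<in> Bs \<and> c \<in> Bs then xi c (br a b) else 0)"
definition Fs where "Fs a b c = (if a \<in> Bs \<and> b \<in> Bs \<and> c \<in> Bs then xi a (cobr (xi b) c (wt c)) else 0)"

lemma cobr_xi_space: "b \<in> Bs \<Longrightarrow> c \<in> Bs \<Longrightarrow> cobr (xi b) c (wt c) \<in> n_minus_space G (\<lambda>h. wt c h - wt b h)"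
  by (rule cobr_space[OF lin_xi Bs_space]) (auto simp: xi_h)

sublocale double_data Bs wt ht Cs Fs cor
proof
  show "finite {b\<in>Bs. ht b \<le> N}" for N by (rule finite_ht)
  show "ht a = ht b \<and> cor a = cor b" if "wt a = wt b" for a b using that by (simp add: ht_def cor_def)
  show "ht c = ht a + ht b \<and> wt c = (\<lambda>h. wt a h + wt b h)" if "Cs a b c \<noteq> 0" for a b c
  proof -
    have B: "a \<in> Bs" "b \<in> Bs" "c \<in> Bs" "xi c (br a b) \<noteq> 0" using that by (auto simp: Cs_def split: if_splits)
    have "wt c = (\<lambda>h. wt a h + wt b h)"
      by (rule xi_wt[OF n_minus_space_br[OF Bs_space Bs_space] B(3,4)]) (use B in auto)
    then show ?thesis using ht_add B by blast
  qed
  show "ht c = ht a + ht b \<and> wt c = (\<lambda>h. wt a h + wt b h)" if "Fs a b c \<noteq> 0" for a b c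
  proof -
    have B: "a \<in> Bs" "b \<in> Bs" "c \<in> Bs" "xi a (cobr (xi b) c (wt c)) \<noteq> 0" using that by (auto simp: Fs_def split: if_splits)
    have "wt a = (\<lambda>h. wt c h - wt b h)" by (rule xi_wt[OF cobr_xi_space B(1,4)]) (use B in auto)
    then have "wt c = (\<lambda>h. wt a h + wt b h)" by simp
    then show ?thesis using ht_add B by blast
  qed
  show "Cs b a c = - Cs a b c" for a b c
    by (simp add: Cs_def br_swap[of b a] clinear_minus[OF lin_xi])
  show "Fs b a c = - Fs a b c" for a b c
    using cobr_antisym[OF lin_xi[of b] lin_xi[of a] Bs_space[of c]] by (simp add: Fs_def)
qed

lemma n_minus_Bs:
  assumes "w \<noteq> []"
  shows "rn (ff G) w \<in> cspan Bs"
  using space_span[OF rn_space[of w]] complex_vector.span_mono[of "X (wtw G w)" Bs]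
  by (auto simp: Bs_def complex_vector.span_zero)

lemma Y_cong_Bs:
  assumes "clinear \<xi>" "clinear \<eta>" "\<And>c. c \<in> Bs \<Longrightarrow> \<xi> c = \<eta> c"
  shows "V.Y k \<xi> u = V.Y k \<eta> u"
  by (rule V.Y_cong[OF assms(1,2)]) (rule clinear_eq_on_span[OF assms n_minus_Bs])

lemma Y_sum:
  assumes "finite A" "\<And>a. a \<in> A \<Longrightarrow> clinear (\<xi> a)"
  shows "V.Y k (\<lambda>d. \<Sum>a\<in>A. c a * \<xi> a d) u = (\<Sum>a\<in>A. c a *\<^sub>C V.Y k (\<xi> a) u)"
  using assms
proof (induction A)
  case empty
  then show ?case using V.Y_scale[OF clinear_const0, of k 0 u] by simp
next
  case (insert a A)
  have l: "clinear (\<lambda>d. c a * \<xi> a d)" and l': "clinear (\<lambda>d. \<Sum>a\<in>A. c a * \<xi> a d)"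
    by (intro clinear_sum_fun clinear_mult_left insert; simp add: insert)+
  show ?case using insert by (simp add: V.Y_add[OF l l'] V.Y_scale)
qed

lemma Y_expand:
  assumes \<xi>: "clinear \<xi>" and "\<And>c. c \<in> Bs \<Longrightarrow> N < ht c \<Longrightarrow> \<xi> c = 0"
  shows "V.Y k \<xi> u = (\<Sum>c\<in>BN N. \<xi> c *\<^sub>C V.Y k (xi c) u)"
proof -
  have l: "clinear (\<lambda>d. \<Sum>c\<in>BN N. \<xi> c * xi c d)" by (intro clinear_sum_fun clinear_mult_left lin_xi)
  have "V.Y k \<xi> u = V.Y k (\<lambda>d. \<Sum>c\<in>BN N. \<xi> c * xi c d) u"
  proof (rule Y_cong_Bs[OF \<xi> l])
    fix b assume b: "b \<in> Bs"
    have "(\<Sum>c\<in>BN N. \<xi> c * xi c b) = (\<Sum>c\<in>BN N. if c = b then \<xi> b else 0)"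
      by (rule sum.cong) (auto simp: xi_Bs[OF b])
    also have "\<dots> = (if b \<in> BN N then \<xi> b else 0)" by simp
    finally show "\<xi> b = (\<Sum>c\<in>BN N. \<xi> c * xi c b)" using assms(2)[OF b] b by (auto simp: BN_def)
  qed
  also have "\<dots> = (\<Sum>c\<in>BN N. \<xi> c *\<^sub>C V.Y k (xi c) u)" by (rule Y_sum) (auto simp: lin_xi)
  finally show ?thesis .
qed

text \<open>The Lie bracket of functionals dual to the cobracket, prescribed on the basis and
  extended linearly.\<close>

definition brace :: "('g \<Rightarrow> complex) \<Rightarrow> ('g \<Rightarrow> complex) \<Rightarrow> 'g \<Rightarrow> complex" where
  "brace \<xi> \<eta> = complex_vector_pair.construct Bs (\<lambda>c. \<xi> (cobr \<eta> c (wt c)))"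

lemma lin_brace: "clinear (brace \<xi> \<eta>)"
  unfolding brace_def by (rule complex_vector_pair.linear_construct[OF Bs_independent])

lemma brace_Bs: "c \<in> Bs \<Longrightarrow> brace \<xi> \<eta> c = \<xi> (cobr \<eta> c (wt c))"
  unfolding brace_def by (rule complex_vector_pair.construct_basis[OF Bs_independent])

text \<open>Both sides are linear in y within one root space: for \<open>cobr\<close> this follows
  from the uniqueness of its value.\<close>

lemma brace_space:
  assumes \<xi>: "clinear \<xi>" and \<eta>: "clinear \<eta>" and y: "y \<in> n_minus_space G \<beta>"
  shows "brace \<xi> \<eta> y = \<xi> (cobr \<eta> y \<beta>)"
proof -
  consider "\<beta> \<in> pos_roots G" "y \<in> cspan (X \<beta>)" | "y = 0" using space_span[OF y] by blast
  then show ?thesis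
  proof cases
    case 1
    let ?W = "{y\<in>n_minus_space G \<beta>. brace \<xi> \<eta> y = \<xi> (cobr \<eta> y \<beta>)}"
    have "csubspace ?W"
    proof (rule complex_vector.subspaceI)
      have "cobr \<eta> 0 \<beta> = 0" by (rule cobr_eqI[OF cross_zero[OF \<eta>]])
      then show "0 \<in> ?W"
        by (simp add: clinear_zero[OF lin_brace] clinear_zero[OF \<xi>] complex_vector.subspace_0[OF n_minus_space_subspace])
    next
      fix x y assume xy: "x \<in> ?W" "y \<in> ?W"
      then have "cobr \<eta> (x + y) \<beta> = cobr \<eta> x \<beta> + cobr \<eta> y \<beta>"
        by (intro cobr_eqI cross_add[OF \<eta>] cross_cobr[OF \<eta>]) auto
      then show "x + y \<in> ?W" using xy
        by (simp add: clinear_add[OF lin_brace] clinear_add[OF \<xi>] complex_vector.subspace_add[OF n_minus_space_subspace])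
    next
      fix c x assume x: "x \<in> ?W"
      then have "cobr \<eta> (c *\<^sub>C x) \<beta> = c *\<^sub>C cobr \<eta> x \<beta>"
        by (intro cobr_eqI cross_scale[OF \<eta>] cross_cobr[OF \<eta>]) auto
      then show "c *\<^sub>C x \<in> ?W" using x
        by (simp add: clinear_scale[OF lin_brace] clinear_scale[OF \<xi>] complex_vector.subspace_scale[OF n_minus_space_subspace])
    qed
    moreover have "X \<beta> \<subseteq> ?W" using X_space[OF 1(1)] brace_Bs[OF BsI[OF 1(1)]] wt_eqI[OF 1(1)] by auto
    ultimately show ?thesis using 1(2) complex_vector.span_minimal by blast
  next
    case 2
    have "cobr \<eta> 0 \<beta> = 0" by (rule cobr_eqI[OF cross_zero[OF \<eta>]])
    then show ?thesis by (simp add: 2 clinear_zero[OF lin_brace] clinear_zero[OF \<xi>])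
  qed
qed

text \<open>Induction on words: moving both operators past f_i produces the same terms as the
  recursion of \<open>Y\<close> for the bracket of functionals, whose composite with
  \<open>[f_i, -]\<close> is given by the cocycle formula. Thus no separate proof of coassociativity
  is made.\<close>

lemma Y_brace:
  "clinear \<xi> \<Longrightarrow> clinear \<eta> \<Longrightarrow> V.Y k \<xi> (V.Y k \<eta> u) - V.Y k \<eta> (V.Y k \<xi> u) = V.Y k (brace \<xi> \<eta>) u"
proof -
  have words: "V.Y k \<xi> (V.Y k \<eta> (V.wv k w)) - V.Y k \<eta> (V.Y k \<xi> (V.wv k w)) = V.Y k (brace \<xi> \<eta>) (V.wv k w)"
    if "clinear \<xi>" "clinear \<eta>" for \<xi> \<eta> w
    using that
  proof (induction w arbitrary: \<xi> \<eta>)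
    case Nil
    then show ?case by (simp add: V.Y_v lin_brace V.Y_simps)
  next
    case (Cons i w)
    note \<xi> = Cons.prems(1) and \<eta> = Cons.prems(2)
    let ?f = "ff G i" and ?a = "hcoroot G i" and ?u = "V.wv k w"
    let ?\<xi>f = "\<lambda>d. \<xi> (br ?f d)" and ?\<eta>f = "\<lambda>d. \<eta> (br ?f d)"
    let ?\<xi>h = "\<lambda>d. \<xi> (br (hg ?a) d)" and ?\<eta>h = "\<lambda>d. \<eta> (br (hg ?a) d)"
    have lf: "clinear ?\<xi>f" "clinear ?\<eta>f" "clinear ?\<xi>h" "clinear ?\<eta>h"
      using V.lin_comp_br \<xi> \<eta> by auto
    have bf: "brace \<xi> \<eta> ?f = 0"
      by (simp add: brace_space[OF \<xi> \<eta> ff_space] cobr_eqI[OF cross_f[OF \<eta>]] clinear_zero[OF \<xi>])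
    have lb: "clinear (\<lambda>d. brace \<xi> \<eta> (br ?f d))" by (rule V.lin_comp_br[OF lin_brace])
    \<comment> \<open>The bracket of functionals composed with the bracket by f_i: a derivation-like
      pair of terms, corrected by two Cartan terms because f_i has a non-trivial Cartan part under
      \<open>nu_minus\<close>.\<close>
    let ?\<zeta> = "\<lambda>d. (\<eta> ?f * ?\<xi>h d + (- \<xi> ?f) * ?\<eta>h d) + (brace ?\<xi>f \<eta> d + brace \<xi> ?\<eta>f d)"
    have l\<zeta>: "clinear (\<lambda>d. \<eta> ?f * ?\<xi>h d)" "clinear (\<lambda>d. (- \<xi> ?f) * ?\<eta>h d)"
      by (rule clinear_mult_left[OF lf(3)], rule clinear_mult_left[OF lf(4)])
    have "V.Y k (\<lambda>d. brace \<xi> \<eta> (br ?f d)) ?u = V.Y k ?\<zeta> ?u"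
    proof (rule V.Y_cong[OF lb clinear_plus[OF clinear_plus[OF l\<zeta>] clinear_plus[OF lin_brace lin_brace]]])
      fix w' :: "'r list" assume w': "w' \<noteq> []"
      let ?y = "rn (ff G) w'" and ?\<beta> = "wtw G w'"
      let ?c = "sroot G i (flat_inv G ?\<beta>)"
      have y: "?y \<in> n_minus_space G ?\<beta>" by (rule rn_space)
      have fy: "br ?f ?y \<in> n_minus_space G (\<lambda>h. sroot G i h + ?\<beta> h)" by (rule n_minus_space_br[OF ff_space y])
      have rec: "cobr \<eta> (br ?f ?y) (\<lambda>h. sroot G i h + ?\<beta> h) =
        (\<eta> ?y * ?c) *\<^sub>C ?f + br ?f (cobr \<eta> ?y ?\<beta>) + cobr ?\<eta>f ?y ?\<beta> - (\<eta> ?f * ?c) *\<^sub>C ?y"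
        by (intro cobr_eqI cross_step \<eta> y lin_wtw cross_cobr lf)
      have "?\<beta> ?a = form G (flat_inv G ?\<beta>) ?a" by (simp add: form_flat_inv[OF lin_wtw])
      also have "\<dots> = form G ?a (flat_inv G ?\<beta>)" by (rule form_sym)
      also have "\<dots> = ?c" by (simp add: hcoroot_def form_flat_inv[OF lin_sroot])
      finally have hy: "br (hg ?a) ?y = - (?c *\<^sub>C ?y)" by (simp add: br_h_rn_f)
      show "brace \<xi> \<eta> (br ?f ?y) = ?\<zeta> ?y"
        unfolding brace_space[OF \<xi> \<eta> fy] rec brace_space[OF lf(1) \<eta> y] brace_space[OF \<xi> lf(2) y] hy
        by (simp add: clinear_add[OF \<xi>] clinear_diff[OF \<xi>] clinear_scale[OF \<xi>] clinear_minus[OF \<xi>]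
            clinear_scale[OF \<eta>] clinear_minus[OF \<eta>] scaleC_complex)
    qed
    also have "\<dots> = (\<eta> ?f *\<^sub>C V.Y k ?\<xi>h ?u + (- \<xi> ?f) *\<^sub>C V.Y k ?\<eta>h ?u) + (V.Y k (brace ?\<xi>f \<eta>) ?u + V.Y k (brace \<xi> ?\<eta>f) ?u)"
      by (simp only: V.Y_add[OF clinear_plus[OF l\<zeta>] clinear_plus[OF lin_brace lin_brace]] V.Y_add[OF l\<zeta>]
          V.Y_add[OF lin_brace lin_brace] V.Y_scale[OF lf(3)] V.Y_scale[OF lf(4)])
    finally have e: "V.Y k (\<lambda>d. brace \<xi> \<eta> (br ?f d)) ?u =
      (\<eta> ?f *\<^sub>C V.Y k ?\<xi>h ?u - \<xi> ?f *\<^sub>C V.Y k ?\<eta>h ?u) + (V.Y k (brace ?\<xi>f \<eta>) ?u + V.Y k (brace \<xi> ?\<eta>f) ?u)"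
      by simp
    have 1: "V.Y k \<xi> (V.Y k \<eta> (act k ?f ?u)) =
      \<eta> ?f *\<^sub>C (act k (hg ?a) (V.Y k \<xi> ?u) + V.Y k ?\<xi>h ?u) +
      (\<xi> ?f *\<^sub>C act k (hg ?a) (V.Y k \<eta> ?u) + act k ?f (V.Y k \<xi> (V.Y k \<eta> ?u)) + V.Y k ?\<xi>f (V.Y k \<eta> ?u)) +
      V.Y k \<xi> (V.Y k ?\<eta>f ?u)"
      using V.H_Y[OF \<xi>, of k ?a ?u] by (simp add: V.Y_f[OF \<eta>] V.Y_f[OF \<xi>] V.Y_simps[OF \<xi>])
    have 2: "V.Y k \<eta> (V.Y k \<xi> (act k ?f ?u)) =
      \<xi> ?f *\<^sub>C (act k (hg ?a) (V.Y k \<eta> ?u) + V.Y k ?\<eta>h ?u) +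
      (\<eta> ?f *\<^sub>C act k (hg ?a) (V.Y k \<xi> ?u) + act k ?f (V.Y k \<eta> (V.Y k \<xi> ?u)) + V.Y k ?\<eta>f (V.Y k \<xi> ?u)) +
      V.Y k \<eta> (V.Y k ?\<xi>f ?u)"
      using V.H_Y[OF \<eta>, of k ?a ?u] by (simp add: V.Y_f[OF \<eta>] V.Y_f[OF \<xi>] V.Y_simps[OF \<eta>])
    have "V.Y k \<xi> (V.Y k \<eta> (act k ?f ?u)) - V.Y k \<eta> (V.Y k \<xi> (act k ?f ?u)) =
      (\<eta> ?f *\<^sub>C V.Y k ?\<xi>h ?u - \<xi> ?f *\<^sub>C V.Y k ?\<eta>h ?u) +
      act k ?f (V.Y k \<xi> (V.Y k \<eta> ?u) - V.Y k \<eta> (V.Y k \<xi> ?u)) +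
      ((V.Y k ?\<xi>f (V.Y k \<eta> ?u) - V.Y k \<eta> (V.Y k ?\<xi>f ?u)) + (V.Y k \<xi> (V.Y k ?\<eta>f ?u) - V.Y k ?\<eta>f (V.Y k \<xi> ?u)))"
      unfolding 1 2 by (simp add: scaleC_distribs V.act_simps algebra_simps)
    also have "\<dots> = act k ?f (V.Y k (brace \<xi> \<eta>) ?u) + V.Y k (\<lambda>d. brace \<xi> \<eta> (br ?f d)) ?u"
      unfolding Cons.IH[OF \<xi> \<eta>] Cons.IH[OF lf(1) \<eta>] Cons.IH[OF \<xi> lf(2)] e by (simp add: algebra_simps)
    also have "\<dots> = V.Y k (brace \<xi> \<eta>) (act k ?f ?u)" by (simp add: V.Y_f[OF lin_brace] bf)
    finally show ?case by (simp only: V.wv.simps)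
  qed
  assume \<xi>: "clinear \<xi>" and \<eta>: "clinear \<eta>"
  show ?thesis
  proof (rule V.eq_on_wv[where u = u])
    show "clinear (\<lambda>u. V.Y k \<xi> (V.Y k \<eta> u) - V.Y k \<eta> (V.Y k \<xi> u))"
      by (intro clinear_minus_fun clinear_compose[OF V.lin_Y V.lin_Y] \<xi> \<eta>)
    show "clinear (V.Y k (brace \<xi> \<eta>))" by (rule V.lin_Y[OF lin_brace])
  qed (rule words[OF \<xi> \<eta>])
qed

lemma double_ops_verma: "double_ops Bs wt ht Cs Fs cor (act k) (\<lambda>b. V.Y k (xi b)) (\<lambda>h. act k (hg h))"
proof (rule double_ops.intro[OF double_data_axioms], rule double_ops_axioms.intro)
  show "clinear (act k b)" "clinear (V.Y k (xi b))" for b by (rule V.lin_act V.lin_Y[OF lin_xi])+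
  show "clinear (act k (hg h))" for h by (rule V.lin_act)
  show "act k (hg h) (act k (hg h') u) = act k (hg h') (act k (hg h) u)" for h h' u
    by (simp add: V.act_swap[of k "hg h"] br_h_h V.act_simps)
  show "act k (hg h) (act k b u) = act k b (act k (hg h) u) - wt b h *\<^sub>C act k b u" if "b \<in> Bs" for b h u
    using Bs_space[OF that] by (simp add: V.act_swap[of k "hg h"] n_minus_space_def V.act_simps)
  show "act k (hg h) (V.Y k (xi b) u) = V.Y k (xi b) (act k (hg h) u) + wt b h *\<^sub>C V.Y k (xi b) u" if "b \<in> Bs" for b h u
  proof -
    have "V.Y k (\<lambda>d. xi b (br (hg h) d)) u = V.Y k (\<lambda>d. - wt b h * xi b d) u"
      by (rule V.Y_cong[OF V.lin_comp_br[OF lin_xi] clinear_mult_left[OF lin_xi]]) (simp add: xi_h[OF that] rn_n_minus)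
    then show ?thesis by (simp only: V.H_Y[OF lin_xi] V.Y_scale[OF lin_xi]) simp
  qed
  show "\<exists>N. \<forall>b\<in>Bs. N < ht b \<longrightarrow> V.Y k (xi b) u = 0" for u
  proof -
    let ?W = "{u. \<exists>N. \<forall>b\<in>Bs. N < ht b \<longrightarrow> V.Y k (xi b) u = 0}"
    note s = V.Y_simps[OF lin_xi]
    have "csubspace ?W"
    proof (rule complex_vector.subspaceI)
      fix x y assume "x \<in> ?W" "y \<in> ?W"
      then obtain N M where "\<forall>b\<in>Bs. N < ht b \<longrightarrow> V.Y k (xi b) x = 0" "\<forall>b\<in>Bs. M < ht b \<longrightarrow> V.Y k (xi b) y = 0"
        by blast
      then have "\<forall>b\<in>Bs. max N M < ht b \<longrightarrow> V.Y k (xi b) (x + y) = 0" by (simp add: s)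
      then show "x + y \<in> ?W" by blast
    qed (auto simp: s)
    moreover have "range (V.wv k) \<subseteq> ?W"
    proof
      fix x assume "x \<in> range (V.wv k)"
      then obtain w where w: "x = V.wv k w" by blast
      have "V.Y k (xi b) x = 0" if b: "b \<in> Bs" "length w < ht b" for b
        unfolding w
      proof (rule V.Y_wv_eq_0[OF lin_xi])
        fix w' :: "'r list" assume "length w' \<le> length w"
        then have "wt b \<noteq> wtw G w'" using b rht_wtw[of w'] by (auto simp: ht_def)
        then show "xi b (rn (ff G) w') = 0" using xi_wt[OF rn_space b(1), of w'] by blast
      qed
      then show "x \<in> ?W" by blast
    qed
    ultimately have "cspan (range (V.wv k)) \<subseteq> ?W" by (rule complex_vector.span_minimal[rotated])
    moreover have "u \<in> cspan (range (V.wv k))" by (rule V.wv_span)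
    ultimately show ?thesis by blast
  qed
  have act_expand: "act k y u = (\<Sum>c\<in>BN N. xi c y *\<^sub>C act k c u)"
    if "y \<in> n_minus_space G \<beta>" "\<beta> \<in> pos_roots G \<Longrightarrow> rht \<beta> \<le> N" for y \<beta> N u
    by (subst expand[OF that]) (auto simp: BN_def clinear_sum[OF V.lin_act_left] clinear_scale[OF V.lin_act_left])
  show "act k a (act k b u) - act k b (act k a u) = (\<Sum>c\<in>BN N. Cs a b c *\<^sub>C act k c u)"
    if ab: "a \<in> Bs" "b \<in> Bs" "ht a + ht b \<le> N" for a b N u
  proof -
    have "act k a (act k b u) - act k b (act k a u) = act k (br a b) u" by (simp add: V.act_br)
    also have "\<dots> = (\<Sum>c\<in>BN N. xi c (br a b) *\<^sub>C act k c u)"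
    proof (rule act_expand[OF n_minus_space_br[OF Bs_space[OF ab(1)] Bs_space[OF ab(2)]]])
      assume r: "(\<lambda>h. wt a h + wt b h) \<in> pos_roots G"
      have "(of_nat (rht (\<lambda>h. wt a h + wt b h)) :: complex) = of_nat (ht a + ht b)"
        using root_h0[OF r] wt_h0[OF ab(1)] wt_h0[OF ab(2)] by simp
      then have "rht (\<lambda>h. wt a h + wt b h) = ht a + ht b" using of_nat_eq_iff by blast
      then show "rht (\<lambda>h. wt a h + wt b h) \<le> N" using ab(3) by simp
    qed
    finally show ?thesis using ab by (simp add: Cs_def BN_def)
  qed
  show "V.Y k (xi a) (V.Y k (xi b) u) - V.Y k (xi b) (V.Y k (xi a) u) = (\<Sum>c\<in>BN N. Fs a b c *\<^sub>C V.Y k (xi c) u)"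
    if ab: "a \<in> Bs" "b \<in> Bs" "ht a + ht b \<le> N" for a b N u
  proof -
    have F: "brace (xi a) (xi b) c = Fs a b c" if "c \<in> Bs" for c using that ab by (simp add: brace_Bs Fs_def)
    have "V.Y k (brace (xi a) (xi b)) u = (\<Sum>c\<in>BN N. brace (xi a) (xi b) c *\<^sub>C V.Y k (xi c) u)"
    proof (rule Y_expand[OF lin_brace])
      fix c assume "c \<in> Bs" "N < ht c"
      then show "brace (xi a) (xi b) c = 0" using F_wt[of a b c] F ab(3) by (cases "Fs a b c = 0") auto
    qed
    also have "\<dots> = (\<Sum>c\<in>BN N. Fs a b c *\<^sub>C V.Y k (xi c) u)"
      by (intro sum.cong HOL.refl) (simp add: F BN_def)
    finally show ?thesis by (simp add: Y_brace[OF lin_xi lin_xi])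
  qed
  show "V.Y k (xi a) (act k b u) - act k b (V.Y k (xi a) u) = (if a = b then act k (hg (cor a)) u else 0) +
      (\<Sum>c\<in>BN N. Cs b c a *\<^sub>C V.Y k (xi c) u) + (\<Sum>c\<in>BN N. Fs c a b *\<^sub>C act k c u)"
    if "a \<in> BN N" "b \<in> BN N" for a b N u
  proof -
    have ab: "a \<in> Bs" "b \<in> Bs" "ht a \<le> N" "ht b \<le> N" using that by (auto simp: BN_def)
    let ?z = "cobr (xi a) b (wt b)"
    have cr: "cross (xi a) b (wt b) ?z" by (rule cross_cobr[OF lin_xi Bs_space[OF ab(2)]])
    have 1: "V.Y k (\<lambda>d. xi a (br b d)) u = (\<Sum>c\<in>BN N. Cs b c a *\<^sub>C V.Y k (xi c) u)"
    proof -
      have Cc: "xi a (br b c) = Cs b c a" if "c \<in> Bs" for c using that ab by (simp add: Cs_def)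
      have "V.Y k (\<lambda>d. xi a (br b d)) u = (\<Sum>c\<in>BN N. xi a (br b c) *\<^sub>C V.Y k (xi c) u)"
      proof (rule Y_expand[OF V.lin_comp_br[OF lin_xi]])
        fix c assume "c \<in> Bs" "N < ht c"
        then show "xi a (br b c) = 0" using C_wt[of b c a] Cc ab(3) by (cases "Cs b c a = 0") auto
      qed
      then show ?thesis by (simp add: Cc BN_def)
    qed
    have 2: "act k ?z u = (\<Sum>c\<in>BN N. Fs c a b *\<^sub>C act k c u)"
    proof -
      have "act k ?z u = (\<Sum>c\<in>BN N. xi c ?z *\<^sub>C act k c u)"
      proof (rule act_expand[OF cobr_xi_space[OF ab(1,2)]])
        assume r: "(\<lambda>h. wt b h - wt a h) \<in> pos_roots G"
        have "of_nat (rht (\<lambda>h. wt b h - wt a h)) = (of_nat (ht b) - of_nat (ht a) :: complex)"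
          using root_h0[OF r] wt_h0[OF ab(1)] wt_h0[OF ab(2)] by simp
        then have "(of_nat (rht (\<lambda>h. wt b h - wt a h) + ht a) :: complex) = of_nat (ht b)" by simp
        then have "rht (\<lambda>h. wt b h - wt a h) + ht a = ht b" using of_nat_eq_iff by blast
        then show "rht (\<lambda>h. wt b h - wt a h) \<le> N" using ab(4) by simp
      qed
      then show ?thesis using ab by (simp add: Fs_def BN_def)
    qed
    have "xi a b *\<^sub>C act k (hg (flat_inv G (wt b))) u = (if a = b then act k (hg (cor a)) u else 0)"
      using xi_Bs[OF ab(2), of a] by (auto simp: cor_def)
    then show ?thesis using crossD(2)[OF cr, of k u] by (simp add: 1 2)
  qed
qed

sublocale double_tensor Bs wt ht Cs Fs cor "\<lambda>k b. on_factor k (act k b)" "\<lambda>k b. on_factor k (V.Y k (xi b))"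
  hfac "\<lambda>s. axis s 1" hdual
proof (rule double_tensor.intro[OF double_data_axioms], rule double_tensor_axioms.intro)
  show "double_ops Bs wt ht Cs Fs cor (\<lambda>b. on_factor i (act i b)) (\<lambda>b. on_factor i (V.Y i (xi b))) (hfac i)" for i
    using double_ops_on_factor[OF double_ops_verma[of i], of i] unfolding hfac_def[abs_def] .
  show "on_factor i (act i a) (on_factor j (act j b) u) = on_factor j (act j b) (on_factor i (act i a) u)"
    "on_factor i (V.Y i (xi a)) (on_factor j (V.Y j (xi b)) u) = on_factor j (V.Y j (xi b)) (on_factor i (V.Y i (xi a)) u)"
    "on_factor i (V.Y i (xi a)) (on_factor j (act j b) u) = on_factor j (act j b) (on_factor i (V.Y i (xi a)) u)"
    if "i \<noteq> j" for i j a b u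
    using that by (auto intro!: on_factor_commute V.lin_act V.lin_Y lin_xi)
  show "hfac i h (on_factor j (act j b) u) = on_factor j (act j b) (hfac i h u)"
    "hfac i h (on_factor j (V.Y j (xi b)) u) = on_factor j (V.Y j (xi b)) (hfac i h u)"
    if "i \<noteq> j" for i j b h u
    unfolding hfac_def using that by (auto intro!: on_factor_commute V.lin_act V.lin_Y lin_xi)
  show "hfac i h (hfac j h' u) = hfac j h' (hfac i h u)" if "i \<noteq> j" for i j h h' u
    unfolding hfac_def using that by (auto intro!: on_factor_commute V.lin_act)
  show add: "hfac i (h + h') u = hfac i h u + hfac i h' u" for i h h' u
    unfolding hfac_def clinear_add[OF lin_hg] on_factor_add[OF V.lin_act V.lin_act, symmetric]
    by (simp only: clinear_add[OF V.lin_act_left, abs_def])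
  show scale: "hfac i (c *\<^sub>C h) u = c *\<^sub>C hfac i h u" for i c h u
    unfolding hfac_def clinear_scale[OF lin_hg] on_factor_scale[OF V.lin_act, symmetric]
    by (simp only: clinear_scale[OF V.lin_act_left, abs_def])
  show "clinear (wt b)" if "b \<in> Bs" for b by (rule lin_wt[OF that])
  show "cor b = (\<Sum>s\<in>UNIV. wt b (axis s 1) *\<^sub>C hdual s)" "cor b = (\<Sum>s\<in>UNIV. wt b (hdual s) *\<^sub>C axis s 1)"
    if "b \<in> Bs" for b
    unfolding cor_def by (rule flat_inv_expand[OF lin_wt[OF that]])+
  show "(\<Sum>s\<in>UNIV. hfac i (axis s 1) (hfac j (hdual s) u)) = (\<Sum>s\<in>UNIV. hfac i (hdual s) (hfac j (axis s 1) u))" for i j u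
    by (rule hdual_symmetric, rule cbilinearI)
      (auto intro!: clinearI simp: add scale clinear_add[OF lin_hfac] clinear_scale[OF lin_hfac])
qed

lemma Delta_plus_eq:
  assumes "\<alpha> \<in> pos_roots G"
  shows "Delta_plus G act v X \<alpha> u = total.Delta \<alpha> u"
proof -
  \<comment> \<open>Contracting after moving the \<open>n_minus\<close> component to the front is
    the same as applying \<open>Y\<close> on the k-th factor; this identifies the operators of the
    equations with the abstract ones.\<close>
  have nf: "contract \<xi> (nu_factor G act v k u) = on_factor k (V.Y k \<xi>) u" if \<xi>: "clinear \<xi>" for \<xi> k u
  proof -
    have bil: "cbilinear (\<lambda>d y. d \<otimes>\<^sub>C pure (m(k := y)))" for m :: "'n \<Rightarrow> 'm"
      by (intro cbilinearI clinear_compose[OF cbilinearD(1)[OF cbilinear_tens] clinear_pure]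
          cbilinearD(2)[OF cbilinear_tens])
    let ?t = "\<lambda>m. tensor_lift (\<lambda>d y. d \<otimes>\<^sub>C pure (m(k := y)))"
    have lt: "clinear (?t m)" for m :: "'n \<Rightarrow> 'm" by (rule clinear_tensor_lift[OF bil])
    have tt: "?t m (d \<otimes>\<^sub>C y) = d \<otimes>\<^sub>C pure (m(k := y))" for m :: "'n \<Rightarrow> 'm" and d :: 'g and y
      by (rule tensor_lift_tens[OF bil])
    have ml: "multilinear (\<lambda>m. ?t m (nu_minus G (act k) (v k) (m k)))"
      unfolding multilinear_def
    proof (intro allI)
      fix m :: "'n \<Rightarrow> 'm" and i
      show "clinear (\<lambda>x. ?t (m(i := x)) (nu_minus G (act k) (v k) ((m(i := x)) k)))"
      proof (cases "i = k")
        case True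
        then show ?thesis using clinear_compose[OF lt V.nu(1)] by simp
      next
        case False
        have "clinear (\<lambda>x. ?t (m(i := x)) t)" for t :: "('g, 'm) tensor"
        proof (rule clinearI)
          have sw: "pure (m(i := x, k := y)) = pure (m(k := y, i := x))" for x y using False by (simp add: fun_upd_twist)
          note tr = cbilinearD(1)[OF cbilinear_tens]
          show "?t (m(i := x + x')) t = ?t (m(i := x)) t + ?t (m(i := x')) t" for x x'
            by (rule tensor_eqI[where t = t, OF lt clinear_plus[OF lt lt]])
              (simp only: tt, simp only: sw pure_add clinear_add[OF tr])
          show "?t (m(i := c *\<^sub>C x)) t = c *\<^sub>C ?t (m(i := x)) t" for c x
            by (rule tensor_eqI[where t = t, OF lt clinear_scaleC[OF lt]])
              (simp only: tt, simp only: sw pure_scale clinear_scale[OF tr])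
        qed
        then show ?thesis using False by simp
      qed
    qed
    have ct: "contract \<xi> (?t m t) = pure (m(k := contract \<xi> t))" for m :: "'n \<Rightarrow> 'm" and t :: "('g, 'm) tensor"
      by (rule tensor_eqI[where t = t, OF clinear_compose[OF clinear_contract[OF \<xi>] lt]
            clinear_compose[OF clinear_pure clinear_contract[OF \<xi>]]])
        (simp only: tt contract_tens[OF \<xi>] pure_scale)
    show ?thesis
      unfolding nu_factor_def
      by (rule tpower_eqI[where t = u, OF clinear_compose[OF clinear_contract[OF \<xi>] clinear_tpower_lift[OF ml]]
            clinear_on_factor[OF V.lin_Y[OF \<xi>]]])
        (simp only: tpower_lift_pure[OF ml] ct on_factor_pure[OF V.lin_Y[OF \<xi>]] V.Y_def)
  qed
  have "Delta_plus G act v X \<alpha> u = (\<Sum>x\<in>X \<alpha>. tx x (ty x u))"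
    unfolding Delta_plus_def
  proof (rule sum.cong[OF HOL.refl])
    fix x
    have "contract (dual_vec G X x) (nu_total G act v u) = ty x u"
      by (simp add: nu_total_def xi_def[symmetric] clinear_sum[OF clinear_contract[OF lin_xi]] nf[OF lin_xi] ty_def)
    then show "total_act act x (contract (dual_vec G X x) (nu_total G act v u)) = tx x (ty x u)"
      by (simp add: total_act_def tx_def)
  qed
  then show ?thesis by (simp add: total.Delta_def wt_fiber[OF assms])
qed

text \<open>\<open>Omega_plus\<close> quantifies over arbitrary functions as weights, but the form
  on weights can be evaluated only for linear ones. A non-zero weight vector forces
  linearity.\<close>

lemma weight_linear:
  assumes "m \<in> weight_space G (act k) l" "m \<noteq> 0"
  shows "clinear l"
proof (rule clinearI)
  have w: "act k (hg h) m = l h *\<^sub>C m" for h using assms by (simp add: weight_space_def)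
  have "l (x + y) *\<^sub>C m = (l x + l y) *\<^sub>C m" for x y
    using w[of "x + y"] by (simp add: hg_simps V.act_simps w scaleC_distribs)
  then show "l (x + y) = l x + l y" for x y using assms(2) by simp
  have "l (c *\<^sub>C x) *\<^sub>C m = (c *\<^sub>C l x) *\<^sub>C m" for c x
  proof -
    have "act k (hg (c *\<^sub>C x)) m = c *\<^sub>C (l x *\<^sub>C m)"
      by (simp only: clinear_scale[OF lin_hg] clinear_scale[OF V.lin_act_left] w)
    then show ?thesis by (simp only: w scaleC_scaleC scaleC_complex_def)
  qed
  then show "l (c *\<^sub>C x) = c *\<^sub>C l x" for c x
    by (rule complex_vector.scale_right_imp_eq[OF assms(2)])
qed

lemma Omega_formula:
  assumes ij: "i \<noteq> j" and m: "m i \<in> weight_space G (act i) l" "m j \<in> weight_space G (act j) l'"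
  shows "Om i j (pure m) = dual_form G l l' *\<^sub>C pure m +
          Sum_any (\<lambda>\<beta>. if \<beta> \<in> pos_roots G then
            \<Sum>x\<in>X \<beta>.
              pure (m(i := act i x (m i),
                      j := contract (dual_vec G X x) (nu_minus G (act j) (v j) (m j)))) +
              pure (m(i := contract (dual_vec G X x) (nu_minus G (act i) (v i) (m i)),
                      j := act j x (m j)))
            else 0)" (is "_ = _ + Sum_any ?g")
proof -
  obtain N where N: "adm N (pure m)" using adm_ex by blast
  let ?T = "\<lambda>b. on_factor i (act i b) (on_factor j (V.Y j (xi b)) (pure m)) + on_factor i (V.Y i (xi b)) (on_factor j (act j b) (pure m))"
  have T: "pure (m(i := act i x (m i), j := contract (dual_vec G X x) (nu_minus G (act j) (v j) (m j)))) +
     pure (m(i := contract (dual_vec G X x) (nu_minus G (act i) (v i) (m i)), j := act j x (m j))) = ?T x" for x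
    using ij by (simp add: V.lin_act V.lin_Y lin_xi V.Y_def[symmetric] xi_def[symmetric] fun_upd_twist)
  have T0: "?T b = 0" if "b \<in> Bs" "N < ht b" for b
    using adm_zero[OF N that, of j] adm_zero[OF N that, of i]
    by (simp add: on_factor_commute[OF V.lin_Y[OF lin_xi] V.lin_act ij] clinear_zero[OF clinear_on_factor[OF V.lin_act]]
        del: on_factor_pure)
  have S: "Sum_any ?g = (\<Sum>b\<in>BN N. ?T b)"
    unfolding T BN_def by (rule Sum_any_graded[OF T0])
  have H: "(\<Sum>s\<in>UNIV. hfac i (axis s 1) (hfac j (hdual s) (pure m))) = dual_form G l l' *\<^sub>C pure m"
  proof (cases "m i = 0 \<or> m j = 0")
    \<comment> \<open>For a zero entry the weights are arbitrary functions and the formula holds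
      because the tensor vanishes.\<close>
    case True
    then have "pure m = 0" using pure_eq_0[of m i] pure_eq_0[of m j] by blast
    then show ?thesis by (simp add: clinear_zero[OF lin_hfac])
  next
    case False
    have lin: "clinear l" "clinear l'" using weight_linear[OF m(1)] weight_linear[OF m(2)] False by auto
    have w: "act i (hg h) (m i) = l h *\<^sub>C m i" "act j (hg h) (m j) = l' h *\<^sub>C m j" for h
      using m by (auto simp: weight_space_def)
    have "hfac j h (pure m) = l' h *\<^sub>C pure m" for h
      by (simp add: hfac_def V.lin_act w pure_scale)
    moreover have "hfac i h (pure m) = l h *\<^sub>C pure m" for h
      by (simp add: hfac_def V.lin_act w pure_scale)
    ultimately show ?thesis
      by (simp add: clinear_scale[OF lin_hfac] dual_form_eq[OF lin] complex_vector.scale_sum_left scaleC_scaleC mult.commute)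
  qed
  show ?thesis unfolding Om_eq[OF ij N] OmN_def S H by (simp add: add.commute)
qed

lemma wv_weight: "V.wv k w \<in> weight_space G (act k) (\<lambda>h. \<Lambda> k h - wtw G w h)"
  by (simp add: weight_space_def V.act_h_wv)

text \<open>Justifies the \<open>THE\<close>: the formula prescribes the operator on tensors of word
  vectors, which are weight vectors and span.\<close>

lemma Omega_plus_eq:
  assumes ij: "i \<noteq> j"
  shows "Omega_plus G act v X i j = Om i j"
  unfolding Omega_plus_def
proof (rule the_equality)
  show "clinear (Om i j) \<and> (\<forall>m l l'. m i \<in> weight_space G (act i) l \<and> m j \<in> weight_space G (act j) l' \<longrightarrow>
        Om i j (pure m) = dual_form G l l' *\<^sub>C pure m +
          Sum_any (\<lambda>\<beta>. if \<beta> \<in> pos_roots G then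
            \<Sum>x\<in>X \<beta>.
              pure (m(i := act i x (m i),
                      j := contract (dual_vec G X x) (nu_minus G (act j) (v j) (m j)))) +
              pure (m(i := contract (dual_vec G X x) (nu_minus G (act i) (v i) (m i)),
                      j := act j x (m j)))
            else 0))"
    using lin_Om[OF ij] Omega_formula[OF ij] by blast
  fix T :: "('n, 'm) tpower \<Rightarrow> ('n, 'm) tpower"
  assume T: "clinear T \<and> (\<forall>m l l'. m i \<in> weight_space G (act i) l \<and> m j \<in> weight_space G (act j) l' \<longrightarrow>
        T (pure m) = dual_form G l l' *\<^sub>C pure m +
          Sum_any (\<lambda>\<beta>. if \<beta> \<in> pos_roots G then
            \<Sum>x\<in>X \<beta>.
              pure (m(i := act i x (m i),
                      j := contract (dual_vec G X x) (nu_minus G (act j) (v j) (m j)))) +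
              pure (m(i := contract (dual_vec G X x) (nu_minus G (act i) (v i) (m i)),
                      j := act j x (m j)))
            else 0))"
  have "T (hvec ws) = Om i j (hvec ws)" for ws
  proof -
    let ?m = "\<lambda>k. V.wv k (ws k)"
    let ?l = "\<lambda>k h. \<Lambda> k h - wtw G (ws k) h"
    have w: "?m i \<in> weight_space G (act i) (?l i)" "?m j \<in> weight_space G (act j) (?l j)" by (rule wv_weight)+
    show ?thesis unfolding hvec_def Omega_formula[of i j ?m, OF ij w]
      using T[THEN conjunct2, rule_format, of ?m "?l i" "?l j"] w by blast
  qed
  then have eq: "T x = Om i j x" if "x \<in> range hvec" for x using that by blast
  show "T = Om i j"
  proof
    show "T u = Om i j u" for u
      by (rule clinear_eq_on_span[OF conjunct1[OF T] lin_Om[OF ij] eq hvec_span])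
  qed
qed

lemma compatible_without_Serre:
  "KZ_dyn_compatible \<kappa> (pos_roots G) hfac (Omega_plus G act v X) (Delta_plus G act v X)"
proof (rule compatible)
  show "wt ` Bs \<subseteq> pos_roots G" using wt_root by blast
  show "Omega_plus G act v X i j u = Om i j u" if "i \<noteq> j" for i j u by (simp add: Omega_plus_eq[OF that])
  show "\<exists>S. finite S \<and> {w. \<forall>h. th h w = l h *\<^sub>C w} \<subseteq> cspan S" for l
    using htot_weight_space[of l] finite_hwt[of l] unfolding htot_def th_def by blast
qed (rule Delta_plus_eq)

end

section \<open>Triangular decomposition and the invariant form\<close>

context kac_moody_algebra
begin

section \<open>The involution exchanging raising and lowering operators\<close>

primrec tau_eval :: "(complex ^ 'd, 'r) lexpr \<Rightarrow> 'g" where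
  "tau_eval (LH x) = - hg x"
| "tau_eval (LE i) = - ff G i"
| "tau_eval (LF i) = - ee G i"
| "tau_eval LZero = 0"
| "tau_eval (LAdd a b) = tau_eval a + tau_eval b"
| "tau_eval (LScale s a) = s *\<^sub>C tau_eval a"
| "tau_eval (LBrk a b) = br (tau_eval a) (tau_eval b)"

lemma br_f_e: "br (ff G i) (ee G j) = - (if i = j then hg (hcoroot G i) else 0)"
  by (subst br_swap) (auto simp: br_e_f)

lemma tau_eval_sound: "km_eq G a b \<Longrightarrow> tau_eval a = tau_eval b"
proof (induction rule: km_eq.induct)
  case (jacobi a b c)
  show ?case using br_jacobi0[of "tau_eval a" "tau_eval b" "tau_eval c"] by (simp add: add.assoc)
next
  case (rel_ef i j)
  show ?case by (simp add: br_simps br_f_e)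
qed (simp_all add: br_simps hg_simps br_h_e br_h_f br_h_h scaleC_distribs scaleC_scaleC add_ac)

definition tau' :: "'g \<Rightarrow> 'g" where
  "tau' x = tau_eval (SOME a. leval G a = x)"

lemma tau'_leval: "tau' (leval G a) = tau_eval a"
proof -
  have "leval G (SOME b. leval G b = leval G a) = leval G a" by (rule someI) simp
  then show ?thesis unfolding tau'_def leval_iff by (rule tau_eval_sound)
qed

lemma tau'_add: "tau' (x + y) = tau' x + tau' y" and tau'_scale: "tau' (c *\<^sub>C x) = c *\<^sub>C tau' x"
  and tau'_br: "tau' (br x y) = br (tau' x) (tau' y)"
proof -
  obtain a b where ab: "x = leval G a" "y = leval G b" using leval_ex[OF clinear_const0] by metis
  show "tau' (x + y) = tau' x + tau' y" "tau' (c *\<^sub>C x) = c *\<^sub>C tau' x" "tau' (br x y) = br (tau' x) (tau' y)"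
    using tau'_leval[of "LAdd a b"] tau'_leval[of "LScale c a"] tau'_leval[of "LBrk a b"]
    by (simp_all add: ab tau'_leval)
qed

lemma lin_tau': "clinear tau'" by (rule clinearI) (simp_all add: tau'_add tau'_scale)

lemma tau'_gen: "tau' (hg h) = - hg h" "tau' (ee G i) = - ff G i" "tau' (ff G i) = - ee G i"
  using tau'_leval[of "LH h"] tau'_leval[of "LE i"] tau'_leval[of "LF i"] by simp_all

lemma agree_on_generators:
  assumes p: "clinear p" "\<And>x y. p (br x y) = br (p x) (p y)"
    and q: "clinear q" "\<And>x y. q (br x y) = br (q x) (q y)"
    and "\<And>h. p (hg h) = q (hg h)" "\<And>i. p (ee G i) = q (ee G i)" "\<And>i. p (ff G i) = q (ff G i)"
  shows "p x = q x"
proof -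
  have "x \<in> {x. p x = q x}"
    by (rule algebra_induct)
      (auto intro!: complex_vector.subspaceI simp: clinear_simps[OF p(1)] clinear_simps[OF q(1)] assms)
  then show ?thesis by simp
qed

lemma tau'_tau': "tau' (tau' x) = x"
  by (rule agree_on_generators[where p = "\<lambda>x. tau' (tau' x)" and q = "\<lambda>x. x"])
    (simp_all add: clinear_compose lin_tau' clinear_ident tau'_br tau'_gen clinear_minus[OF lin_tau'])

lemma tau_eq: "tau G = tau'"
  unfolding tau_def
proof (rule the_equality)
  have "bij tau'" by (rule involuntory_imp_bij) (rule tau'_tau')
  then show "clinear tau' \<and> bij tau' \<and> (\<forall>x y. tau' (br x y) = br (tau' x) (tau' y)) \<and>
     (\<forall>i. tau' (ee G i) = - ff G i) \<and> (\<forall>i. tau' (ff G i) = - ee G i) \<and> (\<forall>h. tau' (hg h) = - hg h)"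
    by (simp add: lin_tau' tau'_br tau'_gen)
  fix t assume t: "clinear t \<and> bij t \<and> (\<forall>x y. t (br x y) = br (t x) (t y)) \<and>
     (\<forall>i. t (ee G i) = - ff G i) \<and> (\<forall>i. t (ff G i) = - ee G i) \<and> (\<forall>h. t (hg h) = - hg h)"
  show "t = tau'"
    by (rule ext, rule agree_on_generators) (use t in \<open>simp_all add: lin_tau' tau'_br tau'_gen\<close>)
qed

lemma tau'_n_plus: "x \<in> n_plus G \<Longrightarrow> tau' x \<in> n_minus G"
  and tau'_n_minus: "x \<in> n_minus G \<Longrightarrow> tau' x \<in> n_plus G"
proof -
  have "lie_subalgebra G {x. tau' x \<in> n_minus G}" "lie_subalgebra G {x. tau' x \<in> n_plus G}"
    using csubspace_vimage[OF lin_tau' n_minus_subspace] csubspace_vimage[OF lin_tau' n_plus_subspace]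
    by (auto simp: lie_subalgebra_def tau'_br n_minus_br n_plus_br)
  moreover have "range (ee G) \<subseteq> {x. tau' x \<in> n_minus G}" "range (ff G) \<subseteq> {x. tau' x \<in> n_plus G}"
    by (auto simp: tau'_gen intro: complex_vector.subspace_neg[OF n_minus_subspace ff_n_minus]
        complex_vector.subspace_neg[OF n_plus_subspace ee_n_plus])
  ultimately have "n_plus G \<subseteq> {x. tau' x \<in> n_minus G}" "n_minus G \<subseteq> {x. tau' x \<in> n_plus G}"
    unfolding n_plus_def n_minus_def by (simp_all only: hull_minimal)
  then show "x \<in> n_plus G \<Longrightarrow> tau' x \<in> n_minus G" "x \<in> n_minus G \<Longrightarrow> tau' x \<in> n_plus G" by auto
qed

lemma tau'_rn: "tau' (rn (ee G) w) = (if even (length w) then 1 else -1) *\<^sub>C rn (ff G) w"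
proof (induction w)
  case (Cons i w)
  then show ?case by (cases "w = []") (auto simp: rn_Cons tau'_br tau'_gen br_simps)
qed (simp add: clinear_zero[OF lin_tau'])

text \<open>Roots are defined through \<open>n_minus\<close>; the involution carries brackets of the
  e_i to those of the f_i up to sign, so the same roots govern \<open>n_plus\<close>.\<close>

lemma rn_root:
  assumes "rn (ee G) w \<noteq> 0 \<or> rn (ff G) w \<noteq> 0"
  shows "wtw G w \<in> pos_roots G"
proof -
  have "rn (ff G) w \<noteq> 0"
  proof
    assume "rn (ff G) w = 0"
    then have "tau' (rn (ee G) w) = 0" by (simp add: tau'_rn)
    then have "rn (ee G) w = 0" using tau'_tau'[of "rn (ee G) w"] by (simp add: clinear_zero[OF lin_tau'])
    then show False using assms \<open>rn (ff G) w = 0\<close> by simp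
  qed
  then have "n_minus_space G (wtw G w) \<noteq> {0}" using rn_space[of w] by blast
  then show ?thesis by (simp only: pos_roots_iff simp_thms)
qed

section \<open>Triangular decomposition\<close>

definition U0 :: "'g set" where
  "U0 = {rn (ff G) w | w. w \<noteq> []} \<union> range hg \<union> {rn (ee G) w | w. w \<noteq> []}"

text \<open>Stated for two families of generators so that it serves for e_i against lowering
  brackets and for f_i against raising ones. Taking the bracket with q_i removes a letter and leaves
  at most a Cartan element, which acts diagonally.\<close>

lemma br_cross_span:
  assumes h: "\<And>x i. br (hg x) (q' i) \<in> cspan {q' i}" and qq: "\<And>i j. br (q i) (q' j) \<in> range hg"
  shows "br (q i) (rn q' w) \<in> cspan (range hg \<union> {rn q' w | w. w \<noteq> []})"
proof -
  let ?W = "cspan (range hg \<union> {rn q' w | w. w \<noteq> []})"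
  note sub = complex_vector.subspace_span[of "range hg \<union> {rn q' w | w. w \<noteq> []}"]
  have base: "hg x \<in> ?W" "w \<noteq> [] \<Longrightarrow> rn q' w \<in> ?W" for x w
    by (rule complex_vector.span_base, blast)+
  have q1: "q' i \<in> ?W" for i using base(2)[of "[i]"] by simp
  have hq: "br (hg x) (q' i) \<in> ?W" for x i
    using complex_vector.span_minimal[of "{q' i}" ?W] sub h[of x i] q1 by blast
  have q: "br (q' i) y \<in> ?W" if "y \<in> ?W" for i y
  proof (rule clinear_span_image[OF lin_br_right _ sub that])
    fix y assume "y \<in> range hg \<union> {rn q' w | w. w \<noteq> []}"
    then consider x where "y = hg x" | w where "y = rn q' w" "w \<noteq> []" by blast
    then show "br (q' i) y \<in> ?W"
    proof cases
      case (1 x)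
      have "- br (hg x) (q' i) \<in> ?W" by (intro complex_vector.span_neg hq)
      then show ?thesis using br_swap[of "q' i" "hg x"] 1 by simp
    next
      case (2 w)
      then show ?thesis using base(2)[of "i # w"] by (simp add: rn_Cons)
    qed
  qed
  have hw: "br (hg x) (rn q' w) \<in> ?W" for x w
  proof (induction w)
    case (Cons i w)
    show ?case
    proof (cases "w = []")
      case False
      obtain c where "br (hg x) (q' i) = c *\<^sub>C q' i"
        using h[of x i] by (auto simp: complex_vector.span_singleton)
      then have "br (hg x) (rn q' (i # w)) = c *\<^sub>C rn q' (i # w) + br (q' i) (br (hg x) (rn q' w))"
        using False by (simp add: rn_Cons br_jacobi[of "hg x"] br_simps)
      then show ?thesis using q[OF Cons] base(2)[of "i # w"]
        by (simp add: complex_vector.span_add complex_vector.span_scale)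
    qed (use hq in simp)
  qed (simp add: br_simps complex_vector.span_zero)
  show ?thesis
  proof (induction w)
    case (Cons j w)
    obtain x where x: "br (q i) (q' j) = hg x" using qq by blast
    show ?case
    proof (cases "w = []")
      case False
      have "br (q i) (rn q' (j # w)) = br (hg x) (rn q' w) + br (q' j) (br (q i) (rn q' w))"
        using False by (simp add: rn_Cons br_jacobi[of "q i"] x)
      then show ?thesis using hw q[OF Cons] by (simp add: complex_vector.span_add)
    qed (use x base in simp)
  qed (simp add: br_simps complex_vector.span_zero)
qed

text \<open>The elements whose bracket preserves the span form a subalgebra; it contains the
  generators, hence is everything. So the span is itself a subalgebra containing the
  generators.\<close>

lemma U0_span: "x \<in> cspan U0"
proof -
  note sub = complex_vector.subspace_span[of U0]
  have base: "w \<noteq> [] \<Longrightarrow> rn (ff G) w \<in> cspan U0" "hg x \<in> cspan U0" "w \<noteq> [] \<Longrightarrow> rn (ee G) w \<in> cspan U0" for w x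
    unfolding U0_def by (rule complex_vector.span_base, blast)+
  have gen1: "ff G i \<in> cspan U0" "ee G i \<in> cspan U0" for i
    using base(1)[of "[i]"] base(3)[of "[i]"] by simp_all
  have e: "br (ee G i) (rn (ff G) w) \<in> cspan U0" for i w
  proof -
    have "br (ee G i) (rn (ff G) w) \<in> cspan (range hg \<union> {rn (ff G) w | w. w \<noteq> []})"
      proof (rule br_cross_span[where q = "ee G"])
        show "br (hg x) (ff G j) \<in> cspan {ff G j}" for x j
          by (simp add: br_h_f complex_vector.span_neg complex_vector.span_scale complex_vector.span_base)
        show "br (ee G j) (ff G k) \<in> range hg" for j k
          using rangeI[of hg "hcoroot G j"] rangeI[of hg 0] by (simp add: br_e_f hg_simps)
      qed
    moreover have "range hg \<union> {rn (ff G) w | w. w \<noteq> []} \<subseteq> U0" by (auto simp: U0_def)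
    ultimately show ?thesis using complex_vector.span_mono by blast
  qed
  have f: "br (ff G i) (rn (ee G) w) \<in> cspan U0" for i w
  proof -
    have "br (ff G i) (rn (ee G) w) \<in> cspan (range hg \<union> {rn (ee G) w | w. w \<noteq> []})"
      proof (rule br_cross_span[where q = "ff G"])
        show "br (hg x) (ee G j) \<in> cspan {ee G j}" for x j
          by (simp add: br_h_e complex_vector.span_scale complex_vector.span_base)
        show "br (ff G j) (ee G k) \<in> range hg" for j k
          using rangeI[of hg "- hcoroot G j"] rangeI[of hg 0] by (auto simp: br_f_e hg_simps clinear_minus[OF lin_hg])
      qed
    moreover have "range hg \<union> {rn (ee G) w | w. w \<noteq> []} \<subseteq> U0" by (auto simp: U0_def)
    ultimately show ?thesis using complex_vector.span_mono by blast
  qed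
  let ?W = "{x. \<forall>y\<in>cspan U0. br x y \<in> cspan U0}"
  have onU: "x \<in> ?W" if "\<And>s. s \<in> U0 \<Longrightarrow> br x s \<in> cspan U0" for x
    using clinear_span_image[OF lin_br_right that sub] by blast
  have all: "x \<in> ?W" for x
  proof (rule algebra_induct)
    show "csubspace ?W"
      by (auto intro!: complex_vector.subspaceI
          simp: br_simps complex_vector.span_zero complex_vector.span_add complex_vector.span_scale)
    show "hg h \<in> ?W" for h
    proof (rule onU)
      fix s assume "s \<in> U0"
      then consider w where "s = rn (ff G) w" "w \<noteq> []" | x where "s = hg x" | w where "s = rn (ee G) w" "w \<noteq> []"
        unfolding U0_def by blast
      then show "br (hg h) s \<in> cspan U0"
        by cases (simp_all add: br_h_rn_f br_h_rn_e br_h_h base complex_vector.span_scale complex_vector.span_neg complex_vector.span_zero)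
    qed
    show "ee G i \<in> ?W" for i
    proof (rule onU)
      fix s assume "s \<in> U0"
      then consider w where "s = rn (ff G) w" "w \<noteq> []" | x where "s = hg x" | w where "s = rn (ee G) w" "w \<noteq> []"
        unfolding U0_def by blast
      then show "br (ee G i) s \<in> cspan U0"
      proof cases
        case (2 x)
        then show ?thesis
          by (simp add: br_swap[of "ee G i"] br_h_e gen1 complex_vector.span_scale complex_vector.span_neg)
      next
        case (3 w)
        then show ?thesis using base(3)[of "i # w"] by (simp add: rn_Cons)
      qed (simp add: e)
    qed
    show "ff G i \<in> ?W" for i
    proof (rule onU)
      fix s assume "s \<in> U0"
      then consider w where "s = rn (ff G) w" "w \<noteq> []" | x where "s = hg x" | w where "s = rn (ee G) w" "w \<noteq> []"
        unfolding U0_def by blast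
      then show "br (ff G i) s \<in> cspan U0"
      proof cases
        case (1 w)
        then show ?thesis using base(1)[of "i # w"] by (simp add: rn_Cons)
      next
        case (2 x)
        then show ?thesis
          by (simp add: br_swap[of "ff G i"] br_h_f gen1 complex_vector.span_scale complex_vector.span_neg br_simps)
      qed (simp add: f)
    qed
    show "br x y \<in> ?W" if xy: "x \<in> ?W" "y \<in> ?W" for x y
    proof -
      have "br (br x y) z = br x (br y z) - br y (br x z)" for z using br_jacobi[of x y z] by simp
      then show ?thesis using xy by (simp add: complex_vector.span_diff)
    qed
  qed
  show ?thesis
    by (rule algebra_induct) (use all sub base gen1 in auto)
qed

lemma U0_weight:
  assumes "s \<in> U0"
  shows "\<exists>l. weight_vec adh l s"
proof -
  have "weight_vec adh (\<lambda>h. - wtw G w h) (rn (ff G) w)" "weight_vec adh (wtw G w) (rn (ee G) w)" "weight_vec adh (\<lambda>_. 0) (hg x)" for w x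
    by (simp_all add: weight_vec_def adh_def br_h_rn_f br_h_rn_e br_h_h)
  then show ?thesis using assms unfolding U0_def by blast
qed

lemma U0_cases:
  assumes s: "s \<in> U0" "s \<noteq> 0" and w: "weight_vec adh \<gamma> s"
  shows "(\<exists>w. s = rn (ff G) w \<and> \<gamma> = (\<lambda>h. - wtw G w h)) \<and> (\<lambda>h. - \<gamma> h) \<in> pos_roots G \<or>
    (\<exists>w. s = rn (ee G) w \<and> \<gamma> = wtw G w) \<and> \<gamma> \<in> pos_roots G \<or> s \<in> range hg \<and> \<gamma> = (\<lambda>h. 0)"
proof -
  have g: "br (hg h) s = \<gamma> h *\<^sub>C s" for h using w by (simp add: weight_vec_def adh_def)
  have eq: "\<gamma> = \<delta>" if "\<And>h. br (hg h) s = \<delta> h *\<^sub>C s" for \<delta>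
  proof
    fix h
    have "\<gamma> h *\<^sub>C s = \<delta> h *\<^sub>C s" using g[of h] that[of h] by (simp only:)
    then show "\<gamma> h = \<delta> h" by (rule complex_vector.scale_right_imp_eq[OF s(2)])
  qed
  consider w where "s = rn (ff G) w" | x where "s = hg x" | w where "s = rn (ee G) w"
    using s(1) unfolding U0_def by blast
  then show ?thesis
  proof cases
    case (1 w)
    have e: "\<gamma> = (\<lambda>h. - wtw G w h)" by (rule eq) (simp only: 1 br_h_rn_f)
    have "wtw G w \<in> pos_roots G" by (rule rn_root) (use s 1 in simp)
    then show ?thesis using 1 by (auto simp: e)
  next
    case (2 x)
    have "\<gamma> = (\<lambda>h. 0)" by (rule eq) (simp add: 2 br_h_h)
    then show ?thesis using 2 by blast
  next
    case (3 w)
    have e: "\<gamma> = wtw G w" by (rule eq) (simp only: 3 br_h_rn_e)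
    have "wtw G w \<in> pos_roots G" by (rule rn_root) (use s 3 in simp)
    then show ?thesis using 3 e by blast
  qed
qed

lemma triangular: "\<exists>y h z. x = y + hg h + z \<and> y \<in> n_minus G \<and> z \<in> n_plus G"
proof -
  let ?P = "\<lambda>x. \<exists>y h z. x = y + hg h + z \<and> y \<in> n_minus G \<and> z \<in> n_plus G"
  note s0 = complex_vector.subspace_0[OF n_minus_subspace] complex_vector.subspace_0[OF n_plus_subspace]
  have "csubspace {x. ?P x}"
  proof (rule complex_vector.subspaceI)
    show "0 \<in> {x. ?P x}" using s0 by (auto intro!: exI[of _ 0] simp: hg_simps)
  next
    fix a b assume "a \<in> {x. ?P x}" "b \<in> {x. ?P x}"
    then obtain y h z y' h' z' where "a = y + hg h + z" "b = y' + hg h' + z'" "y \<in> n_minus G" "y' \<in> n_minus G"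
      "z \<in> n_plus G" "z' \<in> n_plus G" by blast
    then have "a + b = (y + y') + hg (h + h') + (z + z')" "y + y' \<in> n_minus G" "z + z' \<in> n_plus G"
      using complex_vector.subspace_add[OF n_minus_subspace] complex_vector.subspace_add[OF n_plus_subspace]
      by (auto simp: hg_simps algebra_simps)
    then show "a + b \<in> {x. ?P x}" by blast
  next
    fix c a assume "a \<in> {x. ?P x}"
    then obtain y h z where "a = y + hg h + z" "y \<in> n_minus G" "z \<in> n_plus G" by blast
    then have "c *\<^sub>C a = c *\<^sub>C y + hg (c *\<^sub>C h) + c *\<^sub>C z" "c *\<^sub>C y \<in> n_minus G" "c *\<^sub>C z \<in> n_plus G"
      using complex_vector.subspace_scale[OF n_minus_subspace] complex_vector.subspace_scale[OF n_plus_subspace]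
      by (auto simp: hg_simps scaleC_distribs)
    then show "c *\<^sub>C a \<in> {x. ?P x}" by blast
  qed
  moreover have "U0 \<subseteq> {x. ?P x}"
  proof
    fix x assume "x \<in> U0"
    then consider w where "x = rn (ff G) w + hg 0 + 0" | h where "x = 0 + hg h + 0" | w where "x = 0 + hg 0 + rn (ee G) w"
      unfolding U0_def by (auto simp: hg_simps)
    then show "x \<in> {x. ?P x}" using rn_n_minus rn_n_plus s0 by cases blast+
  qed
  ultimately show ?thesis using complex_vector.span_minimal[of U0 "{x. ?P x}"] U0_span[of x] by blast
qed

text \<open>The difference of two invariant forms with the same normalization has all generators in its
  radical, which is an ideal.\<close>
lemma invariant_form_unique:
  assumes K: "invariant_form G K" and K': "invariant_form G K'"
  shows "K x y = K' x y"
proof -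
  have inv: "cbilinear K" "cbilinear K'" "\<And>x y z. K (br x y) z = K x (br y z)" "\<And>x y z. K' (br x y) z = K' x (br y z)"
    using K K' by (auto simp: invariant_form_def)
  note lr = cbilinearD(1)[OF inv(1)] cbilinearD(1)[OF inv(2)] and ll = cbilinearD(2)[OF inv(1)] cbilinearD(2)[OF inv(2)]
  let ?R = "{x. \<forall>y. K x y = K' x y}"
  have hh: "K (hg a) y = K' (hg a) y" if "y \<in> n_minus G \<union> n_plus G" for a y
    using K K' that by (simp add: invariant_form_def)
  have onU: "K x y = K' x y" if "\<And>s. s \<in> U0 \<Longrightarrow> K x s = K' x s" for x y
    by (rule clinear_eq_on_span[OF lr that U0_span])
  have h: "hg a \<in> ?R" for a
  proof (rule CollectI, rule allI, rule onU)
    fix s assume "s \<in> U0"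
    then show "K (hg a) s = K' (hg a) s"
      using hh rn_n_minus rn_n_plus K K' unfolding U0_def by (auto simp: invariant_form_def)
  qed
  have neg: "K x (- y) = - K x y" "K' x (- y) = - K' x y" "K (- x) y = - K x y" "K' (- x) y = - K' x y" "K 0 y = 0" "K' 0 y = 0" for x y
    using clinear_minus[OF lr(1)] clinear_minus[OF lr(2)] clinear_minus[OF ll(1)] clinear_minus[OF ll(2)]
      clinear_zero[OF ll(1)] clinear_zero[OF ll(2)] by auto
  have ef: "K (ee G i) (rn (ff G) w) = K' (ee G i) (rn (ff G) w)" if "w \<noteq> []" for i w
  proof (cases w)
    case (Cons j w')
    show ?thesis
    proof (cases "w' = []")
      case True
      then show ?thesis using K K' Cons by (simp add: invariant_form_def)
    next
      case False
      then show ?thesis using Cons h by (auto simp: rn_Cons inv(3,4)[symmetric] br_e_f neg)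
    qed
  qed (use that in simp)
  have fe: "K (ff G i) (rn (ee G) w) = K' (ff G i) (rn (ee G) w)" if "w \<noteq> []" for i w
  proof (cases w)
    case (Cons j w')
    show ?thesis
    proof (cases "w' = []")
      case True
      then show ?thesis using K K' Cons by (simp add: invariant_form_def)
    next
      case False
      then show ?thesis using Cons h by (auto simp: rn_Cons inv(3,4)[symmetric] br_f_e neg)
    qed
  qed (use that in simp)
  have e: "ee G i \<in> ?R" for i
  proof (rule CollectI, rule allI, rule onU)
    fix s assume "s \<in> U0"
    then show "K (ee G i) s = K' (ee G i) s"
      using ef rn_n_plus ee_n_plus K K' unfolding U0_def by (auto simp: invariant_form_def)
  qed
  have f: "ff G i \<in> ?R" for i
  proof (rule CollectI, rule allI, rule onU)
    fix s assume "s \<in> U0"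
    then show "K (ff G i) s = K' (ff G i) s"
      using fe rn_n_minus ff_n_minus K K' unfolding U0_def by (auto simp: invariant_form_def)
  qed
  have "x \<in> ?R"
  proof (rule algebra_induct[OF _ h e f])
    show "csubspace ?R"
      by (auto intro!: complex_vector.subspaceI simp: clinear_add[OF ll(1)] clinear_add[OF ll(2)]
          clinear_scale[OF ll(1)] clinear_scale[OF ll(2)] clinear_zero[OF ll(1)] clinear_zero[OF ll(2)])
    show "br x y \<in> ?R" if "x \<in> ?R" "y \<in> ?R" for x y using that by (simp add: inv(3,4))
  qed
  then show ?thesis by simp
qed

text \<open>The transposed form is invariant with the same normalization, so uniqueness
  applies.\<close>

lemma invariant_form_sym:
  assumes K: "invariant_form G K"
  shows "K x y = K y x"
proof (rule invariant_form_unique[OF K, where K' = "\<lambda>x y. K y x"])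
  have inv: "cbilinear K" "\<And>x y z. K (br x y) z = K x (br y z)" using K by (auto simp: invariant_form_def)
  note lr = cbilinearD(1)[OF inv(1)] and ll = cbilinearD(2)[OF inv(1)]
  have "K z (br x y) = K (br y z) x" for x y z
  proof -
    have "K z (br x y) = - K z (br y x)" by (subst br_swap) (rule clinear_minus[OF lr])
    also have "\<dots> = - K (br z y) x" by (simp add: inv(2))
    also have "\<dots> = K (br y z) x" by (subst br_swap) (simp add: clinear_minus[OF ll])
    finally show ?thesis .
  qed
  moreover have "cbilinear (\<lambda>x y. K y x)" by (intro cbilinearI lr ll)
  ultimately show "invariant_form G (\<lambda>x y. K y x)"
    using K form_sym unfolding invariant_form_def by auto
qed

text \<open>The form transported by the involution has the same normalization: the two signs on
  generators cancel.\<close>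

lemma invariant_form_tau:
  assumes K: "invariant_form G K"
  shows "K (tau' x) (tau' y) = K x y"
proof (rule invariant_form_unique[where K = "\<lambda>x y. K (tau' x) (tau' y)", OF _ K])
  have inv: "cbilinear K" "\<And>x y z. K (br x y) z = K x (br y z)" using K by (auto simp: invariant_form_def)
  note lr = cbilinearD(1)[OF inv(1)] and ll = cbilinearD(2)[OF inv(1)]
  have neg: "K (- x) (- y) = K x y" "K (- x) y = - K x y" "K x (- y) = - K x y" for x y
    by (simp_all add: clinear_minus[OF ll] clinear_minus[OF lr])
  have "cbilinear (\<lambda>x y. K (tau' x) (tau' y))"
    by (intro cbilinearI clinear_compose[OF lr lin_tau'] clinear_compose[OF ll lin_tau'])
  then show "invariant_form G (\<lambda>x y. K (tau' x) (tau' y))"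
    using K tau'_n_plus tau'_n_minus
    by (auto simp: invariant_form_def tau'_br tau'_gen neg)
qed

end

section \<open>Compatibility for the algebra with Serre relations\<close>

locale serre_quotient = verma_family G \<Lambda> act v
  for G :: "('d::finite, 'r::finite, 'g::complex_vector) km" and \<Lambda> :: "'n::finite \<Rightarrow> complex ^ 'd \<Rightarrow> complex"
    and act :: "'n \<Rightarrow> 'g \<Rightarrow> 'm \<Rightarrow> 'm::complex_vector" and v +
  fixes K :: "'g \<Rightarrow> 'g \<Rightarrow> complex" and S :: "'n \<Rightarrow> 'm \<Rightarrow> 'm \<Rightarrow> complex"
    and p :: "'g \<Rightarrow> 'q::complex_vector" and \<pi> :: "('n, 'm) tpower \<Rightarrow> 'l::complex_vector"
    and E :: "(complex ^ 'd \<Rightarrow> complex) \<Rightarrow> 'q set" and hs :: "'d \<Rightarrow> complex ^ 'd"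
  assumes K: "invariant_form G K" and S: "contravariant_form G (act k) (v k) (S k)"
    and p: "is_quotient p (form_kernel (S_lie G K))"
    and pi: "is_quotient \<pi> (form_kernel (product_form S))"
    and E: "\<alpha> \<in> pos_roots G \<Longrightarrow> is_basis (E \<alpha>) (bar_root_space G p \<alpha>)"
    and hs: "form G (hs s) (hs t) = (if s = t then 1 else 0)"
begin

lemma K_bilinear: "cbilinear K" and K_inv: "K (br x y) z = K x (br y z)" and K_hh: "K (hg a) (hg b) = form G a b"
  and K_nh: "y \<in> n_minus G \<union> n_plus G \<Longrightarrow> K y (hg a) = 0"
  using K by (auto simp: invariant_form_def)

lemmas K_sym = invariant_form_sym[OF K]
lemmas K_lin_right = cbilinearD(1)[OF K_bilinear] and K_lin_left = cbilinearD(2)[OF K_bilinear]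
lemmas K_simps = clinear_simps[OF K_lin_right] clinear_simps[OF K_lin_left]

section \<open>The quotient algebra and its weights\<close>

definition rad :: "'g \<Rightarrow> bool" where "rad x \<longleftrightarrow> (\<forall>y. K x y = 0)"

text \<open>\<open>S\<close> differs from K by a sign and the involution in the first argument.
  Since the involution is bijective and preserves K, both have the same kernel.\<close>

lemma lin_p: "clinear p" and surj_p: "surj p" and p_eq_0: "p x = 0 \<longleftrightarrow> rad x"
proof -
  show "clinear p" "surj p" using p by (auto simp: is_quotient_def)
  have "p x = 0 \<longleftrightarrow> x \<in> form_kernel (S_lie G K)" using p by (auto simp: is_quotient_def)
  also have "\<dots> \<longleftrightarrow> (\<forall>y. K (tau' x) y = 0)" by (simp add: form_kernel_def S_lie_def tau_eq)
  also have "\<dots> \<longleftrightarrow> (\<forall>y. K x (tau' y) = 0)" using invariant_form_tau[OF K] tau'_tau' by metis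
  also have "\<dots> \<longleftrightarrow> rad x" unfolding rad_def by (metis tau'_tau')
  finally show "p x = 0 \<longleftrightarrow> rad x" .
qed

lemmas p_simps = clinear_simps[OF lin_p]

lemma q_ex: "\<exists>x. q = p x" using surj_p by (rule surjD)

lemma p_inv [simp]: "p (inv p q) = q" by (rule surj_f_inv_f[OF surj_p])

lemma rad_br: "rad x \<Longrightarrow> rad (br x y)" "rad x \<Longrightarrow> rad (br y x)"
proof -
  assume x: "rad x"
  show 1: "rad (br x y)" using x by (simp add: rad_def K_inv)
  then show "rad (br y x)" by (subst br_swap) (simp add: rad_def K_simps)
qed

lemma p_eq_iff: "p x = p y \<longleftrightarrow> rad (x - y)"
  using p_eq_0[of "x - y"] by (simp add: p_simps)

definition qb where "qb = bar_brk G p"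
definition qK where "qK = bar_form K p"
definition qh where "qh h = p (hg h)"

text \<open>The induced bracket picks representatives by \<open>inv\<close>; the result does not
  depend on them because the radical is an ideal. All laws then transfer through
  \<open>p\<close>.\<close>

lemma qb_p: "qb (p x) (p y) = p (br x y)"
proof -
  let ?x = "inv p (p x)" and ?y = "inv p (p y)"
  have "rad (?x - x)" "rad (?y - y)" by (simp_all add: p_eq_iff[symmetric])
  then have "p (br (?x - x) ?y) = 0" "p (br x (?y - y)) = 0" using rad_br p_eq_0 by auto
  then show ?thesis by (simp add: qb_def bar_brk_def br_simps p_simps)
qed

lemma qK_p: "qK (p x) (p y) = K x y"
proof -
  let ?x = "inv p (p x)" and ?y = "inv p (p y)"
  have r: "rad (?x - x)" "rad (?y - y)" by (simp_all add: p_eq_iff[symmetric])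
  have "K (?x - x) ?y = 0" "K (?y - y) x = 0" using r by (simp_all only: rad_def)
  then show ?thesis by (simp add: qK_def bar_form_def K_simps K_sym[of x])
qed

lemma qb_bilinear: "cbilinear qb"
proof (intro cbilinearI clinearI)
  fix q r s c
  obtain x y z where [simp]: "q = p x" "r = p y" "s = p z" using q_ex by metis
  show "qb q (r + s) = qb q r + qb q s" "qb q (c *\<^sub>C r) = c *\<^sub>C qb q r"
    "qb (r + s) q = qb r q + qb s q" "qb (c *\<^sub>C r) q = c *\<^sub>C qb r q"
    by (simp_all add: p_simps(1,2)[symmetric] qb_p br_simps)
qed

lemma qK_bilinear: "cbilinear qK"
proof (intro cbilinearI clinearI)
  fix q r s c
  obtain x y z where [simp]: "q = p x" "r = p y" "s = p z" using q_ex by metis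
  show "qK q (r + s) = qK q r + qK q s" "qK q (c *\<^sub>C r) = c *\<^sub>C qK q r"
    "qK (r + s) q = qK r q + qK s q" "qK (c *\<^sub>C r) q = c *\<^sub>C qK r q"
    by (simp_all add: p_simps(1,2)[symmetric] qK_p K_simps)
qed

lemmas qb_lin_right = cbilinearD(1)[OF qb_bilinear] and qb_lin_left = cbilinearD(2)[OF qb_bilinear]
lemmas qb_simps = clinear_simps[OF qb_lin_right] clinear_simps[OF qb_lin_left]
lemmas qK_lin_right = cbilinearD(1)[OF qK_bilinear] and qK_lin_left = cbilinearD(2)[OF qK_bilinear]
lemmas qK_simps = clinear_simps[OF qK_lin_right] clinear_simps[OF qK_lin_left]

lemma qb_swap: "qb q r = - qb r q"
proof -
  obtain x y where "q = p x" "r = p y" using q_ex by metis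
  then show ?thesis using br_swap[of x y] by (simp add: qb_p p_simps)
qed

lemma qK_sym: "qK q r = qK r q"
proof -
  obtain x y where "q = p x" "r = p y" using q_ex by metis
  then show ?thesis using K_sym by (simp add: qK_p)
qed

lemma qK_inv: "qK (qb q r) s = qK q (qb r s)"
proof -
  obtain x y z where "q = p x" "r = p y" "s = p z" using q_ex by metis
  then show ?thesis by (simp add: qK_p qb_p K_inv)
qed

lemma qK_nondeg: "(\<And>r. qK q r = 0) \<Longrightarrow> q = 0"
proof -
  assume z: "\<And>r. qK q r = 0"
  obtain x where x: "q = p x" using q_ex by metis
  have "rad x" unfolding rad_def using z[of "p _"] by (simp add: x qK_p)
  then show "q = 0" using p_eq_0 x by simp
qed

lemma qK_qh: "qK (qh a) (qh b) = form G a b" by (simp add: qh_def qK_p K_hh)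

definition adq where "adq = (\<lambda>h. qb (qh h))"

lemma lin_adq: "clinear (adq h)" unfolding adq_def by (rule qb_lin_right)

lemma adq_weight: "weight_vec adq \<gamma> q \<Longrightarrow> qb (qh h) q = \<gamma> h *\<^sub>C q"
  by (simp add: weight_vec_def adq_def)

lemma adq_weight': "weight_vec adq \<gamma> q \<Longrightarrow> qb q (qh h) = - \<gamma> h *\<^sub>C q"
  by (subst qb_swap) (simp add: adq_weight)

lemma bar_root_space_iff: "q \<in> bar_root_space G p \<gamma> \<longleftrightarrow> weight_vec adq \<gamma> q"
  by (simp add: bar_root_space_def weight_vec_def adq_def qb_def qh_def)

lemma p_weight: "weight_vec adh \<gamma> x \<Longrightarrow> weight_vec adq \<gamma> (p x)"
  by (simp add: weight_vec_def adq_def adh_def qh_def qb_p p_simps)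

lemma qb_weight:
  assumes a: "weight_vec adq \<gamma> q" and b: "weight_vec adq \<delta> r"
  shows "weight_vec adq (\<lambda>h. \<gamma> h + \<delta> h) (qb q r)"
proof -
  have jac: "qb (qh h) (qb q r) = qb (qb (qh h) q) r + qb q (qb (qh h) r)" for h
  proof -
    obtain x y where "q = p x" "r = p y" using q_ex by metis
    then show ?thesis by (simp add: qh_def qb_p p_simps(1)[symmetric] br_jacobi[of "hg h"])
  qed
  show ?thesis
    unfolding weight_vec_def adq_def
    by (simp add: jac adq_weight[OF a] adq_weight[OF b] qb_simps scaleC_distribs)
qed

lemma qU_span: "q \<in> cspan (p ` U0)"
proof -
  obtain x where x: "q = p x" using q_ex by metis
  show ?thesis unfolding x
    by (rule clinear_span_image[OF lin_p _ complex_vector.subspace_span U0_span])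
      (auto intro: complex_vector.span_base)
qed

text \<open>Images of the spanning weight vectors span the quotient; those that vanish there have
  every weight and are discarded.\<close>

lemma q_weight_span:
  assumes q: "weight_vec adq \<gamma> q"
  shows "q \<in> cspan (p ` {s\<in>U0. s \<noteq> 0 \<and> weight_vec adh \<gamma> s})"
proof -
  let ?R = "p ` {s\<in>U0. s \<noteq> 0 \<and> weight_vec adh \<gamma> s}"
  have "\<exists>l. weight_vec adq l r" if "r \<in> p ` U0" for r using that U0_weight p_weight by blast
  then have "q \<in> cspan {r\<in>p ` U0. weight_vec adq \<gamma> r}"
    by (intro weight_span[where T = adq, OF lin_adq _ qU_span q])
  also have "{r\<in>p ` U0. weight_vec adq \<gamma> r} \<subseteq> insert 0 ?R"
  proof
    fix r assume "r \<in> {r\<in>p ` U0. weight_vec adq \<gamma> r}"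
    then obtain s where s: "s \<in> U0" "r = p s" "weight_vec adq \<gamma> r" by blast
    show "r \<in> insert 0 ?R"
    proof (cases "r = 0")
      case False
      obtain l where l: "weight_vec adh l s" using U0_weight[OF s(1)] by blast
      have "\<gamma> h *\<^sub>C r = l h *\<^sub>C r" for h
        using adq_weight[OF s(3)] adq_weight[OF p_weight[OF l]] s(2) by metis
      then have "\<gamma> = l" using complex_vector.scale_right_imp_eq[OF False] by blast
      moreover have "s \<noteq> 0" using False s(2) by (auto simp: p_simps)
      ultimately show ?thesis using s l by blast
    qed simp
  qed
  then have "cspan {r\<in>p ` U0. weight_vec adq \<gamma> r} \<subseteq> cspan ?R"
    by (drule_tac complex_vector.span_mono) (simp only: complex_vector.span_insert_0)
  finally show ?thesis .
qed

lemma root_positive: "\<beta> \<in> pos_roots G \<Longrightarrow> \<exists>n>0. \<beta> h0 = of_nat n \<and> rht \<beta> = n"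
  using pos_roots_wtw[of \<beta>] wtw_h0 rht_wtw by (metis length_greater_0_conv)

lemma q_root:
  assumes q: "weight_vec adq \<gamma> q" "q \<noteq> 0"
  shows "\<gamma> \<in> pos_roots G \<or> (\<lambda>h. - \<gamma> h) \<in> pos_roots G \<or> \<gamma> = (\<lambda>h. 0)"
proof (rule ccontr)
  assume "\<not> ?thesis"
  then have "{s\<in>U0. s \<noteq> 0 \<and> weight_vec adh \<gamma> s} = {}" using U0_cases by blast
  then show False using q_weight_span[OF q(1)] q(2) by (simp only: image_empty complex_vector.span_empty singleton_iff)
qed

lemma q_zero_weight:
  assumes q: "weight_vec adq \<gamma> q" and 0: "\<gamma> h0 = 0"
  shows "(\<exists>h. q = qh h \<and> \<gamma> = (\<lambda>h. 0)) \<or> q = 0"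
proof (cases "q = 0")
  case False
  have nr: "\<gamma> \<notin> pos_roots G" "(\<lambda>h. - \<gamma> h) \<notin> pos_roots G"
    using root_positive[of \<gamma>] root_positive[of "\<lambda>h. - \<gamma> h"] 0 by auto
  then have \<gamma>: "\<gamma> = (\<lambda>h. 0)" using q_root[OF q False] by blast
  have "{s\<in>U0. s \<noteq> 0 \<and> weight_vec adh \<gamma> s} \<subseteq> range hg" using U0_cases nr by blast
  then have "p ` {s\<in>U0. s \<noteq> 0 \<and> weight_vec adh \<gamma> s} \<subseteq> range qh" by (auto simp: qh_def)
  moreover have "csubspace (range qh)"
  proof (rule complex_vector.subspaceI)
    show "0 \<in> range qh" by (rule range_eqI[of _ _ 0]) (simp add: qh_def hg_simps p_simps)
    show "x + y \<in> range qh" if xy: "x \<in> range qh" "y \<in> range qh" for x y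
    proof -
      obtain a b where "x = qh a" "y = qh b" using xy by blast
      then have "x + y = qh (a + b)" by (simp add: qh_def hg_simps p_simps)
      then show ?thesis by blast
    qed
    show "c *\<^sub>C x \<in> range qh" if x: "x \<in> range qh" for c x
    proof -
      obtain a where "x = qh a" using x by blast
      then have "c *\<^sub>C x = qh (c *\<^sub>C a)" by (simp add: qh_def hg_simps p_simps)
      then show ?thesis by blast
    qed
  qed
  ultimately have "q \<in> range qh" using q_weight_span[OF q] complex_vector.span_minimal by blast
  then show ?thesis using \<gamma> by blast
qed simp

lemma q_orthogonal:
  assumes "weight_vec adq \<gamma> q" "weight_vec adq \<delta> r" "qK q r \<noteq> 0"
  shows "\<delta> h = - \<gamma> h"
proof -
  have "qK (qb q (qh h)) r = qK q (qb (qh h) r)" by (rule qK_inv)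
  then have "- \<gamma> h * qK q r = \<delta> h * qK q r"
    by (simp only: adq_weight[OF assms(2)] adq_weight'[OF assms(1)] clinear_scale[OF qK_lin_left]
        clinear_scale[OF qK_lin_right] scaleC_complex)
  then show ?thesis using assms(3) by (metis mult_right_cancel)
qed

text \<open>Weight spaces pair trivially unless their weights are opposite, so a vector orthogonal
  to the opposite weight space is orthogonal to all.\<close>

lemma q_nondeg_weight:
  assumes q: "weight_vec adq \<gamma> q" and z: "\<And>r. weight_vec adq (\<lambda>h. - \<gamma> h) r \<Longrightarrow> qK q r = 0"
  shows "q = 0"
proof (rule qK_nondeg)
  fix r
  show "qK q r = 0"
  proof (rule clinear_eq_on_span[OF qK_lin_right clinear_const0 _ qU_span])
    fix s assume "s \<in> p ` U0"
    then obtain l where l: "weight_vec adq l s" using U0_weight p_weight by blast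
    show "qK q s = 0"
    proof (rule ccontr)
      assume n: "qK q s \<noteq> 0"
      have "l = (\<lambda>h. - \<gamma> h)" using q_orthogonal[OF q l n] by (rule ext)
      then show False using z l n by blast
    qed
  qed
qed

lemma E_weight: "\<alpha> \<in> pos_roots G \<Longrightarrow> x \<in> E \<alpha> \<Longrightarrow> weight_vec adq \<alpha> x \<and> x \<noteq> 0"
  using E[of \<alpha>] complex_vector.span_base[of x "E \<alpha>"] complex_vector.dependent_zero[of "E \<alpha>"]
  by (auto simp: is_basis_def bar_root_space_iff[symmetric])

lemma E_span: "\<alpha> \<in> pos_roots G \<Longrightarrow> weight_vec adq \<alpha> q \<Longrightarrow> q \<in> cspan (E \<alpha>)"
  using E[of \<alpha>] by (auto simp: is_basis_def bar_root_space_iff[symmetric])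

lemma finite_E:
  assumes "\<alpha> \<in> pos_roots G"
  shows "finite (E \<alpha>)"
proof (rule is_basis_finite[OF E[OF assms]])
  let ?F = "p ` rn (ee G) ` {w. wtw G w = \<alpha>}"
  show "finite ?F" using finite_wtw by blast
  show "bar_root_space G p \<alpha> \<subseteq> cspan ?F"
  proof
    fix q assume "q \<in> bar_root_space G p \<alpha>"
    then have q: "q \<in> cspan (p ` {s\<in>U0. s \<noteq> 0 \<and> weight_vec adh \<alpha> s})"
      using q_weight_span by (simp add: bar_root_space_iff)
    obtain n where n: "n > 0" "\<alpha> h0 = of_nat n" using root_positive[OF assms] by blast
    have "(\<lambda>h. - \<alpha> h) \<notin> pos_roots G" "\<alpha> \<noteq> (\<lambda>h. 0)"
    proof
      assume "(\<lambda>h. - \<alpha> h) \<in> pos_roots G"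
      then obtain k where "k > 0" "- \<alpha> h0 = of_nat k" using root_positive by blast
      then have "(of_nat (n + k) :: complex) = 0" using n by (metis add.right_inverse of_nat_add)
      then show False using n by (simp only: of_nat_eq_0_iff)
    qed (use n in auto)
    then have "{s\<in>U0. s \<noteq> 0 \<and> weight_vec adh \<alpha> s} \<subseteq> rn (ee G) ` {w. wtw G w = \<alpha>}"
      using U0_cases by blast
    then show "q \<in> cspan ?F" using q complex_vector.span_mono[OF image_mono] by blast
  qed
qed

section \<open>Dual bases of opposite root spaces\<close>

sublocale graded_index G E
proof (rule graded_index.intro[OF kac_moody_algebra_axioms], rule graded_index_axioms.intro)
  show "\<beta> = \<gamma>" if "\<beta> \<in> pos_roots G" "\<gamma> \<in> pos_roots G" "b \<in> E \<beta>" "b \<in> E \<gamma>" for \<beta> \<gamma> b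
  proof
    fix h
    have "\<beta> h *\<^sub>C b = \<gamma> h *\<^sub>C b" using E_weight that adq_weight by metis
    then show "\<beta> h = \<gamma> h" using E_weight that complex_vector.scale_right_imp_eq by blast
  qed
qed (rule finite_E)

lemma Bs_weight: "b \<in> Bs \<Longrightarrow> weight_vec adq (wt b) b"
  using wt_root E_weight by blast

lemma ht_pos: "b \<in> Bs \<Longrightarrow> 0 < ht b"
  using wt_root root_positive unfolding ht_def by metis

text \<open>Pairing with the basis vectors gives functionals on the opposite root space; they are
  independent there by non-degeneracy.\<close>

lemma dual_exists:
  assumes \<alpha>: "\<alpha> \<in> pos_roots G"
  shows "\<exists>d. \<forall>x\<in>E \<alpha>. weight_vec adq (\<lambda>h. - \<alpha> h) (d x) \<and> (\<forall>x'\<in>E \<alpha>. qK (d x) x' = (if x' = x then 1 else 0))"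
proof -
  let ?V = "{r. weight_vec adq (\<lambda>h. - \<alpha> h) r}"
  have "\<exists>d. \<forall>x\<in>E \<alpha>. d x \<in> ?V \<and> (\<forall>x'\<in>E \<alpha>. qK (d x) x' = (if x' = x then 1 else 0))"
  proof (rule dual_vectors[where \<phi> = "\<lambda>x r. qK r x"])
    show "csubspace ?V" by (rule weight_vec_subspace[OF lin_adq])
    fix c assume c: "\<And>y. y \<in> ?V \<Longrightarrow> (\<Sum>x\<in>E \<alpha>. c x * qK y x) = 0"
    let ?z = "\<Sum>x\<in>E \<alpha>. c x *\<^sub>C x"
    have wz: "weight_vec adq \<alpha> ?z"
      using complex_vector.subspace_sum[OF weight_vec_subspace[of adq \<alpha>, OF lin_adq], of "E \<alpha>" "\<lambda>x. c x *\<^sub>C x"]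
        complex_vector.subspace_scale[OF weight_vec_subspace[of adq \<alpha>, OF lin_adq]] E_weight[OF \<alpha>] by auto
    have "?z = 0"
    proof (rule q_nondeg_weight[OF wz])
      fix r assume "weight_vec adq (\<lambda>h. - \<alpha> h) r"
      then show "qK ?z r = 0"
        using c[of r] unfolding qK_sym[of ?z r]
                by (simp add: clinear_sum[OF qK_lin_right] clinear_scale[OF qK_lin_right] scaleC_complex_def)
    qed
    moreover have "\<not> complex_vector.dependent (E \<alpha>)" using E[OF \<alpha>] by (simp add: is_basis_def)
    ultimately show "\<forall>x\<in>E \<alpha>. c x = 0"
      using finite_E[OF \<alpha>] complex_vector.independentD[of "E \<alpha>" "E \<alpha>" c] by blast
  qed (use finite_E[OF \<alpha>] qK_lin_left in auto)
  then show ?thesis by simp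
qed

lemma bar_dual_props:
  assumes \<alpha>: "\<alpha> \<in> pos_roots G" and x: "x \<in> E \<alpha>"
  shows "weight_vec adq (\<lambda>h. - \<alpha> h) (bar_dual G K p E \<alpha> x)"
    "x' \<in> E \<alpha> \<Longrightarrow> qK (bar_dual G K p E \<alpha> x) x' = (if x' = x then 1 else 0)"
proof -
  let ?P = "\<lambda>y. weight_vec adq (\<lambda>h. - \<alpha> h) y \<and> (\<forall>x'\<in>E \<alpha>. qK y x' = (if x' = x then 1 else 0))"
  obtain y where y: "?P y" using dual_exists[OF \<alpha>] x by blast
  have uniq: "y = y'" if y': "?P y'" for y'
  proof -
    have "weight_vec adq (\<lambda>h. - \<alpha> h) (y - y')"
      using complex_vector.subspace_diff[OF weight_vec_subspace[of adq "\<lambda>h. - \<alpha> h", OF lin_adq], of y y'] y y' by simp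
    moreover have "qK (y - y') r = 0" if "weight_vec adq (\<lambda>h. - (- \<alpha> h)) r" for r
    proof (rule clinear_eq_on_span[OF qK_lin_right clinear_const0])
      show "r \<in> cspan (E \<alpha>)" using E_span[OF \<alpha>] that by simp
      show "qK (y - y') s = 0" if "s \<in> E \<alpha>" for s using y y' that by (simp add: qK_simps)
    qed
    ultimately have "y - y' = 0" by (rule q_nondeg_weight)
    then show ?thesis by simp
  qed
  have "bar_dual G K p E \<alpha> x = y"
    unfolding bar_dual_def qK_def[symmetric] bar_root_space_iff
    by (rule the_equality, rule y, rule uniq[symmetric])
  then show "weight_vec adq (\<lambda>h. - \<alpha> h) (bar_dual G K p E \<alpha> x)"
    "x' \<in> E \<alpha> \<Longrightarrow> qK (bar_dual G K p E \<alpha> x) x' = (if x' = x then 1 else 0)"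
    using y by auto
qed

text \<open>In the quotient the index is the raising vector itself: y_b is b and x_b is
  \<open>fd b\<close>. For Verma modules it is the lowering one.\<close>

definition fd where "fd b = bar_dual G K p E (wt b) b"

lemma fd_weight: "b \<in> Bs \<Longrightarrow> weight_vec adq (\<lambda>h. - wt b h) (fd b)"
  unfolding fd_def using bar_dual_props(1) wt_root by blast

lemma fd_pairing:
  assumes b: "b \<in> Bs" and c: "c \<in> Bs"
  shows "qK (fd b) c = (if c = b then 1 else 0)"
proof (cases "wt c = wt b")
  case True
  then have "c \<in> E (wt b)" using wt_root[OF c] by simp
  then show ?thesis unfolding fd_def using bar_dual_props(2) wt_root[OF b] by blast
next
  case False
  have "qK (fd b) c = 0"
  proof (rule ccontr)
    assume "qK (fd b) c \<noteq> 0"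
    then have "wt c = (\<lambda>h. - (- wt b h))"
      using q_orthogonal[OF fd_weight[OF b] Bs_weight[OF c]] by (intro ext)
    then show False using False by simp
  qed
  then show ?thesis using False by auto
qed

abbreviation "BB N \<equiv> {b\<in>Bs. ht b \<le> N}"

lemma expand_pos:
  assumes q: "weight_vec adq \<gamma> q" and n: "\<gamma> h0 = of_nat n" "0 < n" "n \<le> N"
  shows "q = (\<Sum>c\<in>BB N. qK (fd c) q *\<^sub>C c)"
proof (cases "q = 0")
  case False
  have lin: "clinear (\<lambda>q. \<Sum>c\<in>BB N. qK (fd c) q *\<^sub>C c)"
    by (intro clinear_sum_fun clinear_scaleC_left qK_lin_right)
  have "(\<lambda>h. - \<gamma> h) \<notin> pos_roots G"
  proof
    assume "(\<lambda>h. - \<gamma> h) \<in> pos_roots G"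
    then obtain k where "k > 0" "- \<gamma> h0 = of_nat k" using root_positive by blast
    then have "(of_nat (n + k) :: complex) = 0" using n by (metis add.right_inverse of_nat_add)
    then show False using n by (simp only: of_nat_eq_0_iff)
  qed
  then have r: "\<gamma> \<in> pos_roots G" using q_root[OF q False] n by auto
  have rn: "rht \<gamma> = n" using root_positive[OF r] n(1) by auto
  show ?thesis
  proof (rule clinear_eq_on_span[OF clinear_ident lin _ E_span[OF r q]])
    fix x assume x: "x \<in> E \<gamma>"
    then have xB: "x \<in> BB N" using BsI[OF r x] wt_eqI[OF r x] rn n by (auto simp: ht_def)
    have "(\<Sum>c\<in>BB N. qK (fd c) x *\<^sub>C c) = (\<Sum>c\<in>BB N. if c = x then x else 0)"
      by (rule sum.cong) (use xB in \<open>auto simp: fd_pairing\<close>)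
    then show "x = (\<Sum>c\<in>BB N. qK (fd c) x *\<^sub>C c)" using xB finite_ht[of N] by simp
  qed
qed (simp add: qK_simps)

text \<open>The vectors \<open>fd c\<close> are known only through their pairings, so the expansion
  is tested by non-degeneracy: the difference pairs to zero with the opposite root space.\<close>

lemma expand_neg:
  assumes q: "weight_vec adq \<gamma> q" and n: "\<gamma> h0 = - of_nat n" "0 < n" "n \<le> N"
  shows "q = (\<Sum>c\<in>BB N. qK q c *\<^sub>C fd c)"
proof (cases "q = 0")
  case False
  let ?\<alpha> = "\<lambda>h. - \<gamma> h"
  have "\<gamma> \<notin> pos_roots G"
  proof
    assume "\<gamma> \<in> pos_roots G"
    then obtain k where "k > 0" "\<gamma> h0 = of_nat k" using root_positive by blast
    then have "(of_nat (n + k) :: complex) = 0" using n by (metis add.right_inverse of_nat_add)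
    then show False using n by (simp only: of_nat_eq_0_iff)
  qed
  then have r: "?\<alpha> \<in> pos_roots G" using q_root[OF q False] n by auto
  have rn: "rht ?\<alpha> = n" using root_positive[OF r] n(1) by auto
  let ?s = "\<Sum>c\<in>E ?\<alpha>. qK q c *\<^sub>C fd c"
  have EB: "c \<in> Bs" "wt c = ?\<alpha>" if "c \<in> E ?\<alpha>" for c using BsI[OF r that] wt_eqI[OF r that] by auto
  note sub = weight_vec_subspace[of adq \<gamma>, OF lin_adq]
  have ws: "weight_vec adq \<gamma> ?s"
    using complex_vector.subspace_sum[OF sub, of "E ?\<alpha>" "\<lambda>c. qK q c *\<^sub>C fd c"]
      complex_vector.subspace_scale[OF sub] fd_weight EB by fastforce
  have "weight_vec adq \<gamma> (q - ?s)" using complex_vector.subspace_diff[OF sub, of q ?s] q ws by simp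
  moreover have "qK (q - ?s) r' = 0" if "weight_vec adq ?\<alpha> r'" for r'
  proof (rule clinear_eq_on_span[OF qK_lin_right clinear_const0 _ E_span[OF r that]])
    fix x assume x: "x \<in> E ?\<alpha>"
    have "qK ?s x = (\<Sum>c\<in>E ?\<alpha>. if c = x then qK q x else 0)"
      unfolding clinear_sum[OF qK_lin_left] clinear_scale[OF qK_lin_left]
      by (rule sum.cong) (use x EB in \<open>auto simp: fd_pairing scaleC_complex\<close>)
    then show "qK (q - ?s) x = 0" using x finite_E[OF r] by (simp add: qK_simps)
  qed
  ultimately have "q - ?s = 0" by (rule q_nondeg_weight)
  then have "q = ?s" by simp
  also have "\<dots> = (\<Sum>c\<in>BB N. qK q c *\<^sub>C fd c)"
  proof (rule sum.mono_neutral_left[OF finite_ht])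
    show "E ?\<alpha> \<subseteq> BB N" using EB rn n by (auto simp: ht_def)
    show "\<forall>c\<in>BB N - E ?\<alpha>. qK q c *\<^sub>C fd c = 0"
    proof
      fix c assume c: "c \<in> BB N - E ?\<alpha>"
      have "qK q c = 0"
      proof (rule ccontr)
        assume "qK q c \<noteq> 0"
        then have "wt c = ?\<alpha>" using q_orthogonal[OF q Bs_weight] c by (intro ext) auto
        then show False using c wt_root[of c] by auto
      qed
      then show "qK q c *\<^sub>C fd c = 0" by simp
    qed
  qed
  finally show ?thesis .
qed (simp add: qK_simps)

text \<open>Structure constants of the lowering part, and in \<open>Fq\<close> of the raising part,
  obtained by pairing a bracket with the dual basis.\<close>

definition Cq where "Cq a b c = (if a \<in> Bs \<and> b \<in> Bs \<and> c \<in> Bs then qK (qb (fd a) (fd b)) c else 0)"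
definition Fq where "Fq a b c = (if a \<in> Bs \<and> b \<in> Bs \<and> c \<in> Bs then qK (fd c) (qb a b) else 0)"

sublocale double_data Bs wt ht Cq Fq cor
proof
  show "finite {b\<in>Bs. ht b \<le> N}" for N by (rule finite_ht)
  show "ht a = ht b \<and> cor a = cor b" if "wt a = wt b" for a b using that by (simp add: ht_def cor_def)
  show "ht c = ht a + ht b \<and> wt c = (\<lambda>h. wt a h + wt b h)" if "Cq a b c \<noteq> 0" for a b c
  proof -
    have B: "a \<in> Bs" "b \<in> Bs" "c \<in> Bs" "qK (qb (fd a) (fd b)) c \<noteq> 0" using that by (auto simp: Cq_def split: if_splits)
    have "wt c h = wt a h + wt b h" for h
      using q_orthogonal[OF qb_weight[OF fd_weight[OF B(1)] fd_weight[OF B(2)]] Bs_weight[OF B(3)] B(4), of h] by simp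
    then have "wt c = (\<lambda>h. wt a h + wt b h)" by (rule ext)
    then show ?thesis using ht_add B by blast
  qed
  show "ht c = ht a + ht b \<and> wt c = (\<lambda>h. wt a h + wt b h)" if "Fq a b c \<noteq> 0" for a b c
  proof -
    have B: "a \<in> Bs" "b \<in> Bs" "c \<in> Bs" "qK (fd c) (qb a b) \<noteq> 0" using that by (auto simp: Fq_def split: if_splits)
    have "wt c h = wt a h + wt b h" for h
      using q_orthogonal[OF fd_weight[OF B(3)] qb_weight[OF Bs_weight[OF B(1)] Bs_weight[OF B(2)]] B(4), of h] by simp
    then have "wt c = (\<lambda>h. wt a h + wt b h)" by (rule ext)
    then show ?thesis using ht_add B by blast
  qed
  show "Cq b a c = - Cq a b c" for a b c
    by (simp add: Cq_def qb_swap[of "fd b" "fd a"] qK_simps)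
  show "Fq b a c = - Fq a b c" for a b c
    by (simp add: Fq_def qb_swap[of b a] qK_simps)
qed

lemma qb_fd_fd:
  assumes "a \<in> Bs" "b \<in> Bs" "ht a + ht b \<le> N"
  shows "qb (fd a) (fd b) = (\<Sum>c\<in>BB N. Cq a b c *\<^sub>C fd c)"
proof -
  have "qb (fd a) (fd b) = (\<Sum>c\<in>BB N. qK (qb (fd a) (fd b)) c *\<^sub>C fd c)"
    by (rule expand_neg[OF qb_weight[OF fd_weight fd_weight], where n = "ht a + ht b"])
      (use assms wt_h0 ht_pos in auto)
  then show ?thesis using assms by (simp add: Cq_def)
qed

lemma qb_y_y:
  assumes "a \<in> Bs" "b \<in> Bs" "ht a + ht b \<le> N"
  shows "qb a b = (\<Sum>c\<in>BB N. Fq a b c *\<^sub>C c)"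
proof -
  have "qb a b = (\<Sum>c\<in>BB N. qK (fd c) (qb a b) *\<^sub>C c)"
    by (rule expand_pos[OF qb_weight[OF Bs_weight Bs_weight], where n = "ht a + ht b"])
      (use assms wt_h0 ht_pos in auto)
  then show ?thesis using assms by (simp add: Fq_def)
qed

text \<open>The difference of heights decides: the bracket is raising, lowering, or of degree zero,
  and in each case the sums of the wrong kind vanish. In degree zero it lies in the Cartan part and
  is found by pairing with that part.\<close>

lemma qb_y_fd:
  assumes ab: "a \<in> Bs" "b \<in> Bs" "ht a \<le> N" "ht b \<le> N"
  shows "qb a (fd b) = (if a = b then qh (cor a) else 0) + (\<Sum>c\<in>BB N. Cq b c a *\<^sub>C c) + (\<Sum>c\<in>BB N. Fq c a b *\<^sub>C fd c)"
proof -
  let ?q = "qb a (fd b)" and ?\<gamma> = "\<lambda>h. wt a h + - wt b h"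
  have w: "weight_vec adq ?\<gamma> ?q" by (rule qb_weight[OF Bs_weight fd_weight]) (use ab in auto)
  have C: "Cq b c a = qK (fd c) ?q" if "c \<in> Bs" for c
    using that ab qK_sym[of "fd c" ?q] qK_inv[of a "fd b" "fd c"] qK_sym[of a] by (simp add: Cq_def)
  have F: "Fq c a b = qK ?q c" if "c \<in> Bs" for c
    using that ab qK_sym[of ?q c] qK_inv[of c a "fd b"] qK_sym[of "qb c a"] by (simp add: Fq_def)
  have C0: "Cq b c a = 0" if "ht a \<le> ht b" "c \<in> Bs" for c
    using C_wt[of b c a] ht_pos[OF that(2)] that by (cases "Cq b c a = 0") auto
  have F0: "Fq c a b = 0" if "ht b \<le> ht a" "c \<in> Bs" for c
    using F_wt[of c a b] ht_pos[OF that(2)] that by (cases "Fq c a b = 0") auto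
  consider "ht b < ht a" | "ht a < ht b" | "ht a = ht b" by linarith
  then show ?thesis
  proof cases
    case 1
    have "?q = (\<Sum>c\<in>BB N. qK (fd c) ?q *\<^sub>C c)"
      by (rule expand_pos[OF w, where n = "ht a - ht b"]) (use ab wt_h0 1 in \<open>auto simp: of_nat_diff\<close>)
    then show ?thesis using 1 C F0 by (auto intro!: sum.cong)
  next
    case 2
    have "?q = (\<Sum>c\<in>BB N. qK ?q c *\<^sub>C fd c)"
      by (rule expand_neg[OF w, where n = "ht b - ht a"]) (use ab wt_h0 2 in \<open>auto simp: of_nat_diff\<close>)
    then show ?thesis using 2 F C0 by (auto intro!: sum.cong)
  next
    case 3
    have s0: "(\<Sum>c\<in>BB N. Cq b c a *\<^sub>C c) = 0" "(\<Sum>c\<in>BB N. Fq c a b *\<^sub>C fd c) = 0"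
      using C0 F0 3 by (auto intro!: sum.neutral)
    have K': "qK ?q (qh h) = (if a = b then wt b h else 0)" for h
    proof -
      have "qK ?q (qh h) = qK a (qb (fd b) (qh h))" by (rule qK_inv)
      also have "\<dots> = wt b h * qK (fd b) a"
        using adq_weight'[OF fd_weight[OF ab(2)], of h] by (simp add: qK_simps scaleC_complex qK_sym[of a])
      finally show ?thesis using fd_pairing[OF ab(2,1)] by simp
    qed
    have g0: "?\<gamma> h0 = 0" using wt_h0 ab 3 by simp
    have "?q = (if a = b then qh (cor a) else 0)"
    proof (cases "?q = 0")
      case True
      \<comment> \<open>For equal indices the bracket cannot vanish: its pairing with the grading
        element is the height of b, which is positive.\<close>
      have "a \<noteq> b"
      proof
        assume "a = b"
        then have "wt b h = 0" for h using K'[of h] True by (simp add: qK_simps)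
        then show False using wt_h0[OF ab(2)] ht_pos[OF ab(2)] by simp
      qed
      then show ?thesis using True by simp
    next
      case False
      then obtain k where k: "?q = qh k" using q_zero_weight[OF w g0] by blast
      have "form G k h = (if a = b then wt b h else 0)" for h using K'[of h] by (simp add: k qK_qh)
      then have "k = (if a = b then cor a else 0)"
        using form_flat_inv[OF lin_wt[OF ab(2)]]
        by (intro form_eqD) (auto simp: cor_def form_simps)
      then show ?thesis by (auto simp: k qh_def hg_simps p_simps)
    qed
    then show ?thesis by (simp add: s0)
  qed
qed

end

section \<open>The Lie algebra acting on one factor of a tensor product\<close>

context verma_family
begin

definition oa :: "'n \<Rightarrow> 'g \<Rightarrow> ('n, 'm) tpower \<Rightarrow> ('n, 'm) tpower" where
  "oa i x = on_factor i (act i x)"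

lemma lin_oa: "clinear (oa i x)"
  unfolding oa_def by (rule clinear_on_factor[OF V.lin_act])

lemma oa_pure: "oa i x (pure m) = pure (m(i := act i x (m i)))"
  unfolding oa_def by (rule on_factor_pure[OF V.lin_act])

lemma oa_add: "oa i (x + y) u = oa i x u + oa i y u" and oa_scale: "oa i (c *\<^sub>C x) u = c *\<^sub>C oa i x u"
  by (rule tpower_eqI[where t = u];
    simp add: lin_oa clinear_plus clinear_scaleC oa_pure V.act_simps pure_add pure_scale)+

lemma lin_oa_left: "clinear (\<lambda>x. oa i x u)"
  by (rule clinearI) (simp_all add: oa_add oa_scale)

lemmas oa_simps = clinear_simps[OF lin_oa] clinear_simps[OF lin_oa_left]

lemma oa_br: "oa i (br x y) u = oa i x (oa i y u) - oa i y (oa i x u)"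
  unfolding oa_def
  by (simp add: on_factor_compose V.lin_act on_factor_diff[symmetric] clinear_compose V.act_br[abs_def])

lemma oa_commute: "i \<noteq> j \<Longrightarrow> oa i x (oa j y u) = oa j y (oa i x u)"
  unfolding oa_def by (rule on_factor_commute[OF V.lin_act V.lin_act])

text \<open>x raises the degree by more than the length of the word, and no word vector has such a
  degree. This gives local finiteness of the raising operators.\<close>

lemma raising_kills:
  assumes x: "br (hg h0) x = of_nat n *\<^sub>C x" and n: "length w < n"
  shows "act k x (V.wv k w) = 0"
proof -
  let ?T = "\<lambda>_::unit. act k (hg h0)" and ?l = "\<lambda>_::unit. \<Lambda> k h0 - of_nat (length w) + of_nat n"
  have wv: "act k (hg h0) (V.wv k w) = (\<Lambda> k h0 - of_nat (length w)) *\<^sub>C V.wv k w" for w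
    by (simp add: V.act_h_wv wtw_h0)
  have "weight_vec ?T ?l (act k x (V.wv k w))"
    unfolding weight_vec_def V.act_swap[of k "hg h0" x]
    by (simp add: wv x V.act_simps scaleC_distribs)
  moreover have "\<exists>l. weight_vec ?T l s" if s: "s \<in> range (V.wv k)" for s
  proof -
    obtain w where "s = V.wv k w" using s by blast
    then have "weight_vec ?T (\<lambda>_. \<Lambda> k h0 - of_nat (length w)) s" by (simp add: weight_vec_def wv)
    then show ?thesis by blast
  qed
  ultimately have mem: "act k x (V.wv k w) \<in> cspan {s\<in>range (V.wv k). weight_vec ?T ?l s}"
    by (intro weight_span[where T = ?T, OF V.lin_act _ V.wv_span])
  have "{s\<in>range (V.wv k). weight_vec ?T ?l s} \<subseteq> {0}"
  proof
    fix s assume "s \<in> {s\<in>range (V.wv k). weight_vec ?T ?l s}"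
    then obtain w' where s: "s = V.wv k w'" "act k (hg h0) s = (\<Lambda> k h0 - of_nat (length w) + of_nat n) *\<^sub>C s"
      by (auto simp: weight_vec_def)
    have "s = 0"
    proof (rule ccontr)
      assume nz: "s \<noteq> 0"
      have "(\<Lambda> k h0 - of_nat (length w')) *\<^sub>C s = (\<Lambda> k h0 - of_nat (length w) + of_nat n) *\<^sub>C s"
        using wv[of w'] s by simp
      then have "\<Lambda> k h0 - of_nat (length w') = \<Lambda> k h0 - of_nat (length w) + of_nat n"
        by (rule complex_vector.scale_right_imp_eq[OF nz])
      then have "(of_nat (length w) :: complex) = of_nat (length w' + n)" by (simp add: algebra_simps)
      then have "length w = length w' + n" by (simp only: of_nat_eq_iff)
      then show False using n by simp
    qed
    then show "s \<in> {0}" by simp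
  qed
  then have "cspan {s\<in>range (V.wv k). weight_vec ?T ?l s} \<subseteq> cspan {0}" by (rule complex_vector.span_mono)
  then show ?thesis using mem by (auto simp: complex_vector.span_insert_0)
qed

end

lemma multilinear_prod:
  fixes f :: "'n::finite \<Rightarrow> 'a::complex_vector \<Rightarrow> complex"
  assumes "\<And>k. clinear (f k)"
  shows "multilinear (\<lambda>m. \<Prod>k\<in>UNIV. f k (m k))"
  unfolding multilinear_def
proof (intro allI)
  fix m :: "'n \<Rightarrow> 'a" and i
  have "(\<Prod>k\<in>UNIV. f k ((m(i := x)) k)) = (\<Prod>k\<in>UNIV - {i}. f k (m k)) * f i x" for x
  proof -
    have "(\<Prod>k\<in>UNIV. f k ((m(i := x)) k)) = f i x * (\<Prod>k\<in>UNIV - {i}. f k ((m(i := x)) k))"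
      by (subst prod.remove[of _ i]) auto
    also have "(\<Prod>k\<in>UNIV - {i}. f k ((m(i := x)) k)) = (\<Prod>k\<in>UNIV - {i}. f k (m k))"
      by (rule prod.cong) auto
    finally show ?thesis by (simp add: mult.commute)
  qed
  then show "clinear (\<lambda>x. \<Prod>k\<in>UNIV. f k ((m(i := x)) k))"
    using clinear_mult_left[OF assms] by simp
qed

lemma product_form_bilinear:
  fixes S :: "'n::finite \<Rightarrow> 'm::complex_vector \<Rightarrow> 'm \<Rightarrow> complex"
  assumes S: "\<And>k. cbilinear (S k)"
  shows "cbilinear (product_form S)" and "product_form S (pure m) (pure m') = (\<Prod>k\<in>UNIV. S k (m k) (m' k))"
proof -
  note lr = cbilinearD(1)[OF S] and ll = cbilinearD(2)[OF S]
  let ?P = "\<lambda>m. tpower_lift (\<lambda>m'. \<Prod>k\<in>UNIV. S k (m k) (m' k))"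
  have mr: "multilinear (\<lambda>m'. \<Prod>k\<in>UNIV. S k (m k) (m' k))" for m by (rule multilinear_prod[OF lr])
  have ml: "multilinear (\<lambda>m. \<Prod>k\<in>UNIV. S k (m k) (m' k))" for m' by (rule multilinear_prod[OF ll])
  have P: "?P m (pure m') = (\<Prod>k\<in>UNIV. S k (m k) (m' k))" for m m' by (rule tpower_lift_pure[OF mr])
  have linP: "clinear (?P m)" for m by (rule clinear_tpower_lift[OF mr])
  have mP: "multilinear (\<lambda>m. ?P m w)" for w
    unfolding multilinear_def
  proof (intro allI clinearI)
    fix m :: "'n \<Rightarrow> 'm" and i x y c
    have c: "clinear (\<lambda>x. \<Prod>k\<in>UNIV. S k ((m(i := x)) k) (m' k))" for m'
      using ml by (auto simp: multilinear_def)
    show "?P (m(i := x + y)) w = ?P (m(i := x)) w + ?P (m(i := y)) w"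
      by (rule tpower_eqI[where t = w, OF linP clinear_plus[OF linP linP]]) (simp only: P, rule clinear_add[OF c])
    show "?P (m(i := c *\<^sub>C x)) w = c *\<^sub>C ?P (m(i := x)) w"
      by (rule tpower_eqI[where t = w, OF linP clinear_scaleC[OF linP]]) (simp only: P, rule clinear_scale[OF c])
  qed
  have eq: "product_form S u w = tpower_lift (\<lambda>m. ?P m w) u" for u w by (simp add: product_form_def)
  have pure: "product_form S (pure m) w = ?P m w" for m w unfolding eq by (rule tpower_lift_pure[OF mP])
  have linl: "clinear (\<lambda>u. product_form S u w)" for w unfolding eq by (rule clinear_tpower_lift[OF mP])
  have "clinear (product_form S u)" for u
  proof (rule clinearI)
    fix w w' c
    show "product_form S u (w + w') = product_form S u w + product_form S u w'"
      by (rule tpower_eqI[where t = u, OF linl clinear_plus[OF linl linl]]) (simp only: pure clinear_add[OF linP])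
    show "product_form S u (c *\<^sub>C w) = c *\<^sub>C product_form S u w"
      by (rule tpower_eqI[where t = u, OF linl clinear_scaleC[OF linl]]) (simp only: pure clinear_scale[OF linP])
  qed
  then show "cbilinear (product_form S)" using linl by (rule cbilinearI)
  show "product_form S (pure m) (pure m') = (\<Prod>k\<in>UNIV. S k (m k) (m' k))" by (simp only: pure P)
qed

section \<open>Contravariant forms and the quotient module\<close>

context serre_quotient
begin

lemma S_bilinear: "cbilinear (S k)" and S_v: "S k (v k) (v k) = 1"
  and S_e: "S k (act k (ee G i) u) w = S k u (act k (ff G i) w)"
  and S_f: "S k (act k (ff G i) u) w = S k u (act k (ee G i) w)"
  using S[of k] by (auto simp: contravariant_form_def)

lemmas S_lin_right = cbilinearD(1)[OF S_bilinear] and S_lin_left = cbilinearD(2)[OF S_bilinear]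
lemmas S_simps = clinear_simps[OF S_lin_right] clinear_simps[OF S_lin_left]

text \<open>A word that begins with f_i pairs to zero with \<open>v\<close>, since f_i moves over to
  e_i, which kills \<open>v\<close>.\<close>

lemma S_v_right: "S k u (v k) = V.vac k u"
proof (rule V.eq_on_wv[OF S_lin_left V.vac(1)])
  show "S k (V.wv k w) (v k) = V.vac k (V.wv k w)" for w
    by (cases w) (simp_all add: S_v V.vac S_f V.act_n_plus ee_n_plus S_simps)
qed

lemma vac_h: "V.vac k (act k (hg h) u) = \<Lambda> k h * V.vac k u"
proof (rule V.eq_on_wv[OF clinear_compose[OF V.vac(1) V.lin_act] clinear_mult_left[OF V.vac(1)]])
  show "V.vac k (act k (hg h) (V.wv k w)) = \<Lambda> k h * V.vac k (V.wv k w)" for w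
  proof (cases w)
    case (Cons i w')
    then have "V.vac k (V.wv k w) = 0" by (simp add: V.vac)
    then show ?thesis by (simp only: V.act_h_wv clinear_scale[OF V.vac(1)] mult_zero_right complex_vector.scale_zero_right)
  qed (simp add: V.act_h_v clinear_scale[OF V.vac(1)] V.vac scaleC_complex_def)
qed

text \<open>Contravariance is postulated for the e_i and f_i only. For h it follows by induction on
  the word in the second argument, starting from the vacuum functional.\<close>

lemma S_h: "S k (act k (hg h) u) w = S k u (act k (hg h) w)"
proof -
  have "\<forall>u. S k (act k (hg h) u) (V.wv k w) = S k u (act k (hg h) (V.wv k w))" for w
  proof (induction w)
    case Nil
    show ?case by (simp add: S_v_right vac_h V.act_h_v S_simps scaleC_complex_def)
  next
    case (Cons i w)
    show ?case
    proof
      fix u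
      let ?e = "act k (ee G i)" and ?f = "act k (ff G i)" and ?h = "act k (hg h)" and ?w = "V.wv k w"
      have he: "?e (?h u) = ?h (?e u) - sroot G i h *\<^sub>C ?e u"
        using V.act_br[of k "hg h" "ee G i" u] by (simp add: br_h_e V.act_simps)
      have hf: "?h (?f ?w) = ?f (?h ?w) - sroot G i h *\<^sub>C ?f ?w"
        using V.act_br[of k "hg h" "ff G i" ?w] by (simp add: br_h_f V.act_simps algebra_simps)
      have "S k (?h u) (?f ?w) = S k (?e (?h u)) ?w" by (simp add: S_e)
      also have "\<dots> = S k (?e u) (?h ?w) - sroot G i h * S k (?e u) ?w"
        using Cons by (simp add: he S_simps scaleC_complex_def)
      also have "\<dots> = S k u (?h (?f ?w))" by (simp add: hf S_e S_simps scaleC_complex_def)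
      finally show "S k (?h u) (V.wv k (i # w)) = S k u (?h (V.wv k (i # w)))" by simp
    qed
  qed
  then have "S k (act k (hg h) u) (V.wv k w) = S k u (act k (hg h) (V.wv k w))" for w by blast
  then show ?thesis by (rule V.eq_on_wv[OF S_lin_right clinear_compose[OF S_lin_right V.lin_act]])
qed

text \<open>The elements possessing an adjoint form a subalgebra containing the generators; adjoints
  reverse brackets. One adjoint serves all factors.\<close>

lemma S_adjoint: "\<exists>x'. \<forall>k u w. S k (act k x u) w = S k u (act k x' w)"
proof -
  let ?W = "{x. \<exists>x'. \<forall>k u w. S k (act k x u) w = S k u (act k x' w)}"
  have "x \<in> ?W"
  proof (rule algebra_induct)
    show "csubspace ?W"
    proof (rule complex_vector.subspaceI)
      show "0 \<in> ?W" by (rule CollectI, rule exI[of _ 0]) (simp add: V.act_simps S_simps)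
      show "x + y \<in> ?W" if xy: "x \<in> ?W" "y \<in> ?W" for x y
      proof -
        obtain x' y' where "\<forall>k u w. S k (act k x u) w = S k u (act k x' w)" "\<forall>k u w. S k (act k y u) w = S k u (act k y' w)"
          using xy by blast
        then show ?thesis by (intro CollectI exI[of _ "x' + y'"]) (simp add: V.act_simps S_simps)
      qed
      show "c *\<^sub>C x \<in> ?W" if x: "x \<in> ?W" for c x
      proof -
        obtain x' where "\<forall>k u w. S k (act k x u) w = S k u (act k x' w)" using x by blast
        then show ?thesis by (intro CollectI exI[of _ "c *\<^sub>C x'"]) (simp add: V.act_simps S_simps)
      qed
    qed
    show "hg h \<in> ?W" for h using S_h by blast
    show "ee G i \<in> ?W" "ff G i \<in> ?W" for i using S_e S_f by blast+
    show "br x y \<in> ?W" if xy: "x \<in> ?W" "y \<in> ?W" for x y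
    proof -
      obtain x' y' where "\<forall>k u w. S k (act k x u) w = S k u (act k x' w)" "\<forall>k u w. S k (act k y u) w = S k u (act k y' w)"
        using xy by blast
      then show ?thesis by (intro CollectI exI[of _ "br y' x'"]) (simp add: V.act_br S_simps)
    qed
  qed
  then show ?thesis by simp
qed

text \<open>Commuting x to the right past the letters keeps it in the radical. At \<open>v\<close>
  only the Cartan component of x could contribute, and it vanishes because x is orthogonal to the
  Cartan subalgebra.\<close>

lemma rad_vac: "rad x \<Longrightarrow> V.vac k (act k x (V.wv k w)) = 0"
proof (induction w arbitrary: x)
  case Nil
  obtain y h z where x: "x = y + hg h + z" and y: "y \<in> n_minus G" and z: "z \<in> n_plus G"
    using triangular by blast
  have "form G h a = 0" for a
  proof -
    have "K x (hg a) = 0" using Nil by (simp add: rad_def)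
    then show ?thesis using y z K_nh by (simp add: x K_simps K_hh)
  qed
  then have "h = 0" by (rule form_nondeg)
  then show ?case
    by (simp add: x hg_simps V.act_simps V.act_n_plus[OF z] V.vac_n_minus[OF y])
next
  case (Cons i w)
  have "V.vac k (act k (br x (ff G i)) (V.wv k w)) = 0" by (rule Cons.IH) (rule rad_br(1)[OF Cons.prems])
  then show ?case
    by (simp add: V.act_swap[of k x "ff G i"] clinear_add[OF V.vac(1)] V.vac)
qed

text \<open>Letters of the second argument move to the first as raising operators; commuting them
  past x leaves the radical again, until the vacuum functional is reached.\<close>

lemma rad_S:
  assumes "rad x"
  shows "S k (act k x u) w = 0"
proof -
  have v: "V.vac k (act k x u) = 0" if "rad x" for x u
    by (rule V.eq_on_wv[where q = "\<lambda>_. 0", OF clinear_compose[OF V.vac(1) V.lin_act] clinear_const0])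
      (rule rad_vac[OF that])
  have "\<forall>x u. rad x \<longrightarrow> S k (act k x u) (V.wv k w) = 0" for w
  proof (induction w)
    case (Cons i w)
    show ?case
    proof (intro allI impI)
      fix x u assume x: "rad x"
      have "S k (act k x u) (V.wv k (i # w)) = S k (act k (ee G i) (act k x u)) (V.wv k w)" by (simp add: S_e)
      also have "\<dots> = 0"
        unfolding V.act_swap[of k "ee G i" x] using Cons x rad_br(2)[OF x] by (simp add: S_simps)
      finally show "S k (act k x u) (V.wv k (i # w)) = 0" .
    qed
  qed (simp add: S_v_right v)
  then have "S k (act k x u) (V.wv k w) = 0" for w using assms by blast
  then show ?thesis by (rule V.eq_on_wv[where q = "\<lambda>_. 0", OF S_lin_right clinear_const0])
qed

abbreviation "PF \<equiv> product_form S"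

lemmas PF_bilinear = product_form_bilinear(1)[OF S_bilinear]
  and PF_pure = product_form_bilinear(2)[OF S_bilinear]

lemmas PF_lin_right = cbilinearD(1)[OF PF_bilinear] and PF_lin_left = cbilinearD(2)[OF PF_bilinear]

lemma PF_eqI:
  assumes "\<And>m m'. PF (A (pure m)) (pure m') = PF (pure m) (B (pure m'))" "clinear A" "clinear B"
  shows "PF (A u) w = PF u (B w)"
proof (rule tpower_eqI[where t = u, OF clinear_compose[OF PF_lin_left assms(2)] PF_lin_left])
  show "PF (A (pure m)) w = PF (pure m) (B w)" for m
    by (rule tpower_eqI[where t = w, OF PF_lin_right clinear_compose[OF PF_lin_right assms(3)] assms(1)])
qed

lemma PF_adjoint: "\<exists>x'. \<forall>u w. PF (oa i x u) w = PF u (oa i x' w)"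
proof -
  obtain x' where x': "\<forall>k u w. S k (act k x u) w = S k u (act k x' w)" using S_adjoint by blast
  have "PF (oa i x u) w = PF u (oa i x' w)" for u w
  proof (rule PF_eqI[OF _ lin_oa lin_oa])
    fix m m'
    have "S k ((m(i := act i x (m i))) k) (m' k) = S k (m k) ((m'(i := act i x' (m' i))) k)" for k
      using x' by simp
    then show "PF (oa i x (pure m)) (pure m') = PF (pure m) (oa i x' (pure m'))"
      by (simp only: oa_pure PF_pure)
  qed
  then show ?thesis by blast
qed

lemma rad_PF:
  assumes "rad x"
  shows "PF (oa i x u) w = 0"
proof -
  have "PF (oa i x u) w = PF u ((\<lambda>_. 0) w)"
  proof (rule PF_eqI[OF _ lin_oa clinear_const0])
    fix m m'
    have "(\<Prod>k\<in>UNIV. S k ((m(i := act i x (m i))) k) (m' k)) = 0"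
      using rad_S[OF assms] by (intro prod_zero bexI[of _ i]) simp_all
    then show "PF (oa i x (pure m)) (pure m') = PF (pure m) 0"
      by (simp only: oa_pure PF_pure clinear_zero[OF PF_lin_right])
  qed
  then show ?thesis by (simp add: clinear_zero[OF PF_lin_right])
qed

lemma lin_pi: "clinear \<pi>" and surj_pi: "surj \<pi>" and pi_eq_0: "\<pi> u = 0 \<longleftrightarrow> (\<forall>w. PF u w = 0)"
  using pi by (auto simp: is_quotient_def form_kernel_def)

lemmas pi_simps = clinear_simps[OF lin_pi]

lemma l_ex: "\<exists>u. l = \<pi> u" using surj_pi by (rule surjD)

lemma pi_inv [simp]: "\<pi> (inv \<pi> l) = l" by (rule surj_f_inv_f[OF surj_pi])

definition bact where "bact i q = bar_act act p \<pi> i q"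

text \<open>Both choices of representatives are harmless: the radical acts into the kernel of the
  form, and that kernel is stable because every operator has an adjoint.\<close>

lemma bact_p: "bact i (p x) (\<pi> u) = \<pi> (oa i x u)"
proof -
  let ?x = "inv p (p x)" and ?u = "inv \<pi> (\<pi> u)"
  have "rad (?x - x)" by (simp add: p_eq_iff[symmetric])
  then have 1: "\<pi> (oa i (?x - x) u) = 0" by (simp add: pi_eq_0 rad_PF)
  have "\<pi> (?u - u) = 0" by (simp add: pi_simps)
  then have "\<pi> (oa i ?x (?u - u)) = 0" using PF_adjoint[of i ?x] by (auto simp: pi_eq_0)
  then have "\<pi> (oa i ?x ?u) = \<pi> (oa i ?x u)" by (simp add: oa_simps pi_simps)
  also have "\<dots> = \<pi> (oa i x u)" using 1 by (simp add: oa_simps pi_simps)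
  finally show ?thesis by (simp add: bact_def bar_act_def oa_def)
qed

lemma bact_bilinear: "cbilinear (bact i)"
proof (intro cbilinearI clinearI)
  fix q r l l' c
  obtain x y where [simp]: "q = p x" "r = p y" using q_ex by metis
  obtain u w where [simp]: "l = \<pi> u" "l' = \<pi> w" using l_ex by metis
  show "bact i q (l + l') = bact i q l + bact i q l'" "bact i q (c *\<^sub>C l) = c *\<^sub>C bact i q l"
    "bact i (q + r) l = bact i q l + bact i r l" "bact i (c *\<^sub>C q) l = c *\<^sub>C bact i q l"
    by (simp_all add: pi_simps(1,2)[symmetric] p_simps(1,2)[symmetric] bact_p oa_simps)
qed

lemmas lin_bact = cbilinearD(1)[OF bact_bilinear] and lin_bact_left = cbilinearD(2)[OF bact_bilinear]
lemmas bact_simps = clinear_simps[OF lin_bact] clinear_simps[OF lin_bact_left]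

lemma bact_qb: "bact i (qb q r) l = bact i q (bact i r l) - bact i r (bact i q l)"
proof -
  obtain x y u where "q = p x" "r = p y" "l = \<pi> u" using q_ex l_ex by metis
  then show ?thesis by (simp add: qb_p bact_p oa_br pi_simps)
qed

lemma bact_commute: "i \<noteq> j \<Longrightarrow> bact i q (bact j r l) = bact j r (bact i q l)"
proof -
  assume ij: "i \<noteq> j"
  obtain x y u where "q = p x" "r = p y" "l = \<pi> u" using q_ex l_ex by metis
  then show ?thesis by (simp add: bact_p oa_commute[OF ij])
qed

text \<open>A root vector of the quotient lifts to a combination of raising brackets of its height,
  each of which kills a shorter word.\<close>

lemma bact_hvec:
  assumes b: "b \<in> Bs" and n: "length (ws i) < ht b"
  shows "bact i b (\<pi> (hvec ws)) = 0"
proof (rule clinear_eq_on_span[OF lin_bact_left clinear_const0 _ q_weight_span[OF Bs_weight[OF b]]])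
  fix q assume "q \<in> p ` {s\<in>U0. s \<noteq> 0 \<and> weight_vec adh (wt b) s}"
  then obtain s where s: "q = p s" "weight_vec adh (wt b) s" by blast
  have "br (hg h0) s = of_nat (ht b) *\<^sub>C s" using s(2) wt_h0[OF b] by (simp add: weight_vec_def adh_def)
  then have z: "act i s (V.wv i (ws i)) = 0" by (rule raising_kills[OF _ n])
  have "oa i s (hvec ws) = 0" unfolding hvec_def oa_pure z by (rule pure_zero)
  then show "bact i q (\<pi> (hvec ws)) = 0" by (simp add: s(1) bact_p pi_simps)
qed

lemma L_span: "l \<in> cspan (\<pi> ` range hvec)"
proof -
  obtain u where u: "l = \<pi> u" using l_ex by metis
  have "\<pi> x \<in> cspan (\<pi> ` range hvec)" if "x \<in> range hvec" for x
    by (rule complex_vector.span_base) (use that in blast)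
  then show ?thesis unfolding u
    by (rule clinear_span_image[OF lin_pi _ complex_vector.subspace_span hvec_span])
qed

lemma bact_locally_finite: "\<exists>N. \<forall>b\<in>Bs. N < ht b \<longrightarrow> bact i b l = 0"
proof -
  let ?W = "{l. \<exists>N. \<forall>b\<in>Bs. N < ht b \<longrightarrow> bact i b l = 0}"
  have "csubspace ?W"
  proof (rule complex_vector.subspaceI)
    show "0 \<in> ?W" by (simp add: bact_simps)
    show "x + y \<in> ?W" if xy: "x \<in> ?W" "y \<in> ?W" for x y
    proof -
      obtain M N where "\<forall>b\<in>Bs. M < ht b \<longrightarrow> bact i b x = 0" "\<forall>b\<in>Bs. N < ht b \<longrightarrow> bact i b y = 0"
        using xy by blast
      then show ?thesis by (intro CollectI exI[of _ "max M N"]) (simp add: bact_simps)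
    qed
    show "c *\<^sub>C x \<in> ?W" if x: "x \<in> ?W" for c x
    proof -
      obtain N where "\<forall>b\<in>Bs. N < ht b \<longrightarrow> bact i b x = 0" using x by blast
      then show ?thesis by (intro CollectI exI[of _ N]) (simp add: bact_simps)
    qed
  qed
  moreover have "\<pi> ` range hvec \<subseteq> ?W" using bact_hvec by blast
  ultimately show ?thesis using complex_vector.span_minimal[of "\<pi> ` range hvec" ?W] L_span[of l] by blast
qed

end

section \<open>The quotient module as a module over the double\<close>

context serre_quotient
begin

lemma double_ops_L: "double_ops Bs wt ht Cq Fq cor (\<lambda>b. bact i (fd b)) (bact i) (\<lambda>h. bact i (qh h))"
proof (rule double_ops.intro[OF double_data_axioms], rule double_ops_axioms.intro)
  show "clinear (bact i (fd b))" "clinear (bact i b)" for b by (rule lin_bact)+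
  show "clinear (bact i (qh h))" for h by (rule lin_bact)
  show "bact i (qh h) (bact i (qh k) u) = bact i (qh k) (bact i (qh h) u)" for h k u
  proof -
    have "qb (qh h) (qh k) = 0" by (simp add: qh_def qb_p br_h_h p_simps)
    then show ?thesis using bact_qb[of i "qh h" "qh k" u] by (simp add: bact_simps)
  qed
  show "bact i (qh h) (bact i (fd b) u) = bact i (fd b) (bact i (qh h) u) - wt b h *\<^sub>C bact i (fd b) u" if "b \<in> Bs" for b h u
    using bact_qb[of i "qh h" "fd b" u] adq_weight[OF fd_weight[OF that], of h]
    by (simp add: bact_simps algebra_simps)
  show "bact i (qh h) (bact i b u) = bact i b (bact i (qh h) u) + wt b h *\<^sub>C bact i b u" if "b \<in> Bs" for b h u
    using bact_qb[of i "qh h" b u] adq_weight[OF Bs_weight[OF that], of h]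
    by (simp add: bact_simps algebra_simps)
  show "\<exists>N. \<forall>b\<in>Bs. N < ht b \<longrightarrow> bact i b u = 0" for u by (rule bact_locally_finite)
  show "bact i (fd a) (bact i (fd b) u) - bact i (fd b) (bact i (fd a) u) = (\<Sum>c\<in>BN N. Cq a b c *\<^sub>C bact i (fd c) u)"
    if "a \<in> Bs" "b \<in> Bs" "ht a + ht b \<le> N" for a b N u
    unfolding bact_qb[symmetric] qb_fd_fd[OF that] BN_def
    by (simp only: clinear_sum[OF lin_bact_left] clinear_scale[OF lin_bact_left])
  show "bact i a (bact i b u) - bact i b (bact i a u) = (\<Sum>c\<in>BN N. Fq a b c *\<^sub>C bact i c u)"
    if "a \<in> Bs" "b \<in> Bs" "ht a + ht b \<le> N" for a b N u
    unfolding bact_qb[symmetric] qb_y_y[OF that] BN_def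
    by (simp only: clinear_sum[OF lin_bact_left] clinear_scale[OF lin_bact_left])
  show "bact i a (bact i (fd b) u) - bact i (fd b) (bact i a u) = (if a = b then bact i (qh (cor a)) u else 0) +
      (\<Sum>c\<in>BN N. Cq b c a *\<^sub>C bact i c u) + (\<Sum>c\<in>BN N. Fq c a b *\<^sub>C bact i (fd c) u)"
    if ab: "a \<in> BN N" "b \<in> BN N" for a b N u
  proof -
    have "a \<in> Bs" "b \<in> Bs" "ht a \<le> N" "ht b \<le> N" using ab by (simp_all add: BN_def)
    then show ?thesis
      unfolding bact_qb[symmetric] BN_def
      by (simp add: qb_y_fd clinear_add[OF lin_bact_left] clinear_sum[OF lin_bact_left]
          clinear_scale[OF lin_bact_left] clinear_zero[OF lin_bact_left])
  qed
qed

text \<open>Orthonormal vectors are independent, and there are as many of them as coordinates, so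
  they span by dimension.\<close>

lemma hs_span: "x \<in> cspan (range hs)"
proof (rule ccontr)
  assume x: "x \<notin> cspan (range hs)"
  have coeff: "form G (\<Sum>s\<in>UNIV. c s *\<^sub>C hs s) (hs t) = c t" for c t
    by (simp add: clinear_sum[OF form_lin_left] clinear_scale[OF form_lin_left] hs scaleC_complex_def
        if_distrib[of "(*) _"] cong: if_cong)
  have inj: "inj hs"
  proof (rule injI)
    fix s t assume "hs s = hs t"
    then show "s = t" using hs[of s s] hs[of s t] by (auto split: if_splits)
  qed
  have ind: "\<not> complex_vector.dependent (range hs)"
  proof
    assume "complex_vector.dependent (range hs)"
    then obtain u where u: "(\<Sum>y\<in>range hs. u y *\<^sub>C y) = 0" "\<exists>y\<in>range hs. u y \<noteq> 0"
      using complex_vector.dependent_finite[of "range hs"] by auto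
    have "(\<Sum>s\<in>UNIV. u (hs s) *\<^sub>C hs s) = 0" using u(1) by (simp add: sum.reindex[OF inj])
    then have "u (hs t) = 0" for t using coeff[of "\<lambda>s. u (hs s)" t] by (simp add: form_simps)
    then show False using u(2) by blast
  qed
  let ?T = "range (\<lambda>s::'d. axis s (1::complex))"
  have "y \<in> cspan ?T" for y :: "complex ^ 'd"
    by (subst scaleC_vec_expansion[of y])
      (rule complex_vector.span_sum, rule complex_vector.span_scale, rule complex_vector.span_base, simp)
  then have "insert x (range hs) \<subseteq> cspan ?T" by blast
  moreover have "\<not> complex_vector.dependent (insert x (range hs))"
    using x ind by (rule complex_vector.independent_insertI)
  ultimately have "card (insert x (range hs)) \<le> card ?T"
    using complex_vector.independent_span_bound[of ?T "insert x (range hs)"] by simp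
  also have "\<dots> \<le> CARD('d)" by (rule card_image_le) simp
  finally have "card (insert x (range hs)) \<le> CARD('d)" .
  moreover have "x \<notin> range hs" using x complex_vector.span_base[of x "range hs"] by blast
  ultimately show False by (simp add: card_image[OF inj])
qed

lemma cor_orthonormal:
  assumes "b \<in> Bs"
  shows "cor b = (\<Sum>s\<in>UNIV. wt b (hs s) *\<^sub>C hs s)"
proof (rule form_eqD)
  fix y
  let ?r = "\<Sum>s\<in>UNIV. wt b (hs s) *\<^sub>C hs s"
  show "form G (cor b) y = form G ?r y"
  proof (rule clinear_eq_on_span[OF form_lin_right form_lin_right _ hs_span])
    fix z assume "z \<in> range hs"
    then obtain t where z: "z = hs t" by blast
    have "form G ?r (hs t) = wt b (hs t)"
      by (simp add: clinear_sum[OF form_lin_left] clinear_scale[OF form_lin_left] hs scaleC_complex_def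
          if_distrib[of "(*) _"] cong: if_cong)
    then show "form G (cor b) z = form G ?r z"
      by (simp add: z cor_def form_flat_inv[OF lin_wt[OF assms]])
  qed
qed

lemma qh_simps: "qh (h + k) = qh h + qh k" "qh (c *\<^sub>C h) = c *\<^sub>C qh h"
  by (simp_all add: qh_def hg_simps p_simps)

sublocale double_tensor Bs wt ht Cq Fq cor "\<lambda>i b. bact i (fd b)" bact "\<lambda>i h. bact i (qh h)" hs hs
proof (rule double_tensor.intro[OF double_data_axioms], rule double_tensor_axioms.intro)
  show "double_ops Bs wt ht Cq Fq cor (\<lambda>b. bact i (fd b)) (bact i) (\<lambda>h. bact i (qh h))" for i
    by (rule double_ops_L)
qed (rule bact_commute lin_wt cor_orthonormal HOL.refl; assumption | simp add: qh_simps bact_simps)+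

lemma bar_Delta_eq:
  assumes "\<alpha> \<in> pos_roots G"
  shows "bar_Delta G act K p \<pi> E \<alpha> l = total.Delta \<alpha> l"
proof -
  have "bar_Delta G act K p \<pi> E \<alpha> l = (\<Sum>x\<in>E \<alpha>. tx x (ty x l))"
    unfolding bar_Delta_def Let_def bact_def[symmetric] tx_def ty_def
    by (intro sum.cong HOL.refl) (simp only: fd_def wt_eqI[OF assms])
  then show ?thesis by (simp add: total.Delta_def wt_fiber[OF assms])
qed

text \<open>The definition lists the two terms of each root in the opposite order to the abstract
  operator, and operators on distinct factors commute; the cut-off is taken from the vector at
  hand.\<close>

lemma bar_Omega_eq:
  assumes ij: "i \<noteq> j"
  shows "bar_Omega G act K p \<pi> E hs i j l = Om i j l"
proof -
  obtain N where N: "adm N l" using adm_ex by blast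
  let ?T = "\<lambda>x. bact i x (bact j (fd x) l) + bact i (fd x) (bact j x l)"
  have T0: "?T b = 0" if "b \<in> Bs" "N < ht b" for b
    using adm_zero[OF N that] bact_commute[OF ij, of b "fd b" l] by (simp add: bact_simps)
  have "(\<lambda>\<alpha>. if \<alpha> \<in> pos_roots G then
      \<Sum>x\<in>E \<alpha>. bact i x (bact j (bar_dual G K p E \<alpha> x) l) + bact i (bar_dual G K p E \<alpha> x) (bact j x l) else 0) =
    (\<lambda>\<alpha>. if \<alpha> \<in> pos_roots G then \<Sum>x\<in>E \<alpha>. ?T x else 0)"
  proof
    fix \<alpha>
    have "fd x = bar_dual G K p E \<alpha> x" if "\<alpha> \<in> pos_roots G" "x \<in> E \<alpha>" for x
      by (simp only: fd_def wt_eqI[OF that])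
    then show "(if \<alpha> \<in> pos_roots G then
      \<Sum>x\<in>E \<alpha>. bact i x (bact j (bar_dual G K p E \<alpha> x) l) + bact i (bar_dual G K p E \<alpha> x) (bact j x l) else 0) =
      (if \<alpha> \<in> pos_roots G then \<Sum>x\<in>E \<alpha>. ?T x else 0)" by simp
  qed
  moreover have "Sum_any (\<lambda>\<alpha>. if \<alpha> \<in> pos_roots G then \<Sum>x\<in>E \<alpha>. ?T x else 0) = (\<Sum>b\<in>BN N. ?T b)"
    unfolding BN_def by (rule Sum_any_graded[OF T0])
  ultimately have "bar_Omega G act K p \<pi> E hs i j l =
    (\<Sum>s\<in>UNIV. bact i (qh (hs s)) (bact j (qh (hs s)) l)) + (\<Sum>b\<in>BN N. ?T b)"
    unfolding bar_Omega_def Let_def bact_def[symmetric] qh_def[symmetric] by (simp only:)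
  then show ?thesis by (simp add: Om_eq[OF ij N] OmN_def add.commute)
qed

lemma th_pi: "th h (\<pi> u) = \<pi> (htot h u)"
  unfolding th_def by (simp add: htot_def hfac_def qh_def bact_p oa_def clinear_sum[OF lin_pi])

lemma weight_space_L: "{w. \<forall>h. th h w = l h *\<^sub>C w} \<subseteq> cspan ((\<lambda>ws. \<pi> (hvec ws)) ` {ws. hwt ws = l})"
proof
  fix w assume "w \<in> {w. \<forall>h. th h w = l h *\<^sub>C w}"
  then have w: "weight_vec th l w" by (simp add: weight_vec_def)
  let ?S = "\<pi> ` range hvec"
  have hw: "weight_vec th (hwt ws) (\<pi> (hvec ws))" for ws
    using htot_hvec[of ws] by (simp add: weight_vec_def th_pi pi_simps)
  have S: "\<exists>l. weight_vec th l s" if "s \<in> ?S" for s using that hw by blast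
  have "w \<in> cspan {s \<in> ?S. weight_vec th l s}"
    by (rule weight_span[OF lin_th S L_span w])
  also have "{s \<in> ?S. weight_vec th l s} \<subseteq> insert 0 ((\<lambda>ws. \<pi> (hvec ws)) ` {ws. hwt ws = l})"
  proof
    fix s assume "s \<in> {s \<in> ?S. weight_vec th l s}"
    then obtain ws where s: "s = \<pi> (hvec ws)" "weight_vec th l s" by blast
    show "s \<in> insert 0 ((\<lambda>ws. \<pi> (hvec ws)) ` {ws. hwt ws = l})"
    proof (cases "s = 0")
      case False
      have "l h *\<^sub>C s = hwt ws h *\<^sub>C s" for h
        using hw[of ws] s unfolding weight_vec_def by metis
      then have "hwt ws h = l h" for h using False by (simp only: complex_vector.scale_cancel_right simp_thms)
      then have "hwt ws = l" by (intro ext)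
      then show ?thesis using s by blast
    qed simp
  qed
  then have "cspan {s \<in> ?S. weight_vec th l s} \<subseteq> cspan ((\<lambda>ws. \<pi> (hvec ws)) ` {ws. hwt ws = l})"
    by (drule_tac complex_vector.span_mono) (simp only: complex_vector.span_insert_0)
  finally show "w \<in> cspan ((\<lambda>ws. \<pi> (hvec ws)) ` {ws. hwt ws = l})" .
qed

lemma compatible_with_Serre:
  "KZ_dyn_compatible \<kappa> (pos_roots G) (\<lambda>i h. bar_act act p \<pi> i (p (hg h)))
     (bar_Omega G act K p \<pi> E hs) (bar_Delta G act K p \<pi> E)"
proof -
  have "KZ_dyn_compatible \<kappa> (pos_roots G) (\<lambda>i h. bact i (qh h))
     (bar_Omega G act K p \<pi> E hs) (bar_Delta G act K p \<pi> E)"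
  proof (rule compatible)
    show "wt ` Bs \<subseteq> pos_roots G" using wt_root by blast
    show "bar_Omega G act K p \<pi> E hs i j u = Om i j u" if "i \<noteq> j" for i j u by (rule bar_Omega_eq[OF that])
    show "\<exists>S. finite S \<and> {w. \<forall>h. th h w = l h *\<^sub>C w} \<subseteq> cspan S" for l
      using weight_space_L[of l] finite_hwt[of l] by blast
  qed (rule bar_Delta_eq)
  then show ?thesis by (simp only: bact_def qh_def)
qed

end

theorem corollary7p4:
  fixes G :: "('d::finite, 'r::finite, 'g::complex_vector) km"
    and \<Lambda> :: "'n::finite \<Rightarrow> complex ^ 'd \<Rightarrow> complex"
    and act :: "'n \<Rightarrow> 'g \<Rightarrow> 'm \<Rightarrow> 'm::complex_vector"
    and v :: "'n \<Rightarrow> 'm"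
    and \<kappa> :: complex
  assumes "kac_moody G"
    and "\<And>k. clinear (\<Lambda> k)"
    and "\<And>k. verma_module G (\<Lambda> k) (act k) (v k)"
    and "\<kappa> \<noteq> 0"
  shows
    "(\<forall>X. (\<forall>\<beta>\<in>pos_roots G. is_basis (X \<beta>) (n_minus_space G \<beta>)) \<longrightarrow>
       KZ_dyn_compatible \<kappa> (pos_roots G)
         (\<lambda>i h. on_factor i (act i (hh G h)))
         (Omega_plus G act v X) (Delta_plus G act v X)) \<and>
     (\<forall>K S (p :: 'g \<Rightarrow> 'q::complex_vector) (\<pi> :: ('n, 'm) tpower \<Rightarrow> 'l::complex_vector) E hs.
       invariant_form G K \<and>
       (\<forall>k. contravariant_form G (act k) (v k) (S k)) \<and>
       is_quotient p (form_kernel (S_lie G K)) \<and>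
       is_quotient \<pi> (form_kernel (product_form S)) \<and>
       (\<forall>\<alpha>\<in>pos_roots G. is_basis (E \<alpha>) (bar_root_space G p \<alpha>)) \<and>
       (\<forall>s t. form G (hs s) (hs t) = (if s = t then 1 else 0)) \<longrightarrow>
       KZ_dyn_compatible \<kappa> (pos_roots G)
         (\<lambda>i h. bar_act act p \<pi> i (p (hh G h)))
         (bar_Omega G act K p \<pi> E hs) (bar_Delta G act K p \<pi> E))"
proof -
  have fam: "verma_family G \<Lambda> act v"
    by (rule verma_family.intro[OF kac_moody_algebra.intro verma_family_axioms.intro]) (rule assms(1-3))+
  show ?thesis
  proof (intro conjI allI impI)
    fix X assume "\<forall>\<beta>\<in>pos_roots G. is_basis (X \<beta>) (n_minus_space G \<beta>)"
    then interpret verma_basis G \<Lambda> act v X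
      by (intro verma_basis.intro[OF fam] verma_basis_axioms.intro) blast
    have "hfac = (\<lambda>i h. on_factor i (act i (hh G h)))" by (intro ext) (simp only: hfac_def)
    then show "KZ_dyn_compatible \<kappa> (pos_roots G) (\<lambda>i h. on_factor i (act i (hh G h)))
        (Omega_plus G act v X) (Delta_plus G act v X)"
      using compatible_without_Serre[of \<kappa>] by simp
  next
    fix K S and p :: "'g \<Rightarrow> 'q" and \<pi> :: "('n, 'm) tpower \<Rightarrow> 'l" and E and hs :: "'d \<Rightarrow> complex ^ 'd"
    assume a: "invariant_form G K \<and>
       (\<forall>k. contravariant_form G (act k) (v k) (S k)) \<and>
       is_quotient p (form_kernel (S_lie G K)) \<and>
       is_quotient \<pi> (form_kernel (product_form S)) \<and>
       (\<forall>\<alpha>\<in>pos_roots G. is_basis (E \<alpha>) (bar_root_space G p \<alpha>)) \<and>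
       (\<forall>s t. form G (hs s) (hs t) = (if s = t then 1 else 0))"
    interpret serre_quotient G \<Lambda> act v K S p \<pi> E hs
      by (rule serre_quotient.intro[OF fam], rule serre_quotient_axioms.intro) (use a in blast)+
    show "KZ_dyn_compatible \<kappa> (pos_roots G) (\<lambda>i h. bar_act act p \<pi> i (p (hh G h)))
        (bar_Omega G act K p \<pi> E hs) (bar_Delta G act K p \<pi> E)"
      by (rule compatible_with_Serre)
  qed
qed

end
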